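(* Let $a(x)=\tilde a(F^Tx)$ be a quasiperiodic ($d\times d$) matrix field satisfying assumption (QP$'$) of the context, and assume moreover that $\tilde a$ is a trigonometric polynomial. Let $u^\circ,v^\circ\in\mathcal S(\mathbb R^d)$ have compactly supported Fourier transforms, with $\hat v^\circ$ supported away from $0$. Let $k_0\in\mathcal O\setminus\{0\}$ (non-resonant, see context), let $\beta>0$, and set $\varepsilon=\lambda^\beta$. Let $u_\lambda$ be the solution of $$\partial_{tt}^2u_\lambda=\nabla\cdot(\mathrm{Id}+\lambda a)\nabla u_\lambda,\qquad u_\lambda(x)|_{t=0}=\varepsilon^{d/2}e^{ik_0\cdot x}u^\circ(\varepsilon x),\qquad\partial_tu_\lambda(x)|_{t=0}=\varepsilon^{d/2}e^{ik_0\cdot x}v^\circ(\varepsilon x).$$ Then for every integer $\ell\ge1$ there exist $0<\gamma=\gamma(\beta,\ell)\le1$, $\lambda_0>0$ and $C<\infty$ (with $C$ depending on $k_0,\ell,u^\circ,v^\circ$ and on the data, but not on $\lambda,t$) such that for all $t\ge0$ and $0<\lambda\le\lambda_0$, $$\|u_\lambda^t-\tilde U_\lambda^{\ell;t}\|_{L^2(\mathbb R^d)}\le C\lambda^\gamma(1+\lambda^\ell t),$$ where $\tilde U_\lambda^{\ell;t}:=\frac12\big(\tilde U_{\lambda,+}^{\ell;t}+\tilde U_{\lambda,-}^{\ell;t}\big)$ with $$\tilde U_{\lambda,\pm}^{\ell;t}(x):=\varepsilon^{d/2}e^{ik_0\cdot(x\mp t\frac{k_0}{|k_0|})}A_{\lambda,\pm}^{\ell;t}\big(\varepsilon(x\mp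 t\tfrac{k_0}{|k_0|})\big),$$ and where the amplitudes $A_{\lambda,\pm}^\ell$ solve $$\Big(i\partial_t\pm\varepsilon^2\frac{|k_0|^2\triangle-(k_0\cdot\nabla)^2}{2|k_0|^3}\mp\lambda\frac{\nu_{k_0}^0}{2|k_0|}\Big)A_{\lambda,\pm}^\ell=\pm\sum_{\substack{0\le m\le\ell,\ 0\le p\le\lfloor\ell/\beta\rfloor\\ m+p\ge2,\ (m,p)\ne(0,2)}}\lambda^m\varepsilon^p\,C_{m,p}(k_0)\odot(-i\nabla)^{\otimes p}A_{\lambda,\pm}^\ell$$ with initial data $A_{\lambda,\pm}^\ell|_{t=0}=u^\circ\pm\frac{iv^\circ}{|k_0|}$. Here $\odot$ is the total contraction of tensors, and $\nu_{k}^n$ and the $p$-th order tensors $C_{m,p}(k_0)$ are defined in the context.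
   Context: **Assumption (QP$'$).** $a(x)=\tilde a(F^Tx)$ with $M\ge d$, $F\in\mathbb R^{d\times M}$, and a continuous matrix-valued map $\tilde a$ on $\mathbb T^M=[0,2\pi)^M$, such that for some $r_0>0$, $C\ge1$, $\alpha>0$: $|F\xi|\ge\frac1C|\xi|^{-r_0}$ for all $\xi\in\mathbb Z^M\setminus\{0\}$, and $\|\mathbf 1_{|\cdot|>K}\mathcal F\tilde a\|_{\ell^1(\mathbb Z^M)}\le\exp(-K^\alpha)$ for all $K\ge0$, where $\mathcal F\tilde a(\xi)=\int_{\mathbb T^M}e^{-i\xi\cdot y}\tilde a(y)\,dy$. Fourier transform on $\mathbb R^d$: $\hat f(k)=\int e^{-ik\cdot x}f(x)\,dx$. **Non-resonant set.** $\mathcal O:=\mathbb R^d\setminus\bigcup_{\xi\in\mathbb Z^M\setminus\{0\}}\{k\in\mathbb R^d:|F\xi+k|=|k|\}$. **Rayleigh–Schrödinger coefficients.** Let $\mathbb E$ be the mean over $\mathbb T^M$ (normalized Lebesgue measure), $\Pi f:=f-\mathbb E[f]$, and for functions on $\mathbb T^M$ write $\nabla:=F\nabla_{\mathbb T^M}$, so that $-\triangle_k:=-\triangle-2ik\cdot\nabla$ is the Fourier multiplier with symbol $\xi\mapsto|F\xi+k|^2-|k|^2$. Set $\phi_k^0:=1$, $\nu_k^n:=-ik\cdot\mathbb E[\tilde a(\nabla+ik)\phi_k^n]$ for $n\ge0$, and let $\phi_k^{n+1}$ be the mean-zero solution of $-\triangle_k\phi_k^{n+1}=\Pi(\nabla+ik)\cdot\tilde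 a(\nabla+ik)\phi_k^n+\sum_{l=0}^{n-1}\nu_k^l\phi_k^{n-l}$. In particular $\nu_{k}^0=k\cdot\mathbb E[\tilde a]k$. Since $\tilde a$ is a trigonometric polynomial, for each $n$ these are well defined and smooth in $k$ in a neighborhood of $k_0\in\mathcal O$. **Tensors $C_{m,p}(k_0)$.** For $m,p\ge0$, $$C_{m,p}(k_0):=\sum_{r=0}^p\sum_{n=0}^m|k_0|^{1-2n-r}\Big(\sum_{\substack{0\le l\le s\\2s-l=r}}\frac{(-1)^s\prod_{j=0}^{s-1}(2n-1+2j)}{2^{s-l}\,l!\,(s-l)!}\big(\tfrac{k_0}{|k_0|}\big)^{\otimes l}\otimes\mathrm{Id}^{\otimes(s-l)}\Big)\otimes\Big(\frac{(-1)^n(2n)!}{(1-2n)4^n(n!)^2}\sum_{\substack{\alpha\in\mathbb N^n\\|\alpha|=m-n}}\ \sum_{\substack{\beta\in\mathbb N^n\\|\beta|=p-r}}\frac1{\beta!}\nabla^{\beta_1}\nu_{k_0}^{\alpha_1}\otimes\cdots\otimes\nabla^{\beta_n}\nu_{k_0}^{\alpha_n}\Big),$$ where $\mathbb N\ni0$, $\alpha,\beta$ here are multi-indices (unrelated to the exponents above), derivatives are in $k$ at $k_0$, and for $n=0$ the double sum is $1$ if $m=0$ and $p=r$, and $0$ otherwise.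
   Formalization: The matrix field ã is assumed Hermitian at every point (this includes real symmetric fields); without symmetry the claim fails, e.g. for ã = i·Id, where u and the approximation grow exponentially at different rates. *)

theory Defs
  imports "HOL-Analysis.Analysis"
begin

section \<open>Calculus on \<open>\<real>\<^sup>n\<close>\<close>

definition partial :: "'n::finite \<Rightarrow> (real^'n \<Rightarrow> complex) \<Rightarrow> real^'n \<Rightarrow> complex" where
  "partial i f x = frechet_derivative f (at x) (axis i 1)"

fun partials :: "'n::finite list \<Rightarrow> (real^'n \<Rightarrow> complex) \<Rightarrow> real^'n \<Rightarrow> complex" where
  "partials [] f = f"
| "partials (i # is) f = partial i (partials is f)"

definition smooth :: "(real^'n::finite \<Rightarrow> complex) \<Rightarrow> bool" where
  "smooth f \<longleftrightarrow> (\<forall>is x. partials is f differentiable (at x))"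

definition grad :: "(real^'n::finite \<Rightarrow> complex) \<Rightarrow> real^'n \<Rightarrow> complex^'n" where
  "grad f x = (\<chi> i. partial i f x)"

definition divergence :: "(real^'n::finite \<Rightarrow> complex^'n) \<Rightarrow> real^'n \<Rightarrow> complex" where
  "divergence V x = (\<Sum>i\<in>UNIV. partial i (\<lambda>x. V x $ i) x)"

definition C2_on :: "'a::real_normed_vector set \<Rightarrow> ('a \<Rightarrow> 'b::real_normed_vector) \<Rightarrow> bool" where
  "C2_on S f \<longleftrightarrow> (\<exists>(Df :: 'a \<Rightarrow> 'a \<Rightarrow>\<^sub>L 'b) (D2f :: 'a \<Rightarrow> 'a \<Rightarrow>\<^sub>L 'a \<Rightarrow>\<^sub>L 'b).
     (\<forall>z\<in>S. (f has_derivative blinfun_apply (Df z)) (at z within S)) \<and>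
     (\<forall>z\<in>S. (Df has_derivative blinfun_apply (D2f z)) (at z within S)) \<and>
     continuous_on S D2f)"

text \<open>Bounded subsets of the Schwartz space (all seminorms are bounded on the set).\<close>
definition schwartz_bounded :: "(real^'n::finite \<Rightarrow> complex) set \<Rightarrow> bool" where
  "schwartz_bounded S \<longleftrightarrow> (\<forall>f\<in>S. smooth f) \<and>
     (\<forall>N is. \<exists>B. \<forall>f\<in>S. \<forall>x. (1 + norm x) ^ N * norm (partials is f x) \<le> B)"

definition schwartz :: "(real^'n::finite \<Rightarrow> complex) \<Rightarrow> bool" where
  "schwartz f \<longleftrightarrow> schwartz_bounded {f}"

definition fourier :: "(real^'n::finite \<Rightarrow> complex) \<Rightarrow> real^'n \<Rightarrow> complex" where
  "fourier f k = (LINT x|lborel. cis (- (k \<bullet> x)) * f x)"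

definition fourier_support :: "(real^'n::finite \<Rightarrow> complex) \<Rightarrow> (real^'n) set" where
  "fourier_support f = closure {k. fourier f k \<noteq> 0}"

definition L2 :: "(real^'n::finite \<Rightarrow> complex) \<Rightarrow> bool" where
  "L2 f \<longleftrightarrow> f \<in> borel_measurable lborel \<and> integrable lborel (\<lambda>x. (norm (f x))\<^sup>2)"

definition L2_norm :: "(real^'n::finite \<Rightarrow> complex) \<Rightarrow> real" where
  "L2_norm f = sqrt (LINT x|lborel. (norm (f x))\<^sup>2)"

definition cvec :: "real^'n::finite \<Rightarrow> complex^'n" where
  "cvec k = (\<chi> i. of_real (k $ i))"

text \<open>The bilinear (not sesquilinear) product.\<close>
definition cdot :: "complex^'n::finite \<Rightarrow> complex^'n \<Rightarrow> complex" where
  "cdot a b = (\<Sum>i\<in>UNIV. a $ i * b $ i)"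

section \<open>Functions on the torus\<close>

text \<open>Functions on \<open>\<T>\<^sup>M = [0, 2\<pi>)\<^sup>M\<close> are \<open>2\<pi>\<close>-periodic functions on \<open>\<real>\<^sup>M\<close>.\<close>

definition torus_periodic :: "(real^'m::finite \<Rightarrow> 'b) \<Rightarrow> bool" where
  "torus_periodic f \<longleftrightarrow> (\<forall>y j. f (y + axis j (2 * pi)) = f y)"

definition torus_cell :: "(real^'m::finite) set" where
  "torus_cell = {y. \<forall>j. 0 \<le> y $ j \<and> y $ j < 2 * pi}"

definition ivec :: "int^'m::finite \<Rightarrow> real^'m" where
  "ivec \<xi> = (\<chi> j. of_int (\<xi> $ j))"

definition torus_fourier :: "(real^'m::finite \<Rightarrow> complex) \<Rightarrow> int^'m \<Rightarrow> complex" where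
  "torus_fourier f \<xi> = (LINT y:torus_cell|lborel. cis (- (ivec \<xi> \<bullet> y)) * f y)"

definition torus_fourier_matrix ::
    "(real^'m::finite \<Rightarrow> complex^'d::finite^'d) \<Rightarrow> int^'m \<Rightarrow> complex^'d^'d" where
  "torus_fourier_matrix a \<xi> = (\<chi> i j. torus_fourier (\<lambda>y. a y $ i $ j) \<xi>)"

definition torus_mean :: "(real^'m::finite \<Rightarrow> complex) \<Rightarrow> complex" where
  "torus_mean f = (LINT y:torus_cell|lborel. f y) / of_real ((2 * pi) ^ CARD('m))"

definition torus_mean_vec :: "(real^'m::finite \<Rightarrow> complex^'d::finite) \<Rightarrow> complex^'d" where
  "torus_mean_vec g = (\<chi> i. torus_mean (\<lambda>y. g y $ i))"

definition mean_free :: "(real^'m::finite \<Rightarrow> complex) \<Rightarrow> real^'m \<Rightarrow> complex" where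
  "mean_free f y = f y - torus_mean f"

definition trig_poly :: "(real^'m::finite \<Rightarrow> complex) \<Rightarrow> bool" where
  "trig_poly f \<longleftrightarrow> (\<exists>S c. finite S \<and> (\<forall>y. f y = (\<Sum>\<xi>\<in>S. c \<xi> * cis (ivec \<xi> \<bullet> y))))"

section \<open>Quasiperiodic coefficient fields\<close>

definition quasiperiodic_field ::
    "real^'m::finite^'d::finite \<Rightarrow> (real^'m \<Rightarrow> complex^'d^'d) \<Rightarrow> real^'d \<Rightarrow> complex^'d^'d" where
  "quasiperiodic_field F aT x = aT (transpose F *v x)"

definition QP' :: "real^'m::finite^'d::finite \<Rightarrow> (real^'m \<Rightarrow> complex^'d^'d) \<Rightarrow> bool" where
  "QP' F aT \<longleftrightarrow> CARD('m) \<ge> CARD('d) \<and> continuous_on UNIV aT \<and> torus_periodic aT \<and>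
     (\<exists>r\<^sub>0>0. \<exists>C\<ge>1. \<exists>\<alpha>>0.
        (\<forall>\<xi>. \<xi> \<noteq> 0 \<longrightarrow> norm (F *v ivec \<xi>) \<ge> 1 / C * norm (ivec \<xi>) powr (- r\<^sub>0)) \<and>
        (\<forall>K\<ge>0.
           (\<lambda>\<xi>. norm (torus_fourier_matrix aT \<xi>)) summable_on {\<xi>. norm (ivec \<xi>) > K} \<and>
           (\<Sum>\<^sub>\<infinity>\<xi>\<in>{\<xi>. norm (ivec \<xi>) > K}. norm (torus_fourier_matrix aT \<xi>))
             \<le> exp (- (K powr \<alpha>))))"

definition hermitian :: "complex^'d::finite^'d \<Rightarrow> bool" where
  "hermitian A \<longleftrightarrow> (\<forall>i j. A $ i $ j = cnj (A $ j $ i))"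

definition nonresonant :: "real^'m::finite^'d::finite \<Rightarrow> (real^'d) set" where
  "nonresonant F = UNIV - (\<Union>\<xi>\<in>{\<xi>. \<xi> \<noteq> 0}. {k. norm (F *v ivec \<xi> + k) = norm k})"

section \<open>Rayleigh--Schroedinger coefficients\<close>

text \<open>On the torus, \<open>\<nabla>\<close> stands for \<open>F \<nabla>\<^sub>\<T>\<close>, the derivative that corresponds to \<open>\<nabla>\<^sub>x\<close>
  under \<open>x \<mapsto> F\<^sup>T x\<close>.\<close>

definition qgrad :: "real^'m::finite^'d::finite \<Rightarrow> (real^'m \<Rightarrow> complex) \<Rightarrow> real^'m \<Rightarrow> complex^'d" where
  "qgrad F f y = (\<chi> i. \<Sum>j\<in>UNIV. of_real (F $ i $ j) * partial j f y)"

definition qdiv :: "real^'m::finite^'d::finite \<Rightarrow> (real^'m \<Rightarrow> complex^'d) \<Rightarrow> real^'m \<Rightarrow> complex" where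
  "qdiv F g y = (\<Sum>i\<in>UNIV. \<Sum>j\<in>UNIV. of_real (F $ i $ j) * partial j (\<lambda>y. g y $ i) y)"

definition qgrad_shift ::
    "real^'m::finite^'d::finite \<Rightarrow> real^'d \<Rightarrow> (real^'m \<Rightarrow> complex) \<Rightarrow> real^'m \<Rightarrow> complex^'d" where
  "qgrad_shift F k f y = qgrad F f y + (\<i> * f y) *s cvec k"

definition qdiv_shift ::
    "real^'m::finite^'d::finite \<Rightarrow> real^'d \<Rightarrow> (real^'m \<Rightarrow> complex^'d) \<Rightarrow> real^'m \<Rightarrow> complex" where
  "qdiv_shift F k g y = qdiv F g y + \<i> * cdot (cvec k) (g y)"

definition neg_laplace_shift ::
    "real^'m::finite^'d::finite \<Rightarrow> real^'d \<Rightarrow> (real^'m \<Rightarrow> complex) \<Rightarrow> real^'m \<Rightarrow> complex" where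
  "neg_laplace_shift F k f y = - qdiv F (qgrad F f) y - 2 * \<i> * cdot (cvec k) (qgrad F f y)"

text \<open>The mean-zero solution of \<open>-\<triangle>\<^sub>k \<psi> = g\<close>. Resonant \<open>k\<close> may accumulate at a non-resonant one,
  and for those the kernel of \<open>-\<triangle>\<^sub>k\<close> contains nonconstant exponentials. The last condition
  discards these: only frequencies present in \<open>g\<close> may occur in \<open>\<psi>\<close>. Thus, for a trigonometric
  polynomial \<open>g\<close>, the solution is well defined in a whole neighborhood of a non-resonant point;
  at non-resonant \<open>k\<close> that condition holds automatically.\<close>
definition mean_zero_solution ::
    "real^'m::finite^'d::finite \<Rightarrow> real^'d \<Rightarrow> (real^'m \<Rightarrow> complex) \<Rightarrow> real^'m \<Rightarrow> complex" where
  "mean_zero_solution F k g = (THE \<psi>. trig_poly \<psi> \<and> torus_mean \<psi> = 0 \<and>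
     (\<forall>y. neg_laplace_shift F k \<psi> y = g y) \<and>
     (\<forall>\<xi>. torus_fourier g \<xi> = 0 \<longrightarrow> torus_fourier \<psi> \<xi> = 0))"

definition nu_of ::
    "real^'m::finite^'d::finite \<Rightarrow> (real^'m \<Rightarrow> complex^'d^'d) \<Rightarrow> real^'d \<Rightarrow> (real^'m \<Rightarrow> complex) \<Rightarrow> complex"
  where
  "nu_of F aT k f = - \<i> * cdot (cvec k) (torus_mean_vec (\<lambda>y. aT y *v qgrad_shift F k f y))"

fun rs_phi ::
    "real^'m::finite^'d::finite \<Rightarrow> (real^'m \<Rightarrow> complex^'d^'d) \<Rightarrow> real^'d \<Rightarrow> nat \<Rightarrow> real^'m \<Rightarrow> complex"
  where
  "rs_phi F aT k 0 = (\<lambda>y. 1)"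
| "rs_phi F aT k (Suc n) = mean_zero_solution F k (\<lambda>y.
     mean_free (qdiv_shift F k (\<lambda>y. aT y *v qgrad_shift F k (rs_phi F aT k n) y)) y
     + (\<Sum>l<n. nu_of F aT k (rs_phi F aT k l) * rs_phi F aT k (n - l) y))"

definition rs_nu ::
    "real^'m::finite^'d::finite \<Rightarrow> (real^'m \<Rightarrow> complex^'d^'d) \<Rightarrow> nat \<Rightarrow> real^'d \<Rightarrow> complex" where
  "rs_nu F aT n k = nu_of F aT k (rs_phi F aT k n)"

section \<open>Tensors\<close>

text \<open>A tensor of order \<open>p\<close> on \<open>\<complex>\<^sup>d\<close> is given by its entries, indexed by the lists of length \<open>p\<close>
  over the index type; values at lists of other lengths are irrelevant.\<close>

type_synonym 'd tensor = "'d list \<Rightarrow> complex"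

text \<open>\<open>tensor_prod r S T\<close> is \<open>S \<otimes> T\<close> for \<open>S\<close> of order \<open>r\<close>.\<close>
definition tensor_prod :: "nat \<Rightarrow> 'd tensor \<Rightarrow> 'd tensor \<Rightarrow> 'd tensor" where
  "tensor_prod r S T is = S (take r is) * T (drop r is)"

definition vec_tensor_power :: "real^'d::finite \<Rightarrow> 'd tensor" where
  "vec_tensor_power v is = (\<Prod>i\<leftarrow>is. of_real (v $ i))"

fun id_tensor_power :: "'d tensor" where
  "id_tensor_power [] = 1"
| "id_tensor_power [i] = 0"
| "id_tensor_power (i # j # is) = (if i = j then 1 else 0) * id_tensor_power is"

text \<open>\<open>\<nabla>\<^bsup>\<beta>\<^sub>1\<^esup> \<nu>\<^bsup>\<alpha>\<^sub>1\<^esup> \<otimes> \<dots> \<otimes> \<nabla>\<^bsup>\<beta>\<^sub>n\<^esup> \<nu>\<^bsup>\<alpha>\<^sub>n\<^esup>\<close> at \<open>k\<close>, for \<open>\<alpha>\<close> and \<open>\<beta>\<close> of length \<open>n\<close>\<close>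
fun deriv_tensor ::
    "(nat \<Rightarrow> real^'d::finite \<Rightarrow> complex) \<Rightarrow> real^'d \<Rightarrow> nat list \<Rightarrow> nat list \<Rightarrow> 'd tensor" where
  "deriv_tensor \<nu> k (a # \<alpha>) (b # \<beta>) =
     tensor_prod b (\<lambda>is. partials is (\<nu> a) k) (deriv_tensor \<nu> k \<alpha> \<beta>)"
| "deriv_tensor \<nu> k _ _ = (\<lambda>is. 1)"

definition radial_tensor :: "real^'d::finite \<Rightarrow> nat \<Rightarrow> nat \<Rightarrow> 'd tensor" where
  "radial_tensor k n r is =
     (\<Sum>(l, s)\<in>{(l, s). l \<le> s \<and> 2 * s - l = r}.
        of_real ((-1) ^ s * (\<Prod>j<s. 2 * real n - 1 + 2 * real j)
                 / (2 ^ (s - l) * fact l * fact (s - l)))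
        * tensor_prod l (vec_tensor_power (k /\<^sub>R norm k)) id_tensor_power is)"

definition nu_tensor ::
    "(nat \<Rightarrow> real^'d::finite \<Rightarrow> complex) \<Rightarrow> real^'d \<Rightarrow> nat \<Rightarrow> nat \<Rightarrow> nat \<Rightarrow> 'd tensor" where
  "nu_tensor \<nu> k n a b is =
     of_real ((-1) ^ n * fact (2 * n) / ((1 - 2 * real n) * 4 ^ n * (fact n)\<^sup>2))
     * (\<Sum>\<alpha>\<in>{\<alpha>. length \<alpha> = n \<and> sum_list \<alpha> = a}. \<Sum>\<beta>\<in>{\<beta>. length \<beta> = n \<and> sum_list \<beta> = b}.
          of_real (1 / (\<Prod>j\<leftarrow>\<beta>. fact j)) * deriv_tensor \<nu> k \<alpha> \<beta> is)"

definition C_tensor ::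
    "real^'m::finite^'d::finite \<Rightarrow> (real^'m \<Rightarrow> complex^'d^'d) \<Rightarrow> nat \<Rightarrow> nat \<Rightarrow> real^'d \<Rightarrow> 'd tensor" where
  "C_tensor F aT m p k is =
     (\<Sum>r\<le>p. \<Sum>n\<le>m. of_real (norm k powi (1 - 2 * int n - int r))
        * tensor_prod r (radial_tensor k n r) (nu_tensor (rs_nu F aT) k n (m - n) (p - r)) is)"

text \<open>\<open>T \<odot> (-\<i>\<nabla>)\<^bsup>\<otimes>p\<^esup> f\<close>\<close>
definition contract_deriv :: "nat \<Rightarrow> 'd::finite tensor \<Rightarrow> (real^'d \<Rightarrow> complex) \<Rightarrow> real^'d \<Rightarrow> complex"
  where
  "contract_deriv p T f x = (\<Sum>is\<in>{is. length is = p}. T is * ((- \<i>) ^ p * partials is f x))"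

section \<open>The wave equation and the amplitude equations\<close>

definition time_deriv :: "(real \<Rightarrow> 'a \<Rightarrow> complex) \<Rightarrow> real \<Rightarrow> 'a \<Rightarrow> complex" where
  "time_deriv u t x = vector_derivative (\<lambda>s. u s x) (at t within {0..})"

definition wave_packet ::
    "real \<Rightarrow> real^'d::finite \<Rightarrow> (real^'d \<Rightarrow> complex) \<Rightarrow> real^'d \<Rightarrow> complex" where
  "wave_packet \<epsilon> k f x =
     of_real (\<epsilon> powr (real CARD('d) / 2)) * cis (k \<bullet> x) * f (\<epsilon> *\<^sub>R x)"

text \<open>Classical solutions. Since coefficients and data are smooth, and the equation has finite speed
  of propagation for small \<open>lam\<close>, there is exactly one, and it is the finite-energy solution; no
  decay has to be imposed.\<close>
definition wave_solution ::
    "(real^'d::finite \<Rightarrow> complex^'d^'d) \<Rightarrow> real \<Rightarrow> (real^'d \<Rightarrow> complex) \<Rightarrow> (real^'d \<Rightarrow> complex)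
     \<Rightarrow> (real \<Rightarrow> real^'d \<Rightarrow> complex) \<Rightarrow> bool" where
  "wave_solution a lam f g u \<longleftrightarrow>
     C2_on ({0..} \<times> UNIV) (\<lambda>(t, x). u t x) \<and>
     (\<forall>t\<ge>0. \<forall>x. time_deriv (time_deriv u) t x
        = divergence (\<lambda>x. (mat 1 + lam *\<^sub>R a x) *v grad (u t) x) x) \<and>
     (\<forall>x. u 0 x = f x) \<and>
     (\<forall>x. time_deriv u 0 x = g x)"

text \<open>\<open>(|k|\<^sup>2 \<triangle> - (k\<cdot>\<nabla>)\<^sup>2) f / (2 |k|\<^sup>3)\<close>\<close>
definition transverse_laplace :: "real^'d::finite \<Rightarrow> (real^'d \<Rightarrow> complex) \<Rightarrow> real^'d \<Rightarrow> complex" where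
  "transverse_laplace k f x =
     (of_real ((norm k)\<^sup>2) * divergence (grad f) x
      - cdot (cvec k) (grad (\<lambda>x. cdot (cvec k) (grad f x)) x)) / of_real (2 * norm k ^ 3)"

text \<open>\<open>\<sigma> = 1\<close> and \<open>\<sigma> = -1\<close> give the equations for the two amplitudes. The solution is sought in the
  class of functions that are bounded in the Schwartz space locally uniformly in time. For initial
  data with compactly supported Fourier transform it exists and is unique there (without decay at
  infinity, uniqueness may fail).\<close>
definition amplitude_solution ::
    "real \<Rightarrow> real^'m::finite^'d::finite \<Rightarrow> (real^'m \<Rightarrow> complex^'d^'d) \<Rightarrow> real^'d \<Rightarrow> real \<Rightarrow> nat \<Rightarrow> real
     \<Rightarrow> (real^'d \<Rightarrow> complex) \<Rightarrow> (real^'d \<Rightarrow> complex) \<Rightarrow> (real \<Rightarrow> real^'d \<Rightarrow> complex) \<Rightarrow> bool" where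
  "amplitude_solution \<sigma> F aT k \<beta> L lam u\<^sub>0 v\<^sub>0 A \<longleftrightarrow> (let \<epsilon> = lam powr \<beta> in
     (\<forall>T. schwartz_bounded (A ` {0..T})) \<and>
     (\<forall>t\<ge>0. \<forall>x. (\<lambda>s. A s x) differentiable (at t within {0..})) \<and>
     (\<forall>t\<ge>0. \<forall>x.
        \<i> * time_deriv A t x
        + of_real (\<sigma> * \<epsilon>\<^sup>2) * transverse_laplace k (A t) x
        - of_real (\<sigma> * lam) * (rs_nu F aT 0 k / of_real (2 * norm k)) * A t x
        = of_real \<sigma> *
          (\<Sum>(m, p)\<in>{(m, p). m \<le> L \<and> int p \<le> \<lfloor>real L / \<beta>\<rfloor> \<and> m + p \<ge> 2 \<and> (m, p) \<noteq> (0, 2)}.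
             of_real (lam ^ m * \<epsilon> ^ p) * contract_deriv p (C_tensor F aT m p k) (A t) x)) \<and>
     (\<forall>x. A 0 x = u\<^sub>0 x + of_real \<sigma> * (\<i> * v\<^sub>0 x / of_real (norm k))))"

definition U_branch ::
    "real \<Rightarrow> real^'d::finite \<Rightarrow> real \<Rightarrow> (real \<Rightarrow> real^'d \<Rightarrow> complex) \<Rightarrow> real \<Rightarrow> real^'d \<Rightarrow> complex" where
  "U_branch \<sigma> k \<epsilon> A t x = wave_packet \<epsilon> k (A t) (x - (\<sigma> * t) *\<^sub>R (k /\<^sub>R norm k))"

definition U_approx ::
    "real^'d::finite \<Rightarrow> real \<Rightarrow> (real \<Rightarrow> real^'d \<Rightarrow> complex) \<Rightarrow> (real \<Rightarrow> real^'d \<Rightarrow> complex)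
     \<Rightarrow> real \<Rightarrow> real^'d \<Rightarrow> complex" where
  "U_approx k \<epsilon> Ap Am t x = (U_branch 1 k \<epsilon> Ap t x + U_branch (-1) k \<epsilon> Am t x) / 2"

end

theory Submission
 imports Defs "HOL-Probability.Characteristic_Functions" "HOL-Probability.Sinc_Integral"
begin

text \<open>For frequencies near \<open>k\<^sub>0\<close>, the truncated Rayleigh--Schroedinger series is a Bloch wave of
 \<open>-\<nabla> \<cdot> (Id + \<lambda> a) \<nabla>\<close> with eigenvalue \<open>|K|\<^sup>2 + \<Sum>\<^sub>j \<lambda>\<^bsup>j+1\<^esup> \<nu>\<^sub>K\<^sup>j\<close>, up to \<open>O(\<lambda>\<^bsup>L+1\<^esup>)\<close>. The tensors
 \<open>C\<^bsub>m,p\<^esub>\<close> are the Taylor coefficients at \<open>k\<^sub>0\<close> of the square root of that eigenvalue, expanded in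
 \<open>\<lambda>\<close>. Hence \<open>|k\<^sub>0|\<close> plus the transport and the amplitude symbol is the frequency of the Bloch wave up
 to \<open>O(\<lambda>\<^bsup>L+1\<^esup> + \<epsilon>\<^bsup>P+1\<^esup>)\<close> with \<open>P = \<lfloor>L/\<beta>\<rfloor>\<close>. A superposition of Bloch waves with this frequency is
 \<open>O(\<lambda>\<^sup>\<gamma>)\<close>-close to the approximation and solves the wave equation up to a residual of the above size.
 The error is compared by an energy estimate for its time primitive, so that \<open>L\<^sup>2\<close> norms (rather than
 energies) are controlled: the initial velocity and the residual, integrated in time, enter as data in
 divergence form and as a source that stays small because the residual oscillates.\<close>

section \<open>Integration on Euclidean space\<close>

text \<open>The bound grows like t although the equation is of second order. A residual of size
  lambda^(L + gamma) integrated twice would give t^2; its first primitive is therefore written down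
  exactly, by dividing each amplitude by its frequency, which is at least |k0|/2. Only one time
  integration is left for the energy estimate. All denominators are values of the symbol |K + F
  xi|^2 - |K|^2. As the coefficient field is a trigonometric polynomial, the correctors up to order
  L reach finitely many frequencies xi. A non-resonant k0 thus has a neighbourhood in which all
  these denominators are nonzero, and there every coefficient is a rational function of K. This
  yields smoothness, uniform bounds and continuity of all packet amplitudes at once. The exponent
  gamma is the least of three numbers: 1, the order of the first corrector; beta, the order by which
  frequency and wave vector vary across a packet of width epsilon; and beta (P + 1) - L, what the
  Taylor remainder epsilon^(P + 1) gains over lambda^L. The last is positive because P + 1 > L /
  beta.\<close>

lemma lborel_affine_integrable:
 fixes f :: "'a::euclidean_space => 'b::{banach, second_countable_topology}"
 assumes f: "integrable lborel f" and c: "c ~= 0"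
 shows "integrable lborel (\<lambda>x. f (t + c *\<^sub>R x))"
  and "integral\<^sup>L lborel f = \<bar>c\<bar> ^ DIM('a) *\<^sub>R (LINT x|lborel. f (t + c *\<^sub>R x))"
proof -
 have [measurable]: "f \<in> borel_measurable borel"
  using f borel_measurable_integrable by force
 have "(\<integral>\<^sup>+x. norm (f x) \<partial>lborel) = \<bar>c\<bar>^DIM('a) * (\<integral>\<^sup>+x. norm (f (t + c *\<^sub>R x)) \<partial>lborel)"
  by (subst lborel_affine[OF c, of t])
    (simp add: nn_integral_density nn_integral_distr nn_integral_cmult)
 moreover have "(\<integral>\<^sup>+x. norm (f x) \<partial>lborel) < \<infinity>"
  using f by (simp add: integrable_iff_bounded)
 moreover have "ennreal (\<bar>c\<bar>^DIM('a)) > 0" using c by (simp add: ennreal_zero_less_mult_iff)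
 ultimately have "(\<integral>\<^sup>+x. norm (f (t + c *\<^sub>R x)) \<partial>lborel) < \<infinity>"
  by (metis ennreal_mult_eq_top_iff infinity_ennreal_def less_top not_less_zero)
 then show i: "integrable lborel (\<lambda>x. f (t + c *\<^sub>R x))"
  by (simp add: integrable_iff_bounded)
 show "integral\<^sup>L lborel f = \<bar>c\<bar> ^ DIM('a) *\<^sub>R (LINT x|lborel. f (t + c *\<^sub>R x))"
  using i by (subst lborel_affine[OF c, of t]) (simp add: integral_density integral_distr)
qed

lemma lborel_translate_integral:
 fixes f :: "'a::euclidean_space => 'b::{banach, second_countable_topology}"
 assumes "integrable lborel f"
 shows "(LINT x|lborel. f (t + x)) = integral\<^sup>L lborel f"
 using lborel_affine_integrable(2)[OF assms, of 1 t] by simp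

text \<open>Fubini for integrands that split over the coordinates. \<open>lborel\<close> on
  \<open>real^'n\<close> is the image of a product measure indexed by \<open>Basis\<close>, so the
  work lies in passing between the basis vectors \<open>axis i 1\<close> and the indices
  \<open>i\<close>; \<open>ix\<close> inverts that bijection.\<close>

lemma integral_lborel_vec_prod:
 fixes f :: "'n::finite => real => complex"
 assumes f: "!!i. integrable lborel (f i)"
 shows "integrable lborel (\<lambda>x::real^'n. \<Prod>i\<in>UNIV. f i (x $ i))"
  and "(LINT x|lborel. (\<Prod>i\<in>UNIV. f i ((x::real^'n) $ i))) = (\<Prod>i\<in>UNIV. integral\<^sup>L lborel (f i))"
proof -
 interpret product_sigma_finite "\<lambda>_::real^'n. lborel :: real measure" by standard
 define ix where "ix b = (SOME i. b = axis i (1::real))" for b :: "real^'n"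
 have ix: "ix (axis i 1) = i" for i :: 'n
  by (simp add: ix_def axis_eq_axis)
 have bij: "bij_betw (\<lambda>i::'n. axis i (1::real)) UNIV Basis"
  by (auto simp: bij_betw_def inj_on_def axis_eq_axis Basis_vec_def)
 have prod_eq: "(\<Prod>b\<in>Basis. g (ix b) b) = (\<Prod>i\<in>UNIV. g i (axis i 1))" for g :: "'n => real^'n => complex"
  by (subst prod.reindex_bij_betw[OF bij, symmetric]) (simp add: ix)
 have [measurable]: "f i \<in> borel_measurable borel" for i
  using f borel_measurable_integrable by force
 have comp: "(\<Sum>b\<in>Basis. x b *\<^sub>R b) $ i = x (axis i 1)" for x :: "real^'n => real" and i
 proof -
  have "(\<Sum>b\<in>Basis. x b *\<^sub>R b) $ i = (\<Sum>b\<in>Basis. x b *\<^sub>R b) \<bullet> axis i 1"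
   by (simp add: inner_axis)
  also have "... = x (axis i 1)"
   by (intro inner_sum_left_Basis) (auto simp: Basis_vec_def)
  finally show ?thesis .
 qed
 have eq: "(\<Prod>i\<in>UNIV. f i ((\<Sum>b\<in>Basis. x b *\<^sub>R b) $ i)) = (\<Prod>b\<in>Basis. f (ix b) (x b))"
  for x :: "real^'n => real"
  unfolding comp by (rule prod_eq[of "\<lambda>i b. f i (x b)", symmetric])
 have eqfun: "(\<lambda>x. \<Prod>i\<in>UNIV. f i ((\<Sum>b\<in>Basis. x b *\<^sub>R b) $ i)) = (\<lambda>x::real^'n => real. \<Prod>b\<in>Basis. f (ix b) (x b))"
  using eq by blast
 have int: "integrable (\<Pi>\<^sub>M b\<in>(Basis::(real^'n) set). lborel) (\<lambda>x. \<Prod>b\<in>Basis. f (ix b) (x b))"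
  by (rule product_integrable_prod) (auto simp: f)
 have m: "(\<lambda>x::real^'n. \<Prod>i\<in>UNIV. f i (x $ i)) \<in> borel_measurable borel"
  by measurable
 have m2: "(\<lambda>x. \<Sum>b\<in>Basis. x b *\<^sub>R b) \<in> (\<Pi>\<^sub>M b\<in>(Basis::(real^'n) set). lborel) \<rightarrow>\<^sub>M borel"
  by measurable
 show "integrable lborel (\<lambda>x::real^'n. \<Prod>i\<in>UNIV. f i (x $ i))"
  unfolding lborel_eq[where 'a="real^'n"]
  by (subst integrable_distr_eq[OF m2 m]) (use int in \<open>simp only: eqfun\<close>)
 have "(LINT x|lborel. (\<Prod>i\<in>UNIV. f i ((x::real^'n) $ i))) =
   (LINT x|(\<Pi>\<^sub>M b\<in>(Basis::(real^'n) set). lborel). (\<Prod>b\<in>Basis. f (ix b) (x b)))"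
  unfolding lborel_eq[where 'a="real^'n"]
  by (subst integral_distr[OF m2 m]) (simp only: eqfun)
 also have "... = (\<Prod>b\<in>Basis. integral\<^sup>L lborel (f (ix b)))"
  by (rule product_integral_prod) (auto simp: f)
 also have "... = (\<Prod>i\<in>UNIV. integral\<^sup>L lborel (f i))"
  by (rule prod_eq[of "\<lambda>i b. integral\<^sup>L lborel (f i)"])
 finally show "(LINT x|lborel. (\<Prod>i\<in>UNIV. f i ((x::real^'n) $ i))) = (\<Prod>i\<in>UNIV. integral\<^sup>L lborel (f i))" .
qed

text \<open>Dominated convergence for difference quotients: on the convex set \<open>T\<close> the
  mean value inequality bounds them by \<open>D\<close>, and subtracting the linear part costs
  another \<open>D\<close>. The derivative is taken within \<open>T\<close> because time intervals
  \<open>{0..t}\<close> have only one-sided derivatives at their ends.\<close>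

lemma has_derivative_integral_dominated:
 fixes F :: "'p::{real_normed_vector,perfect_space} => 'a => 'b::{banach,second_countable_topology}"
 assumes T: "convex T" "p0 \<in> T"
  and int: "!!p. p \<in> T ==> integrable M (F p)"
  and der: "!!p x. p \<in> T ==> ((\<lambda>p. F p x) has_derivative F' p x) (at p within T)"
  and bnd: "!!p x v. p \<in> T ==> norm (F' p x v) <= D x * norm v"
  and D: "integrable M D"
  and meas: "!!v. (\<lambda>x. F' p0 x v) \<in> borel_measurable M"
 shows "((\<lambda>p. LINT x|M. F p x) has_derivative (\<lambda>v. LINT x|M. F' p0 x v)) (at p0 within T)"
proof -
 have iF': "integrable M (\<lambda>x. F' p0 x v)" for v
  by (rule Bochner_Integration.integrable_bound[of M "\<lambda>x. D x * norm v"])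
   (use D meas bnd[OF T(2)] in \<open>auto intro!: order_trans[OF bnd[OF T(2)]]\<close>)
 have lin: "bounded_linear (F' p0 x)" for x
  using der[OF T(2)] has_derivative_bounded_linear by blast
 have bl: "bounded_linear (\<lambda>v. LINT x|M. F' p0 x v)"
 proof (rule bounded_linear_intro[where K="LINT x|M. D x"])
  fix u v :: 'p and r :: real
  show "(LINT x|M. F' p0 x (u + v)) = (LINT x|M. F' p0 x u) + (LINT x|M. F' p0 x v)"
   by (simp add: linear_simps(1)[OF lin] iF' flip: Bochner_Integration.integral_add)
  show "(LINT x|M. F' p0 x (r *\<^sub>R v)) = r *\<^sub>R (LINT x|M. F' p0 x v)"
   by (simp add: linear_simps(5)[OF lin])
  have "norm (LINT x|M. F' p0 x v) <= (LINT x|M. D x * norm v)"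
   by (rule order_trans[OF integral_norm_bound integral_mono]) (use iF' D bnd[OF T(2)] in auto)
  then show "norm (LINT x|M. F' p0 x v) <= norm v * (LINT x|M. D x)"
   by (simp add: mult.commute)
 qed
 have lip: "norm (F y x - F p0 x) <= D x * norm (y - p0)" if "y \<in> T" for x y
 proof (rule differentiable_bound[OF T(1) der])
  show "onorm (F' p x) <= D x" if "p \<in> T" for p
   by (rule onorm_le) (rule bnd[OF that])
 qed (use that T in auto)
 show ?thesis
  unfolding has_derivative_within
 proof (intro conjI bl)
  show "((\<lambda>y. (1 / norm (y - p0)) *\<^sub>R ((LINT x|M. F y x) - ((LINT x|M. F p0 x) + (LINT x|M. F' p0 x (y - p0)))))
    \<longlongrightarrow> 0) (at p0 within T)"
   unfolding tendsto_at_iff_sequentially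
  proof (intro allI impI)
   fix X :: "nat => 'p" assume X: "\<forall>i. X i \<in> T - {p0}" and lim: "X \<longlonglongrightarrow> p0"
   define s where "s i x = (1 / norm (X i - p0)) *\<^sub>R (F (X i) x - (F p0 x + F' p0 x (X i - p0)))" for i x
   have "(\<lambda>i. LINT x|M. s i x) \<longlonglongrightarrow> (LINT x|M. 0)"
   proof (rule integral_dominated_convergence[where w="\<lambda>x. 2 * D x"])
    show "s i \<in> borel_measurable M" for i
     unfolding s_def using borel_measurable_integrable[OF int[of "X i"]]
      borel_measurable_integrable[OF int[OF T(2)]] X meas by auto
    show "integrable M (\<lambda>x. 2 * D x)" using D by simp
    show "AE x in M. (\<lambda>i. s i x) \<longlonglongrightarrow> 0"
    proof (rule AE_I2)
     fix x
     have "((\<lambda>y. (1 / norm (y - p0)) *\<^sub>R (F y x - (F p0 x + F' p0 x (y - p0)))) \<longlongrightarrow> 0) (at p0 within T)"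
      using der[OF T(2), of x] unfolding has_derivative_within by blast
     then show "(\<lambda>i. s i x) \<longlonglongrightarrow> 0"
      unfolding tendsto_at_iff_sequentially s_def o_def using X lim by blast
    qed
    show "AE x in M. norm (s i x) <= 2 * D x" for i
    proof (rule AE_I2)
     fix x
     have p: "norm (X i - p0) > 0" "X i \<in> T" using X by auto
     have "norm (F (X i) x - (F p0 x + F' p0 x (X i - p0))) <=
       norm (F (X i) x - F p0 x) + norm (F' p0 x (X i - p0))"
      by (metis diff_diff_eq norm_triangle_ineq4)
     also have "... <= 2 * D x * norm (X i - p0)"
      using lip[OF p(2), of x] bnd[OF T(2), of x "X i - p0"] by linarith
     finally show "norm (s i x) <= 2 * D x"
      using p by (simp add: s_def divide_simps)
    qed
   qed auto
   moreover have "(LINT x|M. s i x) = (1 / norm (X i - p0)) *\<^sub>R ((LINT x|M. F (X i) x) - ((LINT x|M. F p0 x) + (LINT x|M. F' p0 x (X i - p0))))" for i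
    unfolding s_def using int[of "X i"] int[OF T(2)] iF' X by simp
   ultimately show "((\<lambda>y. (1 / norm (y - p0)) *\<^sub>R ((LINT x|M. F y x) - ((LINT x|M. F p0 x) + (LINT x|M. F' p0 x (y - p0))))) \<circ> X) \<longlonglongrightarrow> 0"
    by (simp add: o_def)
  qed
 qed
qed

section \<open>Gaussians, Fourier inversion and a Plancherel inequality\<close>

definition gauss :: "'a::real_inner => real" where
 "gauss x = exp (- (x \<bullet> x) / 2)"

lemma gauss_pos [simp]: "gauss x > 0" and gauss_le_1 [simp]: "gauss x <= 1" and gauss_0 [simp]: "gauss 0 = 1"
 and gauss_minus [simp]: "gauss (- x) = gauss x"
 by (auto simp: gauss_def)

lemma gauss_ge_0 [simp]: "gauss x >= 0"
 using gauss_pos[of x] by linarith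

lemma continuous_on_gauss [continuous_intros]:
 "continuous_on S f ==> continuous_on S (\<lambda>x. gauss (f x))"
 unfolding gauss_def by (intro continuous_intros) auto

lemma borel_measurable_gauss [measurable]: "gauss \<in> borel_measurable (borel :: 'a::euclidean_space measure)"
 by (intro borel_measurable_continuous_onI continuous_intros)

lemma cis_measurable [measurable]: "cis \<in> borel_measurable borel"
 by (intro borel_measurable_continuous_onI continuous_intros)

lemma cnj_measurable [measurable]: "cnj \<in> borel_measurable borel"
 by (intro borel_measurable_continuous_onI continuous_intros)

text \<open>This is the characteristic function of the standard normal distribution without its
  normalization.\<close>

lemma gauss_fourier_real:
 fixes t :: real
 shows "integrable lborel (\<lambda>x. cis (t * x) * of_real (exp (- x\<^sup>2 / 2)))"
  and "(LINT x|lborel. cis (t * x) * of_real (exp (- x\<^sup>2 / 2))) = of_real (sqrt (2 * pi) * exp (- t\<^sup>2 / 2))"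
proof -
 have i0: "integrable lborel std_normal_density" by simp
 have "integrable lborel (\<lambda>x. sqrt (2 * pi) * std_normal_density x)"
  using i0 by simp
 then have i1: "integrable lborel (\<lambda>x::real. exp (- x\<^sup>2 / 2))"
  by (simp add: std_normal_density_def)
 show "integrable lborel (\<lambda>x. cis (t * x) * of_real (exp (- x\<^sup>2 / 2)))"
  by (rule Bochner_Integration.integrable_bound[OF i1]) (auto simp: norm_mult)
 have "(LINT x|std_normal_distribution. cis (t * x)) = of_real (exp (- t\<^sup>2 / 2))"
  using char_std_normal_distribution unfolding char_def fun_eq_iff cis_conv_exp by simp
 then have "of_real (exp (- t\<^sup>2 / 2)) = (LINT x|lborel. std_normal_density x *\<^sub>R cis (t * x))"
  by (subst (asm) integral_density) auto
 also have "... = (LINT x|lborel. (1 / sqrt (2 * pi)) * (cis (t * x) * of_real (exp (- x\<^sup>2 / 2))))"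
  by (intro Bochner_Integration.integral_cong) (auto simp: std_normal_density_def scaleR_conv_of_real)
 also have "... = (1 / sqrt (2 * pi)) * (LINT x|lborel. (cis (t * x) * of_real (exp (- x\<^sup>2 / 2))))"
  by simp
 finally show "(LINT x|lborel. cis (t * x) * of_real (exp (- x\<^sup>2 / 2))) = of_real (sqrt (2 * pi) * exp (- t\<^sup>2 / 2))"
  by (simp add: field_simps)
qed

lemma gauss_vec: "gauss (x :: real^'n::finite) = (\<Prod>i\<in>UNIV. exp (- (x $ i)\<^sup>2 / 2))"
 unfolding gauss_def inner_vec_def
 by (simp add: exp_sum sum_divide_distrib sum_negf power2_eq_square flip: exp_sum)

lemma cis_inner_vec: "cis (k \<bullet> (x :: real^'n::finite)) = (\<Prod>i\<in>UNIV. cis (k $ i * x $ i))"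
 by (simp add: inner_vec_def cis_conv_exp sum_distrib_left exp_sum)

lemma gauss_fourier:
 fixes k :: "real^'n::finite"
 shows "integrable lborel (\<lambda>x. cis (k \<bullet> x) * of_real (gauss x))"
  and "(LINT x|lborel. cis (k \<bullet> x) * of_real (gauss x)) = of_real (sqrt (2 * pi) ^ CARD('n) * gauss k)"
proof -
 have eq: "cis (k \<bullet> x) * of_real (gauss x) = (\<Prod>i\<in>UNIV. cis (k $ i * x $ i) * of_real (exp (- (x $ i)\<^sup>2 / 2)))" for x
  by (simp add: gauss_vec cis_inner_vec prod.distrib)
 show "integrable lborel (\<lambda>x. cis (k \<bullet> x) * of_real (gauss x))"
  unfolding eq by (rule integral_lborel_vec_prod(1)[where f="\<lambda>i y. cis (k $ i * y) * of_real (exp (- y\<^sup>2 / 2))"])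
    (rule gauss_fourier_real)
 show "(LINT x|lborel. cis (k \<bullet> x) * of_real (gauss x)) = of_real (sqrt (2 * pi) ^ CARD('n) * gauss k)"
  unfolding eq
  by (subst integral_lborel_vec_prod(2)[where f="\<lambda>i y. cis (k $ i * y) * of_real (exp (- y\<^sup>2 / 2))"])
    (simp_all only: gauss_fourier_real, simp add: gauss_vec prod.distrib of_real_prod)
qed

lemma integrable_gauss: "integrable lborel (gauss :: real^'n::finite => real)"
 and integral_gauss: "integral\<^sup>L lborel (gauss :: real^'n::finite => real) = sqrt (2 * pi) ^ CARD('n)"
proof -
 have *: "integrable lborel (\<lambda>x::real^'n. complex_of_real (gauss x))"
  using gauss_fourier(1)[of 0] by simp
 then show "integrable lborel (gauss :: real^'n::finite => real)"
  by (simp add: complex_of_real_integrable_eq)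
 have "complex_of_real (integral\<^sup>L lborel (gauss :: real^'n::finite => real)) = of_real (sqrt (2 * pi) ^ CARD('n))"
  using gauss_fourier(2)[of "0::real^'n"] by simp
 then show "integral\<^sup>L lborel (gauss :: real^'n::finite => real) = sqrt (2 * pi) ^ CARD('n)"
  using of_real_eq_iff by blast
qed

lemma gauss_fourier_scaled:
 fixes k :: "real^'n::finite"
 assumes s: "s > 0"
 shows "integrable lborel (\<lambda>x. cis (k \<bullet> x) * of_real (gauss (s *\<^sub>R x)))"
  and "(LINT x|lborel. cis (k \<bullet> x) * of_real (gauss (s *\<^sub>R x))) =
      of_real ((sqrt (2 * pi) / s) ^ CARD('n) * gauss (k /\<^sub>R s))"
proof -
 have eq: "cis ((k /\<^sub>R s) \<bullet> (s *\<^sub>R x)) * of_real (gauss (s *\<^sub>R x)) = cis (k \<bullet> x) * of_real (gauss (s *\<^sub>R x))" for x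
  using s by (simp add: field_simps)
 show "integrable lborel (\<lambda>x. cis (k \<bullet> x) * of_real (gauss (s *\<^sub>R x)))"
  using lborel_affine_integrable(1)[OF gauss_fourier(1)[of "k /\<^sub>R s"], of s 0] s by (simp only: eq add_0_left)
 have "of_real (sqrt (2 * pi) ^ CARD('n) * gauss (k /\<^sub>R s)) =
   s ^ CARD('n) *\<^sub>R (LINT x|lborel. cis (k \<bullet> x) * of_real (gauss (s *\<^sub>R x)))"
  using lborel_affine_integrable(2)[OF gauss_fourier(1)[of "k /\<^sub>R s"], of s 0] s
  by (simp only: eq add_0_left gauss_fourier(2)) simp
 then show "(LINT x|lborel. cis (k \<bullet> x) * of_real (gauss (s *\<^sub>R x))) =
      of_real ((sqrt (2 * pi) / s) ^ CARD('n) * gauss (k /\<^sub>R s))"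
  using s by (simp add: scaleR_conv_of_real field_simps power_divide)
qed

lemma integrable_pair_bound:
 fixes f :: "'a::euclidean_space \<times> 'b::euclidean_space => complex"
 assumes "f \<in> borel_measurable borel" and g: "integrable lborel g" and h: "integrable lborel h"
  and b: "!!x y. norm (f (x, y)) <= g x * h y"
 shows "integrable (lborel \<Otimes>\<^sub>M lborel) f"
proof (rule Bochner_Integration.integrable_bound)
 have [measurable]: "g \<in> borel_measurable borel" "h \<in> borel_measurable borel"
  using g h borel_measurable_integrable by force+
 have "(\<lambda>p. g (fst p) * h (snd p)) \<in> borel_measurable (lborel \<Otimes>\<^sub>M lborel)"
  by measurable
 then show "integrable (lborel \<Otimes>\<^sub>M lborel) (\<lambda>p. g (fst p) * h (snd p))"
  by (intro lborel_pair.Fubini_integrable) (use g h in \<open>auto simp: abs_mult integrable_mult_right\<close>)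
 show "f \<in> borel_measurable (lborel \<Otimes>\<^sub>M lborel)"
  using assms(1) by (simp add: lborel_prod)
 show "AE p in lborel \<Otimes>\<^sub>M lborel. norm (f p) <= norm (g (fst p) * h (snd p))"
  using b by (auto intro!: AE_I2 order_trans[OF b])
qed

text \<open>Insert the cutoff \<open>gauss (s *\<^sub>R k)\<close> into the frequency integral. By
  Fubini the integral becomes an average of \<open>f\<close> around \<open>x\<close> against a
  Gaussian of width \<open>s\<close>. As s tends to 0, dominated convergence applies on both sides:
  the majorant is \<open>fourier f\<close> in frequency, and \<open>B\<close> times a Gaussian in
  space.\<close>

lemma fourier_inversion:
 fixes f :: "real^'n::finite => complex"
 assumes cont: "continuous_on UNIV f" and f: "integrable lborel f" and bd: "!!x. norm (f x) <= B"
  and ff: "integrable lborel (fourier f)"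
 shows "(LINT k|lborel. cis (k \<bullet> x) * fourier f k) = of_real ((2 * pi) ^ CARD('n)) * f x"
proof -
 define s where "s i = inverse (real (Suc i))" for i
 have s: "s i > 0" for i by (simp add: s_def)
 have s0: "s \<longlonglongrightarrow> 0" unfolding s_def by (rule LIMSEQ_inverse_real_of_nat)
 have [measurable]: "f \<in> borel_measurable borel" "fourier f \<in> borel_measurable borel"
  using f ff borel_measurable_integrable by force+
 have gs: "integrable lborel (\<lambda>x::real^'n. gauss (s i *\<^sub>R x))" for i
  using lborel_affine_integrable(1)[OF integrable_gauss, of "s i" 0] s[of i] by simp
 have key: "(LINT k|lborel. cis (k \<bullet> x) * fourier f k * of_real (gauss (s i *\<^sub>R k))) =
   of_real (sqrt (2 * pi) ^ CARD('n)) * (LINT z|lborel. f (x + s i *\<^sub>R z) * of_real (gauss z))" for i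
 proof -
  define G where "G = (\<lambda>k y. cis (k \<bullet> (x - y)) * f y * of_real (gauss (s i *\<^sub>R k)))"
  have "(\<lambda>(k, y). G k y) \<in> borel_measurable borel"
   unfolding G_def borel_prod[symmetric] by measurable
  then have iG: "integrable (lborel \<Otimes>\<^sub>M lborel) (\<lambda>(k, y). G k y)"
   by (rule integrable_pair_bound[OF _ gs[of i] integrable_norm[OF f]]) (auto simp: G_def norm_mult)
  have "(LINT k|lborel. cis (k \<bullet> x) * fourier f k * of_real (gauss (s i *\<^sub>R k))) = (LINT k|lborel. LINT y|lborel. G k y)"
  proof (rule Bochner_Integration.integral_cong[OF refl])
   fix k
   have "cis (k \<bullet> x) * fourier f k * of_real (gauss (s i *\<^sub>R k)) =
     (LINT y|lborel. cis (k \<bullet> x) * (cis (- (k \<bullet> y)) * f y) * of_real (gauss (s i *\<^sub>R k)))"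
    unfolding fourier_def by simp
   also have "... = (LINT y|lborel. G k y)"
    by (intro Bochner_Integration.integral_cong[OF refl])
     (simp add: G_def inner_diff_right cis_mult flip: mult.assoc)
   finally show "cis (k \<bullet> x) * fourier f k * of_real (gauss (s i *\<^sub>R k)) = (LINT y|lborel. G k y)" .
  qed
  also have "... = (LINT y|lborel. LINT k|lborel. G k y)"
   by (rule lborel_pair.Fubini_integral[OF iG, symmetric])
  also have "... = (LINT y|lborel. f y * of_real ((sqrt (2 * pi) / s i) ^ CARD('n) * gauss ((x - y) /\<^sub>R s i)))"
  proof (rule Bochner_Integration.integral_cong[OF refl])
   fix y
   have "(LINT k|lborel. G k y) = (LINT k|lborel. f y * (cis ((x - y) \<bullet> k) * of_real (gauss (s i *\<^sub>R k))))"
    by (simp add: G_def mult_ac inner_commute)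
   also have "... = f y * of_real ((sqrt (2 * pi) / s i) ^ CARD('n) * gauss ((x - y) /\<^sub>R s i))"
    by (simp only: integral_mult_right_zero gauss_fourier_scaled(2)[OF s])
   finally show "(LINT k|lborel. G k y) = f y * of_real ((sqrt (2 * pi) / s i) ^ CARD('n) * gauss ((x - y) /\<^sub>R s i))" .
  qed
  also have "... = s i ^ CARD('n) *\<^sub>R (LINT z|lborel. f (x + s i *\<^sub>R z) * of_real ((sqrt (2 * pi) / s i) ^ CARD('n) * gauss ((x - (x + s i *\<^sub>R z)) /\<^sub>R s i)))"
  proof (subst lborel_affine_integrable(2)[where c="s i" and t=x])
   show "integrable lborel (\<lambda>y. f y * of_real ((sqrt (2 * pi) / s i) ^ CARD('n) * gauss ((x - y) /\<^sub>R s i)))"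
   proof (rule Bochner_Integration.integrable_bound[of _ "\<lambda>y. (sqrt (2 * pi) / s i) ^ CARD('n) * norm (f y)"])
    show "AE y in lborel. norm (f y * of_real ((sqrt (2 * pi) / s i) ^ CARD('n) * gauss ((x - y) /\<^sub>R s i)))
      <= norm ((sqrt (2 * pi) / s i) ^ CARD('n) * norm (f y))"
    proof (rule AE_I2)
     fix y
     have "norm (complex_of_real (C * gauss ((x - y) /\<^sub>R s i))) <= C" if "C >= 0" for C
      using that by (simp only: norm_of_real) (simp add: abs_mult mult_left_le)
     from this[of "(sqrt (2 * pi) / s i) ^ CARD('n)"]
     have "norm (complex_of_real ((sqrt (2 * pi) / s i) ^ CARD('n) * gauss ((x - y) /\<^sub>R s i))) <= (sqrt (2 * pi) / s i) ^ CARD('n)"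
      using s[of i] by simp
     then show "norm (f y * of_real ((sqrt (2 * pi) / s i) ^ CARD('n) * gauss ((x - y) /\<^sub>R s i)))
      <= norm ((sqrt (2 * pi) / s i) ^ CARD('n) * norm (f y))"
      using s[of i] unfolding norm_mult by (simp add: abs_mult mult.commute mult_left_mono)
    qed
   qed (use f in auto)
  qed (use s[of i] in auto)
  also have "... = of_real (sqrt (2 * pi) ^ CARD('n)) * (LINT z|lborel. f (x + s i *\<^sub>R z) * of_real (gauss z))"
  proof -
   have "(LINT z|lborel. f (x + s i *\<^sub>R z) * of_real ((sqrt (2 * pi) / s i) ^ CARD('n) * gauss ((x - (x + s i *\<^sub>R z)) /\<^sub>R s i)))
    = (LINT z|lborel. of_real ((sqrt (2 * pi) / s i) ^ CARD('n)) * (f (x + s i *\<^sub>R z) * of_real (gauss z)))"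
    using s[of i] by (intro Bochner_Integration.integral_cong[OF refl]) (simp add: mult_ac)
   also have "... = of_real ((sqrt (2 * pi) / s i) ^ CARD('n)) * (LINT z|lborel. (f (x + s i *\<^sub>R z) * of_real (gauss z)))"
    by (rule integral_mult_right_zero)
   finally show ?thesis using s[of i]
    by (simp add: scaleR_conv_of_real power_divide)
  qed
  finally show ?thesis .
 qed
 have gc: "(\<lambda>i. gauss (s i *\<^sub>R k)) \<longlonglongrightarrow> 1" for k :: "real^'n"
 proof -
  have "(\<lambda>i. exp (- ((s i *\<^sub>R k) \<bullet> (s i *\<^sub>R k)) / 2)) \<longlonglongrightarrow> exp (- ((0 *\<^sub>R k) \<bullet> (0 *\<^sub>R k)) / 2)"
   by (intro tendsto_intros s0) auto
  then show ?thesis by (simp add: gauss_def)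
 qed
 have L: "(\<lambda>i. LINT k|lborel. cis (k \<bullet> x) * fourier f k * of_real (gauss (s i *\<^sub>R k))) \<longlonglongrightarrow>
   (LINT k|lborel. cis (k \<bullet> x) * fourier f k)"
 proof (rule integral_dominated_convergence[where w="\<lambda>k. norm (fourier f k)"])
  show "AE k in lborel. (\<lambda>i. cis (k \<bullet> x) * fourier f k * of_real (gauss (s i *\<^sub>R k))) \<longlonglongrightarrow> cis (k \<bullet> x) * fourier f k"
  proof (rule AE_I2)
   fix k
   show "(\<lambda>i. cis (k \<bullet> x) * fourier f k * of_real (gauss (s i *\<^sub>R k))) \<longlonglongrightarrow> cis (k \<bullet> x) * fourier f k"
    using tendsto_mult[OF tendsto_const[of "cis (k \<bullet> x) * fourier f k"] tendsto_of_real[OF gc[of k]]] by simp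
  qed
  show "AE k in lborel. norm (cis (k \<bullet> x) * fourier f k * of_real (gauss (s i *\<^sub>R k))) <= norm (fourier f k)" for i
   by (auto simp: norm_mult mult_left_le)
 qed (use ff in \<open>auto intro: integrable_norm\<close>)
 have "(\<lambda>i. LINT z|lborel. f (x + s i *\<^sub>R z) * of_real (gauss z)) \<longlonglongrightarrow> (LINT z|lborel. f x * of_real (gauss (z::real^'n)))"
 proof (rule integral_dominated_convergence[where w="\<lambda>z. B * gauss z"])
  show "integrable lborel (\<lambda>z::real^'n. B * gauss z)" by (intro integrable_mult_right integrable_gauss)
  show "AE z in lborel. (\<lambda>i. f (x + s i *\<^sub>R z) * of_real (gauss z)) \<longlonglongrightarrow> f x * of_real (gauss z)"
  proof (rule AE_I2)
   fix z
   have "(\<lambda>i. x + s i *\<^sub>R z) \<longlonglongrightarrow> x + 0 *\<^sub>R z" by (intro tendsto_intros s0)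
   then have "(\<lambda>i. f (x + s i *\<^sub>R z)) \<longlonglongrightarrow> f x"
    using cont by (intro isCont_tendsto_compose[of _ f]) (auto simp: continuous_on_eq_continuous_at)
   then show "(\<lambda>i. f (x + s i *\<^sub>R z) * of_real (gauss z)) \<longlonglongrightarrow> f x * of_real (gauss z)"
    by (intro tendsto_intros)
  qed
  show "AE z in lborel. norm (f (x + s i *\<^sub>R z) * of_real (gauss z)) <= B * gauss z" for i
   using bd by (auto simp: norm_mult intro!: mult_right_mono)
 qed auto
 moreover have "(LINT z|lborel. f x * of_real (gauss (z::real^'n))) = f x * of_real (sqrt (2 * pi) ^ CARD('n))"
  by (simp add: integral_gauss)
 ultimately have "(\<lambda>i. LINT z|lborel. f (x + s i *\<^sub>R z) * of_real (gauss z)) \<longlonglongrightarrow> f x * of_real (sqrt (2 * pi) ^ CARD('n))"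
  by (simp only:)
 then have "(\<lambda>i. of_real (sqrt (2 * pi) ^ CARD('n)) * (LINT z|lborel. f (x + s i *\<^sub>R z) * of_real (gauss z))) \<longlonglongrightarrow>
   of_real (sqrt (2 * pi) ^ CARD('n)) * (f x * of_real (sqrt (2 * pi) ^ CARD('n)))"
  by (rule tendsto_mult[OF tendsto_const])
 then have "(LINT k|lborel. cis (k \<bullet> x) * fourier f k) =
   of_real (sqrt (2 * pi) ^ CARD('n)) * (f x * of_real (sqrt (2 * pi) ^ CARD('n)))"
  by (rule LIMSEQ_unique[OF L[unfolded key]])
 also have "... = of_real ((sqrt (2 * pi) * sqrt (2 * pi)) ^ CARD('n)) * f x"
  by (simp only: power_mult_distrib of_real_mult of_real_power mult_ac)
 finally show ?thesis by simp
qed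

text \<open>One half of Plancherel's theorem; upper bounds are all that the L^2 estimates require.
  The Gaussian-weighted integral of |G|^2 is a quadratic form in \<open>g\<close> with an explicit
  convolution kernel, bounded uniformly in the width of the weight.\<close>

lemma fourier_L2_bound:
 fixes g :: "real^'n::finite => complex"
 assumes g: "integrable lborel g" and g2: "integrable lborel (\<lambda>k. (norm (g k))\<^sup>2)"
 defines "G \<equiv> \<lambda>x. LINT k|lborel. cis (k \<bullet> x) * g k"
 shows "integrable lborel (\<lambda>x. (norm (G x))\<^sup>2)"
  and "(LINT x|lborel. (norm (G x))\<^sup>2) <= (2 * pi) ^ CARD('n) * (LINT k|lborel. (norm (g k))\<^sup>2)"
proof -
 have [measurable]: "g \<in> borel_measurable borel"
  using g borel_measurable_integrable by force
 have Gm[measurable]: "G \<in> borel_measurable borel"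
  unfolding G_def by measurable
 define N1 where "N1 = (LINT k|lborel. norm (g k))"
 have Gb: "norm (G x) <= N1" for x
  unfolding G_def N1_def by (rule order_trans[OF integral_norm_bound]) (simp add: norm_mult)
 define Q where "Q = (LINT k|lborel. (norm (g k))\<^sup>2)"
 have gs: "integrable lborel (\<lambda>x::real^'n. gauss (s *\<^sub>R x))" if "s > 0" for s
  using lborel_affine_integrable(1)[OF integrable_gauss, of s 0] that by simp
 have bound: "(LINT x|lborel. (norm (G x))\<^sup>2 * gauss (s *\<^sub>R x)) <= (2 * pi) ^ CARD('n) * Q" if s: "s > 0" for s
 proof -
  define c where "c = (sqrt (2 * pi) / s) ^ CARD('n)"
  have cpos: "c > 0" using s by (simp add: c_def)
  \<comment> \<open>The Fourier transform of the Gaussian weight. It is nonnegative and has total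
    mass (2 pi)^n for every \<open>s\<close>; this makes the bound uniform in
    \<open>s\<close>.\<close>
  define k where "k x = c * gauss ((x::real^'n) /\<^sub>R s)" for x
  have [measurable]: "k \<in> borel_measurable borel" unfolding k_def by measurable
  have kpos: "k x >= 0" for x using cpos by (simp add: k_def)
  have kle: "k x <= c" for x using cpos by (simp add: k_def mult_left_le)
  have kint: "integrable lborel k" and kval: "integral\<^sup>L lborel k = (2 * pi) ^ CARD('n)"
  proof -
   have i: "integrable lborel (\<lambda>x::real^'n. gauss (inverse s *\<^sub>R x))"
    using gs[of "inverse s"] s by simp
   then show "integrable lborel k" unfolding k_def by (rule integrable_mult_right)
   have "sqrt (2 * pi) ^ CARD('n) = inverse s ^ CARD('n) * (LINT x|lborel. gauss (inverse s *\<^sub>R (x::real^'n)))"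
    using lborel_affine_integrable(2)[OF integrable_gauss, of "inverse s" "0::real^'n"] s
    by (simp add: integral_gauss)
   then have "(LINT x|lborel. gauss (inverse s *\<^sub>R (x::real^'n))) = (s * sqrt (2 * pi)) ^ CARD('n)"
    using s by (simp add: field_simps power_mult_distrib)
   then have "integral\<^sup>L lborel k = (sqrt (2 * pi) / s) ^ CARD('n) * (s * sqrt (2 * pi)) ^ CARD('n)"
    unfolding k_def c_def by (simp only: integral_mult_right_zero)
   also have "... = (sqrt (2 * pi) / s * (s * sqrt (2 * pi))) ^ CARD('n)"
    by (simp only: power_mult_distrib)
   also have "sqrt (2 * pi) / s * (s * sqrt (2 * pi)) = 2 * pi"
    using s by (simp add: field_simps flip: real_sqrt_mult)
   finally show "integral\<^sup>L lborel k = (2 * pi) ^ CARD('n)" .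
  qed
  define H where "H p = (LINT q|lborel. g q * of_real (k (p - q)))" for p
  have inner: "(LINT x|lborel. cis (- (p \<bullet> x)) * G x * of_real (gauss (s *\<^sub>R x))) = H p" for p
  proof -
   define J where "J x q = cis (- (p \<bullet> x)) * (cis (q \<bullet> x) * g q) * of_real (gauss (s *\<^sub>R x))" for x q
   have iJ: "integrable (lborel \<Otimes>\<^sub>M lborel) (\<lambda>(x, q). J x q)"
   proof (rule integrable_pair_bound[OF _ gs[OF s] integrable_norm[OF g]])
    show "(\<lambda>(x, q). J x q) \<in> borel_measurable borel"
     unfolding J_def borel_prod[symmetric] by measurable
   qed (auto simp: J_def norm_mult)
   have "(LINT x|lborel. cis (- (p \<bullet> x)) * G x * of_real (gauss (s *\<^sub>R x))) = (LINT x|lborel. LINT q|lborel. J x q)"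
    unfolding G_def J_def by simp
   also have "... = (LINT q|lborel. LINT x|lborel. J x q)"
    by (rule lborel_pair.Fubini_integral[OF iJ, symmetric])
   also have "... = H p"
    unfolding H_def
   proof (rule Bochner_Integration.integral_cong[OF refl])
    fix q
    have "(LINT x|lborel. J x q) = (LINT x|lborel. g q * (cis ((q - p) \<bullet> x) * of_real (gauss (s *\<^sub>R x))))"
    proof (intro Bochner_Integration.integral_cong refl)
     fix x
     have "cis ((q - p) \<bullet> x) = cis (- (p \<bullet> x)) * cis (q \<bullet> x)"
      by (simp add: cis_mult inner_diff_left)
     then show "J x q = g q * (cis ((q - p) \<bullet> x) * of_real (gauss (s *\<^sub>R x)))"
      by (simp add: J_def)
    qed
    also have "... = g q * of_real (c * gauss ((q - p) /\<^sub>R s))"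
     by (simp only: integral_mult_right_zero gauss_fourier_scaled(2)[OF s] c_def)
    also have "gauss ((q - p) /\<^sub>R s) = gauss ((p - q) /\<^sub>R s)"
     by (simp add: gauss_def inner_diff_left inner_diff_right inner_commute algebra_simps)
    finally show "(LINT x|lborel. J x q) = g q * of_real (k (p - q))"
     by (simp add: k_def)
   qed
   finally show ?thesis .
  qed
  define J2 where "J2 x p = cnj (g p) * (cis (- (p \<bullet> x)) * G x * of_real (gauss (s *\<^sub>R x)))" for x p
  have iJ2: "integrable (lborel \<Otimes>\<^sub>M lborel) (\<lambda>(x, p). J2 x p)"
  proof (rule integrable_pair_bound[of _ "\<lambda>x. N1 * gauss (s *\<^sub>R x)" "\<lambda>p. norm (g p)"])
   show "norm (case (x, p) of (x, p) => J2 x p) <= N1 * gauss (s *\<^sub>R x) * norm (g p)" for x p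
    using Gb[of x] by (auto simp: J2_def norm_mult mult_ac intro!: mult_left_mono mult_right_mono)
   show "(\<lambda>(x, p). J2 x p) \<in> borel_measurable borel" unfolding J2_def borel_prod[symmetric] by measurable
  qed (use g gs[OF s] in auto)
  have cnjG: "cnj (G x) = (LINT p|lborel. cnj (g p) * cis (- (p \<bullet> x)))" for x
  proof -
   have "cnj (G x) = (LINT p|lborel. cnj (cis (p \<bullet> x) * g p))"
    unfolding G_def by (rule Bochner_Integration.integral_cnj[symmetric])
   then show ?thesis by (simp add: cis_cnj mult.commute)
  qed
  have "complex_of_real (LINT x|lborel. (norm (G x))\<^sup>2 * gauss (s *\<^sub>R x)) =
    (LINT x|lborel. of_real ((norm (G x))^2 * gauss (s *\<^sub>R x)))"
   by (rule integral_complex_of_real[symmetric])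
  also have "... = (LINT x|lborel. LINT p|lborel. J2 x p)"
  proof (rule Bochner_Integration.integral_cong[OF refl])
   fix x
   have "complex_of_real ((norm (G x))^2 * gauss (s *\<^sub>R x)) = cnj (G x) * (G x * of_real (gauss (s *\<^sub>R x)))"
    unfolding of_real_mult by (subst complex_norm_square) (simp only: mult_ac)
   also have "... = (LINT p|lborel. cnj (g p) * cis (- (p \<bullet> x)) * (G x * of_real (gauss (s *\<^sub>R x))))"
    unfolding cnjG by (rule integral_mult_left_zero[symmetric])
   finally show "complex_of_real ((norm (G x))^2 * gauss (s *\<^sub>R x)) = (LINT p|lborel. J2 x p)"
    by (simp add: J2_def mult_ac)
  qed
  also have "... = (LINT p|lborel. LINT x|lborel. J2 x p)"
   by (rule lborel_pair.Fubini_integral[OF iJ2, symmetric])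
  also have "... = (LINT p|lborel. cnj (g p) * H p)"
   unfolding J2_def by (simp add: inner)
  also have "... = (LINT p|lborel. LINT q|lborel. cnj (g p) * (g q * of_real (k (p - q))))"
   unfolding H_def by simp
  finally have e1: "complex_of_real (LINT x|lborel. (norm (G x))\<^sup>2 * gauss (s *\<^sub>R x)) =
    (LINT p|lborel. LINT q|lborel. cnj (g p) * (g q * of_real (k (p - q))))" .
  have translate: "integrable lborel (\<lambda>q. k (p - q))" "(LINT q|lborel. k (p - q)) = (2 * pi) ^ CARD('n)" for p
   using lborel_affine_integrable[OF kint, of "-1" p] kval by auto
  have translate2: "integrable lborel (\<lambda>q. k (q - p))" "(LINT q|lborel. k (q - p)) = (2 * pi) ^ CARD('n)" for p
   using lborel_affine_integrable[OF kint, of "1" "-p"] kval by auto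
  have i1: "integrable (lborel \<Otimes>\<^sub>M lborel) (\<lambda>(p, q). (norm (g p))\<^sup>2 * k (p - q))"
   by (intro lborel_pair.Fubini_integrable) (use g2 kpos translate in \<open>auto simp: abs_mult\<close>)
  have i2': "integrable (lborel \<Otimes>\<^sub>M lborel) (\<lambda>(q, p). (norm (g q))\<^sup>2 * k (p - q))"
   by (intro lborel_pair.Fubini_integrable) (use g2 kpos translate2 in \<open>auto simp: abs_mult\<close>)
  then have i2: "integrable (lborel \<Otimes>\<^sub>M lborel) (\<lambda>(p, q). (norm (g q))\<^sup>2 * k (p - q))"
   using lborel_pair.integrable_product_swap[OF i2'] by (simp add: case_prod_beta)
  have v1: "(LINT p|lborel. LINT q|lborel. (norm (g p))\<^sup>2 * k (p - q)) = (2 * pi) ^ CARD('n) * Q"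
   by (simp add: translate Q_def)
  have v2: "(LINT p|lborel. LINT q|lborel. (norm (g q))\<^sup>2 * k (p - q)) = (2 * pi) ^ CARD('n) * Q"
   by (subst lborel_pair.Fubini_integral[OF i2, symmetric]) (simp add: translate2 Q_def)
  have "(LINT x|lborel. (norm (G x))\<^sup>2 * gauss (s *\<^sub>R x)) = norm (complex_of_real (LINT x|lborel. (norm (G x))\<^sup>2 * gauss (s *\<^sub>R x)))"
   by (simp add: Bochner_Integration.integral_nonneg)
  also have "... <= (LINT p|lborel. norm (LINT q|lborel. cnj (g p) * (g q * of_real (k (p - q)))))"
   unfolding e1 by (rule integral_norm_bound)
  \<comment> \<open>Schur's test: |g(p)| |g(q)| is at most half the sum of the squares, and each of
    the two resulting double integrals is the mass of \<open>k\<close> times the squared norm of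
    \<open>g\<close>.\<close>
  also have "... <= (LINT p|lborel. LINT q|lborel. ((norm (g p))^2 * k (p - q) + (norm (g q))^2 * k (p - q)) / 2)"
  proof (rule integral_mono')
   show "integrable lborel (\<lambda>p. LINT q|lborel. ((norm (g p))^2 * k (p - q) + (norm (g q))^2 * k (p - q)) / 2)"
    using integrable_divide_zero[OF Bochner_Integration.integrable_add[OF i1 i2], of 2]
    by (intro lborel_pair.integrable_fst) (simp add: case_prod_beta case_prod_beta')
   fix p
   have b1: "integrable lborel (\<lambda>q. (norm (g p))\<^sup>2 * k (p - q))" using translate by simp
   have b2: "integrable lborel (\<lambda>q. (norm (g q))\<^sup>2 * k (p - q))"
    by (rule Bochner_Integration.integrable_bound[of _ "\<lambda>q. c * (norm (g q))^2"])
     (use g2 kpos kle cpos in \<open>auto simp: abs_mult mult.commute[of "(norm _)\<^sup>2"] intro!: AE_I2 mult_right_mono\<close>)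
   show "norm (LINT q|lborel. cnj (g p) * (g q * of_real (k (p - q))))
     <= (LINT q|lborel. ((norm (g p))^2 * k (p - q) + (norm (g q))^2 * k (p - q)) / 2)"
   proof (rule order_trans[OF integral_norm_bound integral_mono'])
    fix q
    have "norm (g p) * norm (g q) <= ((norm (g p))^2 + (norm (g q))^2) / 2"
     using sum_squares_bound[of "norm (g p)" "norm (g q)"] by (simp add: field_simps)
    then have "norm (g p) * norm (g q) * k (p - q) <= ((norm (g p))^2 + (norm (g q))^2) / 2 * k (p - q)"
     using kpos by (rule mult_right_mono)
    then show "norm (cnj (g p) * (g q * of_real (k (p - q)))) <= ((norm (g p))^2 * k (p - q) + (norm (g q))^2 * k (p - q)) / 2"
     using kpos[of "p - q"] by (simp add: norm_mult algebra_simps)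
   qed (use b1 b2 kpos in auto)
  qed (use kpos in \<open>auto intro!: Bochner_Integration.integral_nonneg\<close>)
  also have "... = (LINT p|lborel. ((LINT q|lborel. (norm (g p))\<^sup>2 * k (p - q)) + (LINT q|lborel. (norm (g q))\<^sup>2 * k (p - q))) / 2)"
  proof (rule Bochner_Integration.integral_cong[OF refl])
   fix p
   have b1: "integrable lborel (\<lambda>q. (norm (g p))\<^sup>2 * k (p - q))" using translate by simp
   have b2: "integrable lborel (\<lambda>q. (norm (g q))\<^sup>2 * k (p - q))"
    by (rule Bochner_Integration.integrable_bound[of _ "\<lambda>q. c * (norm (g q))^2"])
     (use g2 kpos kle cpos in \<open>auto simp: abs_mult mult.commute[of "(norm _)\<^sup>2"] intro!: AE_I2 mult_right_mono\<close>)
   show "(LINT q|lborel. ((norm (g p))^2 * k (p - q) + (norm (g q))^2 * k (p - q)) / 2) =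
    ((LINT q|lborel. (norm (g p))\<^sup>2 * k (p - q)) + (LINT q|lborel. (norm (g q))\<^sup>2 * k (p - q))) / 2"
    by (simp only: integral_divide_zero Bochner_Integration.integral_add[OF b1 b2])
  qed
  also have "... = ((LINT p|lborel. LINT q|lborel. (norm (g p))\<^sup>2 * k (p - q)) + (LINT p|lborel. LINT q|lborel. (norm (g q))\<^sup>2 * k (p - q))) / 2"
   by (simp only: integral_divide_zero Bochner_Integration.integral_add[OF lborel_pair.integrable_fst[OF i1] lborel_pair.integrable_fst[OF i2]])
  also have "... = (2 * pi) ^ CARD('n) * Q" unfolding v1 v2 by simp
  finally show ?thesis .
 qed
 have Qpos: "Q >= 0" unfolding Q_def by (rule Bochner_Integration.integral_nonneg) simp
 \<comment> \<open>The weight is removed along s = 1/(i + 1). Fatou's lemma gives the integrability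
   of |G|^2 and its bound together.\<close>
 define s where "s i = inverse (real (Suc i))" for i
 have s: "s i > 0" for i by (simp add: s_def)
 have s0: "s \<longlonglongrightarrow> 0" unfolding s_def by (rule LIMSEQ_inverse_real_of_nat)
 have gc: "(\<lambda>i. gauss (s i *\<^sub>R k)) \<longlonglongrightarrow> 1" for k :: "real^'n"
 proof -
  have "(\<lambda>i. exp (- ((s i *\<^sub>R k) \<bullet> (s i *\<^sub>R k)) / 2)) \<longlonglongrightarrow> exp (- ((0 *\<^sub>R k) \<bullet> (0 *\<^sub>R k)) / 2)"
   by (intro tendsto_intros s0) auto
  then show ?thesis by (simp add: gauss_def)
 qed
 have "(\<integral>\<^sup>+x. ennreal ((norm (G x))^2) \<partial>lborel) = (\<integral>\<^sup>+x. liminf (\<lambda>i. ennreal ((norm (G x))^2 * gauss (s i *\<^sub>R x))) \<partial>lborel)"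
 proof (rule nn_integral_cong)
  fix x
  have "(\<lambda>i. ennreal ((norm (G x))^2 * gauss (s i *\<^sub>R x))) \<longlonglongrightarrow> ennreal ((norm (G x))^2 * 1)"
   by (intro tendsto_ennrealI tendsto_intros gc)
  then show "ennreal ((norm (G x))^2) = liminf (\<lambda>i. ennreal ((norm (G x))^2 * gauss (s i *\<^sub>R x)))"
   using lim_imp_Liminf by (metis mult.right_neutral trivial_limit_sequentially)
 qed
 also have "... <= liminf (\<lambda>i. \<integral>\<^sup>+x. ennreal ((norm (G x))^2 * gauss (s i *\<^sub>R x)) \<partial>lborel)"
  by (rule nn_integral_liminf) measurable
 also have "... <= liminf (\<lambda>i. ennreal ((2 * pi) ^ CARD('n) * Q))"
 proof (intro Liminf_mono always_eventually allI)
  fix i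
  have "integrable lborel (\<lambda>x. (norm (G x))\<^sup>2 * gauss (s i *\<^sub>R x))"
   by (rule Bochner_Integration.integrable_bound[of _ "\<lambda>x. N1\<^sup>2 * gauss (s i *\<^sub>R x)"])
    (use gs[OF s] Gb in \<open>auto simp: abs_mult intro!: mult_right_mono power_mono\<close>)
  then have "(\<integral>\<^sup>+x. ennreal ((norm (G x))^2 * gauss (s i *\<^sub>R x)) \<partial>lborel) = ennreal (LINT x|lborel. (norm (G x))\<^sup>2 * gauss (s i *\<^sub>R x))"
   by (intro nn_integral_eq_integral) auto
  then show "(\<integral>\<^sup>+x. ennreal ((norm (G x))^2 * gauss (s i *\<^sub>R x)) \<partial>lborel) <= ennreal ((2 * pi) ^ CARD('n) * Q)"
   using bound[OF s] by (simp add: ennreal_leI)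
 qed
 also have "... = ennreal ((2 * pi) ^ CARD('n) * Q)"
  by (simp add: Liminf_const)
 finally have fin: "(\<integral>\<^sup>+x. ennreal ((norm (G x))^2) \<partial>lborel) <= ennreal ((2 * pi) ^ CARD('n) * Q)" .
 then show i: "integrable lborel (\<lambda>x. (norm (G x))\<^sup>2)"
  by (intro integrableI_nonneg) (auto simp: le_less_trans[OF _ ennreal_less_top])
 have "ennreal (LINT x|lborel. (norm (G x))\<^sup>2) <= ennreal ((2 * pi) ^ CARD('n) * Q)"
  using fin by (subst (asm) nn_integral_eq_integral[OF i]) auto
 then show "(LINT x|lborel. (norm (G x))\<^sup>2) <= (2 * pi) ^ CARD('n) * (LINT k|lborel. (norm (g k))\<^sup>2)"
  using Qpos by (simp add: Q_def)
qed

section \<open>Oscillatory integrals\<close>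

text \<open>Continuity is required on the closed ball only, and a jump across the sphere is allowed.
  Amplitudes get multiplied by functions such as Bloch coefficients at k + epsilon q, which are
  under control only for q in the ball; the class is stable under such products.\<close>

definition cpt :: "real => (real^'d::finite => complex) => bool" where
 "cpt rho g \<longleftrightarrow> continuous_on (cball 0 rho) g \<and> (\<forall>k. k \<notin> cball 0 rho --> g k = 0)"

text \<open>A wave packet with carrier \<open>p\<close>, width \<open>e\<close> and dispersion
  relation \<open>Omega\<close>. Differentiation in t or x multiplies \<open>g\<close> by a symbol,
  and multiplication by an exponential shifts \<open>p\<close>. All computations with the wave
  operator thereby become algebra on amplitudes.\<close>

definition osc :: "real^'d::finite => real => (real^'d => real) => (real^'d => complex) => real => real^'d => complex" where
 "osc p e Omega g t x = (LINT k|lborel. cis ((p + e *\<^sub>R k) \<bullet> x - t * Omega k) * g k)"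

lemma cpt_measurable:
 assumes "cpt rho g" shows "g \<in> borel_measurable borel"
proof -
 have "(\<lambda>k. indicator (cball 0 rho) k *\<^sub>R g k) \<in> borel_measurable borel"
  using assms by (intro borel_measurable_continuous_on_indicator) (auto simp: cpt_def)
 also have "(\<lambda>k. indicator (cball 0 rho) k *\<^sub>R g k) = g"
  using assms by (auto simp: cpt_def indicator_def fun_eq_iff)
 finally show ?thesis .
qed

lemma cpt_bounded:
 assumes "cpt rho g" obtains B where "B >= 0" "!!k. norm (g k) <= B"
proof -
 have "compact (g ` cball 0 rho)"
  using assms by (intro compact_continuous_image) (auto simp: cpt_def)
 then obtain B where B: "!!k. k \<in> cball 0 rho ==> norm (g k) <= B"
  using compact_imp_bounded bounded_iff by (metis imageI)
 have "norm (g k) <= max B 0" for k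
  using B[of k] assms by (cases "k \<in> cball 0 rho") (auto simp: cpt_def)
 then show ?thesis using that[of "max B 0"] by auto
qed

lemma cpt_bound_integrable:
 fixes g :: "real^'d::finite => complex"
 assumes g: "cpt rho g" and b: "!!k. k \<in> cball 0 rho ==> norm (g k) <= b" and "b >= 0"
 shows "integrable lborel g" "integrable lborel (\<lambda>k. (norm (g k))\<^sup>2)"
  "(LINT k|lborel. (norm (g k))\<^sup>2) <= b\<^sup>2 * measure lborel (cball (0::real^'d) rho)"
proof -
 let ?I = "\<lambda>k::real^'d. indicator (cball 0 rho) k :: real"
 have i: "integrable lborel ?I"
  using emeasure_bounded_finite[OF bounded_cball, of "0::real^'d" rho] by (simp add: integrable_indicator_iff)
 have m[measurable]: "g \<in> borel_measurable borel" by (rule cpt_measurable[OF g])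
 have z: "g k = 0" if "k \<notin> cball 0 rho" for k using g that by (auto simp: cpt_def)
 have le: "norm (g k) <= b * ?I k" for k using b[of k] z[of k] by (cases "k \<in> cball 0 rho") auto
 have le2: "(norm (g k))\<^sup>2 <= b\<^sup>2 * ?I k" for k
  using b[of k] z[of k] by (cases "k \<in> cball 0 rho") (auto intro: power_mono)
 show "integrable lborel g"
  by (rule Bochner_Integration.integrable_bound[of _ "\<lambda>k. b * ?I k"]) (use i le \<open>b >= 0\<close> in auto)
 show i2: "integrable lborel (\<lambda>k. (norm (g k))\<^sup>2)"
  by (rule Bochner_Integration.integrable_bound[of _ "\<lambda>k. b\<^sup>2 * ?I k"]) (use i le2 in auto)
 have "(LINT k|lborel. (norm (g k))\<^sup>2) <= (LINT k|lborel. b\<^sup>2 * ?I k)"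
  by (rule integral_mono[OF i2 _ le2]) (use i in auto)
 then show "(LINT k|lborel. (norm (g k))\<^sup>2) <= b\<^sup>2 * measure lborel (cball (0::real^'d) rho)"
  by simp
qed

lemma cpt_integrable: "cpt rho g ==> integrable lborel g"
 by (metis cpt_bounded cpt_bound_integrable(1))

lemma cpt_mult: "cpt rho g ==> continuous_on (cball 0 rho) h ==> cpt rho (\<lambda>k. h k * g k)"
 by (auto simp: cpt_def intro: continuous_intros)

lemma cpt_add: "cpt rho g ==> cpt rho h ==> cpt rho (\<lambda>k. g k + h k)"
 by (auto simp: cpt_def intro: continuous_intros)

lemma cpt_sum: "(!!i. i \<in> I ==> cpt rho (g i)) ==> cpt rho (\<lambda>k. \<Sum>i\<in>I. g i k)"
 by (auto simp: cpt_def intro: continuous_intros)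

lemma osc_integrable:
 assumes "cpt rho g" "continuous_on UNIV Omega"
 shows "integrable lborel (\<lambda>k. cis ((p + e *\<^sub>R k) \<bullet> x - t * Omega k) * g k)"
proof -
 have [measurable]: "Omega \<in> borel_measurable borel" "g \<in> borel_measurable borel"
  using assms cpt_measurable by (auto intro: borel_measurable_continuous_onI)
 show ?thesis
  by (rule Bochner_Integration.integrable_bound[OF cpt_integrable[OF assms(1)]]) (auto simp: norm_mult)
qed

lemma osc_has_derivative:
 fixes g :: "real^'d::finite => complex"
 assumes g: "cpt rho g" and Omega: "continuous_on UNIV Omega"
 shows "((\<lambda>(t, x). osc p e Omega g t x) has_derivative
   (\<lambda>(s, h). s *\<^sub>R osc p e Omega (\<lambda>k. - \<i> * of_real (Omega k) * g k) t x
    + (\<Sum>i\<in>UNIV. h $ i *\<^sub>R osc p e Omega (\<lambda>k. \<i> * of_real ((p + e *\<^sub>R k) $ i) * g k) t x))) (at (t, x))"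
proof -
 have c1: "cpt rho (\<lambda>k. - \<i> * of_real (Omega k) * g k)"
  by (intro cpt_mult[OF g] continuous_intros continuous_on_subset[OF Omega]) auto
 have c2: "cpt rho (\<lambda>k. \<i> * of_real ((p + e *\<^sub>R k) $ i) * g k)" for i
  by (intro cpt_mult[OF g] continuous_intros)
 obtain B1 where B1: "B1 >= 0" "!!k. norm (- \<i> * of_real (Omega k) * g k) <= B1"
  using cpt_bounded[OF c1] by metis
 have c3: "cpt rho (\<lambda>k. of_real (norm (p + e *\<^sub>R k)) * g k)"
  by (intro cpt_mult[OF g] continuous_intros)
 note i1 = integrable_norm[OF cpt_integrable[OF c1]] and i3 = integrable_norm[OF cpt_integrable[OF c3]]
 \<comment> \<open>Since \<open>cis\<close> has modulus 1, the derivative of the integrand in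
   direction \<open>v\<close> is at most \<open>D k * norm v\<close> for all (t, x). It is
   integrable because \<open>g\<close> is bounded with support in a ball.\<close>
 define D where "D k = norm (- \<i> * of_real (Omega k) * g k) + norm (of_real (norm (p + e *\<^sub>R k)) * g k)" for k
 define F where "F z k = cis ((p + e *\<^sub>R k) \<bullet> snd z - fst z * Omega k) * g k" for z k
 define F' where "F' z k v = ((p + e *\<^sub>R k) \<bullet> snd v - fst v * Omega k) *\<^sub>R (\<i> * F z k)" for z k v
 have [measurable]: "Omega \<in> borel_measurable borel" "g \<in> borel_measurable borel"
  using assms cpt_measurable by (auto intro: borel_measurable_continuous_onI)
 have intF: "integrable lborel (F z)" for z
  unfolding F_def by (rule osc_integrable[OF g Omega])
 have der: "((\<lambda>z. LINT k|lborel. F z k) has_derivative (\<lambda>v. LINT k|lborel. F' (t, x) k v)) (at (t, x) within UNIV)"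
 proof (rule has_derivative_integral_dominated[where F=F and F'=F' and D=D])
  show "integrable lborel D" unfolding D_def using i1 i3 by (intro Bochner_Integration.integrable_add)
  show "((\<lambda>z. F z k) has_derivative F' z k) (at z within UNIV)" for z k
   unfolding F_def F'_def
   by (auto intro!: derivative_eq_intros has_derivative_cis simp: fun_eq_iff scaleR_conv_of_real algebra_simps)
  show "norm (F' z k v) <= D k * norm v" for z k v
  proof -
   have "norm (F' z k v) = \<bar>(p + e *\<^sub>R k) \<bullet> snd v - fst v * Omega k\<bar> * norm (g k)"
    by (simp add: F'_def F_def norm_mult)
   also have "\<bar>(p + e *\<^sub>R k) \<bullet> snd v - fst v * Omega k\<bar> <= norm (p + e *\<^sub>R k) * norm v + norm v * \<bar>Omega k\<bar>"
   proof -
    have "\<bar>(p + e *\<^sub>R k) \<bullet> snd v\<bar> <= norm (p + e *\<^sub>R k) * norm v"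
     using norm_snd_le[of "snd v" "fst v"]
     by (intro order_trans[OF Cauchy_Schwarz_ineq2] mult_left_mono) auto
    moreover have "\<bar>fst v * Omega k\<bar> <= norm v * \<bar>Omega k\<bar>"
     using norm_fst_le[of "fst v" "snd v"] by (simp add: abs_mult mult_right_mono)
    ultimately show ?thesis by linarith
   qed
   finally show ?thesis
    by (simp add: D_def norm_mult algebra_simps mult_right_mono)
  qed
  show "(\<lambda>k. F' (t, x) k v) \<in> borel_measurable lborel" for v
   unfolding F'_def F_def by measurable
 qed (use intF in auto)
 have eq: "(LINT k|lborel. F' (t, x) k v) = fst v *\<^sub>R osc p e Omega (\<lambda>k. - \<i> * of_real (Omega k) * g k) t x
    + (\<Sum>i\<in>UNIV. snd v $ i *\<^sub>R osc p e Omega (\<lambda>k. \<i> * of_real ((p + e *\<^sub>R k) $ i) * g k) t x)" for v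
 proof -
  have "F' (t, x) k v = fst v *\<^sub>R (cis ((p + e *\<^sub>R k) \<bullet> x - t * Omega k) * (- \<i> * of_real (Omega k) * g k))
    + (\<Sum>i\<in>UNIV. snd v $ i *\<^sub>R (cis ((p + e *\<^sub>R k) \<bullet> x - t * Omega k) * (\<i> * of_real ((p + e *\<^sub>R k) $ i) * g k)))" for k
  proof -
   have "(p + e *\<^sub>R k) \<bullet> snd v = (\<Sum>i\<in>UNIV. snd v $ i * (p + e *\<^sub>R k) $ i)"
    by (simp add: inner_vec_def mult.commute)
   then show ?thesis
    unfolding F'_def F_def
    by (simp only: scaleR_left_diff_distrib scaleR_sum_left)
      (simp add: scaleR_conv_of_real sum_distrib_left sum_distrib_right algebra_simps)
  qed
  then show ?thesis
   unfolding osc_def using osc_integrable[OF c1 Omega] osc_integrable[OF c2 Omega]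
   by (simp add: Bochner_Integration.integral_add Bochner_Integration.integral_sum)
 qed
 show ?thesis
  using der unfolding eq by (simp add: case_prod_beta' osc_def F_def)
qed

lemma osc_continuous:
 assumes "cpt rho g" "continuous_on UNIV Omega"
 shows "continuous_on UNIV (\<lambda>(t, x). osc p e Omega g t x)"
 using osc_has_derivative[OF assms]
 by (auto simp: continuous_on_eq_continuous_at intro!: has_derivative_continuous)

lemma osc_has_vector_derivative_time:
 assumes "cpt rho g" "continuous_on UNIV Omega"
 shows "((\<lambda>t. osc p e Omega g t x) has_vector_derivative osc p e Omega (\<lambda>k. - \<i> * of_real (Omega k) * g k) t x) (at t within S)"
proof -
 have "((\<lambda>t. (t, x)) has_derivative (\<lambda>s. (s, 0))) (at t within S)"
  by (auto intro!: derivative_eq_intros)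
 from has_derivative_compose[OF this osc_has_derivative[OF assms]]
 show ?thesis by (simp add: has_vector_derivative_def)
qed

lemma osc_has_derivative_space:
 assumes "cpt rho g" "continuous_on UNIV Omega"
 shows "(osc p e Omega g t has_derivative
   (\<lambda>h. \<Sum>i\<in>UNIV. h $ i *\<^sub>R osc p e Omega (\<lambda>k. \<i> * of_real ((p + e *\<^sub>R k) $ i) * g k) t x)) (at x within S)"
proof -
 have "((\<lambda>x. (t, x)) has_derivative (\<lambda>s. (0, s))) (at x within S)"
  by (auto intro!: derivative_eq_intros)
 from has_derivative_compose[OF this osc_has_derivative[OF assms]]
 show ?thesis by simp
qed

lemma osc_shift: "cis (q \<bullet> x) * osc p e Omega g t x = osc (p + q) e Omega g t x"
proof -
 have "cis (q \<bullet> x) * osc p e Omega g t x = (LINT k|lborel. cis (q \<bullet> x) * (cis ((p + e *\<^sub>R k) \<bullet> x - t * Omega k) * g k))"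
  unfolding osc_def by simp
 also have "... = osc (p + q) e Omega g t x"
  unfolding osc_def
 proof (intro Bochner_Integration.integral_cong refl)
  fix k
  have "cis ((p + q + e *\<^sub>R k) \<bullet> x - t * Omega k) = cis (q \<bullet> x) * cis ((p + e *\<^sub>R k) \<bullet> x - t * Omega k)"
   unfolding cis_mult by (rule arg_cong[of _ _ cis]) (simp add: inner_add_left algebra_simps)
  then show "cis (q \<bullet> x) * (cis ((p + e *\<^sub>R k) \<bullet> x - t * Omega k) * g k) = cis ((p + q + e *\<^sub>R k) \<bullet> x - t * Omega k) * g k"
   by (simp only: mult.assoc)
 qed
 finally show ?thesis .
qed

lemma osc_cmult: "osc p e Omega (\<lambda>k. c * g k) t x = c * osc p e Omega g t x"
 unfolding osc_def by (simp add: mult.left_commute flip: integral_mult_right_zero)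

lemma osc_sum:
 assumes "!!i. i \<in> I ==> cpt rho (g i)" "continuous_on UNIV Omega"
 shows "osc p e Omega (\<lambda>k. \<Sum>i\<in>I. g i k) t x = (\<Sum>i\<in>I. osc p e Omega (g i) t x)"
 unfolding osc_def sum_distrib_left
 by (rule Bochner_Integration.integral_sum) (rule osc_integrable[OF assms])

lemma osc_add:
 assumes "cpt rho g" "cpt rho h" "continuous_on UNIV Omega"
 shows "osc p e Omega (\<lambda>k. g k + h k) t x = osc p e Omega g t x + osc p e Omega h t x"
 unfolding osc_def distrib_left
 by (rule Bochner_Integration.integral_add) (rule osc_integrable assms)+

section \<open>Explicit bounds in L^2\<close>

definition L2_le :: "(real^'d::finite => complex) => real => bool" where
 "L2_le f b \<longleftrightarrow> b >= 0 \<and> L2 f \<and> (LINT x|lborel. (norm (f x))\<^sup>2) <= b\<^sup>2"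

lemma L2_le_norm: "L2_le f b ==> L2 f \<and> L2_norm f <= b"
 by (auto simp: L2_le_def L2_norm_def intro: real_le_lsqrt)

lemma L2_le_mono: "L2_le f b ==> b <= c ==> L2_le f c"
 unfolding L2_le_def by (meson order_trans power_mono)

text \<open>Cauchy-Schwarz for the finite sum in place of Minkowski's inequality. The lost factor
  \<open>card I\<close> is harmless, because the index sets that occur do not depend on lambda or
  t.\<close>

lemma L2_le_sum:
 assumes I: "finite I" and f: "!!i. i \<in> I ==> L2_le (f i) (b i)"
 shows "L2_le (\<lambda>x. \<Sum>i\<in>I. f i x) (real (card I) * (\<Sum>i\<in>I. b i))"
proof (cases "I = {}")
 case True then show ?thesis by (auto simp: L2_le_def L2_def)
next
 case False
 have b: "b i >= 0" if "i \<in> I" for i using f[OF that] by (simp add: L2_le_def)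
 have m: "f i \<in> borel_measurable borel" and int: "integrable lborel (\<lambda>x. (norm (f i x))\<^sup>2)"
  and le: "(LINT x|lborel. (norm (f i x))\<^sup>2) <= (b i)^2" if "i \<in> I" for i
  using f[OF that] by (auto simp: L2_le_def L2_def)
 have ms: "(\<lambda>x. \<Sum>i\<in>I. f i x) \<in> borel_measurable borel" using m by (intro borel_measurable_sum) auto
 have ib: "integrable lborel (\<lambda>x. real (card I) * (\<Sum>i\<in>I. (norm (f i x))\<^sup>2))"
  using int by (intro integrable_mult_right Bochner_Integration.integrable_sum) auto
 have pt: "(norm (\<Sum>i\<in>I. f i x))\<^sup>2 <= real (card I) * (\<Sum>i\<in>I. (norm (f i x))\<^sup>2)" for x
 proof -
  have "(norm (\<Sum>i\<in>I. f i x))\<^sup>2 <= (\<Sum>i\<in>I. norm (f i x))^2"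
   by (intro power_mono norm_sum) auto
  also have "... <= real (card I) * (\<Sum>i\<in>I. (norm (f i x))\<^sup>2)"
   using sum_squared_le_sum_of_squares[of "\<lambda>i. norm (f i x)" I] I False by (simp add: mult.commute)
  finally show ?thesis .
 qed
 have i2: "integrable lborel (\<lambda>x. (norm (\<Sum>i\<in>I. f i x))\<^sup>2)"
  by (rule Bochner_Integration.integrable_bound[OF ib])
   (use ms pt in \<open>auto intro!: AE_I2 order_trans[OF pt] simp: sum_nonneg\<close>)
 have "(LINT x|lborel. (norm (\<Sum>i\<in>I. f i x))\<^sup>2) <= (LINT x|lborel. real (card I) * (\<Sum>i\<in>I. (norm (f i x))\<^sup>2))"
  by (rule integral_mono[OF i2 ib pt])
 also have "... = real (card I) * (\<Sum>i\<in>I. (LINT x|lborel. (norm (f i x))\<^sup>2))"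
  using int by simp
 also have "... <= real (card I) * (\<Sum>i\<in>I. (b i)\<^sup>2)"
  by (intro mult_left_mono sum_mono le) auto
 also have "... <= real (card I) * (\<Sum>i\<in>I. b i)^2"
 proof (intro mult_left_mono)
  have "(\<Sum>i\<in>I. (b i)\<^sup>2) <= (\<Sum>i\<in>I. b i * (\<Sum>j\<in>I. b j))"
   unfolding power2_eq_square
   by (intro sum_mono mult_left_mono) (auto simp: b I intro: member_le_sum)
  then show "(\<Sum>i\<in>I. (b i)\<^sup>2) <= (\<Sum>i\<in>I. b i)^2"
   by (simp add: power2_eq_square sum_distrib_right)
 qed auto
 also have "... <= (real (card I))^2 * (\<Sum>i\<in>I. b i)^2"
 proof (rule mult_right_mono)
  have "real (card I) >= 1" using I False by (simp add: Suc_leI card_gt_0_iff)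
  then show "real (card I) <= (real (card I))^2" by (simp add: power2_eq_square)
 qed auto
 finally show ?thesis
  using i2 ms b by (auto simp: L2_le_def L2_def power_mult_distrib sum_nonneg)
qed

lemma L2_le_add:
 assumes "L2_le f a" "L2_le g b" shows "L2_le (\<lambda>x. f x + g x) (2 * (a + b))"
 using L2_le_sum[of "UNIV :: bool set" "\<lambda>c. if c then f else g" "\<lambda>c. if c then a else b"] assms
 by (simp add: UNIV_bool add.commute)

lemma L2_le_cmult:
 assumes "L2_le f a" shows "L2_le (\<lambda>x. c * f x) (norm c * a)"
 using assms by (auto simp: L2_le_def L2_def norm_mult power_mult_distrib mult_left_mono)

text \<open>Up to the unimodular factor \<open>cis (p \<bullet> x)\<close> the packet is a Fourier
  integral evaluated at \<open>e *\<^sub>R x\<close>, and the time factor is unimodular in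
  frequency. The normalization e^(d/2) exactly compensates the dilation, so the bound depends
  neither on \<open>e\<close> nor on \<open>t\<close>.\<close>

lemma osc_L2:
 fixes g :: "real^'d::finite => complex"
 assumes g: "cpt rho g" and Omega: "continuous_on UNIV Omega" and e: "e > 0" and b: "b >= 0" "!!k. k \<in> cball 0 rho ==> norm (g k) <= b"
 shows "L2_le (\<lambda>x. of_real (e powr (real CARD('d) / 2)) * osc p e Omega g t x)
   (sqrt ((2 * pi) ^ CARD('d) * measure lborel (cball (0::real^'d) rho)) * b)"
proof -
 have [measurable]: "Omega \<in> borel_measurable borel" "g \<in> borel_measurable borel"
  using g Omega cpt_measurable by (auto intro: borel_measurable_continuous_onI)
 define h where "h k = cis (- t * Omega k) * g k" for k
 have ch: "cpt rho h"
  unfolding h_def by (intro cpt_mult[OF g] continuous_intros continuous_on_subset[OF Omega]) auto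
 have nh: "norm (h k) = norm (g k)" for k by (simp add: h_def norm_mult)
 note I = cpt_bound_integrable[OF ch, of b, unfolded nh, OF b(2,1)]
 define G where "G x = (LINT k|lborel. cis (k \<bullet> x) * h k)" for x
 note LB = fourier_L2_bound[of h, unfolded nh, OF I(1,2), folded G_def]
 have G: "osc p e Omega g t x = cis (p \<bullet> x) * G (e *\<^sub>R x)" for x
 proof -
  have "cis (p \<bullet> x) * G (e *\<^sub>R x) = (LINT k|lborel. cis (p \<bullet> x) * (cis (k \<bullet> (e *\<^sub>R x)) * h k))"
   unfolding G_def by simp
  also have "... = osc p e Omega g t x"
   unfolding osc_def
  proof (intro Bochner_Integration.integral_cong refl)
   fix k
   have "cis ((p + e *\<^sub>R k) \<bullet> x - t * Omega k) = cis (p \<bullet> x) * (cis (k \<bullet> (e *\<^sub>R x)) * cis (- t * Omega k))"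
    unfolding cis_mult by (rule arg_cong[of _ _ cis]) (simp add: inner_add_left algebra_simps)
   then show "cis (p \<bullet> x) * (cis (k \<bullet> (e *\<^sub>R x)) * h k) = cis ((p + e *\<^sub>R k) \<bullet> x - t * Omega k) * g k"
    by (simp only: h_def mult.assoc)
  qed
  finally show ?thesis by simp
 qed
 let ?c = "e powr (real CARD('d) / 2)"
 have c2: "?c\<^sup>2 = e ^ CARD('d)"
  using e by (simp add: power2_eq_square powr_realpow flip: powr_add)
 have n: "(norm (of_real ?c * osc p e Omega g t x))\<^sup>2 = e ^ CARD('d) * (norm (G (e *\<^sub>R x)))^2" for x
  by (simp add: G norm_mult power_mult_distrib c2)
 note A = lborel_affine_integrable[OF LB(1), of e 0]
 have 1: "integrable lborel (\<lambda>x. (norm (of_real ?c * osc p e Omega g t x))\<^sup>2)"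
  unfolding n using A e by simp
 have "(LINT x|lborel. (norm (of_real ?c * osc p e Omega g t x))\<^sup>2) = (LINT x|lborel. (norm (G x))\<^sup>2)"
  unfolding n using A e by simp
 also have "... <= (2 * pi) ^ CARD('d) * (b\<^sup>2 * measure lborel (cball (0::real^'d) rho))"
  by (rule order_trans[OF LB(2)]) (use I(3) in auto)
 also have "... = (sqrt ((2 * pi) ^ CARD('d) * measure lborel (cball (0::real^'d) rho)) * b)^2"
 proof -
  have "(2 * pi) ^ CARD('d) * (b\<^sup>2 * m) = (sqrt ((2 * pi) ^ CARD('d) * m) * b)^2" if "m >= 0" for m
   unfolding power_mult_distrib[of "sqrt _"] using that by (subst real_sqrt_pow2) auto
  from this[OF measure_nonneg] show ?thesis .
 qed
 finally have 2: "(LINT x|lborel. (norm (of_real ?c * osc p e Omega g t x))\<^sup>2) <= ..." .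
 have "continuous_on UNIV (osc p e Omega g t)"
  by (rule has_derivative_continuous_on[OF osc_has_derivative_space[OF g Omega]])
 then have "osc p e Omega g t \<in> borel_measurable borel" by (rule borel_measurable_continuous_onI)
 then have "(\<lambda>x. of_real ?c * osc p e Omega g t x) \<in> borel_measurable lborel" by measurable
 moreover have "0 <= sqrt ((2 * pi) ^ CARD('d) * measure lborel (cball (0::real^'d) rho)) * b"
  by (intro mult_nonneg_nonneg b real_sqrt_ge_zero) auto
 ultimately show ?thesis unfolding L2_le_def L2_def using 1 2 by blast
qed

section \<open>Schwartz functions and the amplitude equation\<close>

lemma partial_eqI: "(f has_derivative f') (at x) ==> partial i f x = f' (axis i 1)"
 unfolding partial_def by (metis frechet_derivative_at)

lemma linear_axis_sum:
 fixes f :: "real^'n::finite => 'b::real_normed_vector"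
 assumes "bounded_linear f" shows "f h = (\<Sum>i\<in>UNIV. h $ i *\<^sub>R f (axis i 1))"
proof -
 have "f h = f (\<Sum>i\<in>UNIV. h $ i *\<^sub>R axis i 1)"
  using basis_expansion[of h] by (simp add: scalar_mult_eq_scaleR)
 also have "... = (\<Sum>i\<in>UNIV. h $ i *\<^sub>R f (axis i 1))"
  by (simp add: linear_sum[OF bounded_linear.linear[OF assms]] linear_simps(5)[OF assms])
 finally show ?thesis .
qed

lemma differentiable_has_partials:
 fixes f :: "real^'n::finite => complex"
 assumes "f differentiable (at x)"
 shows "(f has_derivative (\<lambda>h. \<Sum>i\<in>UNIV. h $ i *\<^sub>R partial i f x)) (at x)"
proof -
 have d: "(f has_derivative frechet_derivative f (at x)) (at x)"
  using assms frechet_derivative_works by blast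
 have "frechet_derivative f (at x) = (\<lambda>h. \<Sum>i\<in>UNIV. h $ i *\<^sub>R partial i f x)"
  unfolding partial_def by (rule ext) (rule linear_axis_sum[OF has_derivative_bounded_linear[OF d]])
 then show ?thesis using d by simp
qed

text \<open>A common integrable majorant for Schwartz functions. The exponent 2 n is chosen so that
  (1 + |x|)^(2 n) dominates the product of the n factors 1 + x_i^2, which reduces integrability to
  one dimension.\<close>

definition weight :: "real^'n::finite => real" where
 "weight x = 1 / (1 + norm x) ^ (2 * CARD('n))"

lemma weight_nonneg [simp]: "weight x >= 0" and weight_0 [simp]: "weight 0 = 1"
 by (auto simp: weight_def)

lemma weight_measurable [measurable]: "weight \<in> borel_measurable borel"
 unfolding weight_def by measurable

lemma integrable_weight: "integrable lborel (weight :: real^'n::finite => real)"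
proof -
 have "set_integrable lborel UNIV (\<lambda>x::real. inverse (1 + x\<^sup>2))"
  using integrable_inverse_1_plus_square by simp
 then have "integrable lborel (\<lambda>x::real. complex_of_real (inverse (1 + x\<^sup>2)))"
  unfolding set_integrable_def by (intro integrable_of_real) simp
 then have i: "integrable lborel (\<lambda>x::real^'n. \<Prod>i\<in>UNIV. complex_of_real (inverse (1 + (x $ i)^2)))"
  by (rule integral_lborel_vec_prod(1))
 show ?thesis
 proof (rule Bochner_Integration.integrable_bound[OF i])
  show "AE x::real^'n in lborel. norm (weight x) <= norm (\<Prod>i\<in>UNIV. complex_of_real (inverse (1 + (x $ i)^2)))"
  proof (rule AE_I2)
   fix x :: "real^'n"
   have "(\<Prod>i\<in>UNIV. (1 + (x $ i)^2)) <= (\<Prod>i\<in>(UNIV::'n set). (1 + norm x)\<^sup>2)"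
   proof (rule prod_mono, safe)
    fix i :: 'n
    have "\<bar>x $ i\<bar> <= norm x" by (rule component_le_norm_cart)
    then have "(x $ i)\<^sup>2 <= (norm x)^2" by (metis abs_le_square_iff abs_norm_cancel)
    then show "1 + (x $ i)^2 <= (1 + norm x)^2" using norm_ge_zero[of x] by (auto simp: power2_sum intro: add_increasing2)
   qed simp
   then have "(\<Prod>i\<in>UNIV. (1 + (x $ i)^2)) <= (1 + norm x) ^ (2 * CARD('n))"
    by (simp add: power_mult)
   moreover have "(\<Prod>i\<in>UNIV. (1 + (x $ i)^2)) > 0"
    by (intro prod_pos) (auto simp: add_pos_nonneg)
   ultimately have "weight x <= inverse (\<Prod>i\<in>UNIV. (1 + (x $ i)^2))"
    unfolding inverse_eq_divide weight_def by (intro frac_le) auto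
   moreover have "norm (\<Prod>i\<in>UNIV. complex_of_real (inverse (1 + (x $ i)^2))) = inverse (\<Prod>i\<in>UNIV. (1 + (x $ i)^2))"
   proof -
    have n: "norm (complex_of_real (inverse (1 + y\<^sup>2))) = inverse (1 + y\<^sup>2)" for y
     by (subst norm_of_real) simp
    show ?thesis unfolding prod_norm[symmetric] n by (rule prod_inversef[unfolded o_def])
   qed
   ultimately show "norm (weight x) <= norm (\<Prod>i\<in>UNIV. complex_of_real (inverse (1 + (x $ i)^2)))"
    by simp
  qed
 qed auto
qed

text \<open>Lets one majorant serve all translates by at most 1, as needed for differentiating an
  integral with respect to a translation.\<close>

lemma weight_shift:
 fixes x y :: "real^'n::finite"
 assumes "norm y <= 1"
 shows "weight (x + y) <= 2 ^ (2 * CARD('n)) * weight x"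
proof -
 have "norm x <= norm (x + y) + norm y" by (metis add_diff_cancel_right' norm_triangle_ineq4)
 moreover have "a <= b + c ==> c <= 1 ==> 0 <= b ==> 1 + a <= 2 * (1 + b)" for a b c :: real by simp
 ultimately have "1 + norm x <= 2 * (1 + norm (x + y))" using assms norm_ge_zero by blast
 then have "(1 + norm x) ^ (2 * CARD('n)) <= (2 * (1 + norm (x + y))) ^ (2 * CARD('n))"
  by (intro power_mono) auto
 then have "(1 + norm x) ^ (2 * CARD('n)) <= 2 ^ (2 * CARD('n)) * (1 + norm (x + y)) ^ (2 * CARD('n))"
  by (simp only: power_mult_distrib)
 moreover have "0 < (1 + norm x) ^ (2 * CARD('n))" "0 < (1 + norm (x + y)) ^ (2 * CARD('n))"
  by (auto intro!: zero_less_power simp: add_pos_nonneg)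
 ultimately show ?thesis by (simp add: weight_def field_simps)
qed

lemma integrable_weight_bound:
 fixes f :: "real^'n::finite => 'b::{banach,second_countable_topology}"
 assumes "f \<in> borel_measurable borel" "!!x. norm (f x) <= B * weight x"
 shows "integrable lborel f"
 by (rule Bochner_Integration.integrable_bound[of _ "\<lambda>x. B * weight x"])
  (use assms integrable_weight in \<open>auto intro!: AE_I2 order_trans[OF assms(2)] integrable_mult_right mult_right_mono simp: abs_mult\<close>)

text \<open>By translation invariance the integral of \<open>h\<close> shifted by \<tau> along the
  i-th axis does not depend on \<tau>; differentiating under the integral at \<tau> = 0 gives the
  claim. No boundary terms have to be discussed.\<close>

lemma integral_partial_zero:
 fixes h :: "real^'n::finite => 'b::{banach,second_countable_topology}"
 assumes d: "!!x. (h has_derivative h' x) (at x)" and h: "integrable lborel h"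
  and b: "!!x. norm (h' x (axis i 1)) <= B * weight x"
  and m: "(\<lambda>x. h' x (axis i 1)) \<in> borel_measurable borel"
 shows "(LINT x|lborel. h' x (axis i 1)) = 0"
proof -
 let ?a = "axis i (1::real) :: real^'n"
 have B: "B * weight x >= 0" for x :: "real^'n" using b[of x] norm_ge_zero order_trans by blast
 have B0: "B >= 0" using B[of 0] by simp
 have "((\<lambda>\<tau>. LINT x|lborel. h (\<tau> *\<^sub>R ?a + x)) has_derivative (\<lambda>v. LINT x|lborel. v *\<^sub>R h' (0 *\<^sub>R ?a + x) ?a)) (at 0 within ball (0::real) 1)"
 proof (rule has_derivative_integral_dominated[where D="\<lambda>x. B * (2 ^ (2 * CARD('n)) * weight x)" and F'="\<lambda>\<tau> x v. v *\<^sub>R h' (\<tau> *\<^sub>R ?a + x) ?a"])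
  show "integrable lborel (\<lambda>x. h (p *\<^sub>R ?a + x))" for p
   using lborel_affine_integrable(1)[OF h, of 1 "p *\<^sub>R ?a"] by simp
  show "((\<lambda>p. h (p *\<^sub>R ?a + x)) has_derivative (\<lambda>v. v *\<^sub>R h' (p *\<^sub>R ?a + x) ?a)) (at p within ball 0 1)" for p x
  proof -
   have "((\<lambda>p. p *\<^sub>R ?a + x) has_derivative (\<lambda>v. v *\<^sub>R ?a)) (at p within ball 0 1)"
    by (auto intro!: derivative_eq_intros)
   from has_derivative_compose[OF this d] show ?thesis
    using linear_simps(5)[OF has_derivative_bounded_linear[OF d]] by simp
  qed
  show "norm (v *\<^sub>R h' (p *\<^sub>R ?a + x) ?a) <= B * (2 ^ (2 * CARD('n)) * weight x) * norm v" if "p \<in> ball 0 1" for p x v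
  proof -
   have "norm (h' (p *\<^sub>R ?a + x) ?a) <= B * weight (x + p *\<^sub>R ?a)"
    using b[of "p *\<^sub>R ?a + x"] by (simp add: add.commute)
   also have "... <= B * (2 ^ (2 * CARD('n)) * weight x)"
    using that by (intro mult_left_mono weight_shift B0) auto
   finally have "\<bar>v\<bar> * norm (h' (p *\<^sub>R ?a + x) ?a) <= \<bar>v\<bar> * (B * (2 ^ (2 * CARD('n)) * weight x))"
    by (rule mult_left_mono) simp
   then show ?thesis unfolding norm_scaleR real_norm_def by (simp only: mult.commute)
  qed
  show "(\<lambda>x. v *\<^sub>R h' (0 *\<^sub>R ?a + x) ?a) \<in> borel_measurable lborel" for v using m by simp
 qed (auto intro!: integrable_mult_right integrable_weight)
 then have 1: "((\<lambda>\<tau>::real. LINT x|lborel. h x) has_derivative (\<lambda>v. v *\<^sub>R (LINT x|lborel. h' x ?a))) (at 0)"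
 proof -
  have at: "at (0::real) within ball 0 1 = at 0" by (intro at_within_open) auto
  assume "((\<lambda>\<tau>. LINT x|lborel. h (\<tau> *\<^sub>R ?a + x)) has_derivative (\<lambda>v. LINT x|lborel. v *\<^sub>R h' (0 *\<^sub>R ?a + x) ?a)) (at 0 within ball (0::real) 1)"
  then show ?thesis
   by (simp only: at lborel_translate_integral[OF h] scaleR_zero_left add_0_left integral_scaleR_right)
 qed
 have "((\<lambda>\<tau>::real. LINT x|lborel. h x) has_derivative (\<lambda>v. 0)) (at 0)"
  by (rule has_derivative_const)
 from fun_cong[OF has_derivative_unique[OF 1 this], of 1] show ?thesis by simp
qed

lemma schwartz_bounded_weight:
 fixes S :: "(real^'n::finite => complex) set"
 assumes "schwartz_bounded S"
 obtains B where "B >= 0" "!!f x. f \<in> S ==> norm (partials is f x) <= B * weight x"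
proof -
 obtain B where B: "!!f x. f \<in> S ==> (1 + norm x) ^ (2 * CARD('n)) * norm (partials is f x) <= B"
  using assms unfolding schwartz_bounded_def by metis
 have "norm (partials is f x) <= max B 0 * weight x" if "f \<in> S" for f x
 proof -
  have "0 < (1 + norm x) ^ (2 * CARD('n))" by (auto intro!: zero_less_power simp: add_pos_nonneg)
  then show ?thesis using B[OF that, of x] by (simp add: weight_def field_simps max_def)
 qed
 then show ?thesis using that[of "max B 0"] by auto
qed

lemma schwartz_has_derivative:
 assumes "schwartz f"
 shows "(partials is f has_derivative (\<lambda>h. \<Sum>i\<in>UNIV. h $ i *\<^sub>R partials (i # is) f x)) (at x)"
 using assms differentiable_has_partials[of "partials is f" x]
 by (simp add: schwartz_def schwartz_bounded_def smooth_def)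

lemma schwartz_continuous: "schwartz f ==> continuous_on UNIV (partials is f)"
 by (rule has_derivative_continuous_on[OF has_derivative_at_withinI[OF schwartz_has_derivative]])

lemma schwartz_measurable: "schwartz f ==> partials is f \<in> borel_measurable borel"
 by (intro borel_measurable_continuous_onI schwartz_continuous)

lemma schwartz_integrable: "schwartz f ==> integrable lborel (partials is f)"
proof -
 assume f: "schwartz f"
 obtain B where "B >= 0" "!!x. norm (partials is f x) <= B * weight x"
  using f unfolding schwartz_def by (rule schwartz_bounded_weight[of _ "is"]) auto
 with f show ?thesis by (intro integrable_weight_bound[of _ B] schwartz_measurable)
qed

text \<open>Integration by parts: the integral of the i-th derivative of exp(-i k . x) times the
  function vanishes. Iterated along the list of indices.\<close>

lemma fourier_partials:
 fixes f :: "real^'n::finite => complex"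
 assumes f: "schwartz f"
 shows "fourier (partials is f) k = (\<Prod>i\<leftarrow>is. \<i> * of_real (k $ i)) * fourier f k"
proof (induction "is")
 case (Cons i "is")
 let ?g = "partials is f" and ?e = "\<lambda>x. cis (- (k \<bullet> x))"
 define h' where "h' x v = ?e x * (\<Sum>j\<in>UNIV. v $ j *\<^sub>R partials (j # is) f x) + (- \<i> * of_real (k \<bullet> v)) * ?e x * ?g x" for x v
 obtain B where B: "B >= 0" "!!x. norm (?g x) <= B * weight x"
  using f unfolding schwartz_def by (rule schwartz_bounded_weight[of _ "is"]) auto
 obtain B' where B': "B' >= 0" "!!x. norm (partials (i # is) f x) <= B' * weight x"
  using f unfolding schwartz_def by (rule schwartz_bounded_weight[of _ "i # is"]) auto
 have h'i: "h' x (axis i 1) = ?e x * partials (i # is) f x + (- \<i> * of_real (k $ i)) * (?e x * ?g x)" for x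
  unfolding h'_def by (simp add: axis_def if_distrib[of "\<lambda>r. r *\<^sub>R _"] inner_axis cong: if_cong)
   (simp add: inner_axis[unfolded axis_def])
 have m[measurable]: "?g \<in> borel_measurable borel" "partials (i # is) f \<in> borel_measurable borel"
  using schwartz_measurable[OF f] by blast+
 note m(2)[simplified, measurable]
 have i1: "integrable lborel (\<lambda>x. ?e x * ?g x)"
  by (rule integrable_weight_bound[of _ B]) (use B in \<open>auto simp: norm_mult\<close>)
 have i2: "integrable lborel (\<lambda>x. ?e x * partials (i # is) f x)"
  by (rule integrable_weight_bound[of _ B']) (use B' in \<open>auto simp: norm_mult\<close>)
 have "(LINT x|lborel. h' x (axis i 1)) = 0"
 proof (rule integral_partial_zero[where B="B' + \<bar>k $ i\<bar> * B"])
  show "((\<lambda>x. ?e x * ?g x) has_derivative h' x) (at x)" for x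
   unfolding h'_def
   by (auto intro!: derivative_eq_intros has_derivative_cis schwartz_has_derivative[OF f]
    simp: fun_eq_iff scaleR_conv_of_real algebra_simps)
  show "norm (h' x (axis i 1)) <= (B' + \<bar>k $ i\<bar> * B) * weight x" for x
  proof -
   have "norm (h' x (axis i 1)) <= norm (partials (i # is) f x) + \<bar>k $ i\<bar> * norm (?g x)"
    unfolding h'i by (rule order_trans[OF norm_triangle_ineq]) (simp add: norm_mult)
   also have "... <= B' * weight x + \<bar>k $ i\<bar> * (B * weight x)"
    by (intro add_mono mult_left_mono B B') auto
   finally show ?thesis by (simp add: algebra_simps)
  qed
  show "(\<lambda>x. h' x (axis i 1)) \<in> borel_measurable borel" unfolding h'i by measurable
 qed (rule i1)
 then have "fourier (partials (i # is) f) k + (- \<i> * of_real (k $ i)) * fourier ?g k = 0"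
  unfolding h'i fourier_def by (subst (asm) Bochner_Integration.integral_add) (use i1 i2 in auto)
 then show ?case using Cons by (simp add: add_eq_0_iff mult_ac)
qed simp

lemma fourier_continuous:
 fixes f :: "real^'n::finite => complex"
 assumes f: "integrable lborel f"
 shows "continuous_on UNIV (fourier f)"
 unfolding continuous_on_eq_continuous_at[OF open_UNIV]
proof (intro ballI continuous_at_sequentiallyI)
 fix k :: "real^'n" and u :: "nat => real^'n"
 assume u: "u \<longlonglongrightarrow> k"
 have [measurable]: "f \<in> borel_measurable borel" using f borel_measurable_integrable by force
 show "(\<lambda>n. fourier f (u n)) \<longlonglongrightarrow> fourier f k"
  unfolding fourier_def
 proof (rule integral_dominated_convergence[where w="\<lambda>x. norm (f x)"])
  show "AE x in lborel. (\<lambda>n. cis (- (u n \<bullet> x)) * f x) \<longlonglongrightarrow> cis (- (k \<bullet> x)) * f x"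
   by (intro AE_I2 tendsto_intros u)
 qed (use f in \<open>auto simp: norm_mult intro!: integrable_norm\<close>)
qed

section \<open>Fourier symbols and the explicit solution of the amplitude equation\<close>

definition contr :: "nat => 'd::finite tensor => real^'d => complex" where
 "contr p T q = (\<Sum>is\<in>{is. length is = p}. T is * (\<Prod>i\<leftarrow>is. of_real (q $ i)))"

definition amp_indices :: "nat => real => (nat \<times> nat) set" where
 "amp_indices L \<beta> = {(m, p). m <= L \<and> int p <= \<lfloor>real L / \<beta>\<rfloor> \<and> m + p >= 2 \<and> (m, p) ~= (0, 2)}"

text \<open>Signs are arranged such that the amplitude equation reads i A_t = \<sigma> times this
  symbol applied to A. The transverse Laplacian, with negative symbol, therefore enters with a plus
  sign.\<close>

definition amp_symbol ::
  "real^'m::finite^'d::finite => (real^'m => complex^'d^'d) => real^'d => real => nat => real => real^'d => complex" where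
 "amp_symbol F aT k \<beta> L lam q = (let epsilon = lam powr \<beta> in
   of_real (epsilon\<^sup>2 * ((norm k)^2 * (norm q)^2 - (k \<bullet> q)\<^sup>2) / (2 * norm k ^ 3))
   + of_real lam * rs_nu F aT 0 k / of_real (2 * norm k)
   + (\<Sum>(m, p)\<in>amp_indices L \<beta>. of_real (lam ^ m * epsilon ^ p) * contr p (C_tensor F aT m p k) q))"

lemma finite_amp_indices: "\<beta> > 0 ==> finite (amp_indices L \<beta>)"
 by (rule finite_subset[of _ "{..L} \<times> {..nat \<lfloor>real L / \<beta>\<rfloor>}"]) (auto simp: amp_indices_def)

text \<open>\<open>D\<close> is the image of \<open>f\<close> under a Fourier multiplier.
  Integrability is part of the notion, because otherwise the Fourier transform of a sum could not be
  split.\<close>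

definition has_symbol :: "(real^'n::finite => complex) => (real^'n => complex) => (real^'n => complex) => bool" where
 "has_symbol f D s \<longleftrightarrow> integrable lborel D \<and> (\<forall>k. fourier D k = s k * fourier f k)"

lemma fourier_integrable:
 "integrable lborel D ==> integrable lborel (\<lambda>x. cis (- (k \<bullet> x)) * D (x :: real^'n::finite))"
 by (rule Bochner_Integration.integrable_bound[of _ D]) (auto simp: norm_mult)

lemma has_symbol_partials: "schwartz f ==> has_symbol f (partials is f) (\<lambda>k. \<Prod>i\<leftarrow>is. \<i> * of_real (k $ i))"
 by (simp add: has_symbol_def schwartz_integrable fourier_partials)

lemma has_symbol_add: "has_symbol f D s ==> has_symbol f E r ==> has_symbol f (\<lambda>x. D x + E x) (\<lambda>k. s k + r k)"
 by (auto simp: has_symbol_def fourier_def distrib_left distrib_right fourier_integrable)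

lemma has_symbol_cmult: "has_symbol f D s ==> has_symbol f (\<lambda>x. c * D x) (\<lambda>k. c * s k)"
 by (auto simp: has_symbol_def fourier_def mult.left_commute[of _ c] mult.assoc)

lemma has_symbol_sum:
 "(!!i. i \<in> I ==> has_symbol f (D i) (s i)) ==> has_symbol f (\<lambda>x. \<Sum>i\<in>I. D i x) (\<lambda>k. \<Sum>i\<in>I. s i k)"
 by (induction I rule: infinite_finite_induct)
  (auto intro!: has_symbol_add, auto simp: has_symbol_def fourier_def)

lemma prod_list_ii: "(- \<i>) ^ length is * (\<Prod>i\<leftarrow>is. \<i> * of_real (k $ i)) = (\<Prod>i\<leftarrow>is. of_real (k $ i))"
proof (induction "is")
 case (Cons a "is")
 have "(- \<i>) ^ length (a # is) * (\<Prod>i\<leftarrow>a # is. \<i> * of_real (k $ i)) =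
  (- \<i> * \<i>) * of_real (k $ a) * ((- \<i>) ^ length is * (\<Prod>i\<leftarrow>is. \<i> * of_real (k $ i)))"
  by (simp only: list.map prod_list.Cons length_Cons power_Suc mult_ac)
 then show ?case using Cons by simp
qed simp

text \<open>The factor (-i)^p in \<open>contract_deriv\<close> cancels the i^p that differentiation
  produces, so the symbol is the plain polynomial given by the tensor.\<close>

lemma has_symbol_contract:
 assumes "schwartz f" shows "has_symbol f (contract_deriv p T f) (contr p T)"
proof -
 have "has_symbol f (\<lambda>x. \<Sum>is\<in>{is. length is = p}. (T is * (- \<i>) ^ p) * partials is f x)
   (\<lambda>k. \<Sum>is\<in>{is. length is = p}. (T is * (- \<i>) ^ p) * (\<Prod>i\<leftarrow>is. \<i> * of_real (k $ i)))"
  by (intro has_symbol_sum has_symbol_cmult has_symbol_partials assms)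
 moreover have "(\<Sum>is\<in>{is. length is = p}. (T is * (- \<i>) ^ p) * (\<Prod>i\<leftarrow>is. \<i> * of_real (k $ i))) = contr p T k" for k
  unfolding contr_def by (intro sum.cong) (auto simp: mult.assoc prod_list_ii)
 ultimately show ?thesis by (simp add: contract_deriv_def[abs_def] mult.assoc)
qed

lemma transverse_laplace_eq:
 assumes f: "schwartz f"
 shows "transverse_laplace k f x = ((\<Sum>i\<in>UNIV. of_real ((norm k)^2) * partials [i, i] f x)
  + (\<Sum>i\<in>UNIV. \<Sum>j\<in>UNIV. - of_real (k $ i * k $ j) * partials [i, j] f x)) / of_real (2 * norm k ^ 3)"
proof -
 have g: "grad f x $ i = partial i f x" for i x by (simp add: grad_def)
 have d: "divergence (grad f) x = (\<Sum>i\<in>UNIV. partials [i, i] f x)"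
  by (simp add: divergence_def g)
 have h: "((\<lambda>x. cdot (cvec k) (grad f x)) has_derivative
   (\<lambda>h. \<Sum>j\<in>UNIV. of_real (k $ j) * (\<Sum>i\<in>UNIV. h $ i *\<^sub>R partials [i, j] f x))) (at x)" for x
  unfolding cdot_def cvec_def g using schwartz_has_derivative[OF f, of "[j]" x for j]
  by (auto intro!: derivative_eq_intros)
 define G where "G = (\<lambda>x. cdot (cvec k) (grad f x))"
 have pG: "partial i G x = (\<Sum>j\<in>UNIV. of_real (k $ j) * partials [i, j] f x)" for i
  unfolding G_def
  by (subst partial_eqI[OF h]) (simp add: axis_def if_distrib[of "\<lambda>r. r *\<^sub>R _"] cong: if_cong)
 have "cdot (cvec k) (grad G x) = (\<Sum>i\<in>UNIV. of_real (k $ i) * partial i G x)"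
  by (simp add: cdot_def cvec_def grad_def)
 also have "... = (\<Sum>i\<in>UNIV. \<Sum>j\<in>UNIV. of_real (k $ i * k $ j) * partials [i, j] f x)"
  unfolding pG sum_distrib_left by (simp add: mult.assoc)
 finally have "cdot (cvec k) (grad G x) = ..." .
 then show ?thesis
  unfolding transverse_laplace_def d G_def by (simp add: sum_negf sum_distrib_left)
qed

lemma has_symbol_transverse:
 fixes k :: "real^'n::finite"
 assumes f: "schwartz f"
 shows "has_symbol f (transverse_laplace k f) (\<lambda>q. - of_real (((norm k)^2 * (norm q)^2 - (k \<bullet> q)\<^sup>2) / (2 * norm k ^ 3)))"
proof -
 let ?c = "inverse (complex_of_real (2 * norm k ^ 3))"
 have 1: "has_symbol f (\<lambda>x. ?c * ((\<Sum>i\<in>UNIV. of_real ((norm k)^2) * partials [i, i] f x)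
  + (\<Sum>i\<in>UNIV. \<Sum>j\<in>UNIV. - of_real (k $ i * k $ j) * partials [i, j] f x)))
  (\<lambda>q. ?c * ((\<Sum>i\<in>UNIV. of_real ((norm k)^2) * (\<Prod>i\<leftarrow>[i, i]. \<i> * of_real (q $ i)))
  + (\<Sum>i\<in>UNIV. \<Sum>j\<in>UNIV. - of_real (k $ i * k $ j) * (\<Prod>i\<leftarrow>[i, j]. \<i> * of_real (q $ i)))))"
  by (intro has_symbol_sum has_symbol_cmult has_symbol_add has_symbol_partials f)
 have a: "(\<Sum>i\<in>UNIV. complex_of_real ((norm k)^2) * (\<Prod>i\<leftarrow>[i, i]. \<i> * of_real (q $ i))) = - of_real ((norm k)^2 * (norm q)^2)" for q
 proof -
  have "(norm q)\<^sup>2 = (\<Sum>i\<in>UNIV. q $ i * q $ i)"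
   unfolding power2_norm_eq_inner by (simp add: inner_vec_def)
  then show ?thesis by (simp add: sum_distrib_left sum_negf algebra_simps)
 qed
 have b: "(\<Sum>i\<in>UNIV. \<Sum>j\<in>UNIV. - complex_of_real (k $ i * k $ j) * (\<Prod>i\<leftarrow>[i, j]. \<i> * of_real (q $ i))) = of_real ((k \<bullet> q)^2)" for q
 proof -
  have "(k \<bullet> q)\<^sup>2 = (\<Sum>i\<in>UNIV. \<Sum>j\<in>UNIV. (k $ i * q $ i) * (k $ j * q $ j))"
   by (simp add: inner_vec_def power2_eq_square sum_product)
  then show ?thesis by (simp add: algebra_simps)
 qed
 have c: "?c * (- of_real X + of_real Y) = - of_real ((X - Y) / (2 * norm k ^ 3))" for X Y
  by (simp add: divide_simps algebra_simps)
 have t: "transverse_laplace k f = (\<lambda>x. ?c * ((\<Sum>i\<in>UNIV. of_real ((norm k)^2) * partials [i, i] f x)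
  + (\<Sum>i\<in>UNIV. \<Sum>j\<in>UNIV. - of_real (k $ i * k $ j) * partials [i, j] f x)))"
  by (rule ext) (simp only: transverse_laplace_eq[OF f] divide_inverse mult.commute)
 show ?thesis
  unfolding t by (rule 1[unfolded a b c])
qed

text \<open>One constant for the whole family indexed by \<open>S\<close>: it provides the
  time-independent majorant for differentiating the Fourier transform of a solution in time.\<close>

definition weight_bounded :: "'s set => ('s => real^'n::finite => complex) => bool" where
 "weight_bounded S D \<longleftrightarrow> (\<exists>B. \<forall>s\<in>S. \<forall>x. norm (D s x) <= B * weight x)"

lemma weight_bounded_add: "weight_bounded S D ==> weight_bounded S E ==> weight_bounded S (\<lambda>s x. D s x + E s x)"
proof -
 assume "weight_bounded S D" "weight_bounded S E"
 then obtain B C where "\<forall>s\<in>S. \<forall>x. norm (D s x) <= B * weight x" "\<forall>s\<in>S. \<forall>x. norm (E s x) <= C * weight x"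
  unfolding weight_bounded_def by blast
 then have "\<forall>s\<in>S. \<forall>x. norm (D s x + E s x) <= (B + C) * weight x"
  by (auto simp: distrib_right intro: order_trans[OF norm_triangle_ineq add_mono])
 then show ?thesis unfolding weight_bounded_def by blast
qed

lemma weight_bounded_cmult: "weight_bounded S D ==> weight_bounded S (\<lambda>s x. c * D s x)"
proof -
 assume "weight_bounded S D"
 then obtain B where "\<forall>s\<in>S. \<forall>x. norm (D s x) <= B * weight x"
  unfolding weight_bounded_def by blast
 then have "\<forall>s\<in>S. \<forall>x. norm (c * D s x) <= (norm c * B) * weight x"
  by (auto simp: norm_mult mult.assoc intro: mult_left_mono)
 then show ?thesis unfolding weight_bounded_def by blast
qed

lemma weight_bounded_sum: "(!!i. i \<in> I ==> weight_bounded S (D i)) ==> weight_bounded S (\<lambda>s x. \<Sum>i\<in>I. D i s x)"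
proof (induction I rule: infinite_finite_induct)
 case (insert i I)
 then show ?case by (simp add: weight_bounded_add)
qed (auto simp: weight_bounded_def intro!: exI[of _ 0])

lemma weight_bounded_partials:
 "schwartz_bounded (A ` S) ==> weight_bounded S (\<lambda>s. partials is (A s))"
 unfolding weight_bounded_def by (erule schwartz_bounded_weight) blast

text \<open>In Fourier variables the equation is, for each fixed q, a scalar linear ODE in time.
  Boundedness in the Schwartz space on compact time intervals justifies differentiating the Fourier
  integral. As \<open>Q\<close> is real the solution is a rotation of the initial value, which stays
  supported in the ball, and Fourier inversion turns it into a packet.\<close>

lemma amplitude_formula:
 fixes k :: "real^'d::finite" and A :: "real => real^'d => complex"
 assumes A: "amplitude_solution \<sigma> F aT k \<beta> L lam u\<^sub>0 v\<^sub>0 A"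
  and Q: "!!q. amp_symbol F aT k \<beta> L lam q = of_real (Q q)"
  and Qc: "continuous_on UNIV Q"
  and cp: "cpt rho (fourier (A 0))" and t: "t >= 0"
 shows "of_real ((2 * pi) ^ CARD('d)) * A t x = osc 0 1 (\<lambda>q. \<sigma> * Q q) (fourier (A 0)) t x"
proof -
 define epsilon where "epsilon = lam powr \<beta>"
 have sb: "schwartz_bounded (A ` {0..T})" for T
  using A by (simp add: amplitude_solution_def Let_def)
 have sch: "schwartz (A s)" if "s >= 0" for s
  using sb[of s] that unfolding schwartz_def schwartz_bounded_def by (metis atLeastAtMost_iff imageI order_refl singletonD)
 have diff: "((\<lambda>s. A s x) has_vector_derivative time_deriv A s x) (at s within {0..})" if "s >= 0" for s x
  using A that unfolding amplitude_solution_def Let_def time_deriv_def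
  by (simp add: vector_derivative_works[symmetric])
 define N where "N s x = - of_real (epsilon\<^sup>2) * transverse_laplace k (A s) x
   + of_real lam * rs_nu F aT 0 k / of_real (2 * norm k) * partials [] (A s) x
   + (\<Sum>(m, p)\<in>amp_indices L \<beta>. of_real (lam ^ m * epsilon ^ p) * contract_deriv p (C_tensor F aT m p k) (A s) x)" for s x
 have eq: "time_deriv A s x = (- \<i> * of_real \<sigma>) * N s x" if s: "s >= 0" for s x
 proof -
  have "\<i> * time_deriv A s x + of_real (\<sigma> * epsilon\<^sup>2) * transverse_laplace k (A s) x
    - of_real (\<sigma> * lam) * (rs_nu F aT 0 k / of_real (2 * norm k)) * A s x
    = of_real \<sigma> * (\<Sum>(m, p)\<in>amp_indices L \<beta>. of_real (lam ^ m * epsilon ^ p) * contract_deriv p (C_tensor F aT m p k) (A s) x)"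
   using A s unfolding amplitude_solution_def Let_def epsilon_def amp_indices_def by blast
  then have "\<i> * time_deriv A s x = of_real \<sigma> * N s x"
   by (simp add: N_def algebra_simps)
  then have "- \<i> * (\<i> * time_deriv A s x) = - \<i> * (of_real \<sigma> * N s x)" by simp
  then show ?thesis by (simp add: mult.assoc[symmetric])
 qed
 have sym: "has_symbol (A s) (time_deriv A s) (\<lambda>q. - \<i> * of_real (\<sigma> * Q q))" if s: "s >= 0" for s
 proof -
  have "has_symbol (A s) (N s) (\<lambda>q. - of_real (epsilon\<^sup>2) * (- of_real (((norm k)^2 * (norm q)^2 - (k \<bullet> q)\<^sup>2) / (2 * norm k ^ 3)))
    + of_real lam * rs_nu F aT 0 k / of_real (2 * norm k) * (\<Prod>i\<leftarrow>[]. \<i> * of_real (q $ i))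
    + (\<Sum>i\<in>amp_indices L \<beta>. case i of (m, p) => of_real (lam ^ m * epsilon ^ p) * contr p (C_tensor F aT m p k) q))"
   unfolding N_def
   by (intro has_symbol_add has_symbol_cmult has_symbol_sum has_symbol_transverse has_symbol_partials sch s)
    (auto simp: case_prod_beta intro!: has_symbol_cmult has_symbol_contract sch s)
  also have "(\<lambda>q. - of_real (epsilon\<^sup>2) * (- of_real (((norm k)^2 * (norm q)^2 - (k \<bullet> q)\<^sup>2) / (2 * norm k ^ 3)))
    + of_real lam * rs_nu F aT 0 k / of_real (2 * norm k) * (\<Prod>i\<leftarrow>[]. \<i> * of_real (q $ i))
    + (\<Sum>i\<in>amp_indices L \<beta>. case i of (m, p) => of_real (lam ^ m * epsilon ^ p) * contr p (C_tensor F aT m p k) q))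
    = (\<lambda>q. of_real (Q q))"
   unfolding Q[symmetric] by (rule ext) (simp add: amp_symbol_def epsilon_def Let_def)
  finally have "has_symbol (A s) (\<lambda>x. (- \<i> * of_real \<sigma>) * N s x) (\<lambda>q. (- \<i> * of_real \<sigma>) * of_real (Q q))"
   by (rule has_symbol_cmult)
  moreover have "time_deriv A s = (\<lambda>x. (- \<i> * of_real \<sigma>) * N s x)"
   by (rule ext) (rule eq[OF s])
  ultimately show ?thesis by (simp add: mult.assoc)
 qed
 have bdd: "\<exists>B. \<forall>s\<in>{0..T}. \<forall>x. norm (time_deriv A s x) <= B * weight x" for T
 proof -
  have "weight_bounded {0..T} (\<lambda>s x. inverse (of_real (2 * norm k ^ 3)) * ((\<Sum>i\<in>UNIV. of_real ((norm k)^2) * partials [i, i] (A s) x)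
    + (\<Sum>i\<in>UNIV. \<Sum>j\<in>UNIV. - of_real (k $ i * k $ j) * partials [i, j] (A s) x)))" (is "weight_bounded _ ?D")
   by (intro weight_bounded_add weight_bounded_cmult weight_bounded_sum weight_bounded_partials sb)
  then obtain B where B: "\<forall>s\<in>{0..T}. \<forall>x. norm (?D s x) <= B * weight x"
   unfolding weight_bounded_def by blast
  have tl: "transverse_laplace k (A s) x = ?D s x" if "s \<in> {0..T}" for s x
   using that by (subst transverse_laplace_eq[OF sch]) (simp_all only: divide_inverse mult.commute atLeastAtMost_iff)
  have "weight_bounded {0..T} (\<lambda>s x. transverse_laplace k (A s) x)"
   unfolding weight_bounded_def
  proof (intro exI ballI allI)
   fix s x assume s: "s \<in> {0..T}"
   show "norm (transverse_laplace k (A s) x) <= B * weight x"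
    unfolding tl[OF s] using B s by blast
  qed
  moreover have "weight_bounded {0..T} (\<lambda>s x. contract_deriv p (C_tensor F aT m p k) (A s) x)" for m p
   unfolding contract_deriv_def by (intro weight_bounded_sum weight_bounded_cmult weight_bounded_partials sb)
  ultimately have "weight_bounded {0..T} (\<lambda>s x. (- \<i> * of_real \<sigma>) * N s x)"
   unfolding N_def case_prod_beta
   by (intro weight_bounded_add weight_bounded_cmult weight_bounded_sum weight_bounded_partials sb)
  then show ?thesis unfolding weight_bounded_def by (auto simp: eq)
 qed
 have ode: "fourier (A t) q = cis (- (t * (\<sigma> * Q q))) * fourier (A 0) q" for q
 proof -
  obtain B where B: "!!s x. s \<in> {0..t} ==> norm (time_deriv A s x) <= B * weight x"
   using bdd[of t] by blast
  have y: "((\<lambda>s. fourier (A s) q) has_derivative (\<lambda>v. v *\<^sub>R (- \<i> * of_real (\<sigma> * Q q) * fourier (A s) q))) (at s within {0..t})"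
   if s: "s \<in> {0..t}" for s
  proof -
   have "((\<lambda>s. LINT x|lborel. cis (- (q \<bullet> x)) * A s x) has_derivative
     (\<lambda>v. LINT x|lborel. v *\<^sub>R (cis (- (q \<bullet> x)) * time_deriv A s x))) (at s within {0..t})"
   proof (rule has_derivative_integral_dominated[where D="\<lambda>x. B * weight x" and F'="\<lambda>s x v. v *\<^sub>R (cis (- (q \<bullet> x)) * time_deriv A s x)"])
    show "integrable lborel (\<lambda>x. cis (- (q \<bullet> x)) * A p x)" if "p \<in> {0..t}" for p
     using schwartz_integrable[of "A p" "[]"] sch[of p] that by (auto intro: fourier_integrable)
    show "((\<lambda>p. cis (- (q \<bullet> x)) * A p x) has_derivative (\<lambda>v. v *\<^sub>R (cis (- (q \<bullet> x)) * time_deriv A p x))) (at p within {0..t})"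
     if "p \<in> {0..t}" for p x
    proof -
     have "((\<lambda>s. A s x) has_vector_derivative time_deriv A p x) (at p within {0..t})"
      using that by (intro has_vector_derivative_within_subset[OF diff]) auto
     then show ?thesis unfolding has_vector_derivative_def
      by (auto intro!: derivative_eq_intros simp: fun_eq_iff)
    qed
    show "norm (v *\<^sub>R (cis (- (q \<bullet> x)) * time_deriv A p x)) <= B * weight x * norm v" if "p \<in> {0..t}" for p x v
     using mult_left_mono[OF B[OF that, of x], of "\<bar>v\<bar>"] by (simp add: norm_mult mult_ac)
    have "integrable lborel (\<lambda>x. cis (- (q \<bullet> x)) * time_deriv A s x)"
     using sym[of s] s by (intro fourier_integrable) (auto simp: has_symbol_def)
    then show "(\<lambda>x. v *\<^sub>R (cis (- (q \<bullet> x)) * time_deriv A s x)) \<in> borel_measurable lborel" for v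
     using borel_measurable_integrable by force
   qed (use s integrable_weight in auto)
   moreover have "(LINT x|lborel. v *\<^sub>R (cis (- (q \<bullet> x)) * time_deriv A s x)) = v *\<^sub>R (- \<i> * of_real (\<sigma> * Q q) * fourier (A s) q)" for v
    using sym[of s] s by (simp add: has_symbol_def fourier_def)
   ultimately show ?thesis by (simp add: fourier_def)
  qed
  \<comment> \<open>Integrating factor: undoing the rotation leaves a function of time with zero
    derivative.\<close>
  have "((\<lambda>s. cis (s * (\<sigma> * Q q)) * fourier (A s) q) has_derivative (\<lambda>h. 0)) (at s within {0..t})" if "s \<in> {0..t}" for s
   by (auto intro!: derivative_eq_intros has_derivative_cis y[OF that] simp: fun_eq_iff scaleR_conv_of_real algebra_simps)
  then have "\<exists>c. \<forall>s\<in>{0..t}. cis (s * (\<sigma> * Q q)) * fourier (A s) q = c"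
   by (intro has_derivative_zero_constant) auto
  then obtain c where c: "!!s. s \<in> {0..t} ==> cis (s * (\<sigma> * Q q)) * fourier (A s) q = c"
   by blast
  have "cis (t * (\<sigma> * Q q)) * fourier (A t) q = fourier (A 0) q"
   using c[of t] c[of 0] t by simp
  then have "cis (- (t * (\<sigma> * Q q))) * (cis (t * (\<sigma> * Q q)) * fourier (A t) q) = cis (- (t * (\<sigma> * Q q))) * fourier (A 0) q" by simp
  then show ?thesis by (simp add: cis_mult mult.assoc[symmetric])
 qed
 have cpt: "cpt rho (fourier (A t))"
  unfolding ode by (rule cpt_mult[OF cp]) (intro continuous_intros continuous_on_subset[OF Qc] subset_UNIV)
 obtain B where B: "!!x. norm (A t x) <= B * weight x"
 proof -
  obtain B where "\<forall>s\<in>{0..t}. \<forall>x. norm (partials [] (A s) x) <= B * weight x"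
   using weight_bounded_partials[OF sb] unfolding weight_bounded_def by blast
  then show ?thesis using that[of B] t by simp
 qed
 have "(LINT k|lborel. cis (k \<bullet> x) * fourier (A t) k) = of_real ((2 * pi) ^ CARD('d)) * A t x"
 proof (rule fourier_inversion)
  show "continuous_on UNIV (A t)" using schwartz_continuous[OF sch[OF t], of "[]"] by simp
  show "integrable lborel (A t)" using schwartz_integrable[OF sch[OF t], of "[]"] by simp
  show "norm (A t x) <= \<bar>B\<bar> * 1" for x
  proof -
   have "1 <= (1 + norm x) ^ (2 * CARD('d))" by (rule one_le_power) simp
   then have "weight x <= 1" unfolding weight_def by (subst divide_le_eq_1) linarith
   then show ?thesis
    by (intro order_trans[OF B] mult_mono) auto
  qed
 qed (rule cpt_integrable[OF cpt])
 then show ?thesis unfolding osc_def ode by (simp add: cis_mult mult.assoc[symmetric])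
qed

section \<open>Expansion of the dispersion relation\<close>

text \<open>The filter is \<open>nhds 0\<close>, not \<open>at 0\<close>: the bound also holds at
  eta = 0, where for P > 0 it forces f to vanish. Composition with an inner function that may attain
  the value 0 depends on this.\<close>

definition big_O :: "nat => ('a::real_normed_vector => 'b::real_normed_algebra_1) => bool" where
 "big_O P f \<longleftrightarrow> (\<exists>C. \<forall>\<^sub>F eta in nhds 0. norm (f eta) <= C * norm eta ^ P)"

lemma big_O_add: "big_O P f ==> big_O P g ==> big_O P (\<lambda>eta. f eta + g eta)"
proof -
 assume "big_O P f" "big_O P g"
 then obtain C D where *: "\<forall>\<^sub>F eta in nhds 0. norm (f eta) <= C * norm eta ^ P" "\<forall>\<^sub>F eta in nhds 0. norm (g eta) <= D * norm eta ^ P"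
  unfolding big_O_def by blast
 have "\<forall>\<^sub>F eta in nhds 0. norm (f eta + g eta) <= (C + D) * norm eta ^ P"
  using * by eventually_elim (auto simp: distrib_right intro: order_trans[OF norm_triangle_ineq add_mono])
 then show ?thesis unfolding big_O_def by blast
qed

lemma big_O_mult: "big_O P f ==> big_O Q g ==> big_O (P + Q) (\<lambda>eta. f eta * g eta)"
proof -
 assume "big_O P f" "big_O Q g"
 then obtain C D where *: "\<forall>\<^sub>F eta in nhds 0. norm (f eta) <= C * norm eta ^ P" "\<forall>\<^sub>F eta in nhds 0. norm (g eta) <= D * norm eta ^ Q"
  unfolding big_O_def by blast
 have "\<forall>\<^sub>F eta in nhds 0. norm (f eta * g eta) <= (C * D) * norm eta ^ (P + Q)"
  using *
 proof eventually_elim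
  case (elim eta)
  have "norm (f eta * g eta) <= norm (f eta) * norm (g eta)" by (rule norm_mult_ineq)
  also have "... <= (C * norm eta ^ P) * (D * norm eta ^ Q)"
   using elim by (intro mult_mono) (auto intro: order_trans[OF norm_ge_zero])
  finally show ?case by (simp add: power_add mult_ac)
 qed
 then show ?thesis unfolding big_O_def by blast
qed

lemma big_O_mono: "big_O P f ==> Q <= P ==> big_O Q f"
proof -
 assume "big_O P f" and le: "Q <= P"
 then obtain C where *: "\<forall>\<^sub>F eta in nhds 0. norm (f eta) <= C * norm eta ^ P"
  unfolding big_O_def by blast
 have "\<forall>\<^sub>F eta in nhds (0::'a). eta \<in> ball 0 1"
  by (intro eventually_nhds_in_open) auto
 with * have "\<forall>\<^sub>F eta in nhds 0. norm (f eta) <= \<bar>C\<bar> * norm eta ^ Q"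
 proof eventually_elim
  case (elim eta)
  have "C * norm eta ^ P <= \<bar>C\<bar> * norm eta ^ Q"
   using elim le by (intro mult_mono power_decreasing) auto
  then show ?case using elim by linarith
 qed
 then show ?thesis unfolding big_O_def by blast
qed

lemma big_O_0_const: "big_O 0 (\<lambda>eta. c)"
 unfolding big_O_def by (intro exI[of _ "norm c"]) simp

lemma big_O_zero: "big_O P (\<lambda>eta. 0)"
 unfolding big_O_def by (intro exI[of _ 0]) simp

lemma big_O_cmult: "big_O P f ==> big_O P (\<lambda>eta. c * f eta)"
 using big_O_mult[OF big_O_0_const, of P f c] by simp

lemma big_O_sum: "(!!i. i \<in> I ==> big_O P (f i)) ==> big_O P (\<lambda>eta. \<Sum>i\<in>I. f i eta)"
 by (induction I rule: infinite_finite_induct) (auto intro: big_O_zero big_O_add)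

lemma big_O_power: "big_O P f ==> big_O (P * n) (\<lambda>eta. f eta ^ n)"
proof (induction n)
 case (Suc n)
 then show ?case using big_O_mult[of P f "P * n" "\<lambda>eta. f eta ^ n"] by (simp add: add.commute)
qed (simp add: big_O_0_const)

lemma big_O_cong: "big_O P f ==> \<forall>\<^sub>F eta in nhds 0. f eta = g eta ==> big_O P g"
 unfolding big_O_def
proof (elim exE)
 fix C assume "\<forall>\<^sub>F eta in nhds 0. norm (f eta) <= C * norm eta ^ P" "\<forall>\<^sub>F eta in nhds 0. f eta = g eta"
 then have "\<forall>\<^sub>F eta in nhds 0. norm (g eta) <= C * norm eta ^ P" by eventually_elim simp
 then show "\<exists>C. \<forall>\<^sub>F eta in nhds 0. norm (g eta) <= C * norm eta ^ P" ..
qed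

text \<open>\<open>\<Sum>\<^sub>p c\<^sub>p\<close> is the Taylor series of \<open>f\<close> at \<open>0\<close>, where \<open>c\<^sub>p\<close> is of order \<open>p\<close>.\<close>
definition expands :: "('a::real_normed_vector => complex) => (nat => 'a => complex) => bool" where
 "expands f c \<longleftrightarrow> (\<forall>p. big_O p (c p)) \<and> (\<forall>P. big_O (Suc P) (\<lambda>eta. f eta - (\<Sum>p\<le>P. c p eta)))"

lemma expands_bounded: "expands f c ==> big_O 0 f"
proof -
 assume f: "expands f c"
 then have "big_O (Suc 0) (\<lambda>eta. f eta - (\<Sum>p\<le>0. c p eta))" "big_O 0 (c 0)"
  unfolding expands_def by blast+
 then have "big_O 0 (\<lambda>eta. (f eta - (\<Sum>p\<le>0. c p eta)) + c 0 eta)"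
  by (intro big_O_add) (auto intro: big_O_mono)
 then show ?thesis by simp
qed

lemma expands_const: "expands (\<lambda>eta. a) (\<lambda>p eta. if p = 0 then a else 0)"
 unfolding expands_def by (auto simp: big_O_0_const big_O_zero sum.delta)

lemma expands_cmult: "expands f c ==> expands (\<lambda>eta. a * f eta) (\<lambda>p eta. a * c p eta)"
 unfolding expands_def by (auto intro: big_O_cmult simp flip: sum_distrib_left right_diff_distrib)

lemma expands_add: "expands f c ==> expands g d ==> expands (\<lambda>eta. f eta + g eta) (\<lambda>p eta. c p eta + d p eta)"
 unfolding expands_def
 by (auto intro: big_O_add simp: sum.distrib add_diff_add)

lemma expands_zero: "expands (\<lambda>eta. 0) (\<lambda>p eta. 0)"
 unfolding expands_def by (auto simp: big_O_zero)

lemma expands_sum: "(!!i. i \<in> I ==> expands (f i) (c i)) ==> expands (\<lambda>eta. \<Sum>i\<in>I. f i eta) (\<lambda>p eta. \<Sum>i\<in>I. c i p eta)"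
 by (induction I rule: infinite_finite_induct) (auto intro: expands_zero expands_add)

text \<open>Cauchy product of truncated series. The error consists of the two truncation errors,
  each times a bounded factor, and of the finitely many products with i + j > P, each of order at
  least P + 1.\<close>

lemma expands_mult:
 assumes f: "expands f c" and g: "expands g e"
 shows "expands (\<lambda>eta. f eta * g eta) (\<lambda>p eta. \<Sum>i\<le>p. c i eta * e (p - i) eta)"
 unfolding expands_def
proof (intro conjI allI)
 have c: "big_O p (c p)" and e: "big_O p (e p)" for p using f g by (auto simp: expands_def)
 show "big_O p (\<lambda>eta. \<Sum>i\<le>p. c i eta * e (p - i) eta)" for p
 proof (rule big_O_sum)
  fix i assume "i \<in> {..p}"
  then show "big_O p (\<lambda>eta. c i eta * e (p - i) eta)" using big_O_mult[OF c[of i] e[of "p - i"]] by simp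
 qed
 fix P
 let ?F = "\<lambda>eta. \<Sum>p\<le>P. c p eta" and ?G = "\<lambda>eta. \<Sum>p\<le>P. e p eta"
 let ?H = "\<lambda>eta. \<Sum>(i, j)\<in>{..P} \<times> {..P} - {(i, j). i + j <= P}. c i eta * e j eta"
 have 1: "big_O (Suc P) (\<lambda>eta. f eta - ?F eta)" "big_O (Suc P) (\<lambda>eta. g eta - ?G eta)"
  using f g by (auto simp: expands_def)
 have 2: "big_O 0 ?F" by (intro big_O_sum) (auto intro: big_O_mono[OF c])
 have 3: "big_O (Suc P) ?H"
 proof (rule big_O_sum)
  fix ij assume "ij \<in> {..P} \<times> {..P} - {(i, j). i + j <= P}"
  then obtain i j where ij: "ij = (i, j)" "Suc P <= i + j" by (cases ij) auto
  show "big_O (Suc P) (\<lambda>eta. case ij of (i, j) => c i eta * e j eta)"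
   using big_O_mono[OF big_O_mult[OF c[of i] e[of j]] ij(2)] by (simp add: ij(1))
 qed
 have eq: "?F eta * ?G eta = (\<Sum>p\<le>P. \<Sum>i\<le>p. c i eta * e (p - i) eta) + ?H eta" for eta
 proof -
  have "?F eta * ?G eta = (\<Sum>(i, j)\<in>{..P} \<times> {..P}. c i eta * e j eta)"
   by (simp add: sum_product sum.cartesian_product)
  also have "... = (\<Sum>(i, j)\<in>{(i, j). i + j <= P}. c i eta * e j eta) + ?H eta"
   by (subst sum.subset_diff[of "{(i, j). i + j <= P}"]) (auto simp: add.commute)
  also have "(\<Sum>(i, j)\<in>{(i, j). i + j <= P}. c i eta * e j eta) = (\<Sum>p\<le>P. \<Sum>i\<le>p. c i eta * e (p - i) eta)"
   by (rule sum.triangle_reindex_eq)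
  finally show ?thesis .
 qed
 have "big_O (Suc P) (\<lambda>eta. (f eta - ?F eta) * g eta + ?F eta * (g eta - ?G eta) + ?H eta)"
  using big_O_mult[OF 1(1) expands_bounded[OF g]] big_O_mult[OF 2 1(2)] 3
  by (intro big_O_add) auto
 moreover have "(f eta - ?F eta) * g eta + ?F eta * (g eta - ?G eta) + ?H eta = f eta * g eta - (\<Sum>p\<le>P. \<Sum>i\<le>p. c i eta * e (p - i) eta)" for eta
  using eq[of eta] by (simp add: algebra_simps)
 ultimately show "big_O (Suc P) (\<lambda>eta. f eta * g eta - (\<Sum>p\<le>P. \<Sum>i\<le>p. c i eta * e (p - i) eta))"
  by simp
qed

subsection \<open>Compositions of integers\<close>

text \<open>The index sets of \<open>nu_tensor\<close>. Splitting off the first entry turns a sum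
  over them into an iterated Cauchy product; for this reason they describe both powers of a
  generating series and Taylor coefficients of products.\<close>

definition compositions :: "nat => nat => nat list set" where
 "compositions n b = {\<beta>. length \<beta> = n \<and> sum_list \<beta> = b}"

lemma finite_compositions: "finite (compositions n b)"
proof (rule finite_subset)
 show "compositions n b \<subseteq> {xs. set xs \<subseteq> {..b} \<and> length xs = n}"
  using member_le_sum_list by (fastforce simp: compositions_def)
qed (rule finite_lists_length_eq, simp)

lemma compositions_0: "compositions 0 b = (if b = 0 then {[]} else {})"
 by (auto simp: compositions_def)

lemma sum_compositions_Suc:
 fixes G :: "nat list => 'a::comm_monoid_add"
 shows "(\<Sum>\<beta>\<in>compositions (Suc n) b. G \<beta>) = (\<Sum>i\<le>b. \<Sum>\<beta>\<in>compositions n (b - i). G (i # \<beta>))"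
proof -
 have "(\<Sum>i\<le>b. \<Sum>\<beta>\<in>compositions n (b - i). G (i # \<beta>)) = (\<Sum>(i, \<beta>)\<in>(SIGMA i:{..b}. compositions n (b - i)). G (i # \<beta>))"
  by (rule sum.Sigma) (auto simp: finite_compositions)
 also have "... = (\<Sum>\<beta>\<in>compositions (Suc n) b. G \<beta>)"
  by (rule sum.reindex_bij_witness[of _ "\<lambda>\<beta>. (hd \<beta>, tl \<beta>)" "\<lambda>(i, \<beta>). i # \<beta>"])
    (auto simp: compositions_def length_Suc_conv)
 finally show ?thesis by simp
qed

lemma fps_power_compositions:
 "fps_nth (Abs_fps f ^ n) a = (\<Sum>\<alpha>\<in>compositions n a. \<Prod>j\<leftarrow>\<alpha>. (f j :: complex))"
proof (induction n arbitrary: a)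
 case (Suc n)
 show ?case unfolding power_Suc fps_mult_nth Suc sum_compositions_Suc
  by (simp add: sum_distrib_left atLeast0AtMost)
qed (simp add: compositions_0)

lemma expands_prod_list:
 fixes f :: "'i => 'a::real_normed_vector => complex"
 assumes "!!a. a \<in> set \<alpha> ==> expands (f a) (c a)"
 shows "expands (\<lambda>eta. \<Prod>a\<leftarrow>\<alpha>. f a eta) (\<lambda>b eta. \<Sum>\<beta>\<in>compositions (length \<alpha>) b. \<Prod>(a, b)\<leftarrow>zip \<alpha> \<beta>. c a b eta)"
 using assms
proof (induction \<alpha>)
 case Nil
 have "(\<lambda>b (eta::'a). \<Sum>\<beta>\<in>compositions (length ([]::'i list)) b. \<Prod>(a, b)\<leftarrow>zip [] \<beta>. c a b eta) = (\<lambda>b eta. if b = 0 then 1 else 0)"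
  by (auto simp: compositions_0 fun_eq_iff)
 then show ?case using expands_const[of 1] by simp
next
 case (Cons a \<alpha>)
 have "expands (\<lambda>eta. f a eta * (\<Prod>a\<leftarrow>\<alpha>. f a eta)) (\<lambda>p eta. \<Sum>i\<le>p. c a i eta * (\<Sum>\<beta>\<in>compositions (length \<alpha>) (p - i). \<Prod>(a, b)\<leftarrow>zip \<alpha> \<beta>. c a b eta))"
  using Cons by (intro expands_mult) auto
 then show ?case by (simp add: sum_compositions_Suc sum_distrib_left)
qed

subsection \<open>Contractions\<close>

lemma contr_0: "contr 0 T q = T []"
 by (simp add: contr_def)

lemma contr_Suc: "contr (Suc p) T q = (\<Sum>i\<in>UNIV. of_real (q $ i) * contr p (\<lambda>is. T (i # is)) q)"
proof -
 have "contr (Suc p) T q = (\<Sum>(i, is)\<in>UNIV \<times> {is. length is = p}. T (i # is) * (\<Prod>i\<leftarrow>i # is. of_real (q $ i)))"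
  unfolding contr_def
  by (rule sum.reindex_bij_witness[of _ "\<lambda>(i, is). i # is" "\<lambda>\<beta>. (hd \<beta>, tl \<beta>)"]) (auto simp: length_Suc_conv)
 also have "... = (\<Sum>i\<in>UNIV. \<Sum>is\<in>{is. length is = p}. T (i # is) * (\<Prod>i\<leftarrow>i # is. of_real (q $ i)))"
  by (simp add: sum.cartesian_product)
 finally show ?thesis by (simp add: contr_def sum_distrib_left mult_ac)
qed

lemma contr_cmult: "contr p (\<lambda>is. c * T is) q = c * contr p T q"
 by (simp add: contr_def sum_distrib_left mult.assoc)

text \<open>Contracting every slot with the same vector turns tensors into homogeneous polynomials
  and tensor products into products. From here on all tensor identities are identities of
  polynomials, and the order of the slots becomes irrelevant.\<close>

lemma contr_tensor_prod: "contr (r + p) (tensor_prod r S T) q = contr r S q * contr p T q"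
proof (induction r arbitrary: S)
 case (Suc r)
 have "tensor_prod (Suc r) S T (i # is) = tensor_prod r (\<lambda>is. S (i # is)) T is" for i "is"
  by (simp add: tensor_prod_def)
 then have "(\<lambda>is. tensor_prod (Suc r) S T (i # is)) = tensor_prod r (\<lambda>is. S (i # is)) T" for i
  by (rule ext)
 then show ?case by (simp add: contr_Suc Suc sum_distrib_left sum_distrib_right mult.assoc)
qed (simp add: contr_0 tensor_prod_def[abs_def] contr_cmult)

lemma contr_vec_tensor_power: "contr l (vec_tensor_power v) q = of_real ((v \<bullet> q) ^ l)"
proof (induction l)
 case 0 then show ?case by (simp add: contr_0 vec_tensor_power_def)
next
 case (Suc l)
 have "(\<lambda>is. vec_tensor_power v (i # is)) = (\<lambda>is. of_real (v $ i) * vec_tensor_power v is)" for i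
  by (simp add: vec_tensor_power_def fun_eq_iff)
 then have "contr (Suc l) (vec_tensor_power v) q = (\<Sum>i\<in>UNIV. of_real (q $ i * v $ i) * contr l (vec_tensor_power v) q)"
  by (simp add: contr_Suc contr_def[of l] sum_distrib_left mult_ac)
 also have "... = of_real (v \<bullet> q) * contr l (vec_tensor_power v) q"
 proof -
  have "(\<Sum>i\<in>UNIV. complex_of_real (q $ i * v $ i)) = of_real (v \<bullet> q)"
   by (simp add: inner_vec_def mult.commute)
  then show ?thesis unfolding sum_distrib_right[symmetric] by simp
 qed
 finally show ?case by (simp add: Suc)
qed

lemma contr_id_tensor_power: "contr (2 * j) id_tensor_power q = of_real ((q \<bullet> q) ^ j)"
proof (induction j)
 case 0 then show ?case by (simp add: contr_0)
next
 case (Suc j)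
 have *: "contr p (\<lambda>is. if i = i' then id_tensor_power is else 0) q = (if i = i' then 1 else 0) * contr p id_tensor_power q" for p i i'
  by (simp add: contr_def)
 have "contr (2 * Suc j) id_tensor_power q = (\<Sum>i\<in>UNIV. of_real (q $ i * q $ i) * contr (2 * j) id_tensor_power q)"
  by (simp add: contr_Suc * if_distrib[of "\<lambda>x. x * _"] if_distrib[of "\<lambda>x. _ * x"] mult.assoc[symmetric] cong: if_cong)
 also have "... = of_real (q \<bullet> q) * contr (2 * j) id_tensor_power q"
  unfolding sum_distrib_right[symmetric] by (simp add: inner_vec_def)
 finally show ?case by (simp add: Suc)
qed

lemma contr_sum: "contr p (\<lambda>is. \<Sum>i\<in>I. T i is) q = (\<Sum>i\<in>I. contr p (T i) q)"
 unfolding contr_def sum_distrib_right by (rule sum.swap)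

lemma norm_prod_list_le:
 "norm (\<Prod>i\<leftarrow>is. complex_of_real (q $ i)) <= norm q ^ length is"
 by (induction "is") (auto simp: norm_mult intro!: mult_mono component_le_norm_cart)

lemma norm_contr_le:
 assumes "!!is. length is = p ==> norm (T is) <= B is"
 shows "norm (contr p T q) <= (\<Sum>is\<in>{is. length is = p}. B is) * norm q ^ p"
 unfolding contr_def sum_distrib_right
proof (rule order_trans[OF norm_sum sum_mono])
 fix "is" :: "'a list" assume "is \<in> {is. length is = p}"
 then show "norm (T is * (\<Prod>i\<leftarrow>is. of_real (q $ i))) <= B is * norm q ^ p"
  using assms[of "is"] norm_prod_list_le[of q "is"]
  by (auto simp: norm_mult intro!: mult_mono order_trans[OF norm_ge_zero])
qed

lemma big_O_contr: "big_O p (contr p T)"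
 unfolding big_O_def
 by (rule exI[of _ "\<Sum>is\<in>{is. length is = p}. norm (T is)"]) (intro always_eventually allI norm_contr_le order_refl)

lemma contr_continuous: "continuous_on S (contr p T)"
 unfolding contr_def[abs_def]
proof (intro continuous_intros)
 fix "is" :: "'a list"
 show "continuous_on S (\<lambda>x. \<Prod>i\<leftarrow>is. complex_of_real (x $ i))"
  by (induction "is") (auto intro!: continuous_intros)
qed

subsection \<open>Taylor expansions\<close>

definition smooth_on :: "(real^'d::finite) set => (real^'d => complex) => bool" where
 "smooth_on U f \<longleftrightarrow> (\<forall>is. \<forall>x\<in>U. partials is f differentiable (at x))"

text \<open>One-dimensional Taylor formula with integral remainder along the segment from k to k +
  eta. The m-th derivative of s \<mapsto> f(k + s eta) is the m-th derivative tensor contracted with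
  eta, so the remainder inherits the factor |eta|^(P + 1).\<close>

lemma expands_Taylor:
 fixes f :: "real^'d::finite => complex"
 assumes delta: "delta > 0" and f: "smooth_on (ball k delta) f"
 shows "expands (\<lambda>eta. f (k + eta)) (\<lambda>p eta. of_real (1 / fact p) * contr p (\<lambda>is. partials is f k) eta)"
 unfolding expands_def
proof (intro conjI allI)
 show "big_O p (\<lambda>eta. of_real (1 / fact p) * contr p (\<lambda>is. partials is f k) eta)" for p
  by (intro big_O_cmult big_O_contr)
 fix P
 have der: "(partials is f has_derivative (\<lambda>h. \<Sum>i\<in>UNIV. h $ i *\<^sub>R partials (i # is) f x)) (at x)" if "x \<in> ball k delta" for "is" x
  using differentiable_has_partials[of "partials is f" x] f that by (simp add: smooth_on_def)
 have "\<exists>B. \<forall>x\<in>cball k (delta / 2). norm (partials is f x) <= B" for "is"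
 proof -
  have "continuous_on (cball k (delta / 2)) (partials is f)"
   using delta by (intro continuous_at_imp_continuous_on ballI has_derivative_continuous[OF der]) auto
  then have "bounded (partials is f ` cball k (delta / 2))"
   by (intro compact_imp_bounded compact_continuous_image) auto
  then show ?thesis unfolding bounded_iff by auto
 qed
 then obtain B where B: "!!is x. x \<in> cball k (delta / 2) ==> norm (partials is f x) <= B is" by metis
 define M where "M = (\<Sum>is\<in>{is. length is = Suc P}. B is)"
 have main: "norm (f (k + eta) - (\<Sum>p\<le>P. of_real (1 / fact p) * contr p (\<lambda>is. partials is f k) eta)) <= M * norm eta ^ Suc P"
  if eta: "norm eta <= delta / 2" for eta
 proof -
  have in_cball: "k + s *\<^sub>R eta \<in> cball k (delta / 2)" if "s \<in> {0..1}" for s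
   using mult_right_mono[of s 1 "norm eta"] that eta by (simp add: dist_norm)
  have in_ball: "k + s *\<^sub>R eta \<in> ball k delta" if "s \<in> {0..1}" for s
   using in_cball[OF that] delta by auto
  define Df where "Df m s = contr m (\<lambda>is. partials is f (k + s *\<^sub>R eta)) eta" for m s
  have Df: "(Df m has_vector_derivative Df (Suc m) s) (at s within {0..1})" if s: "0 <= s" "s <= 1" for m s
  proof -
   have d: "((\<lambda>s. partials is f (k + s *\<^sub>R eta)) has_derivative (\<lambda>v. \<Sum>i\<in>UNIV. (v *\<^sub>R eta) $ i *\<^sub>R partials (i # is) f (k + s *\<^sub>R eta))) (at s within {0..1})" for "is"
   proof -
    have "((\<lambda>s. k + s *\<^sub>R eta) has_derivative (\<lambda>v. v *\<^sub>R eta)) (at s within {0..1})"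
     by (auto intro!: derivative_eq_intros)
    from has_derivative_compose[OF this der] in_ball[of s] s show ?thesis by auto
   qed
   have "(Df m has_derivative (\<lambda>v. \<Sum>is\<in>{is. length is = m}. (\<Sum>i\<in>UNIV. (v *\<^sub>R eta) $ i *\<^sub>R partials (i # is) f (k + s *\<^sub>R eta)) * (\<Prod>i\<leftarrow>is. of_real (eta $ i)))) (at s within {0..1})"
    unfolding Df_def contr_def by (intro has_derivative_sum has_derivative_mult_left d)
   also have "(\<lambda>v. \<Sum>is\<in>{is. length is = m}. (\<Sum>i\<in>UNIV. (v *\<^sub>R eta) $ i *\<^sub>R partials (i # is) f (k + s *\<^sub>R eta)) * (\<Prod>i\<leftarrow>is. of_real (eta $ i)))
    = (\<lambda>v. v *\<^sub>R Df (Suc m) s)"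
   proof (rule ext)
    fix v
    have "(\<Sum>is\<in>{is. length is = m}. (\<Sum>i\<in>UNIV. (v *\<^sub>R eta) $ i *\<^sub>R partials (i # is) f (k + s *\<^sub>R eta)) * (\<Prod>i\<leftarrow>is. of_real (eta $ i)))
     = (\<Sum>is\<in>{is. length is = m}. \<Sum>i\<in>UNIV. of_real v * (of_real (eta $ i) * (partials (i # is) f (k + s *\<^sub>R eta) * (\<Prod>i\<leftarrow>is. of_real (eta $ i)))))"
     unfolding sum_distrib_right by (intro sum.cong refl) (simp add: scaleR_conv_of_real[where 'a=complex])
    also have "... = (\<Sum>i\<in>UNIV. \<Sum>is\<in>{is. length is = m}. of_real v * (of_real (eta $ i) * (partials (i # is) f (k + s *\<^sub>R eta) * (\<Prod>i\<leftarrow>is. of_real (eta $ i)))))"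
     by (rule sum.swap)
    also have "... = v *\<^sub>R Df (Suc m) s"
     by (simp add: Df_def contr_Suc contr_def[of m] sum_distrib_left scaleR_conv_of_real)
    finally show "(\<Sum>is\<in>{is. length is = m}. (\<Sum>i\<in>UNIV. (v *\<^sub>R eta) $ i *\<^sub>R partials (i # is) f (k + s *\<^sub>R eta)) * (\<Prod>i\<leftarrow>is. of_real (eta $ i))) = v *\<^sub>R Df (Suc m) s" .
   qed
   finally show ?thesis by (simp add: has_vector_derivative_def)
  qed
  have "((\<lambda>x. ((1 - x) ^ (Suc P - 1) / fact (Suc P - 1)) *\<^sub>R Df (Suc P) x) has_integral
    Df 0 1 - (\<Sum>i<Suc P. ((1 - 0) ^ i / fact i) *\<^sub>R Df i 0)) {0..1}"
   by (rule Taylor_has_integral) (use Df in auto)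
  then have hi: "((\<lambda>x. ((1 - x) ^ P / fact P) *\<^sub>R Df (Suc P) x) has_integral
    f (k + eta) - (\<Sum>p\<le>P. of_real (1 / fact p) * contr p (\<lambda>is. partials is f k) eta)) (cbox 0 1)"
   by (simp add: Df_def contr_0 scaleR_conv_of_real lessThan_Suc_atMost)
  have bd: "norm (((1 - x) ^ P / fact P) *\<^sub>R Df (Suc P) x) <= M * norm eta ^ Suc P" if x: "x \<in> {0..1}" for x
  proof -
   have "norm (Df (Suc P) x) <= M * norm eta ^ Suc P"
    unfolding Df_def M_def by (rule norm_contr_le) (rule B[OF in_cball[OF x]])
   moreover have "(1 - x) ^ P / fact P <= 1" "(1 - x) ^ P / fact P >= 0"
    using x by (auto simp: divide_le_eq_1 intro!: order_trans[OF power_le_one fact_ge_1])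
   ultimately have "\<bar>(1 - x) ^ P / fact P\<bar> * norm (Df (Suc P) x) <= 1 * (M * norm eta ^ Suc P)"
    by (intro mult_mono) (simp_all only: abs_of_nonneg norm_ge_zero zero_le_one)
   then show ?thesis by (simp only: norm_scaleR real_norm_def mult_1)
  qed
  have "M * norm eta ^ Suc P >= 0" by (rule order_trans[OF norm_ge_zero bd[of 0]]) simp
  from has_integral_bound[OF this hi] bd show ?thesis by simp
 qed
 have "\<forall>\<^sub>F eta in nhds (0::real^'d). eta \<in> ball 0 (delta / 2)"
  using delta by (intro eventually_nhds_in_open) auto
 then have "\<forall>\<^sub>F eta in nhds 0. norm (f (k + eta) - (\<Sum>p\<le>P. of_real (1 / fact p) * contr p (\<lambda>is. partials is f k) eta)) <= M * norm eta ^ Suc P"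
  by eventually_elim (rule main, simp)
 then show "big_O (Suc P) (\<lambda>eta. f (k + eta) - (\<Sum>p\<le>P. of_real (1 / fact p) * contr p (\<lambda>is. partials is f k) eta))"
  unfolding big_O_def ..
qed

text \<open>Taylor's formula in s on [0, 1] for (1 + s x)^a; this treats both signs of x at once and
  produces the factor x^(P + 1) explicitly.\<close>

lemma powr_binomial_remainder:
 fixes a :: real
 shows "big_O (Suc P) (\<lambda>x::real. (1 + x) powr a - (\<Sum>s\<le>P. (a gchoose s) * x ^ s))"
proof -
 define c where "c m = fact m * (a gchoose m)" for m
 have cS: "c (Suc m) = c m * (a - real m)" for m
 proof -
  have "real (Suc m) * (a gchoose Suc m) = (a - real m) * (a gchoose m)"
   using gbinomial_mult_1[of a m] by (simp add: algebra_simps)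
  then show ?thesis unfolding c_def fact_Suc by (simp only: mult_ac of_nat_fact of_nat_mult)
 qed
 define b where "b = a - real (Suc P)"
 \<comment> \<open>For |x| at most 1/2 the base 1 + s x lies in [1/2, 3/2]. The exponent
   \<open>b\<close> may have either sign, so the sum of the powers at both ends bounds the power in
   between.\<close>
 define M where "M = \<bar>c (Suc P)\<bar> * ((1/2) powr b + (3/2) powr b)"
 have main: "\<bar>(1 + x) powr a - (\<Sum>s\<le>P. (a gchoose s) * x ^ s)\<bar> <= M * \<bar>x\<bar> ^ Suc P" if x: "\<bar>x\<bar> <= 1/2" for x
 proof -
  have pos: "1 + s * x >= 1/2" "1 + s * x <= 3/2" if "s \<in> {0..1}" for s
  proof -
   have "\<bar>s * x\<bar> <= 1 * (1/2)" unfolding abs_mult using that x by (intro mult_mono) auto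
   then show "1 + s * x >= 1/2" "1 + s * x <= 3/2" by (auto simp: abs_le_iff)
  qed
  define Df where "Df m s = c m * (1 + s * x) powr (a - real m) * x ^ m" for m s
  have Df: "(Df m has_vector_derivative Df (Suc m) s) (at s within {0..1})" if s: "0 <= s" "s <= 1" for m s
  proof -
   have "1 + s * x > 0" using pos[of s] s by auto
   then have "(Df m has_real_derivative c m * ((a - real m) * (1 + s * x) powr (a - real m - 1) * x) * x ^ m) (at s within {0..1})"
    unfolding Df_def by (auto intro!: derivative_eq_intros)
   then show ?thesis
    by (simp add: has_real_derivative_iff_has_vector_derivative Df_def cS algebra_simps)
  qed
  have "((\<lambda>y. ((1 - y) ^ (Suc P - 1) / fact (Suc P - 1)) *\<^sub>R Df (Suc P) y) has_integral
    Df 0 1 - (\<Sum>i<Suc P. ((1 - 0) ^ i / fact i) *\<^sub>R Df i 0)) {0..1}"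
   by (rule Taylor_has_integral) (use Df in auto)
  then have hi: "((\<lambda>y. ((1 - y) ^ P / fact P) *\<^sub>R Df (Suc P) y) has_integral
    (1 + x) powr a - (\<Sum>s\<le>P. (a gchoose s) * x ^ s)) (cbox 0 1)"
   by (simp add: Df_def c_def lessThan_Suc_atMost)
  have bd: "norm (((1 - y) ^ P / fact P) *\<^sub>R Df (Suc P) y) <= M * \<bar>x\<bar> ^ Suc P" if y: "y \<in> {0..1}" for y
  proof -
   have "(1 + y * x) powr b <= (1/2) powr b + (3/2) powr b"
   proof (cases "b >= 0")
    case True
    then have "(1 + y * x) powr b <= (3/2) powr b" using pos[OF y] by (intro powr_mono2) auto
    then show ?thesis using powr_ge_zero[of "1/2" b] by linarith
   next
    case False
    then have "(1 + y * x) powr b <= (1/2) powr b" using pos[OF y] by (intro powr_mono2') auto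
    then show ?thesis using powr_ge_zero[of "3/2" b] by linarith
   qed
   then have "norm (Df (Suc P) y) <= M * \<bar>x\<bar> ^ Suc P"
    unfolding Df_def M_def b_def[symmetric]
    by (auto simp: abs_mult power_abs intro!: mult_mono mult_nonneg_nonneg)
   moreover have "(1 - y) ^ P / fact P <= 1" "(1 - y) ^ P / fact P >= 0"
    using y by (auto simp: divide_le_eq_1 intro!: order_trans[OF power_le_one fact_ge_1])
   ultimately have "\<bar>(1 - y) ^ P / fact P\<bar> * norm (Df (Suc P) y) <= 1 * (M * \<bar>x\<bar> ^ Suc P)"
    by (intro mult_mono) (simp_all only: abs_of_nonneg norm_ge_zero zero_le_one)
   then show ?thesis by (simp only: real_scaleR_def abs_mult real_norm_def mult_1)
  qed
  have "M * \<bar>x\<bar> ^ Suc P >= 0" by (rule order_trans[OF norm_ge_zero bd[of 0]]) simp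
  from has_integral_bound[OF this hi] bd show ?thesis by simp
 qed
 have "\<forall>\<^sub>F x in nhds (0::real). x \<in> ball 0 (1/2)"
  by (intro eventually_nhds_in_open) auto
 then have "\<forall>\<^sub>F x in nhds 0. norm ((1 + x) powr a - (\<Sum>s\<le>P. (a gchoose s) * x ^ s)) <= M * norm x ^ Suc P"
  by eventually_elim (use main in auto)
 then show ?thesis unfolding big_O_def ..
qed

lemma big_O_compose:
 fixes g :: "real => real" and h :: "'a::real_normed_vector => real"
 assumes g: "big_O P g" and h: "big_O 1 h"
 shows "big_O P (\<lambda>eta. g (h eta))"
proof -
 obtain C D where C: "\<forall>\<^sub>F x in nhds 0. norm (g x) <= C * norm x ^ P" and D: "\<forall>\<^sub>F eta in nhds 0. norm (h eta) <= D * norm eta ^ 1"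
  using g h unfolding big_O_def by blast
 have "((\<lambda>eta. D * norm eta) \<longlongrightarrow> D * norm (0::'a)) (nhds 0)"
  by (simp add: tendsto_nhds_iff) (auto intro!: tendsto_eq_intros)
 then have "(h \<longlongrightarrow> 0) (nhds 0)"
  using D by (intro Lim_null_comparison[of h "\<lambda>eta. D * norm eta"]) auto
 then have "\<forall>\<^sub>F eta in nhds 0. norm (g (h eta)) <= C * norm (h eta) ^ P"
  by (rule eventually_compose_filterlim[OF C])
 with D have "\<forall>\<^sub>F eta in nhds 0. norm (g (h eta)) <= \<bar>C\<bar> * \<bar>D\<bar> ^ P * norm eta ^ P"
 proof eventually_elim
  case (elim eta)
  have "norm (h eta) <= \<bar>D\<bar> * norm eta"
   using elim(1) by (auto intro: order_trans[OF _ mult_right_mono])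
  then have "C * norm (h eta) ^ P <= \<bar>C\<bar> * (\<bar>D\<bar> * norm eta) ^ P"
   by (intro mult_mono power_mono) auto
  then show ?case using elim(2) by (simp add: power_mult_distrib mult.assoc)
 qed
 then show ?thesis unfolding big_O_def ..
qed

lemma big_O_of_real:
 fixes f :: "'a::real_normed_vector => real"
 shows "big_O P (\<lambda>eta. complex_of_real (f eta)) \<longleftrightarrow> big_O P f"
 by (simp add: big_O_def)

section \<open>Powers of the modulus, the square root series and the tensors C\<close>

definition radial_indices :: "nat => (nat \<times> nat) set" where
 "radial_indices r = {(l, s). l <= s \<and> 2 * s - l = r}"

definition radial_coeff :: "nat => nat => nat => real" where
 "radial_coeff n l s = (-1) ^ s * (\<Prod>j<s. 2 * real n - 1 + 2 * real j) / (2 ^ (s - l) * fact l * fact (s - l))"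

text \<open>Decodes the coefficient of the radial tensor: the s-th coefficient of the binomial
  series with exponent 1/2 - n, times the coefficient of X^l Y^(s - l) in (X + Y)^s, times the 2^l
  contained in X = 2 (k/|k|) . eta / |k|.\<close>

lemma radial_coeff_gbinomial:
 assumes "l <= s"
 shows "radial_coeff n l s = ((1/2 - real n) gchoose s) * real (s choose l) * 2 ^ l"
proof -
 have "(\<Prod>j<s. 1/2 - real n - real j) = (\<Prod>j<s. (-1/2) * (2 * real n - 1 + 2 * real j))"
  by (intro prod.cong) (auto simp: field_simps)
 also have "... = (-1/2) ^ s * (\<Prod>j<s. 2 * real n - 1 + 2 * real j)"
  by (simp only: prod.distrib prod_constant card_lessThan)
 finally have A: "(1/2 - real n) gchoose s = (-1/2) ^ s * (\<Prod>j<s. 2 * real n - 1 + 2 * real j) / fact s"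
  by (simp add: gbinomial_prod_rev atLeast0LessThan)
 have B: "real (s choose l) = fact s / (fact l * fact (s - l))"
  using assms by (rule binomial_fact)
 have C: "(-1/2::real) ^ s * 2 ^ l = (-1) ^ s / 2 ^ (s - l)"
 proof -
  have "(2::real) ^ s = 2 ^ l * 2 ^ (s - l)" using assms by (simp flip: power_add)
  then show ?thesis unfolding power_divide[of "-1" 2 s] by simp
 qed
 have "((1/2 - real n) gchoose s) * real (s choose l) * 2 ^ l
   = ((-1/2) ^ s * 2 ^ l) * (\<Prod>j<s. 2 * real n - 1 + 2 * real j) / (fact l * fact (s - l))"
  unfolding A B by simp
 then show ?thesis
  unfolding C radial_coeff_def by simp
qed

lemma contr_radial_tensor:
 "contr r (radial_tensor k n r) eta = (\<Sum>(l, s)\<in>radial_indices r. of_real (radial_coeff n l s * ((k /\<^sub>R norm k) \<bullet> eta) ^ l * (eta \<bullet> eta) ^ (s - l)))"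
proof -
 have "contr r (radial_tensor k n r) eta = (\<Sum>x\<in>radial_indices r. contr r (\<lambda>is. case x of (l, s) => of_real (radial_coeff n l s) * tensor_prod l (vec_tensor_power (k /\<^sub>R norm k)) id_tensor_power is) eta)"
  unfolding radial_tensor_def[abs_def] contr_sum[symmetric] radial_indices_def radial_coeff_def
  by (simp add: case_prod_beta)
 also have "... = (\<Sum>(l, s)\<in>radial_indices r. of_real (radial_coeff n l s * ((k /\<^sub>R norm k) \<bullet> eta) ^ l * (eta \<bullet> eta) ^ (s - l)))"
 proof (intro sum.cong refl, clarify)
  fix l s assume "(l, s) \<in> radial_indices r"
  then have r: "r = l + 2 * (s - l)" by (auto simp: radial_indices_def)
  show "contr r (\<lambda>is. of_real (radial_coeff n l s) * tensor_prod l (vec_tensor_power (k /\<^sub>R norm k)) id_tensor_power is) eta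
   = of_real (radial_coeff n l s * ((k /\<^sub>R norm k) \<bullet> eta) ^ l * (eta \<bullet> eta) ^ (s - l))"
   unfolding r contr_cmult contr_tensor_prod contr_vec_tensor_power contr_id_tensor_power by simp
 qed
 finally show ?thesis .
qed

lemma finite_radial_indices: "finite (radial_indices r)"
 by (rule finite_subset[of _ "{..r} \<times> {..r}"]) (auto simp: radial_indices_def)

text \<open>With X = 2 (e . eta) / |k| and Y = |eta|^2 / |k|^2 one has |k + eta|^2 = |k|^2 (1 + X +
  Y), hence |k + eta|^(1 - 2 n) = |k|^(1 - 2 n) (1 + X + Y)^(1/2 - n). In the binomial series the
  term X^l Y^(s - l) has degree 2 s - l, which explains the condition 2 s - l = r on the
  indices.\<close>

lemma expands_radial:
 fixes k :: "real^'d::finite"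
 assumes k: "k ~= 0"
 shows "expands (\<lambda>eta. of_real (norm (k + eta) powi (1 - 2 * int n)))
  (\<lambda>r eta. of_real (norm k powi (1 - 2 * int n - int r)) * contr r (radial_tensor k n r) eta)"
 unfolding expands_def
proof (intro conjI allI)
 show "big_O r (\<lambda>eta. of_real (norm k powi (1 - 2 * int n - int r)) * contr r (radial_tensor k n r) eta)" for r
  by (intro big_O_cmult big_O_contr)
 fix P
 define e where "e = k /\<^sub>R norm k"
 define a where "a = 1/2 - real n"
 define X where "X eta = 2 * (e \<bullet> eta) / norm k" for eta
 define Y where "Y eta = (eta \<bullet> eta) / (norm k)^2" for eta :: "real^'d"
 define T where "T l s eta = (a gchoose s) * real (s choose l) * X eta ^ l * Y eta ^ (s - l)" for l s eta
 have nk: "norm k > 0" using k by simp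
 have oX: "big_O 1 X"
 proof -
  have "norm (X eta) <= 2 / norm k * norm e * norm eta ^ 1" for eta
   using Cauchy_Schwarz_ineq2[of e eta] nk by (simp add: X_def abs_mult field_simps)
  then show ?thesis unfolding big_O_def by (intro exI always_eventually allI)
 qed
 have oY: "big_O 2 Y"
  unfolding big_O_def Y_def
  by (intro exI[of _ "1 / (norm k)^2"] always_eventually allI) (simp add: power2_norm_eq_inner)
 have oZ: "big_O 1 (\<lambda>eta. X eta + Y eta)"
  by (intro big_O_add oX big_O_mono[OF oY]) auto
 have oT: "big_O (2 * s - l) (T l s)" if "l <= s" for l s
 proof -
  have "2 * s - l = 0 + 1 * l + 2 * (s - l)" using that by simp
  then show ?thesis unfolding T_def
   by (simp only:) (intro big_O_mult big_O_power oX oY big_O_0_const)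
 qed
 have "big_O (Suc P) (\<lambda>eta. (1 + (X eta + Y eta)) powr a - (\<Sum>s\<le>P. (a gchoose s) * (X eta + Y eta) ^ s))"
  by (rule big_O_compose[OF powr_binomial_remainder oZ])
 moreover have "(a gchoose s) * (X eta + Y eta) ^ s = (\<Sum>l\<le>s. T l s eta)" for s eta
  by (simp add: T_def binomial_ring sum_distrib_left mult_ac)
 ultimately have 1: "big_O (Suc P) (\<lambda>eta. (1 + (X eta + Y eta)) powr a - (\<Sum>s\<le>P. \<Sum>l\<le>s. T l s eta))" by simp
 \<comment> \<open>The binomial series truncated at s = P is indexed by \<open>I\<close>, the terms
   of degree at most P in eta by \<open>J\<close>. Since l \<le> s, degree at most P implies s \<le>
   P, so \<open>J\<close> lies in \<open>I\<close>; the surplus is of order P + 1.\<close>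
 define I where "I = (SIGMA s:{..P}. {..s})"
 define J where "J = {(s, l). l <= s \<and> 2 * s - l <= P}"
 have JI: "J \<subseteq> I" "finite I" by (auto simp: I_def J_def)
 have 2: "big_O (Suc P) (\<lambda>eta. \<Sum>(s, l)\<in>I - J. T l s eta)"
 proof (rule big_O_sum)
  fix x assume "x \<in> I - J"
  then obtain s l where sl: "x = (s, l)" "l <= s" "\<not> 2 * s - l <= P" by (cases x) (auto simp: I_def J_def)
  then have "Suc P <= 2 * s - l" by linarith
  then show "big_O (Suc P) (\<lambda>eta. case x of (s, l) => T l s eta)"
   using big_O_mono[OF oT[OF sl(2)]] by (simp add: sl(1))
 qed
 have sumI: "(\<Sum>s\<le>P. \<Sum>l\<le>s. T l s eta) = (\<Sum>(s, l)\<in>J. T l s eta) + (\<Sum>(s, l)\<in>I - J. T l s eta)" for eta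
 proof -
  have "(\<Sum>s\<le>P. \<Sum>l\<le>s. T l s eta) = (\<Sum>(s, l)\<in>I. T l s eta)"
   unfolding I_def by (rule sum.Sigma) auto
  then show ?thesis using sum.subset_diff[OF JI, of "\<lambda>(s, l). T l s eta"] by (simp add: add.commute)
 qed
 have sumJ: "(\<Sum>(s, l)\<in>J. T l s eta) = (\<Sum>r\<le>P. \<Sum>(l, s)\<in>radial_indices r. T l s eta)" for eta
 proof -
  have "(\<Sum>r\<le>P. \<Sum>(l, s)\<in>radial_indices r. T l s eta) = (\<Sum>(r, x)\<in>(SIGMA r:{..P}. radial_indices r). case x of (l, s) => T l s eta)"
   by (rule sum.Sigma) (auto simp: finite_radial_indices)
  also have "... = (\<Sum>(s, l)\<in>J. T l s eta)"
   by (rule sum.reindex_bij_witness[of _ "\<lambda>(s, l). (2 * s - l, l, s)" "\<lambda>(r, l, s). (s, l)"])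
    (auto simp: J_def radial_indices_def)
  finally show ?thesis by simp
 qed
 have "big_O (Suc P) (\<lambda>eta. ((1 + (X eta + Y eta)) powr a - (\<Sum>s\<le>P. \<Sum>l\<le>s. T l s eta)) + (\<Sum>(s, l)\<in>I - J. T l s eta))"
  by (rule big_O_add[OF 1 2])
 moreover define S where "S r eta = (\<Sum>(l, s)\<in>radial_indices r. T l s eta)" for r eta
 ultimately have "big_O (Suc P) (\<lambda>eta. norm k powi (1 - 2 * int n) * ((1 + (X eta + Y eta)) powr a - (\<Sum>r\<le>P. S r eta)))"
  by (intro big_O_cmult) (simp add: sumI sumJ S_def)
 then have "big_O (Suc P) (\<lambda>eta. complex_of_real (norm k powi (1 - 2 * int n) * (1 + (X eta + Y eta)) powr a)
   - (\<Sum>r\<le>P. complex_of_real (norm k powi (1 - 2 * int n) * S r eta)))"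
  by (subst (asm) big_O_of_real[symmetric]) (simp add: right_diff_distrib sum_distrib_left)
 moreover have "of_real (norm k powi (1 - 2 * int n) * S r eta) =
   of_real (norm k powi (1 - 2 * int n - int r)) * contr r (radial_tensor k n r) eta" for r eta
 proof -
  have "norm k powi (1 - 2 * int n) * T l s eta = norm k powi (1 - 2 * int n - int r) * (radial_coeff n l s * (e \<bullet> eta) ^ l * (eta \<bullet> eta) ^ (s - l))"
   if "(l, s) \<in> radial_indices r" for l s
  proof -
   have ls: "l <= s" and r: "r = l + 2 * (s - l)" using that by (auto simp: radial_indices_def)
   have "T l s eta = radial_coeff n l s * (e \<bullet> eta) ^ l * (eta \<bullet> eta) ^ (s - l) / norm k ^ r"
    unfolding T_def X_def Y_def radial_coeff_gbinomial[OF ls] a_def r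
    by (simp add: power_divide power_mult_distrib power_add power_mult)
   moreover have "norm k powi (1 - 2 * int n - int r) = norm k powi (1 - 2 * int n) / norm k ^ r"
    using k by (simp add: power_int_diff)
   ultimately show ?thesis by simp
  qed
  then have "norm k powi (1 - 2 * int n) * (\<Sum>(l, s)\<in>radial_indices r. T l s eta) =
    norm k powi (1 - 2 * int n - int r) * (\<Sum>(l, s)\<in>radial_indices r. radial_coeff n l s * (e \<bullet> eta) ^ l * (eta \<bullet> eta) ^ (s - l))"
   unfolding sum_distrib_left by (intro sum.cong) auto
  then show ?thesis
   unfolding contr_radial_tensor e_def[symmetric] S_def by (simp only: of_real_mult of_real_sum case_prod_unfold)
 qed
 ultimately have 3: "big_O (Suc P) (\<lambda>eta. complex_of_real (norm k powi (1 - 2 * int n) * (1 + (X eta + Y eta)) powr a)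
   - (\<Sum>r\<le>P. complex_of_real (norm k powi (1 - 2 * int n - int r)) * contr r (radial_tensor k n r) eta))"
  by simp
 have "\<forall>\<^sub>F eta in nhds (0::real^'d). eta \<in> ball 0 (norm k)"
  using nk by (intro eventually_nhds_in_open) auto
 then have "\<forall>\<^sub>F eta in nhds 0. norm k powi (1 - 2 * int n) * (1 + (X eta + Y eta)) powr a = norm (k + eta) powi (1 - 2 * int n)"
 proof eventually_elim
  case (elim eta)
  then have "k + eta ~= 0" by (metis add.commute add_eq_0_iff mem_ball_0 norm_minus_cancel order_less_irrefl)
  then have p: "norm (k + eta) > 0" by simp
  have "(norm (k + eta))\<^sup>2 = (norm k)^2 * (1 + (X eta + Y eta))"
  proof -
   have "X eta = 2 * (k \<bullet> eta) / (norm k)^2"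
    using k by (simp add: X_def e_def power2_eq_square field_simps)
   then have "(norm k)\<^sup>2 * (1 + (X eta + Y eta)) = (norm k)^2 + (2 * (k \<bullet> eta) + eta \<bullet> eta)"
    using nk by (simp add: Y_def distrib_left)
   then show ?thesis
    unfolding power2_norm_eq_inner by (simp add: inner_add_left inner_add_right inner_commute)
  qed
  then have q: "1 + (X eta + Y eta) = (norm (k + eta) / norm k)^2"
   using nk by (simp add: power_divide field_simps)
  have "(1 + (X eta + Y eta)) powr a = (norm (k + eta) / norm k) powr (real_of_int (1 - 2 * int n))"
   unfolding q using p nk by (simp add: powr_powr a_def algebra_simps flip: powr_numeral)
  also have "... = (norm (k + eta) / norm k) powi (1 - 2 * int n)"
   using p nk by (intro powr_real_of_int') auto
  also have "... = norm (k + eta) powi (1 - 2 * int n) / norm k powi (1 - 2 * int n)"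
   by (rule power_int_divide_distrib)
  finally show ?case using nk by simp
 qed
 then have 4: "\<forall>\<^sub>F eta in nhds 0. complex_of_real (norm k powi (1 - 2 * int n) * (1 + (X eta + Y eta)) powr a)
   - (\<Sum>r\<le>P. of_real (norm k powi (1 - 2 * int n - int r)) * contr r (radial_tensor k n r) eta)
  = of_real (norm (k + eta) powi (1 - 2 * int n)) - (\<Sum>r\<le>P. of_real (norm k powi (1 - 2 * int n - int r)) * contr r (radial_tensor k n r) eta)"
  by eventually_elim simp
 show "big_O (Suc P) (\<lambda>eta. of_real (norm (k + eta) powi (1 - 2 * int n)) - (\<Sum>r\<le>P. of_real (norm k powi (1 - 2 * int n - int r)) * contr r (radial_tensor k n r) eta))"
  by (rule big_O_cong[OF 3 4])
qed

definition half_coeff :: "nat => real" where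
 "half_coeff n = (-1) ^ n * fact (2 * n) / ((1 - 2 * real n) * 4 ^ n * (fact n)^2)"

text \<open>The scalar factor in front of the nu-tensors is the Taylor coefficient of the square
  root of 1 + x.\<close>

lemma half_coeff_gbinomial: "half_coeff n = (1/2) gchoose n"
proof (induction n)
 case (Suc n)
 have g: "real (Suc n) * ((1/2) gchoose Suc n) = (1/2 - real n) * ((1/2) gchoose n)"
  using gbinomial_mult_1[of "1/2::real" n] by (simp add: algebra_simps)
 have f: "fact (2 * Suc n) = (2 * real n + 2) * (2 * real n + 1) * fact (2 * n)"
  by (simp add: algebra_simps)
 have nz: "1 - 2 * real n ~= 0" "1 - 2 * real (Suc n) ~= 0" "2 * real n + 1 ~= 0" "real n + 1 ~= 0"
 proof -
  have "real (2 * n) ~= real 1" by (subst of_nat_eq_iff) presburger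
  then show "1 - 2 * real n ~= 0" by simp
 qed simp_all
 have q: "1 - 2 * real (Suc n) = - (2 * real n + 1)" by simp
 have "half_coeff (Suc n) = (1/2 - real n) / (real n + 1) * half_coeff n"
  unfolding half_coeff_def f q fact_Suc power_Suc using nz
  by (simp add: divide_simps) (simp add: algebra_simps power2_eq_square)
 moreover have "(1/2) gchoose Suc n = ((1/2 - real n) * ((1/2) gchoose n)) / (real n + 1)"
  using g nz(4) by (subst nonzero_eq_divide_eq) (simp_all add: algebra_simps)
 ultimately show ?case unfolding Suc by (simp only: times_divide_eq_left)
qed (simp add: half_coeff_def)

text \<open>The coefficient of \<open>\<lambda>\<^sup>m\<close> in \<open>(|K|\<^sup>2 + \<Sum>\<^sub>j \<lambda>\<^bsup>j+1\<^esup> \<nu>\<^sub>K\<^sup>j)\<^bsup>1/2\<^esup>\<close>.\<close>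
definition disp :: "(nat => real^'d::finite => complex) => nat => real^'d => complex" where
 "disp \<nu> m K = (\<Sum>n\<le>m. of_real (norm K powi (1 - 2 * int n)) *
   (of_real (half_coeff n) * (\<Sum>\<alpha>\<in>compositions n (m - n). \<Prod>a\<leftarrow>\<alpha>. \<nu> a K)))"

text \<open>\<open>C_tensor\<close> for an arbitrary family of functions in place of the
  Rayleigh-Schroedinger coefficients. The expansion of the dispersion relation can then be proved
  without reference to the torus.\<close>

definition C_ten :: "(nat => real^'d::finite => complex) => nat => nat => real^'d => 'd tensor" where
 "C_ten \<nu> m p k is = (\<Sum>r\<le>p. \<Sum>n\<le>m. of_real (norm k powi (1 - 2 * int n - int r))
    * tensor_prod r (radial_tensor k n r) (nu_tensor \<nu> k n (m - n) (p - r)) is)"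

lemma C_tensor_eq: "C_tensor F aT m p k = C_ten (rs_nu F aT) m p k"
 by (rule ext) (simp add: C_tensor_def C_ten_def)

lemma contr_deriv_tensor:
 assumes "length \<alpha> = length \<beta>"
 shows "contr (sum_list \<beta>) (deriv_tensor \<nu> k \<alpha> \<beta>) eta = (\<Prod>(a, b)\<leftarrow>zip \<alpha> \<beta>. contr b (\<lambda>is. partials is (\<nu> a) k) eta)"
 using assms by (induction \<alpha> \<beta> rule: list_induct2) (simp_all add: contr_0 contr_tensor_prod)

lemma contr_nu_tensor:
 "contr b (nu_tensor \<nu> k n a b) eta = of_real (half_coeff n) * (\<Sum>\<alpha>\<in>compositions n a. \<Sum>\<beta>\<in>compositions (length \<alpha>) b.
   \<Prod>(a, b)\<leftarrow>zip \<alpha> \<beta>. of_real (1 / fact b) * contr b (\<lambda>is. partials is (\<nu> a) k) eta)"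
proof -
 have p: "(\<Prod>(a, b)\<leftarrow>zip \<alpha> \<beta>. of_real (1 / fact b) * contr b (\<lambda>is. partials is (\<nu> a) k) eta) =
   of_real (1 / (\<Prod>j\<leftarrow>\<beta>. fact j)) * contr (sum_list \<beta>) (deriv_tensor \<nu> k \<alpha> \<beta>) eta" if "length \<alpha> = length \<beta>" for \<alpha> \<beta>
  unfolding contr_deriv_tensor[OF that] using that
  by (induction \<alpha> \<beta> rule: list_induct2) (simp_all add: mult_ac)
 have "contr b (nu_tensor \<nu> k n a b) eta = of_real (half_coeff n) * (\<Sum>\<alpha>\<in>compositions n a. \<Sum>\<beta>\<in>compositions n b.
   of_real (1 / (\<Prod>j\<leftarrow>\<beta>. fact j)) * contr b (deriv_tensor \<nu> k \<alpha> \<beta>) eta)"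
  unfolding nu_tensor_def[abs_def] contr_cmult contr_sum half_coeff_def compositions_def ..
 also have "... = of_real (half_coeff n) * (\<Sum>\<alpha>\<in>compositions n a. \<Sum>\<beta>\<in>compositions (length \<alpha>) b.
   \<Prod>(a, b)\<leftarrow>zip \<alpha> \<beta>. of_real (1 / fact b) * contr b (\<lambda>is. partials is (\<nu> a) k) eta)"
 proof -
  have "(\<Sum>\<beta>\<in>compositions n b. of_real (1 / (\<Prod>j\<leftarrow>\<beta>. fact j)) * contr b (deriv_tensor \<nu> k \<alpha> \<beta>) eta)
   = (\<Sum>\<beta>\<in>compositions (length \<alpha>) b. \<Prod>(a, b)\<leftarrow>zip \<alpha> \<beta>. of_real (1 / fact b) * contr b (\<lambda>is. partials is (\<nu> a) k) eta)"
   if "\<alpha> \<in> compositions n a" for \<alpha>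
  proof (rule sum.cong)
   show "compositions n b = compositions (length \<alpha>) b" using that by (simp add: compositions_def)
   fix \<beta> assume "\<beta> \<in> compositions (length \<alpha>) b"
   then have "length \<alpha> = length \<beta>" "sum_list \<beta> = b" by (auto simp: compositions_def)
   from p[OF this(1)] this(2)
   show "of_real (1 / (\<Prod>j\<leftarrow>\<beta>. fact j)) * contr b (deriv_tensor \<nu> k \<alpha> \<beta>) eta =
     (\<Prod>(a, b)\<leftarrow>zip \<alpha> \<beta>. of_real (1 / fact b) * contr b (\<lambda>is. partials is (\<nu> a) k) eta)"
    by (simp only:)
  qed
  then show ?thesis by (simp only: cong: sum.cong)
 qed
 finally show ?thesis .
qed

lemma contr_C_ten:
 "contr p (C_ten \<nu> m p k) eta = (\<Sum>n\<le>m. \<Sum>r\<le>p. (of_real (norm k powi (1 - 2 * int n - int r)) * contr r (radial_tensor k n r) eta)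
   * contr (p - r) (nu_tensor \<nu> k n (m - n) (p - r)) eta)"
proof -
 have "contr p (C_ten \<nu> m p k) eta = (\<Sum>r\<le>p. \<Sum>n\<le>m. of_real (norm k powi (1 - 2 * int n - int r)) *
   contr p (tensor_prod r (radial_tensor k n r) (nu_tensor \<nu> k n (m - n) (p - r))) eta)"
  unfolding C_ten_def[abs_def] contr_sum contr_cmult ..
 also have "... = (\<Sum>r\<le>p. \<Sum>n\<le>m. (of_real (norm k powi (1 - 2 * int n - int r)) * contr r (radial_tensor k n r) eta)
   * contr (p - r) (nu_tensor \<nu> k n (m - n) (p - r)) eta)"
 proof (intro sum.cong refl)
  fix r n assume "r \<in> {..p}"
  then have "contr p (tensor_prod r (radial_tensor k n r) (nu_tensor \<nu> k n (m - n) (p - r))) eta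
   = contr r (radial_tensor k n r) eta * contr (p - r) (nu_tensor \<nu> k n (m - n) (p - r)) eta"
   using contr_tensor_prod[of r "p - r"] by simp
  then show "of_real (norm k powi (1 - 2 * int n - int r)) * contr p (tensor_prod r (radial_tensor k n r) (nu_tensor \<nu> k n (m - n) (p - r))) eta
   = of_real (norm k powi (1 - 2 * int n - int r)) * contr r (radial_tensor k n r) eta * contr (p - r) (nu_tensor \<nu> k n (m - n) (p - r)) eta"
   by (simp only: mult.assoc)
 qed
 finally show ?thesis by (simp only: sum.swap[of _ "{..m}"])
qed

text \<open>The meaning of the tensors: for fixed m they are the Taylor coefficients at k of the
  lambda^m term of the dispersion relation. The double sum in their definition is the Cauchy product
  of the radial factor with the Taylor expansions of the products of the nu's.\<close>

lemma expands_disp: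
 assumes k: "k ~= 0" and delta: "delta > 0" and \<nu>: "!!a. a <= m ==> smooth_on (ball k delta) (\<nu> a)"
 shows "expands (\<lambda>eta. disp \<nu> m (k + eta)) (\<lambda>p. contr p (C_ten \<nu> m p k))"
proof -
 have e: "expands (\<lambda>eta. \<Prod>a\<leftarrow>\<alpha>. \<nu> a (k + eta)) (\<lambda>b eta. \<Sum>\<beta>\<in>compositions (length \<alpha>) b. \<Prod>(a, b)\<leftarrow>zip \<alpha> \<beta>.
   of_real (1 / fact b) * contr b (\<lambda>is. partials is (\<nu> a) k) eta)" if "\<alpha> \<in> compositions n (m - n)" for n \<alpha>
 proof (rule expands_prod_list)
  fix a assume "a \<in> set \<alpha>"
  then have "a <= m" using that member_le_sum_list[of a \<alpha>] by (auto simp: compositions_def)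
  then show "expands (\<lambda>eta. \<nu> a (k + eta)) (\<lambda>b eta. of_real (1 / fact b) * contr b (\<lambda>is. partials is (\<nu> a) k) eta)"
   by (rule expands_Taylor[OF delta \<nu>])
 qed
 have "expands (\<lambda>eta. disp \<nu> m (k + eta)) (\<lambda>p eta. \<Sum>n\<le>m. \<Sum>r\<le>p. (of_real (norm k powi (1 - 2 * int n - int r)) * contr r (radial_tensor k n r) eta)
   * (of_real (half_coeff n) * (\<Sum>\<alpha>\<in>compositions n (m - n). \<Sum>\<beta>\<in>compositions (length \<alpha>) (p - r). \<Prod>(a, b)\<leftarrow>zip \<alpha> \<beta>.
   of_real (1 / fact b) * contr b (\<lambda>is. partials is (\<nu> a) k) eta)))"
  unfolding disp_def by (intro expands_sum expands_mult expands_radial k expands_cmult e)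
 then show ?thesis unfolding contr_nu_tensor[symmetric] contr_C_ten[symmetric] by simp
qed

text \<open>In formal power series in lambda, the generating series of \<open>disp\<close> is kappa
  (1 + G)^(1/2) with kappa = |K| and G = lambda N / kappa^2, where N generates the nu's. Its square
  is kappa^2 + lambda N, whose coefficients are read off.\<close>

lemma disp_square:
 assumes K: "K ~= 0"
 shows "(\<Sum>i\<le>m. disp \<nu> i K * disp \<nu> (m - i) K) = (if m = 0 then of_real ((norm K)^2) else \<nu> (m - 1) K)"
proof -
 define kappa where "kappa = complex_of_real (norm K)"
 have kappa: "kappa ~= 0" using K by (simp add: kappa_def)
 define N where "N = Abs_fps (\<lambda>a. \<nu> a K)"
 define G where "G = fps_const (1 / kappa\<^sup>2) * (fps_X * N)"
 define c where "c = fps_const kappa * (fps_compose (fps_binomial (1/2)) G)"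
 have G0: "fps_nth G 0 = 0" by (simp add: G_def)
 have Gi: "fps_nth (G ^ i) m = (1 / kappa\<^sup>2) ^ i * (if m < i then 0 else fps_nth (N ^ i) (m - i))" for i m
  by (simp add: G_def power_mult_distrib fps_const_power fps_X_power_mult_nth)
 have half: "(1/2 :: complex) gchoose i = of_real (half_coeff i)" for i
  by (simp add: half_coeff_gbinomial gbinomial_prod_rev)
 have c_nth: "fps_nth c m = disp \<nu> m K" for m
 proof -
  have "fps_nth c m = (\<Sum>i\<le>m. kappa * (of_real (half_coeff i) * ((1 / kappa\<^sup>2) ^ i * fps_nth (N ^ i) (m - i))))"
   unfolding c_def by (simp add: fps_compose_nth half Gi sum_distrib_left atLeast0AtMost fps_binomial_def)
  also have "... = disp \<nu> m K"
   unfolding disp_def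
  proof (intro sum.cong refl)
   fix i
   have "of_real (norm K powi (1 - 2 * int i)) = kappa * (1 / kappa\<^sup>2) ^ i"
    using K by (simp add: kappa_def power_int_diff power_int_mult power_divide of_real_power_int flip: power_mult)
   then show "kappa * (of_real (half_coeff i) * ((1 / kappa\<^sup>2) ^ i * fps_nth (N ^ i) (m - i)))
    = of_real (norm K powi (1 - 2 * int i)) * (of_real (half_coeff i) * (\<Sum>\<alpha>\<in>compositions i (m - i). \<Prod>a\<leftarrow>\<alpha>. \<nu> a K))"
    unfolding N_def fps_power_compositions by (simp only: mult_ac)
  qed
  finally show ?thesis .
 qed
 have b: "fps_binomial (1/2) * fps_binomial (1/2) = (1 + fps_X :: complex fps)"
  by (simp add: fps_binomial_1 flip: fps_binomial_add_mult)
 have "c * c = fps_const (kappa * kappa) * (fps_compose (fps_binomial (1/2)) G * fps_compose (fps_binomial (1/2)) G)"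
  unfolding c_def by (simp add: fps_const_mult[symmetric] mult_ac del: fps_const_mult)
 also have "fps_compose (fps_binomial (1/2)) G * fps_compose (fps_binomial (1/2)) G = fps_compose (1 + fps_X) G"
  by (simp add: fps_compose_mult_distrib[OF G0, symmetric] b)
 also have "... = 1 + G"
  by (simp add: fps_compose_add_distrib G0)
 finally have cc: "c * c = fps_const (kappa * kappa) * (1 + G)" .
 have "(\<Sum>i\<le>m. disp \<nu> i K * disp \<nu> (m - i) K) = fps_nth (c * c) m"
  by (simp add: fps_mult_nth c_nth atLeast0AtMost)
 also have "... = (if m = 0 then of_real ((norm K)^2) else \<nu> (m - 1) K)"
  unfolding cc G_def using kappa by (simp add: N_def kappa_def power2_eq_square)
 finally show ?thesis .
qed

lemma disp_0: "disp \<nu> 0 K = of_real (norm K)"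
 by (simp add: disp_def compositions_0 half_coeff_def)

section \<open>The truncated dispersion relation, uniformly in lambda\<close>

lemma big_O_uniform:
 fixes f :: "'i => 'a::real_normed_vector => 'b::real_normed_algebra_1"
 assumes "finite I" "!!i. i \<in> I ==> big_O (P i) (f i)"
 obtains C r where "C >= 0" "r > 0" "!!i eta. i \<in> I ==> norm eta <= r ==> norm (f i eta) <= C * norm eta ^ P i"
proof -
 have "\<forall>i\<in>I. \<exists>C. \<forall>\<^sub>F eta in nhds 0. norm (f i eta) <= C * norm eta ^ P i"
  using assms(2) by (simp add: big_O_def)
 then obtain C where C: "!!i. i \<in> I ==> \<forall>\<^sub>F eta in nhds 0. norm (f i eta) <= C i * norm eta ^ P i"
  by metis
 have "\<forall>\<^sub>F eta in nhds 0. \<forall>i\<in>I. norm (f i eta) <= C i * norm eta ^ P i"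
  using C assms(1) by (simp add: eventually_ball_finite)
 then obtain r where r: "r > 0" "!!eta i. norm eta < r ==> i \<in> I ==> norm (f i eta) <= C i * norm eta ^ P i"
  unfolding eventually_nhds_metric by auto
 define M where "M = (\<Sum>i\<in>I. \<bar>C i\<bar>)"
 show ?thesis
 proof
  show "M >= 0" by (simp add: M_def sum_nonneg)
  show "r / 2 > 0" using r by simp
  fix i and eta :: 'a assume i: "i \<in> I" and "norm eta <= r / 2"
  then have "norm (f i eta) <= C i * norm eta ^ P i" using r by auto
  also have "... <= M * norm eta ^ P i"
  proof (rule mult_right_mono)
   have "\<bar>C i\<bar> <= M" unfolding M_def using i assms(1) by (intro member_le_sum) auto
   then show "C i <= M" by linarith
  qed simp
  finally show "norm (f i eta) <= M * norm eta ^ P i" .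
 qed
qed

text \<open>Collects what is needed about the truncated square root: its Taylor error of order P + 1
  in eta, its square compared with the truncated eigenvalue up to lambda^(L + 1), and its distance
  from |k|. The constants are uniform for lambda in [0, 1] because only the finitely many
  coefficients m \<le> L occur.\<close>

lemma dispersion_expansion:
 fixes k :: "real^'d::finite"
 assumes k: "k ~= 0" and delta: "delta > 0" and \<nu>: "!!a. a <= L ==> smooth_on (ball k delta) (\<nu> a)"
 obtains C r where "C >= 0" "r > 0"
  "!!lam eta. 0 <= lam ==> lam <= 1 ==> norm eta <= r ==>
   norm ((\<Sum>m\<le>L. of_real (lam ^ m) * disp \<nu> m (k + eta)) - (\<Sum>m\<le>L. of_real (lam ^ m) * (\<Sum>p\<le>P. contr p (C_ten \<nu> m p k) eta))) <= C * norm eta ^ Suc P"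
  "!!lam eta. 0 <= lam ==> lam <= 1 ==> norm eta <= r ==>
   norm ((\<Sum>m\<le>L. of_real (lam ^ m) * disp \<nu> m (k + eta))^2 - (of_real ((norm (k + eta))^2) + (\<Sum>j<L. of_real (lam ^ Suc j) * \<nu> j (k + eta)))) <= C * lam ^ Suc L"
  "!!lam eta. 0 <= lam ==> lam <= 1 ==> norm eta <= r ==>
   norm ((\<Sum>m\<le>L. of_real (lam ^ m) * disp \<nu> m (k + eta)) - of_real (norm k)) <= C * (lam + norm eta)"
proof -
 have ex: "expands (\<lambda>eta. disp \<nu> m (k + eta)) (\<lambda>p. contr p (C_ten \<nu> m p k))" if "m <= L" for m
  using that by (intro expands_disp[OF k delta] \<nu>) auto
 have 1: "big_O (Suc P) (\<lambda>eta. disp \<nu> m (k + eta) - (\<Sum>p\<le>P. contr p (C_ten \<nu> m p k) eta))" if "m \<in> {..L}" for m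
  using ex that by (auto simp: expands_def)
 have 2: "big_O 0 (\<lambda>eta. disp \<nu> m (k + eta))" if "m \<in> {..L}" for m
  using ex that by (auto intro: expands_bounded)
 obtain C1 r1 where C1: "C1 >= 0" "r1 > 0" "!!m eta. m \<in> {..L} ==> norm eta <= r1 ==>
   norm (disp \<nu> m (k + eta) - (\<Sum>p\<le>P. contr p (C_ten \<nu> m p k) eta)) <= C1 * norm eta ^ Suc P"
  by (rule big_O_uniform[of "{..L}" "\<lambda>_. Suc P" "\<lambda>m eta. disp \<nu> m (k + eta) - (\<Sum>p\<le>P. contr p (C_ten \<nu> m p k) eta)"],
    rule finite_atMost, erule 1, rule that)
 obtain C2 r2 where C2: "C2 >= 0" "r2 > 0" "!!m eta. m \<in> {..L} ==> norm eta <= r2 ==> norm (disp \<nu> m (k + eta)) <= C2 * norm eta ^ 0"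
  by (rule big_O_uniform[of "{..L}" "\<lambda>_. 0" "\<lambda>m eta. disp \<nu> m (k + eta)"],
    rule finite_atMost, erule 2, rule that)
 define r where "r = min (min r1 r2) (norm k / 2)"
 have r: "r > 0" using C1 C2 k by (simp add: r_def)
 have lm: "lam ^ m <= 1" "0 <= lam ^ m" if "0 <= lam" "lam <= 1" for lam :: real and m
  using that by (auto intro: power_le_one)
 define C where "C = real (Suc L) * C1 + (real (Suc L) * real (Suc L)) * C2\<^sup>2 + (real (Suc L) * C2 + 1)"
 have Cge: "C >= real (Suc L) * C1" "C >= (real (Suc L) * real (Suc L)) * C2\<^sup>2" "C >= real (Suc L) * C2 + 1" "C >= 0"
 proof -
  have "0 <= real (Suc L) * C1" "0 <= (real (Suc L) * real (Suc L)) * C2\<^sup>2" "0 <= real (Suc L) * C2 + 1"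
   using C1(1) C2(1) by simp_all
  then show "C >= real (Suc L) * C1" "C >= (real (Suc L) * real (Suc L)) * C2\<^sup>2" "C >= real (Suc L) * C2 + 1" "C >= 0"
   unfolding C_def by linarith+
 qed
 show ?thesis
 proof (rule that[OF Cge(4) r])
  fix lam :: real and eta :: "real^'d" assume lam: "0 <= lam" "lam <= 1" and eta: "norm eta <= r"
  have eta1: "norm eta <= r1" and eta2: "norm eta <= r2" and eta3: "norm eta <= norm k / 2" using eta by (auto simp: r_def)
  have K: "k + eta ~= 0"
  proof
   assume "k + eta = 0"
   then have "eta = - k" by (simp add: add_eq_0_iff)
   then show False using eta3 k by simp
  qed
  define D where "D m = disp \<nu> m (k + eta)" for m
  have D: "norm (D m) <= C2" if "m <= L" for m using C2(3)[of m eta] that eta2 by (simp add: D_def)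
  have "norm (\<Sum>m\<le>L. of_real (lam ^ m) * (D m - (\<Sum>p\<le>P. contr p (C_ten \<nu> m p k) eta))) <= (\<Sum>m\<le>L. 1 * (C1 * norm eta ^ Suc P))"
  proof (intro sum_norm_le)
   fix m assume "m \<in> {..L}"
   then show "norm (of_real (lam ^ m) * (D m - (\<Sum>p\<le>P. contr p (C_ten \<nu> m p k) eta))) <= 1 * (C1 * norm eta ^ Suc P)"
    unfolding norm_mult D_def using lm[OF lam, of m] C1(3)[of m eta] eta1
    by (intro mult_mono) (auto simp: norm_power abs_of_nonneg[OF lam(1)] simp del: power_Suc)
  qed
  also have "... = real (Suc L) * C1 * norm eta ^ Suc P" by (simp add: mult.assoc)
  also have "... <= C * norm eta ^ Suc P" by (intro mult_right_mono Cge) auto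
  finally show "norm ((\<Sum>m\<le>L. of_real (lam ^ m) * disp \<nu> m (k + eta)) - (\<Sum>m\<le>L. of_real (lam ^ m) * (\<Sum>p\<le>P. contr p (C_ten \<nu> m p k) eta))) <= C * norm eta ^ Suc P"
   by (simp add: D_def right_diff_distrib sum_subtractf)
  \<comment> \<open>Squaring the truncated series gives correct coefficients up to order L by
    \<open>disp_square\<close>. The pairs in \<open>T\<close> are the excess products; each carries
    at least lambda^(L + 1).\<close>
  define T where "T = {..L} \<times> {..L} - {(i, j). i + j <= L}"
  have sq: "(\<Sum>m\<le>L. of_real (lam ^ m) * D m)\<^sup>2 = (\<Sum>m\<le>L. \<Sum>i\<le>m. of_real (lam ^ m) * (D i * D (m - i)))
    + (\<Sum>(i, j)\<in>T. of_real (lam ^ i) * D i * (of_real (lam ^ j) * D j))"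
  proof -
   have "(\<Sum>m\<le>L. of_real (lam ^ m) * D m)\<^sup>2 = (\<Sum>(i, j)\<in>{..L} \<times> {..L}. of_real (lam ^ i) * D i * (of_real (lam ^ j) * D j))"
    unfolding power2_eq_square sum_product sum.cartesian_product ..
   also have "... = (\<Sum>(i, j)\<in>{(i, j). i + j <= L}. of_real (lam ^ i) * D i * (of_real (lam ^ j) * D j))
     + (\<Sum>(i, j)\<in>T. of_real (lam ^ i) * D i * (of_real (lam ^ j) * D j))"
    unfolding T_def by (subst sum.subset_diff[of "{(i, j). i + j <= L}"]) (auto simp: add.commute)
   also have "(\<Sum>(i, j)\<in>{(i, j). i + j <= L}. of_real (lam ^ i) * D i * (of_real (lam ^ j) * D j))
     = (\<Sum>m\<le>L. \<Sum>i\<le>m. of_real (lam ^ i) * D i * (of_real (lam ^ (m - i)) * D (m - i)))"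
    by (rule sum.triangle_reindex_eq)
   also have "... = (\<Sum>m\<le>L. \<Sum>i\<le>m. of_real (lam ^ m) * (D i * D (m - i)))"
   proof (intro sum.cong refl)
    fix m i :: nat assume "i \<in> {..m}"
    then have "lam ^ m = lam ^ i * lam ^ (m - i)" by (simp flip: power_add)
    then show "of_real (lam ^ i) * D i * (of_real (lam ^ (m - i)) * D (m - i)) = of_real (lam ^ m) * (D i * D (m - i))"
     by simp
   qed
   finally show ?thesis .
  qed
  have diag: "(\<Sum>m\<le>L. \<Sum>i\<le>m. of_real (lam ^ m) * (D i * D (m - i))) = of_real ((norm (k + eta))^2) + (\<Sum>j<L. of_real (lam ^ Suc j) * \<nu> j (k + eta))"
  proof -
   have "(\<Sum>m\<le>L. \<Sum>i\<le>m. of_real (lam ^ m) * (D i * D (m - i))) = (\<Sum>m\<le>L. of_real (lam ^ m) * (if m = 0 then of_real ((norm (k + eta))^2) else \<nu> (m - 1) (k + eta)))"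
    unfolding sum_distrib_left[symmetric] D_def disp_square[OF K] ..
   also have "... = of_real ((norm (k + eta))^2) + (\<Sum>j<L. of_real (lam ^ Suc j) * \<nu> j (k + eta))"
    by (simp add: sum.atMost_shift del: power_Suc)
   finally show ?thesis .
  qed
  have "norm (\<Sum>(i, j)\<in>T. of_real (lam ^ i) * D i * (of_real (lam ^ j) * D j)) <= (\<Sum>x\<in>T. lam ^ Suc L * C2\<^sup>2)"
  proof (intro sum_norm_le)
   fix x assume "x \<in> T"
   then obtain i j where x: "x = (i, j)" "i <= L" "j <= L" "\<not> i + j <= L" by (cases x) (auto simp: T_def)
   have "norm (of_real (lam ^ i) * D i * (of_real (lam ^ j) * D j)) = lam ^ (i + j) * (norm (D i) * norm (D j))"
    using lam by (simp add: norm_mult norm_power power_add)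
   also have "... <= lam ^ Suc L * (C2 * C2)"
    using x lam D C2(1) by (intro mult_mono power_decreasing) auto
   finally show "norm (case x of (i, j) => of_real (lam ^ i) * D i * (of_real (lam ^ j) * D j)) <= lam ^ Suc L * C2\<^sup>2"
    by (simp add: x(1) power2_eq_square)
  qed
  also have "... = real (card T) * C2\<^sup>2 * lam ^ Suc L" by simp
  also have "... <= C * lam ^ Suc L"
  proof (intro mult_right_mono)
   have "card T <= card ({..L} \<times> {..L})" unfolding T_def by (intro card_mono) auto
   then have "card T <= Suc L * Suc L" by (simp only: card_cartesian_product card_atMost)
   then have "real (card T) <= real (Suc L) * real (Suc L)" by (simp only: of_nat_le_iff flip: of_nat_mult)
   then have "real (card T) * C2\<^sup>2 <= (real (Suc L) * real (Suc L)) * C2\<^sup>2" by (intro mult_right_mono) auto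
   then show "real (card T) * C2\<^sup>2 <= C" using Cge by linarith
  qed (use lam in auto)
  finally show "norm ((\<Sum>m\<le>L. of_real (lam ^ m) * disp \<nu> m (k + eta))^2 - (of_real ((norm (k + eta))^2) + (\<Sum>j<L. of_real (lam ^ Suc j) * \<nu> j (k + eta)))) <= C * lam ^ Suc L"
   using sq diag by (simp add: D_def)
  have "norm (\<Sum>j<L. of_real (lam ^ Suc j) * D (Suc j)) <= (\<Sum>j<L. lam * C2)"
  proof (intro sum_norm_le)
   fix j assume j: "j \<in> {..<L}"
   have "lam ^ Suc j <= lam * 1" unfolding power_Suc using lam lm[OF lam, of j] by (intro mult_left_mono) auto
   then show "norm (of_real (lam ^ Suc j) * D (Suc j)) <= lam * C2"
    unfolding norm_mult using j D[of "Suc j"] lam by (intro mult_mono) (auto simp: norm_power norm_mult)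
  qed
  moreover have "(\<Sum>j<L. lam * C2) <= real (Suc L) * C2 * lam"
   using lam C2(1) by (simp add: mult_ac distrib_left)
  moreover have "norm (D 0 - of_real (norm k)) <= norm eta"
  proof -
   have "D 0 - of_real (norm k) = of_real (norm (k + eta) - norm k)" by (simp add: D_def disp_0)
   then have "norm (D 0 - of_real (norm k)) = \<bar>norm (k + eta) - norm k\<bar>" by (simp only: norm_of_real)
   also have "... <= norm eta" using norm_triangle_ineq3[of "k + eta" k] by simp
   finally show ?thesis .
  qed
  moreover have "(\<Sum>m\<le>L. of_real (lam ^ m) * D m) - of_real (norm k) = (D 0 - of_real (norm k)) + (\<Sum>j<L. of_real (lam ^ Suc j) * D (Suc j))"
   by (simp add: sum.atMost_shift del: power_Suc)
  ultimately have "norm ((\<Sum>m\<le>L. of_real (lam ^ m) * D m) - of_real (norm k)) <= norm eta + real (Suc L) * C2 * lam"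
   using norm_triangle_ineq[of "D 0 - of_real (norm k)"] by (smt (verit))
  also have "... <= C * norm eta + C * lam"
  proof (intro add_mono)
   have "0 <= real (Suc L) * C2" using C2(1) by simp
   then have "1 <= C" "real (Suc L) * C2 <= C" using Cge(3) by linarith+
   then show "norm eta <= C * norm eta" "real (Suc L) * C2 * lam <= C * lam"
    using lam mult_right_mono[of 1 C "norm eta"] by (auto intro: mult_right_mono)
  qed
  finally show "norm ((\<Sum>m\<le>L. of_real (lam ^ m) * disp \<nu> m (k + eta)) - of_real (norm k)) <= C * (lam + norm eta)"
   by (simp add: D_def distrib_left add.commute)
 qed
qed

section \<open>Trigonometric polynomials on the torus\<close>

text \<open>A trigonometric polynomial over a prescribed frequency set. All correctors can be
  written over one common set, so differential identities reduce to identities between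
  coefficients.\<close>

definition tp :: "(int^'m::finite) set => (int^'m => complex) => real^'m => complex" where
 "tp Lambda c y = (\<Sum>xi\<in>Lambda. c xi * cis (ivec xi \<bullet> y))"

lemma ivec_add: "ivec (xi + eta) = ivec xi + ivec eta" and ivec_diff: "ivec (xi - eta) = ivec xi - ivec eta"
 and ivec_0 [simp]: "ivec 0 = 0" and ivec_minus: "ivec (- xi) = - ivec xi"
 by (auto simp: ivec_def vec_eq_iff)

lemma integral_cis_period:
 fixes n :: int
 shows "integrable lborel (\<lambda>y. indicator {0..<2 * pi} y *\<^sub>R cis (of_int n * y))"
  and "(LINT y|lborel. indicator {0..<2 * pi} y *\<^sub>R cis (of_int n * y)) = (if n = 0 then of_real (2 * pi) else 0)"
proof -
 define G where "G y = (if n = 0 then of_real y else cis (of_int n * y) / (\<i> * of_int n))" for y :: real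
 have d: "(G has_vector_derivative cis (of_int n * y)) (at y within {0..2 * pi})" for y
 proof (cases "n = 0")
  case True
  have "((\<lambda>y. complex_of_real y) has_vector_derivative 1) (at y within {0..2 * pi})"
   by (auto intro!: derivative_eq_intros)
  then show ?thesis using True unfolding G_def by simp
 next
  case False
  have e: "\<i> * (x * (\<i> * z)) = - (x * z)" for x z
  proof -
   have "\<i> * (x * (\<i> * z)) = (\<i> * \<i>) * (x * z)" by (simp only: mult_ac)
   then show ?thesis by simp
  qed
  have "((\<lambda>y. cis (of_int n * y) / (\<i> * of_int n)) has_derivative (\<lambda>h. h *\<^sub>R cis (of_int n * y))) (at y within {0..2 * pi})"
   using False by (auto intro!: derivative_eq_intros has_derivative_cis simp: fun_eq_iff scaleR_conv_of_real divide_simps e)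
  then show ?thesis using False unfolding G_def has_vector_derivative_def by simp
 qed
 have "has_bochner_integral lborel (\<lambda>y. indicator {0..2 * pi} y *\<^sub>R cis (of_int n * y)) (G (2 * pi) - G 0)"
  by (rule has_bochner_integral_FTC_Icc) (auto intro!: continuous_intros d)
 moreover have "G (2 * pi) - G 0 = (if n = 0 then of_real (2 * pi) else 0)"
 proof -
  have "cis (of_int n * (2 * pi)) = 1"
   using cis_multiple_2pi[of "of_int n"] by (simp add: mult.commute mult.left_commute)
  then show ?thesis by (simp add: G_def)
 qed
 ultimately have hb: "has_bochner_integral lborel (\<lambda>y. indicator {0..2 * pi} y *\<^sub>R cis (of_int n * y)) (if n = 0 then of_real (2 * pi) else 0)"
  by simp
 have "has_bochner_integral lborel (\<lambda>y. indicator {0..<2 * pi} y *\<^sub>R cis (of_int n * y)) (if n = 0 then of_real (2 * pi) else 0)"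
 proof (rule has_bochner_integralI_AE[OF hb])
  show "AE y in lborel. indicator {0..2 * pi} y *\<^sub>R cis (of_int n * y) = indicator {0..<2 * pi} y *\<^sub>R cis (of_int n * y)"
   using AE_lborel_singleton[of "2 * pi"] by eventually_elim (auto simp: indicator_def)
 qed measurable
 then show "integrable lborel (\<lambda>y. indicator {0..<2 * pi} y *\<^sub>R cis (of_int n * y))"
  "(LINT y|lborel. indicator {0..<2 * pi} y *\<^sub>R cis (of_int n * y)) = (if n = 0 then of_real (2 * pi) else 0)"
  by (auto simp: has_bochner_integral_iff)
qed

lemma torus_integral_cis:
 fixes xi :: "int^'m::finite"
 shows "set_integrable lborel torus_cell (\<lambda>y. cis (ivec xi \<bullet> y))"
  and "(LINT y:torus_cell|lborel. cis (ivec xi \<bullet> y)) = (if xi = 0 then of_real ((2 * pi) ^ CARD('m)) else 0)"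
proof -
 have eq: "indicator torus_cell y *\<^sub>R cis (ivec xi \<bullet> y) = (\<Prod>j\<in>UNIV. indicator {0..<2 * pi} (y $ j) *\<^sub>R cis (of_int (xi $ j) * y $ j))" for y
 proof -
  have "(indicator torus_cell y :: real) = (\<Prod>j\<in>UNIV. indicator {0..<2 * pi} (y $ j))"
  proof (cases "y \<in> torus_cell")
   case True then show ?thesis by (auto simp: torus_cell_def indicator_def)
  next
   case False
   then obtain j where "y $ j \<notin> {0..<2 * pi}" by (auto simp: torus_cell_def)
   then have "(\<Prod>j\<in>UNIV. indicator {0..<2 * pi} (y $ j) :: real) = 0" by (intro prod_zero bexI[of _ j]) auto
   then show ?thesis using False by simp
  qed
  then show ?thesis
   by (simp add: cis_inner_vec ivec_def scaleR_conv_of_real prod.distrib of_real_prod)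
 qed
 show "set_integrable lborel torus_cell (\<lambda>y. cis (ivec xi \<bullet> y))"
  unfolding set_integrable_def eq
  by (rule integral_lborel_vec_prod(1)[where f="\<lambda>j y. indicator {0..<2 * pi} y *\<^sub>R cis (of_int (xi $ j) * y)"]) (rule integral_cis_period)
 show "(LINT y:torus_cell|lborel. cis (ivec xi \<bullet> y)) = (if xi = 0 then of_real ((2 * pi) ^ CARD('m)) else 0)"
  unfolding set_lebesgue_integral_def eq
  by (subst integral_lborel_vec_prod(2)[where f="\<lambda>j y. indicator {0..<2 * pi} y *\<^sub>R cis (of_int (xi $ j) * y)"])
    (auto simp: integral_cis_period vec_eq_iff)
qed

lemma torus_fourier_tp:
 fixes eta :: "int^'m::finite"
 assumes "finite Lambda"
 shows "torus_fourier (tp Lambda c) eta = of_real ((2 * pi) ^ CARD('m)) * (if eta \<in> Lambda then c eta else 0)"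
proof -
 have eq: "cis (- (ivec eta \<bullet> y)) * tp Lambda c y = (\<Sum>xi\<in>Lambda. c xi * cis (ivec (xi - eta) \<bullet> y))" for y
  unfolding tp_def sum_distrib_left
 proof (intro sum.cong refl)
  fix xi
  have "cis (ivec (xi - eta) \<bullet> y) = cis (- (ivec eta \<bullet> y)) * cis (ivec xi \<bullet> y)"
   by (simp add: cis_mult ivec_diff inner_diff_left)
  then show "cis (- (ivec eta \<bullet> y)) * (c xi * cis (ivec xi \<bullet> y)) = c xi * cis (ivec (xi - eta) \<bullet> y)" by simp
 qed
 have "torus_fourier (tp Lambda c) eta = (\<Sum>xi\<in>Lambda. c xi * (LINT y:torus_cell|lborel. cis (ivec (xi - eta) \<bullet> y)))"
  unfolding torus_fourier_def eq
 proof -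
  have "(LINT y:torus_cell|lborel. \<Sum>xi\<in>Lambda. c xi * cis (ivec (xi - eta) \<bullet> y)) = (\<Sum>xi\<in>Lambda. LINT y:torus_cell|lborel. c xi * cis (ivec (xi - eta) \<bullet> y))"
   unfolding set_lebesgue_integral_def scaleR_sum_right
   by (rule Bochner_Integration.integral_sum)
    (rule set_integrable_mult_right[OF torus_integral_cis(1), unfolded set_integrable_def])
  then show "(LINT y:torus_cell|lborel. \<Sum>xi\<in>Lambda. c xi * cis (ivec (xi - eta) \<bullet> y)) = (\<Sum>xi\<in>Lambda. c xi * (LINT y:torus_cell|lborel. cis (ivec (xi - eta) \<bullet> y)))"
   by simp
 qed
 also have "... = (\<Sum>xi\<in>Lambda. if eta = xi then c xi * of_real ((2 * pi) ^ CARD('m)) else 0)"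
  by (intro sum.cong refl) (auto simp: torus_integral_cis)
 also have "... = of_real ((2 * pi) ^ CARD('m)) * (if eta \<in> Lambda then c eta else 0)"
  using assms by (simp add: sum.delta' mult.commute)
 finally show ?thesis .
qed

lemma torus_mean_tp:
 fixes c :: "int^'m::finite => complex"
 assumes "finite Lambda"
 shows "torus_mean (tp Lambda c) = (if 0 \<in> Lambda then c 0 else 0)"
proof -
 have "torus_mean (tp Lambda c) = torus_fourier (tp Lambda c) 0 / of_real ((2 * pi) ^ CARD('m))"
  unfolding torus_mean_def torus_fourier_def by simp
 then show ?thesis by (simp add: torus_fourier_tp[OF assms])
qed

lemma tp_eq_iff:
 assumes "finite Lambda" shows "tp Lambda c = tp Lambda d \<longleftrightarrow> (\<forall>xi\<in>Lambda. c xi = d xi)"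
proof
 assume *: "tp Lambda c = tp Lambda d"
 show "\<forall>xi\<in>Lambda. c xi = d xi"
 proof
  fix xi assume "xi \<in> Lambda"
  then show "c xi = d xi"
   using arg_cong[OF *, of "\<lambda>f. torus_fourier f xi"] by (simp add: torus_fourier_tp[OF assms])
 qed
qed (auto simp: tp_def fun_eq_iff)

lemma tp_superset:
 assumes "finite Lambda'" "Lambda \<subseteq> Lambda'"
 shows "tp Lambda c = tp Lambda' (\<lambda>xi. if xi \<in> Lambda then c xi else 0)"
proof (rule ext)
 fix y show "tp Lambda c y = tp Lambda' (\<lambda>xi. if xi \<in> Lambda then c xi else 0) y"
  unfolding tp_def using assms by (intro sum.mono_neutral_cong_left) auto
qed

lemma tp_has_derivative:
 "(tp Lambda c has_derivative (\<lambda>h. \<Sum>j\<in>UNIV. h $ j *\<^sub>R tp Lambda (\<lambda>xi. \<i> * of_int (xi $ j) * c xi) y)) (at y)"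
proof -
 have "(tp Lambda c has_derivative (\<lambda>h. \<Sum>xi\<in>Lambda. c xi * ((ivec xi \<bullet> h) *\<^sub>R (\<i> * cis (ivec xi \<bullet> y))))) (at y)"
  unfolding tp_def[abs_def] by (auto intro!: derivative_eq_intros has_derivative_cis)
 also have "(\<lambda>h. \<Sum>xi\<in>Lambda. c xi * ((ivec xi \<bullet> h) *\<^sub>R (\<i> * cis (ivec xi \<bullet> y)))) =
   (\<lambda>h. \<Sum>j\<in>UNIV. h $ j *\<^sub>R tp Lambda (\<lambda>xi. \<i> * of_int (xi $ j) * c xi) y)"
 proof (rule ext)
  fix h :: "real^'a"
  have "(\<Sum>j\<in>UNIV. h $ j *\<^sub>R tp Lambda (\<lambda>xi. \<i> * of_int (xi $ j) * c xi) y) = (\<Sum>xi\<in>Lambda. \<Sum>j\<in>UNIV. h $ j *\<^sub>R (\<i> * of_int (xi $ j) * c xi * cis (ivec xi \<bullet> y)))"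
   unfolding tp_def scaleR_sum_right by (rule sum.swap)
  also have "... = (\<Sum>xi\<in>Lambda. c xi * ((ivec xi \<bullet> h) *\<^sub>R (\<i> * cis (ivec xi \<bullet> y))))"
  proof (intro sum.cong refl)
   fix xi :: "int^'a"
   have "ivec xi \<bullet> h = (\<Sum>j\<in>UNIV. h $ j * of_int (xi $ j))" by (simp add: inner_vec_def ivec_def mult.commute)
   then show "(\<Sum>j\<in>UNIV. h $ j *\<^sub>R (\<i> * of_int (xi $ j) * c xi * cis (ivec xi \<bullet> y))) = c xi * ((ivec xi \<bullet> h) *\<^sub>R (\<i> * cis (ivec xi \<bullet> y)))"
    by (simp add: scaleR_conv_of_real[where 'a=complex] sum_distrib_left sum_distrib_right mult_ac)
  qed
  finally show "(\<Sum>xi\<in>Lambda. c xi * ((ivec xi \<bullet> h) *\<^sub>R (\<i> * cis (ivec xi \<bullet> y)))) =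
   (\<Sum>j\<in>UNIV. h $ j *\<^sub>R tp Lambda (\<lambda>xi. \<i> * of_int (xi $ j) * c xi) y)" by simp
 qed
 finally show ?thesis .
qed

lemma partial_tp: "partial j (tp Lambda c) = tp Lambda (\<lambda>xi. \<i> * of_int (xi $ j) * c xi)"
 by (rule ext, subst partial_eqI[OF tp_has_derivative])
  (simp add: axis_def if_distrib[of "\<lambda>r. r *\<^sub>R _"] cong: if_cong)

lemma tp_sum: "(\<Sum>i\<in>I. tp Lambda (c i) y) = tp Lambda (\<lambda>xi. \<Sum>i\<in>I. c i xi) y"
 unfolding tp_def sum_distrib_right by (rule sum.swap)

lemma tp_cmult: "a * tp Lambda c y = tp Lambda (\<lambda>xi. a * c xi) y"
 by (simp add: tp_def sum_distrib_left mult.assoc)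

lemma tp_add: "tp Lambda c y + tp Lambda d y = tp Lambda (\<lambda>xi. c xi + d xi) y"
 by (simp add: tp_def sum.distrib distrib_right)

lemma tp_cong: "(!!xi. xi \<in> Lambda ==> c xi = d xi) ==> tp Lambda c y = tp Lambda d y"
 by (simp add: tp_def)

lemma tp_const: "finite Lambda ==> 0 \<in> Lambda ==> tp Lambda (\<lambda>xi. if xi = 0 then a else 0) y = a"
 by (simp add: tp_def if_distrib[of "\<lambda>x. x * _"] cong: if_cong)

lemma qgrad_tp: "qgrad F (tp Lambda c) y $ i = tp Lambda (\<lambda>xi. \<i> * of_real ((F *v ivec xi) $ i) * c xi) y"
proof -
 have "(\<Sum>j\<in>UNIV. complex_of_real (F $ i $ j) * (\<i> * of_int (xi $ j) * c xi)) = \<i> * of_real ((F *v ivec xi) $ i) * c xi" for xi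
  by (simp add: matrix_vector_mult_def ivec_def sum_distrib_left sum_distrib_right mult_ac)
 then show ?thesis by (simp add: qgrad_def partial_tp tp_cmult tp_sum)
qed

lemma qdiv_tp: "qdiv F (\<lambda>y. \<chi> i. tp Lambda (g i) y) y = tp Lambda (\<lambda>xi. \<Sum>i\<in>UNIV. \<i> * of_real ((F *v ivec xi) $ i) * g i xi) y"
proof -
 have "(\<Sum>j\<in>UNIV. complex_of_real (F $ i $ j) * (\<i> * of_int (xi $ j) * g i xi)) = \<i> * of_real ((F *v ivec xi) $ i) * g i xi" for xi i
  by (simp add: matrix_vector_mult_def ivec_def sum_distrib_left sum_distrib_right mult_ac)
 then show ?thesis by (simp add: qdiv_def partial_tp tp_cmult tp_sum)
qed

definition wave_vec :: "real^'m::finite^'d::finite => real^'d => int^'m => complex^'d" where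
 "wave_vec F K xi = cvec (K + F *v ivec xi)"

text \<open>The symbol of the shifted operator -\<triangle>_K at frequency xi; its zeros with xi
  \<noteq> 0 are the resonances.\<close>

definition detuning :: "real^'m::finite^'d::finite => real^'d => int^'m => real" where
 "detuning F K xi = (norm (F *v ivec xi + K))^2 - (norm K)\<^sup>2"

lemma detuning_0 [simp]: "detuning F K 0 = 0"
 by (simp add: detuning_def)

lemma cdot_sum_right: "cdot u (\<Sum>i\<in>I. v i) = (\<Sum>i\<in>I. cdot u (v i))"
 unfolding cdot_def sum_component sum_distrib_left by (rule sum.swap)

lemma cdot_add_right: "cdot u (v + w) = cdot u v + cdot u w"
 by (simp add: cdot_def sum.distrib distrib_left)

lemma cdot_smult_right: "cdot u (a *s v) = a * cdot u v"
 by (simp add: cdot_def sum_distrib_left mult_ac)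

lemma cdot_0_right [simp]: "cdot u 0 = 0"
 by (simp add: cdot_def)

lemma cdot_wave_vec: "cdot (wave_vec F K xi) (wave_vec F K xi) = of_real (detuning F K xi + (norm K)^2)"
 by (simp add: cdot_def wave_vec_def cvec_def detuning_def power2_norm_eq_inner inner_vec_def add.commute)

lemma neg_laplace_shift_tp:
 "neg_laplace_shift F K (tp Lambda c) y = tp Lambda (\<lambda>xi. of_real (detuning F K xi) * c xi) y"
proof -
 have q: "qgrad F (tp Lambda c) = (\<lambda>y. \<chi> i. tp Lambda (\<lambda>xi. \<i> * of_real ((F *v ivec xi) $ i) * c xi) y)"
  by (simp add: fun_eq_iff vec_eq_iff qgrad_tp)
 have d: "cdot (cvec K) (qgrad F (tp Lambda c) y) = tp Lambda (\<lambda>xi. \<i> * of_real (K \<bullet> (F *v ivec xi)) * c xi) y"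
  by (simp add: cdot_def cvec_def qgrad_tp tp_cmult tp_sum)
    (intro tp_cong, simp add: inner_vec_def sum_distrib_left sum_distrib_right mult_ac)
 have "neg_laplace_shift F K (tp Lambda c) y = (-1) * tp Lambda (\<lambda>xi. \<Sum>i\<in>UNIV. \<i> * of_real ((F *v ivec xi) $ i) * (\<i> * of_real ((F *v ivec xi) $ i) * c xi)) y
   + (- 2 * \<i>) * tp Lambda (\<lambda>xi. \<i> * of_real (K \<bullet> (F *v ivec xi)) * c xi) y"
  unfolding neg_laplace_shift_def d unfolding q qdiv_tp by simp
 also have "... = tp Lambda (\<lambda>xi. of_real (detuning F K xi) * c xi) y"
  unfolding tp_cmult tp_add
 proof (rule tp_cong)
  fix xi :: "int^'a"
  have s: "(\<Sum>i\<in>UNIV. \<i> * of_real ((F *v ivec xi) $ i) * (\<i> * of_real ((F *v ivec xi) $ i) * c xi)) = - of_real ((F *v ivec xi) \<bullet> (F *v ivec xi)) * c xi"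
   by (simp add: inner_vec_def sum_distrib_left sum_negf algebra_simps)
  have "detuning F K xi = (F *v ivec xi) \<bullet> (F *v ivec xi) + 2 * (K \<bullet> (F *v ivec xi))"
   by (simp add: detuning_def power2_norm_eq_inner inner_add_left inner_add_right inner_commute)
  then show "- 1 * (\<Sum>i\<in>UNIV. \<i> * of_real ((F *v ivec xi) $ i) * (\<i> * of_real ((F *v ivec xi) $ i) * c xi)) +
     - 2 * \<i> * (\<i> * of_real (K \<bullet> (F *v ivec xi)) * c xi) = of_real (detuning F K xi) * c xi"
  proof -
   have e: "\<i> * (\<i> * x) = - x" for x by simp
   assume "detuning F K xi = (F *v ivec xi) \<bullet> (F *v ivec xi) + 2 * (K \<bullet> (F *v ivec xi))"
   then show ?thesis unfolding s by (simp add: e mult.assoc distrib_right)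
  qed
 qed
 finally show ?thesis .
qed

text \<open>Uniqueness is the point. Inside \<open>Lambda\<close> the coefficients are forced by the
  nonzero symbol, or by the mean for xi = 0. Outside, where the symbol may vanish, they are forced
  to be 0 by the requirement that the solution has no new frequencies.\<close>

lemma mean_zero_solution_tp:
 assumes fin: "finite Lambda" and z: "0 \<in> Lambda" and g0: "g 0 = 0" and nz: "!!xi. xi \<in> Lambda ==> xi ~= 0 ==> detuning F K xi ~= 0"
 shows "mean_zero_solution F K (tp Lambda g) = tp Lambda (\<lambda>xi. g xi / of_real (detuning F K xi))"
proof -
 let ?\<psi> = "tp Lambda (\<lambda>xi. g xi / of_real (detuning F K xi))"
 let ?P = "\<lambda>\<psi>. trig_poly \<psi> \<and> torus_mean \<psi> = 0 \<and> (\<forall>y. neg_laplace_shift F K \<psi> y = tp Lambda g y) \<and>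
   (\<forall>xi. torus_fourier (tp Lambda g) xi = 0 --> torus_fourier \<psi> xi = 0)"
 have "?P ?\<psi>"
 proof (intro conjI allI impI)
  show "trig_poly ?\<psi>" unfolding trig_poly_def tp_def
   by (intro exI[of _ Lambda] exI[of _ "\<lambda>xi. g xi / of_real (detuning F K xi)"]) (use fin in simp)
  show "torus_mean ?\<psi> = 0" by (simp add: torus_mean_tp[OF fin] g0)
  show "neg_laplace_shift F K ?\<psi> y = tp Lambda g y" for y
   unfolding neg_laplace_shift_tp by (rule tp_cong) (use nz g0 in force)
  show "torus_fourier ?\<psi> xi = 0" if "torus_fourier (tp Lambda g) xi = 0" for xi
   using that by (auto simp: torus_fourier_tp[OF fin])
 qed
 moreover have "\<psi> = ?\<psi>" if P: "?P \<psi>" for \<psi>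
 proof -
  obtain S c where S: "finite S" and \<psi>: "\<psi> = tp S c"
   using P unfolding trig_poly_def tp_def[abs_def] by (auto simp: fun_eq_iff)
  define c' where "c' xi = (if xi \<in> S then c xi else 0)" for xi
  \<comment> \<open>Outside \<open>Lambda\<close> the right-hand side has zero Fourier coefficient,
    so the frequency condition in the definition of the solution applies.\<close>
  have c0: "c' xi = 0" if "xi \<notin> Lambda" for xi
  proof -
   have "torus_fourier \<psi> xi = 0" using P that by (auto simp: torus_fourier_tp[OF fin])
   then show ?thesis by (auto simp: \<psi> torus_fourier_tp[OF S] c'_def split: if_splits)
  qed
  have "\<psi> y = tp Lambda c' y" for y
  proof -
   have "tp S c y = tp (S \<union> Lambda) c' y"
    unfolding tp_def using S fin by (intro sum.mono_neutral_cong_left) (auto simp: c'_def)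
   also have "... = tp Lambda c' y"
    unfolding tp_def using S fin c0 by (intro sum.mono_neutral_right) auto
   finally show ?thesis by (simp add: \<psi>)
  qed
  then have \<psi>': "\<psi> = tp Lambda c'" by (rule ext)
  have "tp Lambda (\<lambda>xi. of_real (detuning F K xi) * c' xi) = tp Lambda g"
   using P unfolding \<psi>' neg_laplace_shift_tp by (simp add: fun_eq_iff)
  then have eq: "of_real (detuning F K xi) * c' xi = g xi" if "xi \<in> Lambda" for xi
   using that by (simp add: tp_eq_iff[OF fin])
  have m0: "c' 0 = 0" using P z by (simp add: \<psi>' torus_mean_tp[OF fin])
  have "c' xi = g xi / of_real (detuning F K xi)" if "xi \<in> Lambda" for xi
   using eq[OF that] nz[OF that] m0 g0 by (cases "xi = 0") (auto simp: field_simps)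
  then show ?thesis unfolding \<psi>' by (simp add: tp_eq_iff[OF fin])
 qed
 ultimately show ?thesis unfolding mean_zero_solution_def by (rule the_equality)
qed

text \<open>A convolution by a frequency shift keeps its index set, provided that every term shifted
  out of \<open>Lambda\<close> is zero. It handles the product of the coefficient field with a
  trigonometric polynomial or with a sum of packets.\<close>

lemma sum_shift:
 fixes h E :: "'a::ab_group_add => complex"
 assumes "finite S" "finite Lambda" "!!eta. eta \<notin> S ==> h eta = 0" "!!eta. eta \<in> S ==> eta + zeta \<notin> Lambda ==> h eta = 0"
 shows "(\<Sum>eta\<in>S. h eta * E (eta + zeta)) = (\<Sum>xi\<in>Lambda. h (xi - zeta) * E xi)"
proof -
 have "(\<Sum>xi\<in>Lambda. h (xi - zeta) * E xi) = (\<Sum>eta\<in>(\<lambda>xi. xi - zeta) ` Lambda. h eta * E (eta + zeta))"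
  by (subst sum.reindex) (auto simp: inj_on_def)
 also have "... = (\<Sum>eta\<in>S \<union> (\<lambda>xi. xi - zeta) ` Lambda. h eta * E (eta + zeta))"
 proof (rule sum.mono_neutral_left)
  show "\<forall>i\<in>S \<union> (\<lambda>xi. xi - zeta) ` Lambda - (\<lambda>xi. xi - zeta) ` Lambda. h i * E (i + zeta) = 0"
   using assms(4) by (force simp: image_iff)
 qed (use assms in auto)
 also have "... = (\<Sum>eta\<in>S. h eta * E (eta + zeta))"
  using assms by (intro sum.mono_neutral_right) auto
 finally show ?thesis by simp
qed

section \<open>Rational functions of the wave vector\<close>

text \<open>Rational functions of K without poles on \<open>U\<close>. Being closed under the field
  operations and under differentiation, the class delivers smoothness and continuity of all
  coefficients without tracking derivatives of the recursion.\<close>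

inductive rational_on :: "(real^'d::finite) set => (real^'d => complex) => bool" for U where
 const: "rational_on U (\<lambda>k. c)"
| coord: "rational_on U (\<lambda>k. of_real (k $ i))"
| add: "rational_on U f ==> rational_on U g ==> rational_on U (\<lambda>k. f k + g k)"
| mult: "rational_on U f ==> rational_on U g ==> rational_on U (\<lambda>k. f k * g k)"
| inv: "rational_on U f ==> (!!k. k \<in> U ==> f k ~= 0) ==> rational_on U (\<lambda>k. inverse (f k))"

lemma rational_on_sum: "(!!i. i \<in> I ==> rational_on U (f i)) ==> rational_on U (\<lambda>k. \<Sum>i\<in>I. f i k)"
 by (induction I rule: infinite_finite_induct) (auto intro: rational_on.intros)

lemma rational_on_derivative:
 assumes "rational_on U f"
 shows "\<exists>g. (\<forall>i. rational_on U (g i)) \<and> (\<forall>x\<in>U. (f has_derivative (\<lambda>h. \<Sum>i\<in>UNIV. h $ i *\<^sub>R g i x)) (at x))"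
 using assms
proof induction
 case (const c)
 show ?case by (rule exI[of _ "\<lambda>i k. 0"]) (auto intro: rational_on.intros)
next
 case (coord j)
 have "((\<lambda>k::real^'a. complex_of_real (k $ j)) has_derivative (\<lambda>h. \<Sum>i\<in>UNIV. h $ i *\<^sub>R (if i = j then 1 else 0))) (at x)" for x
 proof -
  have "((\<lambda>k::real^'a. complex_of_real (k $ j)) has_derivative (\<lambda>h. of_real (h $ j))) (at x)"
   by (auto intro!: derivative_eq_intros bounded_linear_imp_has_derivative[OF bounded_linear_vec_nth])
  moreover have "(\<lambda>h::real^'a. \<Sum>i\<in>UNIV. h $ i *\<^sub>R (if i = j then 1 else 0)) = (\<lambda>h. complex_of_real (h $ j))"
   by (rule ext) (simp add: scaleR_conv_of_real if_distrib[of "\<lambda>r. _ * r"] cong: if_cong)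
  ultimately show ?thesis by simp
 qed
 then show ?case
  by (intro exI[of _ "\<lambda>i k. if i = j then 1 else 0"]) (auto intro: rational_on.intros)
next
 case (add f g)
 then obtain f' g' where f': "!!i. rational_on U (f' i)" "!!x. x \<in> U ==> (f has_derivative (\<lambda>h. \<Sum>i\<in>UNIV. h $ i *\<^sub>R f' i x)) (at x)"
  and g': "!!i. rational_on U (g' i)" "!!x. x \<in> U ==> (g has_derivative (\<lambda>h. \<Sum>i\<in>UNIV. h $ i *\<^sub>R g' i x)) (at x)" by blast
 have "((\<lambda>k. f k + g k) has_derivative (\<lambda>h. \<Sum>i\<in>UNIV. h $ i *\<^sub>R (f' i x + g' i x))) (at x)" if "x \<in> U" for x
  by (rule has_derivative_eq_rhs[OF has_derivative_add[OF f'(2)[OF that] g'(2)[OF that]]])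
   (simp add: scaleR_add_right sum.distrib)
 then show ?case using f'(1) g'(1)
  by (intro exI[of _ "\<lambda>i k. f' i k + g' i k"]) (auto intro: rational_on.intros)
next
 case (mult f g)
 then obtain f' g' where f': "!!i. rational_on U (f' i)" "!!x. x \<in> U ==> (f has_derivative (\<lambda>h. \<Sum>i\<in>UNIV. h $ i *\<^sub>R f' i x)) (at x)"
  and g': "!!i. rational_on U (g' i)" "!!x. x \<in> U ==> (g has_derivative (\<lambda>h. \<Sum>i\<in>UNIV. h $ i *\<^sub>R g' i x)) (at x)" by blast
 have "((\<lambda>k. f k * g k) has_derivative (\<lambda>h. \<Sum>i\<in>UNIV. h $ i *\<^sub>R (f x * g' i x + f' i x * g x))) (at x)" if "x \<in> U" for x
  by (rule has_derivative_eq_rhs[OF has_derivative_mult[OF f'(2)[OF that] g'(2)[OF that]]])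
   (simp add: scaleR_add_right sum.distrib sum_distrib_left sum_distrib_right)
 then show ?case using f'(1) g'(1) mult.hyps
  by (intro exI[of _ "\<lambda>i k. f k * g' i k + f' i k * g k"]) (auto intro!: rational_on.add rational_on.mult)
next
 case (inv f)
 then obtain f' where f': "!!i. rational_on U (f' i)" "!!x. x \<in> U ==> (f has_derivative (\<lambda>h. \<Sum>i\<in>UNIV. h $ i *\<^sub>R f' i x)) (at x)" by blast
 have "((\<lambda>k. inverse (f k)) has_derivative (\<lambda>h. \<Sum>i\<in>UNIV. h $ i *\<^sub>R ((-1) * (inverse (f x) * (f' i x * inverse (f x)))))) (at x)" if "x \<in> U" for x
  by (rule has_derivative_eq_rhs[OF Deriv.has_derivative_inverse[OF inv.hyps(2)[OF that] f'(2)[OF that]]])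
   (simp add: sum_distrib_left sum_distrib_right sum_negf mult.assoc)
 moreover have "rational_on U (\<lambda>k. (-1) * (inverse (f k) * (f' i k * inverse (f k))))" for i
  by (intro rational_on.mult rational_on.const rational_on.inv inv.hyps f')
 ultimately show ?case
  by (intro exI[of _ "\<lambda>i k. (-1) * (inverse (f k) * (f' i k * inverse (f k)))"]) blast
qed

lemma rational_on_differentiable: "rational_on U f ==> x \<in> U ==> f differentiable (at x)"
 by (drule rational_on_derivative) (auto simp: differentiable_def)

lemma rational_on_continuous: "rational_on U f ==> continuous_on U f"
proof (rule continuous_at_imp_continuous_on, rule ballI)
 fix x assume "rational_on U f" "x \<in> U"
 then show "isCont f x" by (intro differentiable_imp_continuous_within rational_on_differentiable)
qed

lemma smooth_on_has_derivative:
 "smooth_on U g ==> x \<in> U ==> (partials is g has_derivative frechet_derivative (partials is g) (at x)) (at x)"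
 by (simp add: smooth_on_def frechet_derivative_works[symmetric])

text \<open>A partial derivative of a rational function agrees with a rational function on
  \<open>U\<close> only; this is enough to continue the induction because \<open>U\<close> is open
  and derivatives are local.\<close>

lemma rational_on_partials:
 assumes U: "open U" and f: "rational_on U f"
 shows "\<exists>g. rational_on U g \<and> (\<forall>x\<in>U. partials is f x = g x \<and> partials is f differentiable (at x))"
proof (induction "is")
 case Nil
 show ?case using f rational_on_derivative[OF f] by (auto simp: differentiable_def)
next
 case (Cons i "is")
 then obtain g where g: "rational_on U g" "!!x. x \<in> U ==> partials is f x = g x" by blast
 obtain g' where g': "!!i. rational_on U (g' i)" "!!x. x \<in> U ==> (g has_derivative (\<lambda>h. \<Sum>i\<in>UNIV. h $ i *\<^sub>R g' i x)) (at x)"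
  using rational_on_derivative[OF g(1)] by blast
 have eq: "partial i (partials is f) x = g' i x" if "x \<in> U" for x
 proof -
  have "(partials is f has_derivative (\<lambda>h. \<Sum>i\<in>UNIV. h $ i *\<^sub>R g' i x)) (at x)"
   by (rule has_derivative_transform_within_open[OF g'(2)[OF that] U that]) (simp add: g)
  from partial_eqI[OF this] show ?thesis
   by (simp add: axis_def if_distrib[of "\<lambda>r. r *\<^sub>R _"] cong: if_cong)
 qed
 have "partial i (partials is f) differentiable (at x)" if x: "x \<in> U" for x
 proof -
  obtain D where "(g' i has_derivative D) (at x)"
   using rational_on_differentiable[OF g'(1)[of i] x] by (auto simp: differentiable_def)
  then have "(partial i (partials is f) has_derivative D) (at x)"
   by (rule has_derivative_transform_within_open[OF _ U x]) (simp add: eq)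
  then show ?thesis by (auto simp: differentiable_def)
 qed
 then show ?case using g'(1)[of i] eq by auto
qed

lemma rational_on_smooth: "open U ==> rational_on U f ==> smooth_on U f"
 using rational_on_partials unfolding smooth_on_def by blast

text \<open>The coefficients defined through the torus coincide with rational functions only where
  the wave vector is regular. Equality on an open set still transfers all derivatives.\<close>

lemma partials_cong_open:
 assumes U: "open U" and eq: "!!x. x \<in> U ==> f x = g x" and sm: "smooth_on U g"
 shows "x \<in> U ==> partials is f x = partials is g x \<and> partials is f differentiable (at x)"
proof (induction "is" arbitrary: x)
 case Nil
 have "(g has_derivative frechet_derivative g (at x)) (at x)"
  using smooth_on_has_derivative[OF sm Nil, of "[]"] by simp
 then have "(f has_derivative frechet_derivative g (at x)) (at x)"
  by (rule has_derivative_transform_within_open[OF _ U Nil]) (simp add: eq)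
 then show ?case using eq[OF Nil] by (auto simp: differentiable_def)
next
 case (Cons i "is")
 have e: "partial i (partials is f) y = partial i (partials is g) y" if "y \<in> U" for y
 proof -
  have d: "(partials is g has_derivative frechet_derivative (partials is g) (at y)) (at y)"
   by (rule smooth_on_has_derivative[OF sm that])
  then have "(partials is f has_derivative frechet_derivative (partials is g) (at y)) (at y)"
   by (rule has_derivative_transform_within_open[OF _ U that]) (simp add: Cons.IH)
  from partial_eqI[OF this] partial_eqI[OF d] show ?thesis by simp
 qed
 have "(partials (i # is) g has_derivative frechet_derivative (partials (i # is) g) (at x)) (at x)"
  by (rule smooth_on_has_derivative[OF sm Cons.prems])
 then have "(partials (i # is) f has_derivative frechet_derivative (partials (i # is) g) (at x)) (at x)"
  by (rule has_derivative_transform_within_open[OF _ U Cons.prems]) (simp add: e)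
 then show ?case using e[OF Cons.prems] by (auto simp: differentiable_def)
qed

lemma partials_real:
 assumes U: "open U" and sm: "smooth_on U f" and re: "!!x. x \<in> U ==> f x \<in> \<real>"
 shows "x \<in> U ==> partials is f x \<in> \<real>"
proof (induction "is" arbitrary: x)
 case (Cons i "is")
 have d: "(partials is f has_derivative frechet_derivative (partials is f) (at x)) (at x)"
  by (rule smooth_on_has_derivative[OF sm Cons.prems])
 have "((\<lambda>x. Im (partials is f x)) has_derivative (\<lambda>h. Im (frechet_derivative (partials is f) (at x) h))) (at x)"
  by (rule has_derivative_Im[OF d])
 then have "((\<lambda>x. 0) has_derivative (\<lambda>h. Im (frechet_derivative (partials is f) (at x) h))) (at x)"
  by (rule has_derivative_transform_within_open[OF _ U Cons.prems]) (use Cons.IH in \<open>auto simp: complex_is_Real_iff\<close>)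
 from has_derivative_unique[OF this has_derivative_const]
 have "Im (frechet_derivative (partials is f) (at x) (axis i 1)) = 0" by (simp add: fun_eq_iff)
 then show ?case by (simp add: partial_eqI[OF d] complex_is_Real_iff)
qed (simp add: re)

section \<open>Rayleigh--Schroedinger series in Fourier coefficients\<close>

text \<open>The coefficient field given by its Fourier coefficients. \<open>a_herm\<close> expresses
  on the Fourier side that the matrices are hermitian, and \<open>N\<close> fixes how many
  multiplications by the field the common frequency set has to accommodate.\<close>

locale trig_field =
 fixes F :: "real^'m::finite^'d::finite" and aT :: "real^'m => complex^'d^'d"
  and a :: "int^'m => complex^'d^'d" and S :: "(int^'m) set" and N :: nat
 assumes finite_S: "finite S" and a_supp: "!!eta. eta \<notin> S ==> a eta = 0"
  and aT_eq: "!!y i j. aT y $ i $ j = (\<Sum>eta\<in>S. a eta $ i $ j * cis (ivec eta \<bullet> y))"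
  and a_herm: "!!eta i j. a (- eta) $ i $ j = cnj (a eta $ j $ i)"
begin

text \<open>The frequencies reachable from 0 by adding at most n frequencies of the field. The n-th
  corrector lives on \<open>levels n\<close>, and one more multiplication by the field leads to
  \<open>levels (Suc n)\<close>.\<close>

primrec levels :: "nat => (int^'m) set" where
 "levels 0 = {0}"
| "levels (Suc n) = levels n \<union> (\<lambda>(zeta, eta). eta + zeta) ` (levels n \<times> S)"

definition freqs :: "(int^'m) set" where "freqs = levels N"

lemma finite_levels: "finite (levels n)"
 by (induction n) (auto simp: finite_S)

lemma levels_mono: "m <= n ==> levels m \<subseteq> levels n"
 by (induction n rule: dec_induct) auto

lemma levels_add: "zeta \<in> levels n ==> eta \<in> S ==> eta + zeta \<in> levels (Suc n)"
 by force

lemma zero_levels: "0 \<in> levels n"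
 using levels_mono[of 0 n] by auto

lemma finite_freqs: "finite freqs" and zero_freqs: "0 \<in> freqs"
 by (auto simp: freqs_def finite_levels zero_levels)

lemma levels_freqs: "n <= N ==> levels n \<subseteq> freqs"
 unfolding freqs_def by (rule levels_mono)

text \<open>The Fourier coefficients of the field applied to the shifted gradient. The sum is
  truncated to \<open>freqs\<close>; nothing is lost for coefficients supported on
  \<open>levels n\<close> with n < N.\<close>

definition flux :: "(int^'m => complex) => real^'d => int^'m => complex^'d" where
 "flux c K xi = (\<Sum>zeta\<in>freqs. (\<i> * c zeta) *s (a (xi - zeta) *v wave_vec F K zeta))"

definition nu_coeff :: "(int^'m => complex) => real^'d => complex" where
 "nu_coeff c K = - \<i> * cdot (cvec K) (flux c K 0)"

text \<open>Kept apart from \<open>phi\<close> so that \<open>pot\<close> is the only recursive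
  object: each corrector is recovered from its vector potential by a shifted divergence.\<close>

definition phi_of :: "nat => real^'d => (int^'m => complex^'d) => int^'m => complex" where
 "phi_of n K d xi = (if n = 0 \<and> xi = 0 then 1 else 0) + \<i> * cdot (wave_vec F K xi) (d xi)"

text \<open>The Fourier coefficients of vector fields \<open>\<psi>\<^sup>n\<close> such that \<open>\<phi>\<^sup>n = (\<nabla> + i K) \<cdot> \<psi>\<^sup>n\<close> for \<open>n >= 1\<close>.
 Thanks to this divergence form, the initial error is bounded in \<open>H\<^bsup>-1\<^esup>\<close> even if \<open>K + F \<xi>\<close>
 vanishes for some \<open>\<xi>\<close>.\<close>
fun pot :: "nat => real^'d => int^'m => complex^'d" where
 "pot 0 K = (\<lambda>xi. 0)"
| "pot (Suc n) K = (\<lambda>xi. if xi \<in> freqs \<and> xi ~= 0 then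
   (1 / of_real (detuning F K xi)) *s (flux (phi_of n K (pot n K)) K xi
    + (\<Sum>l<n. nu_coeff (phi_of l K (pot l K)) K *s pot (n - l) K xi)) else 0)"

definition phi :: "nat => real^'d => int^'m => complex" where
 "phi n K = phi_of n K (pot n K)"

definition nu :: "nat => real^'d => complex" where
 "nu n K = nu_coeff (phi n K) K"

definition regular :: "real^'d => bool" where
 "regular K \<longleftrightarrow> (\<forall>xi\<in>freqs. xi ~= 0 --> detuning F K xi ~= 0)"

lemma phi_eq: "phi n K xi = (if n = 0 \<and> xi = 0 then 1 else 0) + \<i> * cdot (wave_vec F K xi) (pot n K xi)"
 by (simp add: phi_def phi_of_def)

lemma pot_Suc: "pot (Suc n) K xi = (if xi \<in> freqs \<and> xi ~= 0 then
   (1 / of_real (detuning F K xi)) *s (flux (phi n K) K xi + (\<Sum>l<n. nu l K *s pot (n - l) K xi)) else 0)"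
 by (simp add: phi_def[abs_def] nu_def)

declare pot.simps(2) [simp del]

lemma phi_0: "phi 0 K xi = (if xi = 0 then 1 else 0)"
 by (simp add: phi_eq)

lemma pot_at_0: "pot n K 0 = 0"
 by (cases n) (auto simp: pot_Suc)

lemma phi_at_0: "phi n K 0 = (if n = 0 then 1 else 0)"
 by (simp add: phi_eq pot_at_0)

lemma phi_supp_aux: "(xi \<notin> levels n --> pot n K xi = 0) ==> xi \<notin> levels n ==> phi n K xi = 0"
 using zero_levels[of n] by (auto simp: phi_eq)

lemma flux_supp:
 assumes "!!zeta. zeta \<notin> levels n ==> c zeta = 0" "xi \<notin> levels (Suc n)"
 shows "flux c K xi = 0"
 unfolding flux_def
proof (intro sum.neutral ballI)
 fix zeta assume "zeta \<in> freqs"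
 show "(\<i> * c zeta) *s (a (xi - zeta) *v wave_vec F K zeta) = 0"
 proof (cases "zeta \<in> levels n")
  case True
  then have "xi - zeta \<notin> S" using levels_add[OF True, of "xi - zeta"] assms(2) by auto
  then show ?thesis by (simp add: a_supp)
 qed (simp add: assms(1))
qed

lemma pot_supp: "xi \<notin> levels n ==> pot n K xi = 0"
proof (induction n arbitrary: xi rule: less_induct)
 case (less n)
 show ?case
 proof (cases n)
  case (Suc m)
  have f: "flux (phi m K) K xi = 0"
   using less Suc by (intro flux_supp[of m]) (auto intro!: phi_supp_aux)
  have "pot (m - l) K xi = 0" if "l < m" for l
   using less.prems Suc levels_mono[OF le_SucI[OF diff_le_self], of m l] that by (intro less.IH) auto
  then show ?thesis using f by (simp add: Suc pot_Suc)
 qed simp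
qed

lemma phi_supp: "xi \<notin> levels n ==> phi n K xi = 0"
 using phi_supp_aux pot_supp by blast

lemma cdot_wave_vec_0: "wave_vec F K 0 = cvec K"
 by (simp add: wave_vec_def)

text \<open>Letting l run up to n, not only up to n - 1, makes the identity valid at xi = 0 as well.
  There the left side vanishes, only l = n survives on the right, and the equation becomes the
  definition of nu n. For xi \<noteq> 0 the added term contains \<open>phi 0\<close> and is
  zero.\<close>

lemma phi_recursion:
 assumes K: "regular K" and xi: "xi \<in> freqs"
 shows "of_real (detuning F K xi) * phi (Suc n) K xi = \<i> * cdot (wave_vec F K xi) (flux (phi n K) K xi) + (\<Sum>l\<le>n. nu l K * phi (n - l) K xi)"
proof (cases "xi = 0")
 case True
 have "(\<Sum>l\<le>n. nu l K * phi (n - l) K 0) = (\<Sum>l\<le>n. if l = n then nu l K else 0)"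
  by (intro sum.cong refl) (auto simp: phi_at_0)
 then show ?thesis using True by (simp add: cdot_wave_vec_0 nu_def nu_coeff_def)
next
 case False
 then have d: "detuning F K xi ~= 0" using K xi by (auto simp: regular_def)
 have "(\<Sum>l\<le>n. nu l K * phi (n - l) K xi) = (\<Sum>l<n. nu l K * phi (n - l) K xi) + nu n K * phi 0 K xi"
  by (simp flip: lessThan_Suc_atMost)
 also have "... = (\<Sum>l<n. nu l K * (\<i> * cdot (wave_vec F K xi) (pot (n - l) K xi)))"
  using False by (simp add: phi_0) (simp add: phi_eq False)
 finally have s: "(\<Sum>l\<le>n. nu l K * phi (n - l) K xi) = \<i> * (\<Sum>l<n. nu l K * cdot (wave_vec F K xi) (pot (n - l) K xi))"
  by (simp add: sum_distrib_left mult_ac)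
 show ?thesis
  unfolding s using False xi d
  by (simp add: phi_eq pot_Suc cdot_smult_right cdot_add_right cdot_sum_right distrib_left)
qed

lemma qgrad_shift_tp: "qgrad_shift F K (tp Lambda c) y $ j = tp Lambda (\<lambda>xi. \<i> * c xi * wave_vec F K xi $ j) y"
proof -
 have "qgrad_shift F K (tp Lambda c) y $ j = tp Lambda (\<lambda>xi. \<i> * of_real ((F *v ivec xi) $ j) * c xi) y + (\<i> * of_real (K $ j)) * tp Lambda c y"
  by (simp add: qgrad_shift_def qgrad_tp cvec_def mult_ac)
 also have "... = tp Lambda (\<lambda>xi. \<i> * c xi * wave_vec F K xi $ j) y"
  unfolding tp_cmult tp_add by (rule tp_cong) (simp add: wave_vec_def cvec_def algebra_simps)
 finally show ?thesis .
qed

text \<open>The product of two trigonometric polynomials is a discrete convolution of coefficients.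
  The condition n < N guarantees that all resulting frequencies still belong to
  \<open>freqs\<close>.\<close>

lemma flux_tp:
 assumes c: "!!zeta. zeta \<notin> levels n ==> c zeta = 0" and n: "n < N"
 shows "(aT y *v qgrad_shift F K (tp freqs c) y) $ i = tp freqs (\<lambda>xi. flux c K xi $ i) y"
proof -
 define E where "E xi = cis (ivec xi \<bullet> y)" for xi :: "int^'m"
 have E: "E (eta + zeta) = E eta * E zeta" for eta zeta by (simp add: E_def ivec_add inner_add_left cis_mult)
 define h where "h zeta eta = (\<Sum>j\<in>UNIV. a eta $ i $ j * (\<i> * c zeta * wave_vec F K zeta $ j))" for zeta eta
 have "(aT y *v qgrad_shift F K (tp freqs c) y) $ i = (\<Sum>j\<in>UNIV. (\<Sum>eta\<in>S. a eta $ i $ j * E eta) * (\<Sum>zeta\<in>freqs. \<i> * c zeta * wave_vec F K zeta $ j * E zeta))"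
  by (simp add: matrix_vector_mult_def aT_eq qgrad_shift_tp tp_def E_def)
 also have "... = (\<Sum>j\<in>UNIV. \<Sum>zeta\<in>freqs. \<Sum>eta\<in>S. a eta $ i $ j * (\<i> * c zeta * wave_vec F K zeta $ j) * E (eta + zeta))"
 proof (rule sum.cong[OF refl])
  fix j
  have "(\<Sum>eta\<in>S. a eta $ i $ j * E eta) * (\<Sum>zeta\<in>freqs. \<i> * c zeta * wave_vec F K zeta $ j * E zeta) =
   (\<Sum>eta\<in>S. \<Sum>zeta\<in>freqs. a eta $ i $ j * E eta * (\<i> * c zeta * wave_vec F K zeta $ j * E zeta))"
   by (rule sum_product)
  also have "... = (\<Sum>zeta\<in>freqs. \<Sum>eta\<in>S. a eta $ i $ j * E eta * (\<i> * c zeta * wave_vec F K zeta $ j * E zeta))"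
   by (rule sum.swap)
  finally show "(\<Sum>eta\<in>S. a eta $ i $ j * E eta) * (\<Sum>zeta\<in>freqs. \<i> * c zeta * wave_vec F K zeta $ j * E zeta) =
   (\<Sum>zeta\<in>freqs. \<Sum>eta\<in>S. a eta $ i $ j * (\<i> * c zeta * wave_vec F K zeta $ j) * E (eta + zeta))"
   by (simp add: E mult_ac)
 qed
 also have "... = (\<Sum>zeta\<in>freqs. \<Sum>j\<in>UNIV. \<Sum>eta\<in>S. a eta $ i $ j * (\<i> * c zeta * wave_vec F K zeta $ j) * E (eta + zeta))"
  by (rule sum.swap)
 also have "... = (\<Sum>zeta\<in>freqs. \<Sum>eta\<in>S. h zeta eta * E (eta + zeta))"
  unfolding h_def sum_distrib_right by (intro sum.cong refl) (rule sum.swap)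
 also have "... = (\<Sum>zeta\<in>freqs. \<Sum>xi\<in>freqs. h zeta (xi - zeta) * E xi)"
 proof (rule sum.cong[OF refl])
  fix zeta
  have z: "h zeta eta = 0" if "eta \<in> S" "eta + zeta \<notin> freqs" for eta
  proof -
   have "zeta \<notin> levels n" using levels_add[of zeta n eta] that levels_freqs[of "Suc n"] n by auto
   then show ?thesis by (simp add: h_def c)
  qed
  show "(\<Sum>eta\<in>S. h zeta eta * E (eta + zeta)) = (\<Sum>xi\<in>freqs. h zeta (xi - zeta) * E xi)"
   by (rule sum_shift[OF finite_S finite_freqs]) (simp_all add: z, simp add: h_def a_supp)
 qed
 also have "... = (\<Sum>xi\<in>freqs. (\<Sum>zeta\<in>freqs. h zeta (xi - zeta)) * E xi)"
  unfolding sum_distrib_right by (rule sum.swap)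
 also have "... = tp freqs (\<lambda>xi. flux c K xi $ i) y"
  unfolding tp_def E_def[symmetric]
  by (intro sum.cong refl arg_cong2[of _ _ _ _ "(*)"])
   (simp add: flux_def h_def matrix_vector_mult_def sum_distrib_left mult_ac)
 finally show ?thesis .
qed

lemma nu_of_tp:
 assumes c: "!!zeta. zeta \<notin> levels n ==> c zeta = 0" and n: "n < N"
 shows "nu_of F aT K (tp freqs c) = nu_coeff c K"
proof -
 have "torus_mean_vec (\<lambda>y. aT y *v qgrad_shift F K (tp freqs c) y) = flux c K 0"
  unfolding torus_mean_vec_def vec_eq_iff
  by (simp add: flux_tp[OF c n] torus_mean_tp[OF finite_freqs, of "\<lambda>xi. flux c K xi $ _", unfolded tp_def[abs_def]]
   torus_mean_tp[OF finite_freqs] zero_freqs)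
 then show ?thesis by (simp add: nu_of_def nu_coeff_def)
qed

text \<open>Connects the correctors defined by a boundary-free PDE on the torus with the algebraic
  recursion. At each order the right-hand side is a trigonometric polynomial over
  \<open>freqs\<close> with zero mean coefficient, so \<open>mean_zero_solution_tp\<close> divides
  it by the symbol.\<close>

lemma rs_phi_eq:
 assumes K: "regular K"
 shows "n <= N ==> rs_phi F aT K n = tp freqs (phi n K)"
proof (induction n rule: less_induct)
 case (less n)
 show ?case
 proof (cases n)
  case 0
  show ?thesis unfolding 0 phi_0[abs_def] by (simp add: fun_eq_iff tp_const[OF finite_freqs zero_freqs])
 next
  case (Suc m)
  have IH: "rs_phi F aT K l = tp freqs (phi l K)" if "l <= m" for l using less that Suc by auto
  define f where "f xi = \<i> * cdot (wave_vec F K xi) (flux (phi m K) K xi)" for xi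
  define g where "g xi = (if xi = 0 then 0 else f xi) + (\<Sum>l<m. nu l K * phi (m - l) K xi)" for xi
  have m: "m < N" using less.prems Suc by simp
  have G: "(\<lambda>y. aT y *v qgrad_shift F K (rs_phi F aT K m) y) = (\<lambda>y. \<chi> i. tp freqs (\<lambda>xi. flux (phi m K) K xi $ i) y)"
   using flux_tp[OF phi_supp m] by (simp add: fun_eq_iff vec_eq_iff IH)
  have q: "qdiv_shift F K (\<lambda>y. aT y *v qgrad_shift F K (rs_phi F aT K m) y) = tp freqs f"
  proof (rule ext)
   fix y
   have "qdiv_shift F K (\<lambda>y. aT y *v qgrad_shift F K (rs_phi F aT K m) y) y =
    tp freqs (\<lambda>xi. \<Sum>i\<in>UNIV. \<i> * of_real ((F *v ivec xi) $ i) * flux (phi m K) K xi $ i) y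
    + tp freqs (\<lambda>xi. \<i> * (\<Sum>i\<in>UNIV. of_real (K $ i) * flux (phi m K) K xi $ i)) y"
    unfolding qdiv_shift_def G qdiv_tp by (simp add: cdot_def cvec_def tp_cmult tp_sum)
   also have "... = tp freqs f y"
    unfolding tp_add by (rule tp_cong)
     (simp add: f_def cdot_def wave_vec_def cvec_def sum_distrib_left sum.distrib algebra_simps)
   finally show "qdiv_shift F K (\<lambda>y. aT y *v qgrad_shift F K (rs_phi F aT K m) y) y = tp freqs f y" .
  qed
  have nu: "nu_of F aT K (rs_phi F aT K l) = nu l K" if "l < m" for l
   using nu_of_tp[OF phi_supp, of l] IH[of l] that m by (simp add: nu_def)
  have rhs: "(\<lambda>y. mean_free (qdiv_shift F K (\<lambda>y. aT y *v qgrad_shift F K (rs_phi F aT K m) y)) y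
   + (\<Sum>l<m. nu_of F aT K (rs_phi F aT K l) * rs_phi F aT K (m - l) y)) = tp freqs g"
  proof (rule ext)
   fix y
   have "mean_free (tp freqs f) y = tp freqs f y + (-1) * tp freqs (\<lambda>xi. if xi = 0 then f 0 else 0) y"
    by (simp add: mean_free_def torus_mean_tp[OF finite_freqs] zero_freqs tp_const[OF finite_freqs])
   also have "... = tp freqs (\<lambda>xi. if xi = 0 then 0 else f xi) y"
    unfolding tp_cmult tp_add by (rule tp_cong) auto
   finally have 1: "mean_free (tp freqs f) y = tp freqs (\<lambda>xi. if xi = 0 then 0 else f xi) y" .
   have 2: "(\<Sum>l<m. nu_of F aT K (rs_phi F aT K l) * rs_phi F aT K (m - l) y) = tp freqs (\<lambda>xi. \<Sum>l<m. nu l K * phi (m - l) K xi) y"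
    unfolding tp_sum[symmetric] tp_cmult[symmetric]
   proof (rule sum.cong[OF refl])
    fix l assume "l \<in> {..<m}"
    then have "l < m" by simp
    from nu[OF this] show "nu_of F aT K (rs_phi F aT K l) * rs_phi F aT K (m - l) y = nu l K * tp freqs (phi (m - l) K) y"
     by (simp only: IH[OF diff_le_self])
   qed
   show "mean_free (qdiv_shift F K (\<lambda>y. aT y *v qgrad_shift F K (rs_phi F aT K m) y)) y
    + (\<Sum>l<m. nu_of F aT K (rs_phi F aT K l) * rs_phi F aT K (m - l) y) = tp freqs g y"
    unfolding q 1 2 tp_add g_def ..
  qed
  have g0: "g 0 = 0" by (simp add: g_def phi_at_0)
  have "rs_phi F aT K n = tp freqs (\<lambda>xi. g xi / of_real (detuning F K xi))"
   unfolding Suc rs_phi.simps rhs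
   by (rule mean_zero_solution_tp[where K=K and F=F and g=g and Lambda=freqs]) (use K g0 in \<open>auto simp: finite_freqs zero_freqs regular_def\<close>)
  also have "... = tp freqs (phi n K)"
   unfolding tp_eq_iff[OF finite_freqs]
  proof
   fix xi assume xi: "xi \<in> freqs"
   show "g xi / of_real (detuning F K xi) = phi n K xi"
   proof (cases "xi = 0")
    case True then show ?thesis by (simp add: Suc phi_at_0)
   next
    case False
    then have d: "detuning F K xi ~= 0" using K xi by (auto simp: regular_def)
    \<comment> \<open>The additional summand l = m contains \<open>phi 0\<close>, which vanishes
      away from frequency 0; hence the recursion with the longer sum can be used.\<close>
    have "g xi = f xi + (\<Sum>l\<le>m. nu l K * phi (m - l) K xi)"
     using False by (simp add: g_def phi_0 flip: lessThan_Suc_atMost)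
    then have "g xi = of_real (detuning F K xi) * phi (Suc m) K xi"
     unfolding phi_recursion[OF K xi] f_def .
    then show ?thesis using d by (simp add: Suc)
   qed
  qed
  finally show ?thesis .
 qed
qed

lemma rs_nu_eq: "regular K ==> n < N ==> rs_nu F aT n K = nu n K"
 using nu_of_tp[OF phi_supp, of n] by (simp add: rs_nu_def rs_phi_eq nu_def)

lemma rational_detuning: "rational_on U (\<lambda>K. of_real (detuning F K xi))"
proof -
 have "(\<lambda>K. complex_of_real (detuning F K xi)) = (\<lambda>K. of_real ((F *v ivec xi) \<bullet> (F *v ivec xi)) + (\<Sum>i\<in>UNIV. of_real (2 * (F *v ivec xi) $ i) * of_real (K $ i)))"
 proof (rule ext)
  fix K
  have "detuning F K xi = (F *v ivec xi) \<bullet> (F *v ivec xi) + 2 * ((F *v ivec xi) \<bullet> K)"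
   by (simp add: detuning_def power2_norm_eq_inner inner_add_left inner_add_right inner_commute)
  also have "(F *v ivec xi) \<bullet> K = (\<Sum>i\<in>UNIV. (F *v ivec xi) $ i * K $ i)" by (simp add: inner_vec_def)
  finally show "complex_of_real (detuning F K xi) = of_real ((F *v ivec xi) \<bullet> (F *v ivec xi)) + (\<Sum>i\<in>UNIV. of_real (2 * (F *v ivec xi) $ i) * of_real (K $ i))"
   by (simp add: sum_distrib_left mult.assoc)
 qed
 then show ?thesis by (simp only:) (intro rational_on.intros rational_on_sum)
qed

lemma rational_wave_vec: "rational_on U (\<lambda>K. wave_vec F K xi $ i)"
proof -
 have "(\<lambda>K. wave_vec F K xi $ i) = (\<lambda>K. of_real (K $ i) + of_real ((F *v ivec xi) $ i))"
  by (simp add: fun_eq_iff wave_vec_def cvec_def)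
 then show ?thesis by (simp only:) (intro rational_on.intros)
qed

lemma rational_cdot:
 assumes "!!i. rational_on U (\<lambda>K. u K $ i)" "!!i. rational_on U (\<lambda>K. v K $ i)"
 shows "rational_on U (\<lambda>K. cdot (u K) (v K))"
 unfolding cdot_def by (intro rational_on.intros rational_on_sum assms)

lemma rational_flux:
 assumes "!!zeta. rational_on U (\<lambda>K. c K zeta)"
 shows "rational_on U (\<lambda>K. flux (c K) K xi $ i)"
proof -
 have "(\<lambda>K. flux (c K) K xi $ i) = (\<lambda>K. \<Sum>zeta\<in>freqs. \<i> * c K zeta * (\<Sum>j\<in>UNIV. a (xi - zeta) $ i $ j * wave_vec F K zeta $ j))"
  by (simp add: fun_eq_iff flux_def matrix_vector_mult_def)
 then show ?thesis by (simp only:) (intro rational_on.intros rational_on_sum rational_wave_vec assms)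
qed

context
 fixes U assumes U: "!!K. K \<in> U ==> regular K"
begin

lemma rational_phi_of_pot: "(!!i xi. rational_on U (\<lambda>K. pot n K xi $ i)) ==> rational_on U (\<lambda>K. phi n K xi)"
 unfolding phi_eq by (intro rational_on.intros rational_cdot rational_wave_vec)

lemma rational_nu_of_phi:
 assumes "!!xi. rational_on U (\<lambda>K. phi n K xi)"
 shows "rational_on U (nu n)"
proof -
 have c: "rational_on U (\<lambda>K. cvec K $ i)" for i :: 'd
  unfolding cvec_def by simp (rule rational_on.coord)
 have "rational_on U (\<lambda>K. - \<i> * cdot (cvec K) (flux (phi n K) K 0))"
  by (intro rational_on.intros rational_cdot c rational_flux assms)
 then show ?thesis by (simp add: nu_def[abs_def] nu_coeff_def)
qed

lemma rational_pot: "rational_on U (\<lambda>K. pot n K xi $ i)"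
proof (induction n arbitrary: xi i rule: less_induct)
 case (less n)
 show ?case
 proof (cases n)
  case 0 then show ?thesis by (simp add: rational_on.const)
 next
  case (Suc m)
  have ph: "rational_on U (\<lambda>K. phi l K xi)" if "l <= m" for l xi
   using that Suc by (intro rational_phi_of_pot less) auto
  show ?thesis
  proof (cases "xi \<in> freqs \<and> xi ~= 0")
   case True
   then have "(\<lambda>K. pot n K xi $ i) = (\<lambda>K. inverse (of_real (detuning F K xi)) * (flux (phi m K) K xi $ i + (\<Sum>l<m. nu l K * pot (m - l) K xi $ i)))"
    by (simp add: fun_eq_iff Suc pot_Suc divide_inverse distrib_left)
   moreover have "rational_on U (\<lambda>K. inverse (of_real (detuning F K xi)) * (flux (phi m K) K xi $ i + (\<Sum>l<m. nu l K * pot (m - l) K xi $ i)))"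
    using True U Suc
    by (intro rational_on.intros rational_on_sum rational_detuning rational_flux ph rational_nu_of_phi less) (auto simp: regular_def)
   ultimately show ?thesis by simp
  next
   case False
   then have "(\<lambda>K. pot n K xi $ i) = (\<lambda>K. 0)"
    unfolding Suc pot_Suc by (intro ext) (simp only: if_False zero_index)
   then show ?thesis by (simp add: rational_on.const)
  qed
 qed
qed

lemma rational_phi: "rational_on U (\<lambda>K. phi n K xi)"
 by (rule rational_phi_of_pot) (rule rational_pot)

lemma rational_nu: "rational_on U (nu n)"
 by (rule rational_nu_of_phi) (rule rational_phi)

end

section \<open>The truncated Bloch wave and its residual\<close>

definition Psi :: "nat => real => real^'d => int^'m => complex" where
 "Psi L lam K xi = (\<Sum>n\<le>L. of_real (lam ^ n) * phi n K xi)"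

text \<open>What survives of order lambda^(L + 1) and higher: the flux of the last corrector, which
  no later corrector compensates, and those products of the truncated eigenvalue with the truncated
  series whose total order exceeds L.\<close>

definition remainder :: "nat => real => real^'d => int^'m => complex" where
 "remainder L lam K xi = - (of_real (lam ^ Suc L) * (\<i> * cdot (wave_vec F K xi) (flux (phi L K) K xi)))
   - (\<Sum>(l, j)\<in>{(l, j). l < L \<and> j <= L \<and> L <= l + j}. of_real (lam ^ (Suc l + j)) * (nu l K * phi j K xi))"

definition remainder_bound :: "nat => real^'d => int^'m => real" where
 "remainder_bound L K xi = norm (cdot (wave_vec F K xi) (flux (phi L K) K xi))
   + (\<Sum>(l, j)\<in>{(l, j). l < L \<and> j <= L \<and> L <= l + j}. norm (nu l K * phi j K xi))"

lemma norm_remainder_le: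
 assumes "0 <= lam" "lam <= 1"
 shows "norm (remainder L lam K xi) <= lam ^ Suc L * remainder_bound L K xi"
proof -
 have "norm (\<Sum>(l, j)\<in>{(l, j). l < L \<and> j <= L \<and> L <= l + j}. of_real (lam ^ (Suc l + j)) * (nu l K * phi j K xi))
   <= (\<Sum>(l, j)\<in>{(l, j). l < L \<and> j <= L \<and> L <= l + j}. lam ^ Suc L * norm (nu l K * phi j K xi))"
 proof (rule sum_norm_le)
  fix x assume "x \<in> {(l, j). l < L \<and> j <= L \<and> L <= l + j}"
  then obtain l j where x: "x = (l, j)" "L <= l + j" by auto
  have "lam ^ (Suc l + j) <= lam ^ Suc L" using assms x by (intro power_decreasing) auto
  then have "norm (of_real (lam ^ (Suc l + j)) * (nu l K * phi j K xi)) <= lam ^ Suc L * norm (nu l K * phi j K xi)"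
   unfolding norm_mult[of "of_real _"] norm_of_real using assms by (intro mult_right_mono) auto
  then show "norm (case x of (l, j) => of_real (lam ^ (Suc l + j)) * (nu l K * phi j K xi)) <= (case x of (l, j) => lam ^ Suc L * norm (nu l K * phi j K xi))"
   by (simp only: x(1) prod.case)
 qed
 moreover have "norm (of_real (lam ^ Suc L) * (\<i> * cdot (wave_vec F K xi) (flux (phi L K) K xi))) = lam ^ Suc L * norm (cdot (wave_vec F K xi) (flux (phi L K) K xi))"
  unfolding norm_mult norm_of_real using assms by simp
 ultimately show ?thesis
  unfolding remainder_def remainder_bound_def distrib_left sum_distrib_left
  by (intro order_trans[OF norm_triangle_ineq4] add_mono) (simp_all add: case_prod_beta)
qed

lemma flux_Psi: "flux (Psi L lam K) K xi = (\<Sum>n\<le>L. of_real (lam ^ n) *s flux (phi n K) K xi)"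
proof -
 have "flux (Psi L lam K) K xi $ i = (\<Sum>n\<le>L. of_real (lam ^ n) *s flux (phi n K) K xi) $ i" for i
 proof -
  have "flux (Psi L lam K) K xi $ i = (\<Sum>zeta\<in>freqs. \<Sum>n\<le>L. of_real (lam ^ n) * (\<i> * phi n K zeta * (a (xi - zeta) *v wave_vec F K zeta) $ i))"
   by (simp add: flux_def Psi_def sum_distrib_left sum_distrib_right mult_ac)
  also have "... = (\<Sum>n\<le>L. \<Sum>zeta\<in>freqs. of_real (lam ^ n) * (\<i> * phi n K zeta * (a (xi - zeta) *v wave_vec F K zeta) $ i))"
   by (rule sum.swap)
  finally show ?thesis by (simp add: flux_def sum_distrib_left)
 qed
 then show ?thesis by (simp add: vec_eq_iff)
qed

text \<open>Multiply the recursion for n < L by lambda^(n + 1) and sum. The resulting triangular sum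
  over l + j < L is cancelled by the corresponding part of the product of the truncated eigenvalue
  with \<open>Psi\<close>; the rest of that product goes into \<open>remainder\<close>.\<close>

lemma residual:
 assumes K: "regular K" and xi: "xi \<in> freqs"
 shows "of_real (detuning F K xi + (norm K)^2) * Psi L lam K xi - of_real lam * (\<i> * cdot (wave_vec F K xi) (flux (Psi L lam K) K xi))
  = (of_real ((norm K)^2) + (\<Sum>l<L. of_real (lam ^ Suc l) * nu l K)) * Psi L lam K xi + remainder L lam K xi"
proof -
 define f where "f n = \<i> * cdot (wave_vec F K xi) (flux (phi n K) K xi)" for n
 define t where "t l j = of_real (lam ^ (Suc l + j)) * (nu l K * phi j K xi)" for l j
 have 1: "of_real lam * (\<i> * cdot (wave_vec F K xi) (flux (Psi L lam K) K xi)) = (\<Sum>n<L. of_real (lam ^ Suc n) * f n) + of_real (lam ^ Suc L) * f L"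
 proof -
  have "of_real lam * (\<i> * cdot (wave_vec F K xi) (flux (Psi L lam K) K xi)) = (\<Sum>n\<le>L. of_real (lam ^ Suc n) * f n)"
   by (simp add: flux_Psi cdot_sum_right cdot_smult_right f_def sum_distrib_left mult_ac)
  then show ?thesis by (simp flip: lessThan_Suc_atMost)
 qed
 have d0: "of_real (detuning F K xi) * phi 0 K xi = 0" by (simp add: phi_0)
 have "of_real (detuning F K xi) * Psi L lam K xi = (\<Sum>n\<le>L. of_real (lam ^ n) * (of_real (detuning F K xi) * phi n K xi))"
  by (simp add: Psi_def sum_distrib_left mult_ac)
 also have "... = (\<Sum>n<L. of_real (lam ^ Suc n) * (of_real (detuning F K xi) * phi (Suc n) K xi))"
  by (simp add: sum.atMost_shift d0 del: power_Suc)
 also have "... = (\<Sum>n<L. of_real (lam ^ Suc n) * f n) + (\<Sum>n<L. \<Sum>l\<le>n. of_real (lam ^ Suc n) * (nu l K * phi (n - l) K xi))"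
  unfolding phi_recursion[OF K xi] f_def[symmetric] by (simp add: distrib_left sum.distrib sum_distrib_left del: power_Suc)
 also have "(\<Sum>n<L. \<Sum>l\<le>n. of_real (lam ^ Suc n) * (nu l K * phi (n - l) K xi)) = (\<Sum>n<L. \<Sum>l\<le>n. t l (n - l))"
  unfolding t_def by (intro sum.cong refl) auto
 also have "... = (\<Sum>(l, j)\<in>{(l, j). l + j < L}. t l j)"
  by (rule sum.triangle_reindex[symmetric])
 finally have 2: "of_real (detuning F K xi) * Psi L lam K xi = (\<Sum>n<L. of_real (lam ^ Suc n) * f n) + (\<Sum>(l, j)\<in>{(l, j). l + j < L}. t l j)" .
 have 3: "(\<Sum>l<L. of_real (lam ^ Suc l) * nu l K) * Psi L lam K xi = (\<Sum>(l, j)\<in>{(l, j). l + j < L}. t l j) + (\<Sum>(l, j)\<in>{(l, j). l < L \<and> j <= L \<and> L <= l + j}. t l j)"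
 proof -
  have "(\<Sum>l<L. of_real (lam ^ Suc l) * nu l K) * Psi L lam K xi = (\<Sum>(l, j)\<in>{..<L} \<times> {..L}. t l j)"
   unfolding Psi_def sum_product sum.cartesian_product t_def
   by (intro sum.cong refl) (auto simp: power_add)
  also have "... = (\<Sum>(l, j)\<in>{(l, j). l + j < L} \<union> {(l, j). l < L \<and> j <= L \<and> L <= l + j}. t l j)"
   by (intro sum.cong) auto
  also have "... = (\<Sum>(l, j)\<in>{(l, j). l + j < L}. t l j) + (\<Sum>(l, j)\<in>{(l, j). l < L \<and> j <= L \<and> L <= l + j}. t l j)"
  proof (rule sum.union_disjoint)
   show "finite {(l, j). l + j < L}" by (rule finite_subset[of _ "{..<L} \<times> {..L}"]) auto
   show "finite {(l, j). l < L \<and> j <= L \<and> L <= l + j}" by (rule finite_subset[of _ "{..<L} \<times> {..L}"]) auto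
  qed auto
  finally show ?thesis .
 qed
 have r: "remainder L lam K xi = - (of_real (lam ^ Suc L) * f L) - (\<Sum>(l, j)\<in>{(l, j). l < L \<and> j <= L \<and> L <= l + j}. t l j)"
  by (simp only: remainder_def f_def t_def)
 show ?thesis
  unfolding of_real_add distrib_right 1 2 3 r by simp
qed

text \<open>The quadratic form of the perturbation is hermitian: conjugating its kernel swaps the
  two frequencies because a(-eta) is the adjoint of a(eta).\<close>

lemma flux_form_real: "(\<Sum>xi\<in>freqs. cnj (\<psi> xi) * (\<i> * cdot (wave_vec F K xi) (flux \<psi> K xi))) \<in> \<real>"
proof -
 define B where "B xi zeta = cdot (wave_vec F K xi) (a (xi - zeta) *v wave_vec F K zeta)" for xi zeta
 have cB: "cnj (B xi zeta) = B zeta xi" for xi zeta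
 proof -
  have w: "cnj (wave_vec F K xi $ i) = wave_vec F K xi $ i" for xi i by (simp add: wave_vec_def cvec_def)
  have h: "cnj (a (xi - zeta) $ i $ j) = a (zeta - xi) $ j $ i" for i j using a_herm[of "xi - zeta" j i] by simp
  have "cnj (B xi zeta) = (\<Sum>i\<in>UNIV. \<Sum>j\<in>UNIV. wave_vec F K xi $ i * (a (zeta - xi) $ j $ i * wave_vec F K zeta $ j))"
   by (simp add: B_def cdot_def matrix_vector_mult_def w h sum_distrib_left)
  also have "... = (\<Sum>j\<in>UNIV. \<Sum>i\<in>UNIV. wave_vec F K xi $ i * (a (zeta - xi) $ j $ i * wave_vec F K zeta $ j))"
   by (rule sum.swap)
  also have "... = B zeta xi"
   by (simp add: B_def cdot_def matrix_vector_mult_def sum_distrib_left mult_ac)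
  finally show ?thesis .
 qed
 define T where "T = (\<Sum>xi\<in>freqs. \<Sum>zeta\<in>freqs. cnj (\<psi> xi) * \<psi> zeta * B xi zeta)"
 have "(\<Sum>xi\<in>freqs. cnj (\<psi> xi) * (\<i> * cdot (wave_vec F K xi) (flux \<psi> K xi))) = - T"
  unfolding T_def sum_negf[symmetric]
 proof (intro sum.cong refl)
  fix xi
  have "\<i> * (\<i> * x) = - x" for x by simp
  then show "cnj (\<psi> xi) * (\<i> * cdot (wave_vec F K xi) (flux \<psi> K xi)) = (\<Sum>zeta\<in>freqs. - (cnj (\<psi> xi) * \<psi> zeta * B xi zeta))"
   by (simp add: flux_def cdot_sum_right cdot_smult_right B_def sum_distrib_left mult.assoc)
 qed
 moreover have "cnj T = T"
 proof -
  have "cnj T = (\<Sum>xi\<in>freqs. \<Sum>zeta\<in>freqs. cnj (\<psi> zeta) * \<psi> xi * B zeta xi)"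
   unfolding T_def by (simp add: cB mult_ac)
  also have "... = T" unfolding T_def by (rule sum.swap)
  finally show ?thesis .
 qed
 ultimately show ?thesis by (simp add: Reals_cnj_iff)
qed

lemma Psi_at_0: "Psi L lam K 0 = 1"
proof -
 have "Psi L lam K 0 = (\<Sum>n\<le>L. if n = 0 then 1 else 0)"
  unfolding Psi_def by (intro sum.cong refl) (auto simp: phi_at_0)
 then show ?thesis by simp
qed

text \<open>\<open>\<nu>\<^sup>n\<close> is real because the truncated series solves the eigenvalue equation of a symmetric
 operator up to \<open>O(\<lambda>\<^bsup>n+2\<^esup>)\<close>.\<close>
lemma nu_real:
 assumes K: "regular K" shows "nu n K \<in> \<real>"
proof (induction n rule: less_induct)
 case (less n)
 \<comment> \<open>With this order the last term of the truncated eigenvalue is lambda^(n + 1) nu n,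
   while the remainder is of order lambda^(n + 2). Dividing by lambda^(n + 1) and letting lambda
   tend to 0 isolates Im (nu n).\<close>
 define L where "L = Suc n"
 define C where "C = (\<Sum>xi\<in>freqs. (\<Sum>m\<le>L. norm (phi m K xi)) * remainder_bound L K xi)"
 have "\<bar>Im (nu n K)\<bar> <= lam * C" if lam: "0 < lam" "lam <= 1" for lam
 proof -
  let ?P = "Psi L lam K"
  define kappa where "kappa = of_real ((norm K)^2) + (\<Sum>l<L. of_real (lam ^ Suc l) * nu l K)"
  define M where "M = (\<Sum>xi\<in>freqs. (norm (?P xi))\<^sup>2)"
  define rho where "rho = (\<Sum>xi\<in>freqs. cnj (?P xi) * remainder L lam K xi)"
  have cn: "cnj z * z = of_real ((norm z)^2)" for z using complex_norm_square[of z] by (simp add: mult.commute)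
  have "(\<Sum>xi\<in>freqs. cnj (?P xi) * (of_real (detuning F K xi + (norm K)^2) * ?P xi - of_real lam * (\<i> * cdot (wave_vec F K xi) (flux ?P K xi))))
   = (\<Sum>xi\<in>freqs. cnj (?P xi) * (kappa * ?P xi + remainder L lam K xi))"
   unfolding kappa_def by (intro sum.cong refl) (simp only: residual[OF K])
  also have "... = kappa * of_real M + rho"
  proof -
   have "(\<Sum>xi\<in>freqs. cnj (?P xi) * (kappa * ?P xi + remainder L lam K xi)) = (\<Sum>xi\<in>freqs. kappa * (cnj (?P xi) * ?P xi)) + rho"
    unfolding rho_def sum.distrib[symmetric] by (intro sum.cong refl) (simp add: algebra_simps)
   then show ?thesis unfolding cn M_def by (simp add: sum_distrib_left)
  qed
  finally have eq: "(\<Sum>xi\<in>freqs. cnj (?P xi) * (of_real (detuning F K xi + (norm K)^2) * ?P xi - of_real lam * (\<i> * cdot (wave_vec F K xi) (flux ?P K xi)))) = kappa * of_real M + rho" .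
  have "(\<Sum>xi\<in>freqs. cnj (?P xi) * (of_real (detuning F K xi + (norm K)^2) * ?P xi - of_real lam * (\<i> * cdot (wave_vec F K xi) (flux ?P K xi))))
   = (\<Sum>xi\<in>freqs. of_real ((detuning F K xi + (norm K)^2) * (norm (?P xi))^2)) - of_real lam * (\<Sum>xi\<in>freqs. cnj (?P xi) * (\<i> * cdot (wave_vec F K xi) (flux ?P K xi)))"
   unfolding of_real_mult cn[symmetric] sum_distrib_left sum_subtractf[symmetric]
   by (intro sum.cong refl) (simp only: right_diff_distrib mult_ac)
  moreover have "... \<in> \<real>"
   by (intro Reals_diff Reals_mult Reals_of_real sum_in_Reals flux_form_real)
  ultimately have "kappa * of_real M + rho \<in> \<real>" using eq by simp
  then have im: "Im kappa * M + Im rho = 0" by (simp add: complex_is_Real_iff)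
  have "kappa = (of_real ((norm K)^2) + (\<Sum>l<n. of_real (lam ^ Suc l) * nu l K)) + of_real (lam ^ Suc n) * nu n K"
   by (simp add: kappa_def L_def)
  moreover have "(of_real ((norm K)^2) + (\<Sum>l<n. of_real (lam ^ Suc l) * nu l K)) \<in> \<real>"
   by (intro Reals_add sum_in_Reals Reals_mult Reals_of_real) (use less in auto)
  ultimately have imkappa: "Im kappa = lam ^ Suc n * Im (nu n K)"
   by (simp add: complex_is_Real_iff del: power_Suc of_real_power)
  \<comment> \<open>The coefficient of \<open>Psi\<close> at frequency 0 equals 1, so the squared
    norm cannot degenerate as lambda tends to 0.\<close>
  have M1: "M >= 1"
   unfolding M_def using member_le_sum[of 0 freqs "\<lambda>xi. (norm (?P xi))\<^sup>2"]
   by (simp add: finite_freqs zero_freqs Psi_at_0)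
  have "norm rho <= (\<Sum>xi\<in>freqs. (\<Sum>m\<le>L. norm (phi m K xi)) * (lam ^ Suc L * remainder_bound L K xi))"
   unfolding rho_def
  proof (rule sum_norm_le)
   fix xi
   have "norm (?P xi) <= (\<Sum>m\<le>L. norm (phi m K xi))"
    unfolding Psi_def
   proof (rule sum_norm_le)
    fix m
    have "lam ^ m <= 1" using lam by (intro power_le_one) auto
    then show "norm (of_real (lam ^ m) * phi m K xi) <= norm (phi m K xi)"
     unfolding norm_mult norm_of_real using lam by (simp add: mult_left_le_one_le)
   qed
   then show "norm (cnj (?P xi) * remainder L lam K xi) <= (\<Sum>m\<le>L. norm (phi m K xi)) * (lam ^ Suc L * remainder_bound L K xi)"
    unfolding norm_mult complex_mod_cnj using lam
    by (intro mult_mono norm_remainder_le) (auto intro: sum_nonneg)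
  qed
  also have "... = lam ^ Suc L * C" by (simp add: C_def sum_distrib_left mult_ac)
  finally have "\<bar>Im rho\<bar> <= lam ^ Suc L * C" using abs_Im_le_cmod[of rho] by linarith
  moreover have "\<bar>Im kappa\<bar> * M = \<bar>Im rho\<bar>"
  proof -
   have "\<bar>Im kappa\<bar> * M = \<bar>Im kappa * M\<bar>" using M1 by (simp add: abs_mult)
   also have "Im kappa * M = - Im rho" using im by (simp add: add_eq_0_iff)
   finally show ?thesis by simp
  qed
  moreover have "\<bar>Im kappa\<bar> * 1 <= \<bar>Im kappa\<bar> * M" using M1 by (intro mult_left_mono) auto
  ultimately have "\<bar>Im kappa\<bar> <= lam ^ Suc L * C" by linarith
  then have "lam ^ Suc n * \<bar>Im (nu n K)\<bar> <= lam ^ Suc n * (lam * C)"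
   using lam unfolding imkappa L_def by (simp add: abs_mult mult_ac)
  then show ?thesis using lam by (simp add: mult_le_cancel_left_pos del: power_Suc)
 qed
 then have le: "\<bar>Im (nu n K)\<bar> <= lam * C" if "0 < lam" "lam <= 1" for lam using that by blast
 have "((\<lambda>lam. lam * C) \<longlongrightarrow> 0 * C) (at_right (0::real))" by (intro tendsto_intros)
 moreover have "\<forall>\<^sub>F lam in at_right (0::real). \<bar>Im (nu n K)\<bar> <= lam * C"
  using eventually_at_right_less[of 0] eventually_at_right_field[of _ 0] le
  by (auto simp: eventually_at_right_field intro!: exI[of _ 1])
 ultimately have "\<bar>Im (nu n K)\<bar> <= 0 * C"
  by (intro tendsto_lowerbound[of "\<lambda>lam. lam * C"]) auto
 then show ?case by (simp add: complex_is_Real_iff)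
qed

end

section \<open>The energy estimate\<close>

lemma compact_support_integrable:
 fixes f :: "real^'d::finite => 'b::{banach,second_countable_topology}"
 assumes c: "continuous_on UNIV f" and z: "!!x. norm x > R ==> f x = 0"
 shows "integrable lborel f"
proof -
 have "compact (f ` cball 0 R)" by (intro compact_continuous_image continuous_on_subset[OF c]) auto
 then obtain B where B: "!!x. x \<in> cball 0 R ==> norm (f x) <= B"
  using compact_imp_bounded bounded_iff by (metis imageI)
 let ?I = "\<lambda>k::real^'d. indicator (cball 0 R) k :: real"
 have i: "integrable lborel ?I"
  using emeasure_bounded_finite[OF bounded_cball, of "0::real^'d" R] by (simp add: integrable_indicator_iff)
 show ?thesis
 proof (rule Bochner_Integration.integrable_bound[of _ "\<lambda>k. \<bar>B\<bar> * ?I k"])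
  show "f \<in> borel_measurable lborel" using c by (simp add: borel_measurable_continuous_onI)
  show "AE x in lborel. norm (f x) <= norm (\<bar>B\<bar> * ?I x)"
  proof (rule AE_I2)
   fix x show "norm (f x) <= norm (\<bar>B\<bar> * ?I x)"
    using B[of x] z[of x] by (cases "norm x <= R") auto
  qed
 qed (use i in simp)
qed

lemma compact_support_weight_bound:
 fixes f :: "real^'d::finite => 'b::real_normed_vector"
 assumes c: "continuous_on UNIV f" and z: "!!x. norm x > R ==> f x = 0"
 obtains B where "!!x. norm (f x) <= B * weight x"
proof -
 have "compact (f ` cball 0 R)" by (intro compact_continuous_image continuous_on_subset[OF c]) auto
 then obtain B where B: "!!x. x \<in> cball 0 R ==> norm (f x) <= B"
  using compact_imp_bounded bounded_iff by (metis imageI)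
 have w: "(1 + norm x) ^ (2 * CARD('d)) * weight x = 1" for x :: "real^'d"
 proof -
  have "(1 + norm x) ^ (2 * CARD('d)) > 0" by (intro zero_less_power add_pos_nonneg) auto
  moreover have "0 < 1 + norm x" by (simp add: add_pos_nonneg)
  ultimately show ?thesis unfolding weight_def by (metis less_irrefl nonzero_mult_div_cancel_left times_divide_eq_right mult.right_neutral)
 qed
 have "norm (f x) <= (\<bar>B\<bar> * (1 + R) ^ (2 * CARD('d))) * weight x" for x
 proof (cases "norm x <= R")
  case True
  have "(1 + norm x) ^ (2 * CARD('d)) * weight x <= (1 + R) ^ (2 * CARD('d)) * weight x"
   using True by (intro mult_right_mono power_mono) auto
  then have "1 <= (1 + R) ^ (2 * CARD('d)) * weight x" unfolding w .
  then have "\<bar>B\<bar> * 1 <= \<bar>B\<bar> * ((1 + R) ^ (2 * CARD('d)) * weight x)" by (intro mult_left_mono) auto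
  then show ?thesis using B[of x] True by (simp add: mult.assoc)
 next
  case False
  have "0 <= (\<bar>B\<bar> * ((1 + R) ^ CARD('d))^2) * weight x"
   by (intro mult_nonneg_nonneg) auto
  then show ?thesis using z[of x] False by (simp add: power_even_eq)
 qed
 then show ?thesis by (rule that)
qed

text \<open>The positive part itself has a kink; its square is differentiable everywhere. For this
  reason the spatial cutoff enters the energy squared.\<close>

lemma has_real_derivative_max_square:
 "((\<lambda>s::real. (max 0 s)\<^sup>2) has_real_derivative 2 * max 0 s) (at s)"
proof -
 consider "s > 0" | "s < 0" | "s = 0" by linarith
 then show ?thesis
 proof cases
  case 1
  have "((\<lambda>s::real. s\<^sup>2) has_real_derivative 2 * s) (at s)" by (auto intro!: derivative_eq_intros)
  then have "((\<lambda>s::real. (max 0 s)\<^sup>2) has_real_derivative 2 * s) (at s)"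
   by (rule has_field_derivative_transform_within_open[of _ _ _ "{0<..}"]) (use 1 in auto)
  then show ?thesis using 1 by simp
 next
  case 2
  have "((\<lambda>s::real. 0) has_real_derivative 0) (at s)" by simp
  then have "((\<lambda>s::real. (max 0 s)\<^sup>2) has_real_derivative 0) (at s)"
   by (rule has_field_derivative_transform_within_open[of _ _ _ "{..<0}"]) (use 2 in auto)
  then show ?thesis using 2 by simp
 next
  case 3
  have "((\<lambda>h::real. (max 0 h)\<^sup>2 / h) \<longlongrightarrow> 0) (at 0)"
  proof (rule Lim_null_comparison[where g="\<lambda>h. \<bar>h\<bar>"])
   have "norm ((max 0 h)^2 / h) <= \<bar>h\<bar>" for h :: real
    by (cases "h > 0") (auto simp: power2_eq_square max_def)
   then show "\<forall>\<^sub>F h in at 0. norm ((max 0 h)^2 / h) <= \<bar>h::real\<bar>" by simp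
  qed (auto intro!: tendsto_eq_intros)
  then show ?thesis using 3 by (simp add: DERIV_def)
 qed
qed

lemma bounded_linear_matrix_vector_mult_complex: "bounded_linear ((*v) (M :: complex^'n::finite^'m::finite))"
 unfolding linear_conv_bounded_linear[symmetric]
 by (rule linearI)
  (auto simp: matrix_vector_mult_def vec_eq_iff algebra_simps sum.distrib scaleR_sum_right)

lemma sum_inner_le:
 fixes V :: "complex^'d::finite" and y :: "real^'d" and w :: complex
 shows "\<bar>\<Sum>i\<in>UNIV. y $ i * (w \<bullet> V $ i)\<bar> <= norm w * (norm y * norm V)"
proof -
 have "\<bar>\<Sum>i\<in>UNIV. y $ i * (w \<bullet> V $ i)\<bar> <= (\<Sum>i\<in>UNIV. \<bar>y $ i * (w \<bullet> V $ i)\<bar>)"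
  by (rule sum_abs)
 also have "... <= (\<Sum>i\<in>UNIV. norm w * (\<bar>y $ i\<bar> * norm (V $ i)))"
 proof (rule sum_mono)
  fix i
  show "\<bar>y $ i * (w \<bullet> V $ i)\<bar> <= norm w * (\<bar>y $ i\<bar> * norm (V $ i))"
   using mult_left_mono[OF Cauchy_Schwarz_ineq2[of w "V $ i"], of "\<bar>y $ i\<bar>"] by (simp add: abs_mult mult_ac)
 qed
 also have "... = norm w * (\<Sum>i\<in>UNIV. \<bar>y $ i\<bar> * \<bar>norm (V $ i)\<bar>)" by (simp add: sum_distrib_left)
 also have "... <= norm w * (norm y * norm V)"
  using L2_set_mult_ineq[of "\<lambda>i. y $ i" "\<lambda>i. norm (V $ i)" UNIV]
  by (intro mult_left_mono) (auto simp: norm_vec_def L2_set_def)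
 finally show ?thesis .
qed

lemma continuous_slice:
 fixes f :: "real => real^'b::finite => 'c::topological_space"
 assumes "continuous_on ({0..} \<times> UNIV) (\<lambda>z. f (fst z) (snd z))" "(t::real) >= 0"
 shows "continuous_on UNIV (f t)"
proof -
 have "continuous_on UNIV (\<lambda>x::real^'b. (t, x))" by (intro continuous_intros)
 from continuous_on_compose2[OF assms(1) this] assms(2) show ?thesis by auto
qed

text \<open>The cutoff \<open>q\<close> decreases along the cone \<open>|x| + 8 t <= R\<close>. This makes the flux through its
 lateral boundary harmless, so that no decay of \<open>w\<close> has to be assumed.\<close>
lemma energy_cutoff:
 fixes w r :: "real => real^'d::finite => complex" and p g :: "real => real^'d => complex^'d"
  and A :: "real^'d => complex^'d^'d" and H :: "real^'d => complex^'d"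
  and dV :: "'d => 'd => real => real^'d => complex"
 assumes A: "continuous_on UNIV A" "!!x u v. (A x *v u) \<bullet> v = u \<bullet> (A x *v v)"
   "!!x v. (norm v)\<^sup>2 / 2 <= (A x *v v) \<bullet> v" "!!x v. norm (A x *v v) <= 2 * norm v"
  and H: "continuous_on UNIV H" "integrable lborel (\<lambda>x. (norm (H x))\<^sup>2)" "(LINT x|lborel. (norm (H x))\<^sup>2) <= h\<^sup>2"
  and cw: "continuous_on ({0..} \<times> UNIV) (\<lambda>z. w (fst z) (snd z))"
  and cp: "continuous_on ({0..} \<times> UNIV) (\<lambda>z. p (fst z) (snd z))"
  and cg: "continuous_on ({0..} \<times> UNIV) (\<lambda>z. g (fst z) (snd z))"
  and cr: "continuous_on ({0..} \<times> UNIV) (\<lambda>z. r (fst z) (snd z))"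
  and cV: "!!i l. continuous_on ({0..} \<times> UNIV) (\<lambda>z. dV i l (fst z) (snd z))"
  and wt: "!!t x. t >= 0 ==> ((\<lambda>s. w s x) has_vector_derivative (\<Sum>i\<in>UNIV. dV i i t x) + r t x) (at t within {0..})"
  and gt: "!!t x. t >= 0 ==> ((\<lambda>s. g s x) has_vector_derivative p t x) (at t within {0..})"
  and wx: "!!t x. t >= 0 ==> (w t has_derivative (\<lambda>h. \<Sum>l\<in>UNIV. h $ l *\<^sub>R p t x $ l)) (at x)"
  and Vx: "!!i t x. t >= 0 ==> ((\<lambda>x. (A x *v g t x + H x) $ i) has_derivative (\<lambda>h. \<Sum>l\<in>UNIV. h $ l *\<^sub>R dV i l t x)) (at x)"
  and g0: "!!x. g 0 x = 0"
  and r2: "!!t. 0 <= t ==> integrable lborel (\<lambda>x. (norm (r t x))\<^sup>2)" "!!t. 0 <= t ==> (LINT x|lborel. (norm (r t x))\<^sup>2) <= rho\<^sup>2" and rho: "rho > 0"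
  and w0: "integrable lborel (\<lambda>x. (norm (w 0 x))\<^sup>2)" "(LINT x|lborel. (norm (w 0 x))\<^sup>2) <= b\<^sup>2"
  and R: "R > 0" and T: "T >= 0"
 defines "q \<equiv> \<lambda>t x. max 0 (R - 8 * t - sqrt (1 + x \<bullet> x))"
 shows "integrable lborel (\<lambda>x. (q T x)\<^sup>2 * (norm (w T x))^2)"
  and "sqrt (LINT x|lborel. (q T x)\<^sup>2 * (norm (w T x))^2) <= sqrt (R\<^sup>2 * b\<^sup>2 + 2 * R\<^sup>2 * h\<^sup>2 + R) + T * (34 * R * h\<^sup>2 / sqrt R + rho * R)"
proof -
 let ?S = "{0..} \<times> (UNIV :: (real^'d) set)"
 define J where "J x = sqrt (1 + x \<bullet> x)" for x :: "real^'d"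
 have Jpos: "J x >= 1" for x by (simp add: J_def)
 have Jn: "norm x <= J x" for x unfolding J_def norm_eq_sqrt_inner by simp
 have q: "q t x = max 0 (R - 8 * t - J x)" for t x by (simp add: q_def J_def)
 have q0: "q t x >= 0" for t x by (simp add: q)
 have qR: "q t x <= R" if "t >= 0" for t x using that Jpos[of x] R by (simp add: q)
 have qz: "q t x = 0" if "t >= 0" "norm x > R" for t x using that Jn[of x] by (simp add: q)
 have cJ: "continuous_on X J" for X unfolding J_def by (intro continuous_intros)
 have cq: "continuous_on ?S (\<lambda>z. q (fst z) (snd z))"
  unfolding q_def by (intro continuous_intros)
 have qt: "((\<lambda>s. (q s x)\<^sup>2) has_vector_derivative - 16 * q t x) (at t within X)" for t x X
 proof -
  have "((\<lambda>s. R - 8 * s - J x) has_real_derivative - 8) (at t within X)"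
   by (auto intro!: derivative_eq_intros)
  from DERIV_chain2[OF has_real_derivative_max_square this] show ?thesis
   by (simp add: q has_real_derivative_iff_has_vector_derivative mult.commute)
 qed
 have qx: "((\<lambda>x. (q t x)\<^sup>2) has_derivative (\<lambda>v. - 2 * q t x * ((x \<bullet> v) / J x))) (at x)" for t x
 proof -
  have pos: "0 < 1 + x \<bullet> x" by (simp add: add_pos_nonneg)
  have "((\<lambda>x. R - 8 * t - sqrt (1 + x \<bullet> x)) has_derivative (\<lambda>v. - ((x \<bullet> v) / J x))) (at x)"
   unfolding J_def by (rule derivative_eq_intros refl pos)+ (auto simp: fun_eq_iff inner_commute divide_simps)
  from has_derivative_compose[OF this has_real_derivative_max_square[unfolded has_field_derivative_def]] show ?thesis
   by (simp add: q_def J_def)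
 qed
 define V where "V t x = A x *v g t x + H x" for t x
 have cAg: "continuous_on ?S (\<lambda>z. A (snd z) *v g (fst z) (snd z))"
 proof -
  have "continuous_on ?S (\<lambda>z. A (snd z))" by (intro continuous_on_compose2[OF A(1)] continuous_intros) auto
  then show ?thesis
   unfolding matrix_vector_mult_def by (intro continuous_intros cg)
 qed
 have cH: "continuous_on ?S (\<lambda>z. H (snd z))" by (intro continuous_on_compose2[OF H(1)] continuous_intros) auto
 \<comment> \<open>The cross term with \<open>H\<close> is included so that the time derivative is w
   . w_t + V . p with V = A g + H. The divergence of exactly this \<open>V\<close> occurs in w_t, so
   both contributions combine to a divergence plus the source.\<close>
 define e where "e t x = (w t x \<bullet> w t x) / 2 + ((A x *v g t x) \<bullet> g t x) / 2 + g t x \<bullet> H x" for t x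
 define w' where "w' t x = (\<Sum>i\<in>UNIV. dV i i t x) + r t x" for t x
 define et where "et t x = w t x \<bullet> w' t x + V t x \<bullet> p t x" for t x
 have ce: "continuous_on ?S (\<lambda>z. e (fst z) (snd z))"
  unfolding e_def by (intro continuous_intros cw cg cAg cH) auto
 have cw': "continuous_on ?S (\<lambda>z. w' (fst z) (snd z))"
  unfolding w'_def by (intro continuous_intros cV cr)
 have cVV: "continuous_on ?S (\<lambda>z. V (fst z) (snd z))"
  unfolding V_def by (intro continuous_intros cAg cH)
 have cet: "continuous_on ?S (\<lambda>z. et (fst z) (snd z))"
  unfolding et_def by (intro continuous_intros cw cw' cp cVV)
 have edt: "((\<lambda>s. e s x) has_vector_derivative et t x) (at t within {0..})" if t: "t >= 0" for t x
 proof -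
  note d = wt[OF t, of x, folded w'_def, unfolded has_vector_derivative_def] gt[OF t, of x, unfolded has_vector_derivative_def]
  have dA: "((\<lambda>s. A x *v g s x) has_derivative (\<lambda>v. A x *v (v *\<^sub>R p t x))) (at t within {0..})"
   using bounded_linear.has_derivative[OF bounded_linear_matrix_vector_mult_complex d(2)] .
  have "A x *v (c *\<^sub>R u) = c *\<^sub>R (A x *v u)" for c u
   by (rule linear_simps(5)[OF bounded_linear_matrix_vector_mult_complex])
  then show ?thesis
   unfolding has_vector_derivative_def e_def
   by (auto intro!: derivative_eq_intros d dA simp: fun_eq_iff et_def V_def inner_add_left inner_commute[of "p t x"]
     A(2)[of x "p t x"] inner_commute[of "w' t x"] algebra_simps)
 qed
 define F where "F t x = (q t x)^2 * e t x" for t x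
 define Ft where "Ft t x = - 16 * q t x * e t x + (q t x)^2 * et t x" for t x
 have cF: "continuous_on ?S (\<lambda>z. F (fst z) (snd z))" and cFt: "continuous_on ?S (\<lambda>z. Ft (fst z) (snd z))"
  unfolding F_def Ft_def by (intro continuous_intros cq ce cet)+
 have Fdt: "((\<lambda>s. F s x) has_derivative (\<lambda>v. v *\<^sub>R Ft t x)) (at t within {0..})" if t: "t >= 0" for t x
  unfolding F_def
  by (rule has_derivative_eq_rhs[OF has_derivative_mult[OF qt[unfolded has_vector_derivative_def] edt[OF t, unfolded has_vector_derivative_def]]])
    (simp add: fun_eq_iff Ft_def algebra_simps)
 have zF: "F t x = 0" "Ft t x = 0" if "t >= 0" "norm x > R" for t x using qz[OF that] by (auto simp: F_def Ft_def)
 have iF: "integrable lborel (F t)" "integrable lborel (Ft t)" if "t >= 0" for t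
  using that by (auto intro!: compact_support_integrable[where R=R] continuous_slice cF cFt zF)
 define E where "E t = (LINT x|lborel. F t x)" for t
 define E' where "E' t = (LINT x|lborel. Ft t x)" for t
 have Edt: "(E has_derivative (\<lambda>v. v *\<^sub>R E' t)) (at t within {0..T})" if t: "t \<in> {0..T}" for t
 proof -
  have "compact ((\<lambda>z. Ft (fst z) (snd z)) ` ({0..T} \<times> cball 0 R))"
   by (intro compact_continuous_image compact_Times continuous_on_subset[OF cFt]) auto
  then obtain B where B: "!!z. z \<in> {0..T} \<times> cball 0 R ==> norm (Ft (fst z) (snd z)) <= B"
   using compact_imp_bounded bounded_iff by (metis (no_types, lifting) imageI)
  have i: "integrable lborel (\<lambda>k::real^'d. indicator (cball 0 R) k :: real)"
   using emeasure_bounded_finite[OF bounded_cball, of "0::real^'d" R] by (simp add: integrable_indicator_iff)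
  have "((\<lambda>t. LINT x|lborel. F t x) has_derivative (\<lambda>v. LINT x|lborel. v *\<^sub>R Ft t x)) (at t within {0..T})"
  proof (rule has_derivative_integral_dominated[where D="\<lambda>x. \<bar>B\<bar> * indicator (cball 0 R) x"])
   show "((\<lambda>p. F p x) has_derivative (\<lambda>v. v *\<^sub>R Ft p x)) (at p within {0..T})" if "p \<in> {0..T}" for p x
    using that by (intro has_derivative_subset[OF Fdt]) auto
   show "norm (v *\<^sub>R Ft p x) <= \<bar>B\<bar> * indicator (cball 0 R) x * norm v" if "p \<in> {0..T}" for p x v
   proof (cases "norm x <= R")
    case True
    then have "norm (Ft p x) <= \<bar>B\<bar>" using B[of "(p, x)"] that by simp
    then have "\<bar>v\<bar> * norm (Ft p x) <= \<bar>v\<bar> * \<bar>B\<bar>" by (intro mult_left_mono) auto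
    then show ?thesis using True by (simp add: mult.commute abs_mult)
   next
    case False
    then show ?thesis using zF(2)[of p x] that by simp
   qed
   show "(\<lambda>x. v *\<^sub>R Ft t x) \<in> borel_measurable lborel" for v
    using iF(2)[of t] t borel_measurable_integrable by force
  qed (use i iF t in auto)
  then show ?thesis unfolding E_def E'_def by simp
 qed
 \<comment> \<open>The i-th derivative of q^2 (w . V_i), written out. Its integral over space is
   zero, which performs the integration by parts.\<close>
 define N where "N i t x = - 2 * q t x * (x $ i / J x) * (w t x \<bullet> V t x $ i) + (q t x)^2 * (p t x $ i \<bullet> V t x $ i + w t x \<bullet> dV i i t x)" for i t x
 have cN: "continuous_on ?S (\<lambda>z. N i (fst z) (snd z))" for i
 proof -
  have "continuous_on ?S (\<lambda>z. J (snd z))" by (intro continuous_on_compose2[OF cJ[of UNIV]] continuous_intros) auto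
  moreover have "J x ~= 0" for x using Jpos[of x] by linarith
  ultimately show ?thesis unfolding N_def by (intro continuous_intros cq cw cVV cp cV) auto
 qed
 have zN: "N i t x = 0" if "t >= 0" "norm x > R" for i t x using qz[OF that] by (simp add: N_def)
 have iN: "integrable lborel (N i t)" if "t >= 0" for i t
  using that by (auto intro!: compact_support_integrable[where R=R] continuous_slice cN zN)
 have N0: "(LINT x|lborel. N i t x) = 0" if t: "t >= 0" for i t
 proof -
  define h' where "h' x v = - 2 * q t x * ((x \<bullet> v) / J x) * (w t x \<bullet> V t x $ i)
    + (q t x)^2 * ((\<Sum>l\<in>UNIV. v $ l *\<^sub>R p t x $ l) \<bullet> V t x $ i + w t x \<bullet> (\<Sum>l\<in>UNIV. v $ l *\<^sub>R dV i l t x))" for x v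
  have h'N: "h' x (axis i 1) = N i t x" for x
   by (simp add: h'_def N_def inner_axis axis_def if_distrib[of "\<lambda>r. r *\<^sub>R _"] cong: if_cong)
     (simp add: inner_axis[unfolded axis_def])
  obtain B where B: "!!x. norm (N i t x) <= B * weight x"
   using compact_support_weight_bound[OF continuous_slice[OF cN t] zN[OF t]] by blast
  have d: "((\<lambda>x. (q t x)\<^sup>2 * (w t x \<bullet> V t x $ i)) has_derivative h' x) (at x)" for x
   by (rule has_derivative_eq_rhs[OF has_derivative_mult[OF qx has_derivative_inner[OF wx[OF t] Vx[OF t, folded V_def]]]])
     (simp add: fun_eq_iff h'_def algebra_simps)
  have "(LINT x|lborel. h' x (axis i 1)) = 0"
  proof (rule integral_partial_zero[OF d])
   show "integrable lborel (\<lambda>x. (q t x)\<^sup>2 * (w t x \<bullet> V t x $ i))"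
    by (rule compact_support_integrable[where R=R])
     (use qz[OF t] in \<open>auto intro!: continuous_intros continuous_slice[OF _ t] cq cw cVV\<close>)
   show "norm (h' x (axis i 1)) <= B * weight x" for x unfolding h'N by (rule B)
   show "(\<lambda>x. h' x (axis i 1)) \<in> borel_measurable borel" unfolding h'N
    by (intro borel_measurable_continuous_onI continuous_slice[OF cN t])
  qed
  then show ?thesis by (simp add: h'N)
 qed
 define Y where "Y t = (LINT x|lborel. (q t x)\<^sup>2 * (norm (w t x))^2)" for t
 have iY: "integrable lborel (\<lambda>x. (q t x)\<^sup>2 * (norm (w t x))^2)" if t: "t >= 0" for t
  by (rule compact_support_integrable[where R=R])
   (use qz[OF t] in \<open>auto intro!: continuous_intros continuous_slice[OF _ t] cq cw\<close>)
 then show "integrable lborel (\<lambda>x. (q T x)\<^sup>2 * (norm (w T x))^2)" using T by blast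
 have young: "\<alpha> * \<beta> <= c * \<alpha>\<^sup>2 + \<beta>\<^sup>2 / (4 * c)" if "c > 0" for \<alpha> \<beta> c :: real
 proof -
  have "0 <= (2 * c * \<alpha> - \<beta>)^2 / (4 * c)" using that by simp
  also have "... = c * \<alpha>\<^sup>2 + \<beta>\<^sup>2 / (4 * c) - \<alpha> * \<beta>" using that by (simp add: field_simps power2_eq_square)
  finally show ?thesis by simp
 qed
 \<comment> \<open>The cross term has no sign. Half of the coercive term |g|^2/2 absorbs it at the
   price of |H|^2, so the energy is bounded below up to the data.\<close>
 have e_lower: "(norm (w t x))\<^sup>2 / 2 <= e t x + (norm (H x))^2"
  "(norm (w t x))\<^sup>2 / 2 + (norm (g t x))^2 / 4 - norm (g t x) * norm (H x) <= e t x" for t x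
 proof -
  have "- (norm (g t x) * norm (H x)) <= g t x \<bullet> H x"
   using Cauchy_Schwarz_ineq2[of "g t x" "H x"] by linarith
  moreover have "(norm (g t x))\<^sup>2 / 2 <= (A x *v g t x) \<bullet> g t x" by (rule A(3))
  ultimately show 2: "(norm (w t x))\<^sup>2 / 2 + (norm (g t x))^2 / 4 - norm (g t x) * norm (H x) <= e t x"
   unfolding e_def power2_norm_eq_inner by linarith
  show "(norm (w t x))\<^sup>2 / 2 <= e t x + (norm (H x))^2"
   using young[of "1/4" "norm (g t x)" "norm (H x)"] 2 by simp
 qed
 have E_lower: "Y t <= 2 * (E t + R\<^sup>2 * h\<^sup>2)" if t: "t >= 0" for t
 proof -
  have "Y t / 2 = (LINT x|lborel. (q t x)\<^sup>2 * (norm (w t x))^2 / 2)" unfolding Y_def by simp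
  also have "... <= (LINT x|lborel. F t x + R\<^sup>2 * (norm (H x))^2)"
  proof (rule integral_mono)
   fix x
   have "(q t x)\<^sup>2 * ((norm (w t x))^2 / 2) <= (q t x)^2 * (e t x + (norm (H x))^2)"
    by (intro mult_left_mono e_lower) auto
   also have "... <= F t x + R\<^sup>2 * (norm (H x))^2"
    using q0 qR[OF t, of x] by (auto simp: F_def distrib_left intro!: mult_right_mono power_mono)
   finally show "(q t x)\<^sup>2 * (norm (w t x))^2 / 2 <= F t x + R\<^sup>2 * (norm (H x))^2" by simp
  qed (use iY[OF t] iF[OF t] H(2) in auto)
  also have "... = E t + R\<^sup>2 * (LINT x|lborel. (norm (H x))\<^sup>2)"
   unfolding E_def using iF[OF t] H(2) by simp
  also have "... <= E t + R\<^sup>2 * h\<^sup>2" using H(3) by (intro add_left_mono mult_left_mono) auto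
  finally show ?thesis by simp
 qed
 have E0: "E 0 <= R\<^sup>2 * b\<^sup>2 / 2"
 proof -
  have "E 0 <= (LINT x|lborel. R\<^sup>2 / 2 * (norm (w 0 x))^2)"
   unfolding E_def
  proof (rule integral_mono)
   fix x
   have "F 0 x = (q 0 x)^2 * ((norm (w 0 x))^2 / 2)"
    by (simp add: F_def e_def g0 power2_norm_eq_inner)
   also have "... <= R\<^sup>2 * ((norm (w 0 x))^2 / 2)"
    using q0 qR[of 0 x] by (intro mult_right_mono power_mono) auto
   finally show "F 0 x <= R\<^sup>2 / 2 * (norm (w 0 x))^2" by simp
  qed (use iF[of 0] w0 in auto)
  also have "... = R\<^sup>2 / 2 * (LINT x|lborel. (norm (w 0 x))\<^sup>2)" by simp
  also have "... <= R\<^sup>2 / 2 * b\<^sup>2" using w0 by (intro mult_left_mono) auto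
  finally show ?thesis by simp
 qed
 \<comment> \<open>Moving the cutoff inwards with speed 8 contributes -16 q e, the flux at most 2 q
   |w| |V|. With |V| \<le> 2 |g| + |H| and Young's inequality, -8 e plus the flux term is at most 17
   |H|^2, whence 34 R |H|^2. Only the source term keeps w.\<close>
 have pw: "Ft t x - (\<Sum>i\<in>UNIV. N i t x) <= 34 * R * (norm (H x))^2 + (s * ((q t x)^2 * (norm (w t x))^2) + R\<^sup>2 * (norm (r t x))^2 / s) / 2"
  if t: "t >= 0" and s: "s > 0" for t x s
 proof -
  define y :: "real^'d" where "y = x /\<^sub>R J x"
  have ny: "norm y <= 1" using Jn[of x] Jpos[of x] by (simp add: y_def divide_simps)
  define W G h where "W = norm (w t x)" and "G = norm (g t x)" and "h = norm (H x)"
  have eq: "Ft t x - (\<Sum>i\<in>UNIV. N i t x) = 2 * q t x * (- 8 * e t x + (\<Sum>i\<in>UNIV. y $ i * (w t x \<bullet> V t x $ i))) + (q t x)^2 * (w t x \<bullet> r t x)"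
  proof -
   have a: "V t x \<bullet> p t x = (\<Sum>i\<in>UNIV. p t x $ i \<bullet> V t x $ i)" by (simp add: inner_vec_def inner_commute)
   have b: "w t x \<bullet> w' t x = (\<Sum>i\<in>UNIV. w t x \<bullet> dV i i t x) + w t x \<bullet> r t x"
    by (simp add: w'_def inner_add_right inner_sum_right)
   have "(\<Sum>i\<in>UNIV. N i t x) = - 2 * q t x * (\<Sum>i\<in>UNIV. y $ i * (w t x \<bullet> V t x $ i)) + (q t x)^2 * ((\<Sum>i\<in>UNIV. p t x $ i \<bullet> V t x $ i) + (\<Sum>i\<in>UNIV. w t x \<bullet> dV i i t x))"
    unfolding N_def sum.distrib sum_distrib_left distrib_left
    by (intro arg_cong2[of _ _ _ _ "(+)"] sum.cong refl) (simp_all add: y_def divide_inverse)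
   then show ?thesis unfolding Ft_def et_def a b by (simp add: algebra_simps)
  qed
  have "(\<Sum>i\<in>UNIV. y $ i * (w t x \<bullet> V t x $ i)) <= W * (norm y * norm (V t x))"
   using sum_inner_le[of y "w t x" "V t x"] by (simp add: W_def)
  also have "... <= W * (1 * (2 * G + h))"
  proof (intro mult_left_mono mult_mono ny)
   show "norm (V t x) <= 2 * G + h"
    unfolding V_def G_def h_def by (rule order_trans[OF norm_triangle_ineq]) (simp add: A(4))
  qed (auto simp: W_def)
  finally have f1: "(\<Sum>i\<in>UNIV. y $ i * (w t x \<bullet> V t x $ i)) <= 2 * (W * G) + W * h" by (simp add: algebra_simps)
  have f2: "W\<^sup>2 / 2 + G\<^sup>2 / 4 - G * h <= e t x" using e_lower(2)[of t x] by (simp add: W_def G_def h_def)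
  have f3: "2 * (W * G) <= W\<^sup>2 + G\<^sup>2" using sum_squares_bound[of W G] by (simp add: mult.assoc)
  have f4: "W * h <= W\<^sup>2 + h\<^sup>2" using young[of 1 W h] zero_le_power2[of h] by linarith
  have f5: "G * h <= G\<^sup>2 / 8 + 2 * h\<^sup>2" using young[of "1/8" G h] by simp
  have "- 8 * e t x + (\<Sum>i\<in>UNIV. y $ i * (w t x \<bullet> V t x $ i)) <= 17 * h\<^sup>2"
   using f1 f2 f3 f4 f5 zero_le_power2[of W] zero_le_power2[of G] by linarith
  then have "2 * q t x * (- 8 * e t x + (\<Sum>i\<in>UNIV. y $ i * (w t x \<bullet> V t x $ i))) <= 2 * q t x * (17 * h\<^sup>2)"
   using q0 by (intro mult_left_mono) auto
  also have "... <= 34 * R * h\<^sup>2"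
   using qR[OF t, of x] mult_right_mono[of "q t x" R "34 * h\<^sup>2"] by simp
  finally have g1: "2 * q t x * (- 8 * e t x + (\<Sum>i\<in>UNIV. y $ i * (w t x \<bullet> V t x $ i))) <= 34 * R * h\<^sup>2" .
  have "w t x \<bullet> r t x <= W * norm (r t x)" unfolding W_def by (rule norm_cauchy_schwarz)
  also have "... <= s / 2 * W\<^sup>2 + (norm (r t x))^2 / (2 * s)" using young[of "s / 2" W "norm (r t x)"] s by simp
  finally have "(q t x)\<^sup>2 * (w t x \<bullet> r t x) <= (q t x)^2 * (s / 2 * W\<^sup>2 + (norm (r t x))^2 / (2 * s))"
   by (intro mult_left_mono) auto
  also have "... = s * ((q t x)^2 * W\<^sup>2) / 2 + (q t x)^2 * ((norm (r t x))^2 / (2 * s))" by (simp add: algebra_simps)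
  also have "... <= s * ((q t x)^2 * W\<^sup>2) / 2 + R\<^sup>2 * ((norm (r t x))^2 / (2 * s))"
   using q0 qR[OF t, of x] s by (intro add_left_mono mult_right_mono power_mono) auto
  finally have "(q t x)\<^sup>2 * (w t x \<bullet> r t x) <= (s * ((q t x)^2 * W\<^sup>2) + R\<^sup>2 * (norm (r t x))^2 / s) / 2"
   using s by (simp add: field_simps)
  from add_mono[OF g1 this] show ?thesis unfolding eq W_def h_def .
 qed
 have E'_le: "E' t <= 34 * R * h\<^sup>2 + (s * Y t + R\<^sup>2 * rho\<^sup>2 / s) / 2" if t: "t >= 0" and s: "s > 0" for t s
 proof -
  have "E' t = (LINT x|lborel. Ft t x - (\<Sum>i\<in>UNIV. N i t x))"
   unfolding E'_def using iF[OF t] iN[OF t] N0[OF t] by simp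
  also have "... <= (LINT x|lborel. 34 * R * (norm (H x))^2 + (s * ((q t x)^2 * (norm (w t x))^2) + R\<^sup>2 * (norm (r t x))^2 / s) / 2)"
   by (rule integral_mono[OF _ _ pw[OF t s]]) (use iF[OF t] iN[OF t] H(2) iY[OF t] r2(1)[OF t] in auto)
  also have "... = 34 * R * (LINT x|lborel. (norm (H x))\<^sup>2) + (s * Y t + R\<^sup>2 * (LINT x|lborel. (norm (r t x))\<^sup>2) / s) / 2"
   unfolding Y_def using H(2) iY[OF t] r2(1)[OF t] by simp
  also have "... <= 34 * R * h\<^sup>2 + (s * Y t + R\<^sup>2 * rho\<^sup>2 / s) / 2"
   using H(3) r2(2)[OF t] R s by (intro add_mono divide_right_mono mult_left_mono) auto
  finally show ?thesis .
 qed
 \<comment> \<open>The added \<open>R\<close> keeps the radicand positive, so the root is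
   differentiable, and gives G \<ge> sqrt R. The contribution of \<open>H\<close> to G' is then of
   order sqrt R and disappears after division by R as R tends to infinity.\<close>
 define G where "G t = sqrt (2 * (E t + R\<^sup>2 * h\<^sup>2) + R)" for t
 have Ypos: "Y t >= 0" for t unfolding Y_def by (rule Bochner_Integration.integral_nonneg) simp
 have arg: "2 * (E t + R\<^sup>2 * h\<^sup>2) + R >= R" if "t >= 0" for t using E_lower[OF that] Ypos[of t] by linarith
 have Gpos: "G t >= sqrt R" "G t > 0" if "t >= 0" for t
  using arg[OF that] R by (auto simp: G_def)
 define kappa where "kappa = 34 * R * h\<^sup>2 / sqrt R + rho * R"
 have GY: "Y t <= (G t)^2" if "t >= 0" for t
  using E_lower[OF that] arg[OF that] R by (simp add: G_def)
 have Gd: "(G has_derivative (\<lambda>v. v * (E' t / G t))) (at t within {0..T})" if t: "t \<in> {0..T}" for t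
 proof -
  have "0 < 2 * (E t + R\<^sup>2 * h\<^sup>2) + R" using arg[of t] t R by auto
  then show ?thesis
   unfolding G_def
   by (auto intro!: derivative_eq_intros Edt[OF t] simp: fun_eq_iff divide_simps)
 qed
 have Gd_le: "E' t / G t <= kappa" if t: "t >= 0" for t
 proof -
  \<comment> \<open>The Young parameter is taken proportional to 1/G so that both halves of the
    source term are at most rho R G; after division by G the growth is rho R, independent of
    w.\<close>
  define s where "s = rho * R / G t"
  have s: "s > 0" using rho R Gpos[OF t] by (simp add: s_def)
  have "s * Y t <= s * (G t)^2" using GY[OF t] s by (intro mult_left_mono) auto
  also have "... = rho * R * G t" using Gpos[OF t] by (simp add: s_def power2_eq_square)
  finally have 1: "s * Y t <= rho * R * G t" .
  have 2: "R\<^sup>2 * rho\<^sup>2 / s = rho * R * G t" using rho R by (simp add: s_def power2_eq_square)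
  have "E' t <= 34 * R * h\<^sup>2 + rho * R * G t"
  proof -
   have "\<alpha> <= \<beta> + (xi + eta) / 2 ==> xi <= eta ==> \<alpha> <= \<beta> + eta" for \<alpha> \<beta> xi eta :: real by (simp add: field_simps)
   from this[OF E'_le[OF t s, unfolded 2] 1] show ?thesis .
  qed
  then have "E' t / G t <= (34 * R * h\<^sup>2 + rho * R * G t) / G t"
   using Gpos[OF t] by (intro divide_right_mono) auto
  also have "... = 34 * R * h\<^sup>2 / G t + rho * R" using Gpos[OF t] by (simp add: field_simps)
  also have "... <= kappa"
   unfolding kappa_def using Gpos[OF t] R by (intro add_right_mono divide_left_mono mult_pos_pos) auto
  finally show ?thesis .
 qed
 have "G T <= G 0 + T * kappa"
 proof (cases "T = 0")
  case False
  then have "0 < T" using T by simp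
  then obtain xi where xi: "xi \<in> {0<..<T}" "G T - G 0 = (T - 0) * (E' xi / G xi)"
   using mvt_simple[of 0 T G "\<lambda>t v. v * (E' t / G t)"] Gd by auto
  have "(T - 0) * (E' xi / G xi) <= T * kappa" using xi(1) T unfolding diff_0_right by (intro mult_left_mono Gd_le) auto
  then show ?thesis using xi(2) by linarith
 qed simp
 moreover have "G 0 <= sqrt (R\<^sup>2 * b\<^sup>2 + 2 * R\<^sup>2 * h\<^sup>2 + R)"
  unfolding G_def using E0 by simp
 moreover have "sqrt (Y T) <= G T"
  using GY[OF T] Gpos(2)[OF T] by (intro real_le_lsqrt) auto
 ultimately show "sqrt (LINT x|lborel. (q T x)\<^sup>2 * (norm (w T x))^2) <= sqrt (R\<^sup>2 * b\<^sup>2 + 2 * R\<^sup>2 * h\<^sup>2 + R) + T * (34 * R * h\<^sup>2 / sqrt R + rho * R)"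
  unfolding Y_def kappa_def by linarith
qed

text \<open>Divide the localized estimate by R and let R tend to infinity: the cutoff over R tends
  to 1 pointwise, Fatou's lemma yields the integrability of |w|^2, and the two terms of lower order
  in R vanish. The limit is sqrt(b^2 + 2 h^2) + T rho.\<close>

lemma energy_estimate:
 fixes w r :: "real => real^'d::finite => complex" and p g :: "real => real^'d => complex^'d"
  and A :: "real^'d => complex^'d^'d" and H :: "real^'d => complex^'d"
  and dV :: "'d => 'd => real => real^'d => complex"
 assumes A: "continuous_on UNIV A" "!!x u v. (A x *v u) \<bullet> v = u \<bullet> (A x *v v)"
   "!!x v. (norm v)\<^sup>2 / 2 <= (A x *v v) \<bullet> v" "!!x v. norm (A x *v v) <= 2 * norm v"
  and H: "continuous_on UNIV H" "integrable lborel (\<lambda>x. (norm (H x))\<^sup>2)" "(LINT x|lborel. (norm (H x))\<^sup>2) <= h\<^sup>2"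
  and cw: "continuous_on ({0..} \<times> UNIV) (\<lambda>z. w (fst z) (snd z))"
  and cp: "continuous_on ({0..} \<times> UNIV) (\<lambda>z. p (fst z) (snd z))"
  and cg: "continuous_on ({0..} \<times> UNIV) (\<lambda>z. g (fst z) (snd z))"
  and cr: "continuous_on ({0..} \<times> UNIV) (\<lambda>z. r (fst z) (snd z))"
  and cV: "!!i l. continuous_on ({0..} \<times> UNIV) (\<lambda>z. dV i l (fst z) (snd z))"
  and wt: "!!t x. t >= 0 ==> ((\<lambda>s. w s x) has_vector_derivative (\<Sum>i\<in>UNIV. dV i i t x) + r t x) (at t within {0..})"
  and gt: "!!t x. t >= 0 ==> ((\<lambda>s. g s x) has_vector_derivative p t x) (at t within {0..})"
  and wx: "!!t x. t >= 0 ==> (w t has_derivative (\<lambda>h. \<Sum>l\<in>UNIV. h $ l *\<^sub>R p t x $ l)) (at x)"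
  and Vx: "!!i t x. t >= 0 ==> ((\<lambda>x. (A x *v g t x + H x) $ i) has_derivative (\<lambda>h. \<Sum>l\<in>UNIV. h $ l *\<^sub>R dV i l t x)) (at x)"
  and g0: "!!x. g 0 x = 0"
  and r2: "!!t. 0 <= t ==> L2_le (r t) rho" and rho: "rho > 0"
  and w0: "L2_le (w 0) b" and h: "h >= 0" and T: "T >= 0"
 shows "L2_le (w T) (b + 2 * h + T * rho)"
proof -
 have b: "b >= 0" using w0 by (simp add: L2_le_def)
 define R where "R n = real (Suc n)" for n
 have R: "R n > 0" for n by (simp add: R_def)
 define q where "q n x = max 0 (R n - 8 * T - sqrt (1 + x \<bullet> x))" for n and x :: "real^'d"
 define c where "c n = sqrt (b\<^sup>2 + 2 * h\<^sup>2 + 1 / R n) + T * (34 * h\<^sup>2 / sqrt (R n) + rho)" for n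
 have en: "integrable lborel (\<lambda>x. (q n x / R n)\<^sup>2 * (norm (w T x))^2)"
   "(LINT x|lborel. (q n x / R n)\<^sup>2 * (norm (w T x))^2) <= (c n)^2" for n
 proof -
  note EC = energy_cutoff[of A H h w p g r dV rho b "R n" T, OF A H cw cp cg cr cV wt gt wx Vx g0 _ _ rho _ _ R T, folded q_def]
  have i: "integrable lborel (\<lambda>x. (q n x)\<^sup>2 * (norm (w T x))^2)"
   by (rule EC(1)) (use r2 w0 in \<open>auto simp: L2_le_def L2_def\<close>)
  have s: "sqrt (LINT x|lborel. (q n x)\<^sup>2 * (norm (w T x))^2) <= sqrt ((R n)^2 * b\<^sup>2 + 2 * (R n)^2 * h\<^sup>2 + R n) + T * (34 * R n * h\<^sup>2 / sqrt (R n) + rho * R n)"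
   by (rule EC(2)) (use r2 w0 in \<open>auto simp: L2_le_def L2_def\<close>)
  have "sqrt ((R n)^2 * b\<^sup>2 + 2 * (R n)^2 * h\<^sup>2 + R n) = sqrt ((R n)^2 * (b\<^sup>2 + 2 * h\<^sup>2 + 1 / R n))"
   using R[of n] by (simp add: distrib_left power2_eq_square)
  also have "... = R n * sqrt (b\<^sup>2 + 2 * h\<^sup>2 + 1 / R n)" using R[of n] by (simp add: real_sqrt_mult)
  finally have "sqrt (LINT x|lborel. (q n x)\<^sup>2 * (norm (w T x))^2) <= R n * c n"
   using s by (simp add: c_def algebra_simps)
  then have "(LINT x|lborel. (q n x)\<^sup>2 * (norm (w T x))^2) <= (R n * c n)^2"
   by (rule sqrt_le_D)
  then have *: "(LINT x|lborel. (q n x)\<^sup>2 * (norm (w T x))^2) / (R n)^2 <= (c n)^2"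
   using R[of n] by (simp add: power_mult_distrib divide_le_eq mult.commute)
  have eq: "(q n x / R n)\<^sup>2 * (norm (w T x))^2 = ((q n x)^2 * (norm (w T x))^2) / (R n)^2" for x
   by (simp add: power_divide)
  show "integrable lborel (\<lambda>x. (q n x / R n)\<^sup>2 * (norm (w T x))^2)" unfolding eq using i by simp
  show "(LINT x|lborel. (q n x / R n)\<^sup>2 * (norm (w T x))^2) <= (c n)^2" unfolding eq using * by simp
 qed
 have Rinf: "filterlim R at_top sequentially"
  unfolding R_def by (rule filterlim_compose[OF filterlim_real_sequentially filterlim_Suc])
 have iR: "(\<lambda>n. 1 / R n) \<longlonglongrightarrow> 0"
  using Rinf by (intro tendsto_divide_0[OF tendsto_const] filterlim_at_top_imp_at_infinity)
 have clim: "c \<longlonglongrightarrow> sqrt (b\<^sup>2 + 2 * h\<^sup>2 + 0) + T * (0 + rho)"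
  unfolding c_def
 proof (intro tendsto_intros iR)
  have "filterlim (\<lambda>n. sqrt (R n)) at_top sequentially"
   by (rule filterlim_compose[OF sqrt_at_top Rinf])
  then show "(\<lambda>n. 34 * h\<^sup>2 / sqrt (R n)) \<longlonglongrightarrow> 0"
   by (intro tendsto_divide_0[OF tendsto_const] filterlim_at_top_imp_at_infinity)
 qed
 have qlim: "(\<lambda>n. q n x / R n) \<longlonglongrightarrow> 1" for x
 proof -
  have "(\<lambda>n. max 0 (1 - (8 * T + sqrt (1 + x \<bullet> x)) * (1 / R n))) \<longlonglongrightarrow> max 0 (1 - (8 * T + sqrt (1 + x \<bullet> x)) * 0)"
   by (intro tendsto_intros iR)
  moreover have "q n x / R n = max 0 (1 - (8 * T + sqrt (1 + x \<bullet> x)) * (1 / R n))" for n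
   using R[of n] by (simp add: q_def max_def field_simps)
  ultimately show ?thesis by simp
 qed
 have wc: "continuous_on UNIV (w T)" by (rule continuous_slice[OF cw T])
 then have wm: "w T \<in> borel_measurable borel" by (rule borel_measurable_continuous_onI)
 have "(\<integral>\<^sup>+x. ennreal ((norm (w T x))^2) \<partial>lborel) = (\<integral>\<^sup>+x. liminf (\<lambda>n. ennreal ((q n x / R n)^2 * (norm (w T x))^2)) \<partial>lborel)"
 proof (rule nn_integral_cong)
  fix x
  have "(\<lambda>n. ennreal ((q n x / R n)^2 * (norm (w T x))^2)) \<longlonglongrightarrow> ennreal (1\<^sup>2 * (norm (w T x))^2)"
   by (intro tendsto_ennrealI tendsto_intros qlim)
  then show "ennreal ((norm (w T x))^2) = liminf (\<lambda>n. ennreal ((q n x / R n)^2 * (norm (w T x))^2))"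
   by (subst lim_imp_Liminf[OF sequentially_bot]) auto
 qed
 also have "... <= liminf (\<lambda>n. \<integral>\<^sup>+x. ennreal ((q n x / R n)^2 * (norm (w T x))^2) \<partial>lborel)"
 proof (rule nn_integral_liminf)
  have [measurable]: "q n \<in> borel_measurable borel" for n unfolding q_def by measurable
  note wm[measurable]
  show "(\<lambda>x. ennreal ((q n x / R n)^2 * (norm (w T x))^2)) \<in> borel_measurable lborel" for n by measurable
 qed
 also have "... <= liminf (\<lambda>n. ennreal ((c n)^2))"
 proof (intro Liminf_mono always_eventually allI)
  fix n
  have "(\<integral>\<^sup>+x. ennreal ((q n x / R n)^2 * (norm (w T x))^2) \<partial>lborel) = ennreal (LINT x|lborel. (q n x / R n)\<^sup>2 * (norm (w T x))^2)"
   by (intro nn_integral_eq_integral en) auto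
  then show "(\<integral>\<^sup>+x. ennreal ((q n x / R n)^2 * (norm (w T x))^2) \<partial>lborel) <= ennreal ((c n)^2)"
   using en(2)[of n] by (simp add: ennreal_leI)
 qed
 also have "... = ennreal ((sqrt (b\<^sup>2 + 2 * h\<^sup>2 + 0) + T * (0 + rho))^2)"
  by (intro lim_imp_Liminf tendsto_ennrealI tendsto_power clim) simp
 also have "... <= ennreal ((b + 2 * h + T * rho)^2)"
 proof (intro ennreal_leI power_mono)
  have "b\<^sup>2 + 2 * h\<^sup>2 <= (b + 2 * h)^2" using b h by (simp add: power2_sum power_mult_distrib)
  then have "sqrt (b\<^sup>2 + 2 * h\<^sup>2) <= b + 2 * h" using b h by (intro real_le_lsqrt) auto
  then show "sqrt (b\<^sup>2 + 2 * h\<^sup>2 + 0) + T * (0 + rho) <= b + 2 * h + T * rho" by simp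
  show "0 <= sqrt (b\<^sup>2 + 2 * h\<^sup>2 + 0) + T * (0 + rho)" using T rho by simp
 qed
 finally have fin: "(\<integral>\<^sup>+x. ennreal ((norm (w T x))^2) \<partial>lborel) <= ennreal ((b + 2 * h + T * rho)^2)" .
 then have i: "integrable lborel (\<lambda>x. (norm (w T x))\<^sup>2)"
  by (intro integrableI_nonneg) (use wm in \<open>auto intro: le_less_trans[OF _ ennreal_less_top]\<close>)
 have "ennreal (LINT x|lborel. (norm (w T x))\<^sup>2) <= ennreal ((b + 2 * h + T * rho)^2)"
  using fin by (subst (asm) nn_integral_eq_integral[OF i]) auto
 then have "(LINT x|lborel. (norm (w T x))\<^sup>2) <= (b + 2 * h + T * rho)^2" by simp
 moreover have "b + 2 * h + T * rho >= 0" using b h T rho by simp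
 ultimately show ?thesis using i wm by (simp add: L2_le_def L2_def)
qed

section \<open>Time integrals\<close>

definition tint :: "(real => real^'d::finite => complex) => real => real^'d => complex" where
 "tint f t x = integral {0..t} (\<lambda>s. f s x)"

lemma tint_0 [simp]: "tint f 0 x = 0"
 by (simp add: tint_def)

lemma continuous_slice_time:
 fixes f :: "real => real^'d::finite => 'c::topological_space"
 assumes "continuous_on ({0..} \<times> UNIV) (\<lambda>z. f (fst z) (snd z))" "X \<subseteq> {0..}"
 shows "continuous_on X (\<lambda>s. f s x)"
proof -
 have "continuous_on X (\<lambda>s. (s, x))" by (intro continuous_intros)
 from continuous_on_compose2[OF assms(1) this] assms(2) show ?thesis by auto
qed

text \<open>Replaces the variable endpoint by a fixed interval, so joint continuity in (t, x)
  follows from the continuity of parameter integrals.\<close>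

lemma tint_scaled:
 assumes f: "continuous_on ({0..} \<times> UNIV) (\<lambda>z. f (fst z) (snd z))" and t: "t >= 0"
 shows "tint f t x = t *\<^sub>R integral (cbox 0 1) (\<lambda>s. f (t * s) x)"
proof (cases "t = 0")
 case False
 then have t: "t > 0" using t by simp
 have "((\<lambda>s. f s x) has_integral tint f t x) (cbox 0 t)"
  unfolding tint_def using continuous_slice_time[OF f, of "{0..t}" x]
  by (simp add: integrable_integral integrable_continuous_real)
 from has_integral_affinity[OF this, of t 0] t
 have "((\<lambda>s. f (t *\<^sub>R s + 0) x) has_integral (1 / t) *\<^sub>R tint f t x) ((\<lambda>s. (1 / t) *\<^sub>R s + - ((1 / t) *\<^sub>R 0)) ` cbox 0 t)"
  by simp
 moreover have "(\<lambda>s. (1 / t) *\<^sub>R s + - ((1 / t) *\<^sub>R 0)) ` cbox 0 t = cbox 0 1"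
 proof (intro set_eqI iffI)
  fix y assume "y \<in> cbox (0::real) 1"
  then show "y \<in> (\<lambda>s. (1 / t) *\<^sub>R s + - ((1 / t) *\<^sub>R 0)) ` cbox 0 t"
   using t by (intro image_eqI[of _ _ "t * y"]) (auto simp: mult_left_le)
 qed (use t in auto)
 ultimately have "((\<lambda>s. f (t * s) x) has_integral (1 / t) *\<^sub>R tint f t x) (cbox 0 1)" by simp
 then have "integral (cbox 0 1) (\<lambda>s. f (t * s) x) = (1 / t) *\<^sub>R tint f t x" by (rule integral_unique)
 then show ?thesis using t by simp
qed simp

lemma tint_continuous:
 fixes f :: "real => real^'d::finite => complex"
 assumes f: "continuous_on ({0..} \<times> UNIV) (\<lambda>z. f (fst z) (snd z))"
 shows "continuous_on ({0..} \<times> UNIV) (\<lambda>z. tint f (fst z) (snd z))"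
proof -
 have "continuous_on (({0..} \<times> (UNIV :: (real^'d) set)) \<times> cbox (0::real) 1) (\<lambda>y. (fst (fst y) * snd y, snd (fst y)))"
  by (intro continuous_intros)
 moreover have "(\<lambda>y. (fst (fst y) * snd y, snd (fst y))) ` (({0..} \<times> (UNIV :: (real^'d) set)) \<times> cbox (0::real) 1) \<subseteq> {0..} \<times> UNIV"
  by auto
 ultimately have "continuous_on (({0..} \<times> (UNIV :: (real^'d) set)) \<times> cbox (0::real) 1) (\<lambda>y. f (fst (fst y) * snd y) (snd (fst y)))"
  using continuous_on_compose2[OF f] by fastforce
 then have "continuous_on (({0..} \<times> (UNIV :: (real^'d) set)) \<times> cbox (0::real) 1) (\<lambda>(z, s). f (fst z * s) (snd z))"
  by (auto simp: case_prod_beta')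
 then have "continuous_on ({0..} \<times> UNIV) (\<lambda>z::real \<times> (real^'d). integral (cbox 0 1) (\<lambda>s. f (fst z * s) (snd z)))"
  by (rule integral_continuous_on_param)
 then have "continuous_on ({0..} \<times> UNIV) (\<lambda>z::real \<times> (real^'d). fst z *\<^sub>R integral (cbox 0 1) (\<lambda>s. f (fst z * s) (snd z)))"
  by (intro continuous_intros)
 then show ?thesis
  by (rule continuous_on_eq) (auto simp: tint_scaled[OF f])
qed

lemma tint_time_derivative:
 assumes f: "continuous_on ({0..} \<times> UNIV) (\<lambda>z. f (fst z) (snd z))" and t: "t >= 0"
 shows "((\<lambda>s. tint f s x) has_vector_derivative f t x) (at t within {0..})"
proof -
 have "((\<lambda>u. integral {0..u} (\<lambda>s. f s x)) has_vector_derivative f t x) (at t within {0..t + 1})"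
  by (rule integral_has_vector_derivative) (use t continuous_slice_time[OF f] in auto)
 moreover have "at t within {0..t + 1} = at t within {0..}"
  by (rule at_within_nhd[of _ "{..<t + 1}"]) (use t in auto)
 ultimately show ?thesis by (simp add: tint_def)
qed

text \<open>Leibniz rule at fixed time. The derivative in x is packaged as a bounded linear map,
  because the rule asks for its joint continuity in (x, s).\<close>

lemma tint_space_derivative:
 fixes f :: "real => real^'d::finite => complex"
 assumes f: "continuous_on ({0..} \<times> UNIV) (\<lambda>z. f (fst z) (snd z))"
  and D: "!!l. continuous_on ({0..} \<times> UNIV) (\<lambda>z. D l (fst z) (snd z))"
  and fD: "!!s x. s >= 0 ==> (f s has_derivative (\<lambda>h. \<Sum>l\<in>UNIV. h $ l *\<^sub>R D l s x)) (at x)"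
 shows "(tint f t has_derivative (\<lambda>h. \<Sum>l\<in>UNIV. h $ l *\<^sub>R tint (D l) t x)) (at x)"
proof -
 define B where "B x s = Blinfun (\<lambda>h. \<Sum>l\<in>UNIV. (h :: real^'d) $ l *\<^sub>R D l s x)" for x s
 have bl: "bounded_linear (\<lambda>h. \<Sum>l\<in>UNIV. (h :: real^'d) $ l *\<^sub>R D l s x)" for s x
  by (intro bounded_linear_sum bounded_linear_scaleR_left[THEN bounded_linear_compose] bounded_linear_vec_nth)
 have B: "blinfun_apply (B x s) = (\<lambda>h. \<Sum>l\<in>UNIV. (h :: real^'d) $ l *\<^sub>R D l s x)" for x s
  unfolding B_def by (rule bounded_linear_Blinfun_apply[OF bl])
 have cD: "continuous_on (UNIV \<times> cbox 0 t) (\<lambda>z. D l (snd z) (fst z))" for l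
 proof -
  have "continuous_on (UNIV \<times> cbox 0 t) (\<lambda>z::(real^'d) \<times> real. (snd z, fst z))" by (intro continuous_intros)
  moreover have "(\<lambda>z::(real^'d) \<times> real. (snd z, fst z)) ` (UNIV \<times> cbox 0 t) \<subseteq> {0..} \<times> UNIV" by auto
  ultimately show ?thesis using continuous_on_compose2[OF D[of l]] by fastforce
 qed
 have cB: "continuous_on (UNIV \<times> cbox 0 t) (\<lambda>(x, s). B x s)"
  unfolding case_prod_beta'
  by (rule continuous_on_blinfun_componentwise) (unfold B, intro continuous_intros cD)
 have 1: "((\<lambda>x. integral (cbox 0 t) (\<lambda>s. f s x)) has_derivative blinfun_apply (integral (cbox 0 t) (B x))) (at x within UNIV)"
 proof (rule leibniz_rule[OF _ _ cB])
  show "((\<lambda>x. f s x) has_derivative blinfun_apply (B x s)) (at x within UNIV)" if "s \<in> cbox 0 t" for x s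
   using that fD[of s x] by (simp add: B)
  show "(\<lambda>s. f s x) integrable_on cbox 0 t" for x
   using continuous_slice_time[OF f, of "{0..t}" x] by (simp add: integrable_continuous_real)
 qed auto
 have cBs: "B x integrable_on cbox 0 t"
 proof (rule integrable_continuous)
  have "continuous_on (cbox 0 t) (\<lambda>s. (x, s))" by (intro continuous_intros)
  from continuous_on_compose2[OF cB this] show "continuous_on (cbox 0 t) (B x)" by auto
 qed
 have "blinfun_apply (integral (cbox 0 t) (B x)) h = (\<Sum>l\<in>UNIV. h $ l *\<^sub>R tint (D l) t x)" for h
 proof -
  have i: "D l s integrable_on X ==> True" for l s X by simp
  have "blinfun_apply (integral (cbox 0 t) (B x)) h = integral (cbox 0 t) (\<lambda>s. \<Sum>l\<in>UNIV. h $ l *\<^sub>R D l s x)"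
   by (subst blinfun_apply_integral[OF cBs]) (simp add: B)
  also have "... = (\<Sum>l\<in>UNIV. integral (cbox 0 t) (\<lambda>s. h $ l *\<^sub>R D l s x))"
   using continuous_slice_time[OF D, of "{0..t}" _ x]
   by (intro integral_sum) (auto intro!: integrable_continuous_real continuous_intros)
  finally show ?thesis by (simp add: tint_def)
 qed
 then have "blinfun_apply (integral (cbox 0 t) (B x)) = (\<lambda>h. \<Sum>l\<in>UNIV. h $ l *\<^sub>R tint (D l) t x)" by (rule ext)
 then show ?thesis using 1 by (simp add: tint_def[abs_def])
qed

section \<open>Coefficient fields\<close>

text \<open>The entries may come with different frequency sets. Their union is made symmetric under
  negation and coefficients are padded with zeros; complex conjugation then maps the representation
  to itself, and uniqueness of coefficients yields \<open>a_herm\<close>.\<close>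

lemma trig_field_exists:
 fixes aT :: "real^'m::finite => complex^'d::finite^'d"
 assumes tr: "!!i j. trig_poly (\<lambda>y. aT y $ i $ j)" and he: "!!y. hermitian (aT y)"
 shows "\<exists>a S. trig_field aT a S"
proof -
 have "\<forall>i j. \<exists>S c. finite S \<and> (\<forall>y. aT y $ i $ j = tp S c y)"
  using tr unfolding trig_poly_def tp_def by blast
 then obtain S c where S: "!!i j. finite (S i j)" and c: "!!i j y. aT y $ i $ j = tp (S i j) (c i j) y" by metis
 define S0 where "S0 = (\<Union>i j. S i j) \<union> uminus ` (\<Union>i j. S i j)"
 define a where "a eta = (\<chi> i j. if eta \<in> S i j then c i j eta else 0)" for eta
 have fin: "finite S0" using S by (simp add: S0_def)
 have sub: "S i j \<subseteq> S0" for i j by (auto simp: S0_def)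
 have sym: "- eta \<in> S0 \<longleftrightarrow> eta \<in> S0" for eta by (auto simp: S0_def image_iff) (metis minus_minus)+
 have eq: "(\<lambda>y. aT y $ i $ j) = tp S0 (\<lambda>eta. a eta $ i $ j)" for i j
  unfolding c using tp_superset[OF fin sub[of i j], of "c i j"] by (simp add: a_def)
 have supp: "a eta = 0" if "eta \<notin> S0" for eta
  using sub that by (auto simp: a_def vec_eq_iff)
 have cn: "cnj (tp S0 d y) = tp S0 (\<lambda>eta. cnj (d (- eta))) y" for d y
 proof -
  have "cnj (tp S0 d y) = (\<Sum>eta\<in>S0. cnj (d eta) * cis (ivec (- eta) \<bullet> y))"
   by (simp add: tp_def cis_cnj ivec_minus)
  also have "... = tp S0 (\<lambda>eta. cnj (d (- eta))) y"
   unfolding tp_def by (rule sum.reindex_bij_witness[of _ uminus uminus]) (auto simp: sym)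
  finally show ?thesis .
 qed
 have "tp S0 (\<lambda>eta. a eta $ i $ j) = tp S0 (\<lambda>eta. cnj (a (- eta) $ j $ i))" for i j
 proof -
  have "tp S0 (\<lambda>eta. a eta $ i $ j) y = tp S0 (\<lambda>eta. cnj (a (- eta) $ j $ i)) y" for y
  proof -
   have "tp S0 (\<lambda>eta. a eta $ i $ j) y = aT y $ i $ j" using fun_cong[OF eq[of i j], of y] by simp
   also have "... = cnj (tp S0 (\<lambda>eta. a eta $ j $ i) y)" using he fun_cong[OF eq[of j i], of y] unfolding hermitian_def by metis
   also have "... = tp S0 (\<lambda>eta. cnj (a (- eta) $ j $ i)) y" by (rule cn)
   finally show ?thesis .
  qed
  then show ?thesis by (rule ext)
 qed
 then have h: "a eta $ i $ j = cnj (a (- eta) $ j $ i)" if "eta \<in> S0" for eta i j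
  using that by (simp add: tp_eq_iff[OF fin])
 have "trig_field aT a S0"
 proof
  show "aT y $ i $ j = (\<Sum>eta\<in>S0. a eta $ i $ j * cis (ivec eta \<bullet> y))" for y i j
   using fun_cong[OF eq[of i j], of y] by (simp add: tp_def)
  show "a (- eta) $ i $ j = cnj (a eta $ j $ i)" for eta i j
   using h[of "- eta" i j] supp[of eta] supp[of "- eta"] sym[of eta] by (cases "eta \<in> S0") auto
 qed (use fin supp in auto)
 then show ?thesis by blast
qed

text \<open>The inner product on complex vectors used here is real: it is the real part of the
  hermitian one. A hermitian matrix is symmetric for it.\<close>

lemma hermitian_inner:
 fixes M :: "complex^'d::finite^'d"
 assumes "hermitian M" shows "(M *v u) \<bullet> v = u \<bullet> (M *v v)"
proof -
 have i: "x \<bullet> y = Re (\<Sum>i\<in>UNIV. x $ i * cnj (y $ i))" for x y :: "complex^'d"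
  by (simp add: inner_vec_def inner_complex_def Re_sum)
 have m: "cnj (M $ i $ j) = M $ j $ i" for i j
  using assms unfolding hermitian_def by (metis complex_cnj_cnj)
 have "(\<Sum>i\<in>UNIV. (M *v u) $ i * cnj (v $ i)) = (\<Sum>i\<in>UNIV. \<Sum>j\<in>UNIV. M $ i $ j * u $ j * cnj (v $ i))"
  by (simp add: matrix_vector_mult_def sum_distrib_right)
 also have "... = (\<Sum>j\<in>UNIV. \<Sum>i\<in>UNIV. M $ i $ j * u $ j * cnj (v $ i))" by (rule sum.swap)
 also have "... = (\<Sum>j\<in>UNIV. u $ j * cnj ((M *v v) $ j))"
  by (simp add: matrix_vector_mult_def m sum_distrib_left mult_ac)
 finally show ?thesis unfolding i by simp
qed

lemma norm_matrix_vector_mult_le: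
 fixes M :: "complex^'d::finite^'d"
 shows "norm (M *v v) <= (\<Sum>i\<in>UNIV. \<Sum>j\<in>UNIV. norm (M $ i $ j)) * norm v"
proof -
 have "norm (M *v v) <= (\<Sum>i\<in>UNIV. norm ((M *v v) $ i))" unfolding norm_vec_def by (rule L2_set_le_sum) simp
 also have "... <= (\<Sum>i\<in>UNIV. \<Sum>j\<in>UNIV. norm (M $ i $ j) * norm v)"
 proof (rule sum_mono)
  fix i
  show "norm ((M *v v) $ i) <= (\<Sum>j\<in>UNIV. norm (M $ i $ j) * norm v)"
   unfolding matrix_vector_mult_def vec_lambda_beta
   by (intro sum_norm_le) (simp add: norm_mult Finite_Cartesian_Product.norm_nth_le mult_left_mono)
 qed
 finally show ?thesis by (simp add: sum_distrib_right)
qed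

section \<open>The phase\<close>

lemma C_ten_real:
 assumes "!!a is. a <= m ==> partials is (\<nu> a) k \<in> \<real>"
 shows "C_ten \<nu> m p k is \<in> \<real>"
proof -
 have v: "vec_tensor_power w is \<in> \<real>" for w "is"
  unfolding vec_tensor_power_def by (induction "is") auto
 have i: "id_tensor_power is \<in> \<real>" for "is" :: "'a list"
  by (induction "is" rule: id_tensor_power.induct) auto
 have r: "radial_tensor k n r is \<in> \<real>" for n r "is"
  unfolding radial_tensor_def case_prod_beta tensor_prod_def
  by (intro sum_in_Reals Reals_mult Reals_of_real v i)
 have d: "deriv_tensor \<nu> k \<alpha> \<beta> is \<in> \<real>" if "!!a. a \<in> set \<alpha> ==> a <= m" for \<alpha> \<beta> "is"
  using that
 proof (induction \<alpha> arbitrary: \<beta> "is")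
  case (Cons a \<alpha>)
  then show ?case
   by (cases \<beta>) (auto simp: tensor_prod_def intro!: Reals_mult assms)
 qed simp
 have n: "nu_tensor \<nu> k n (m - n) b is \<in> \<real>" for n b "is"
  unfolding nu_tensor_def
 proof (intro Reals_mult Reals_of_real sum_in_Reals d)
  fix \<alpha> \<beta> a assume "\<alpha> \<in> {\<alpha>. length \<alpha> = n \<and> sum_list \<alpha> = m - n}" "a \<in> set \<alpha>"
  then show "a <= m" using member_le_sum_list[of a \<alpha>] by auto
 qed
 show ?thesis
  unfolding C_ten_def tensor_prod_def by (intro sum_in_Reals Reals_mult Reals_of_real r n)
qed

lemma contr_real: "(!!is. T is \<in> \<real>) ==> contr p T q \<in> \<real>"
proof -
 assume T: "!!is. T is \<in> \<real>"
 have "(\<Prod>i\<leftarrow>is. complex_of_real (q $ i)) \<in> \<real>" for "is" by (induction "is") auto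
 then show ?thesis unfolding contr_def by (intro sum_in_Reals Reals_mult T)
qed

lemma contr_scaleR: "contr p T (c *\<^sub>R q) = of_real (c ^ p) * contr p T q"
proof -
 have "(\<Prod>i\<leftarrow>is. complex_of_real ((c *\<^sub>R q) $ i)) = of_real (c ^ length is) * (\<Prod>i\<leftarrow>is. of_real (q $ i))" for "is"
  by (induction "is") (simp_all add: mult_ac)
 then show ?thesis unfolding contr_def sum_distrib_left by (intro sum.cong) (auto simp: mult_ac)
qed

text \<open>The full frequency of a packet: the carrier frequency |k|, the transport along k/|k|
  that is hidden in the moving frame of the approximation, and the symbol of the amplitude
  equation.\<close>

definition phase :: "(nat => real^'d::finite => complex) => real^'d => real => nat => real => real^'d => complex" where
 "phase \<nu> k \<beta> L lam q = (let epsilon = lam powr \<beta> in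
   of_real (norm k + epsilon * ((k /\<^sub>R norm k) \<bullet> q))
   + of_real (epsilon\<^sup>2 * ((norm k)^2 * (norm q)^2 - (k \<bullet> q)\<^sup>2) / (2 * norm k ^ 3))
   + of_real lam * \<nu> 0 k / of_real (2 * norm k)
   + (\<Sum>(m, p)\<in>amp_indices L \<beta>. of_real (lam ^ m * epsilon ^ p) * contr p (C_ten \<nu> m p k) q))"

lemma phase_amp_symbol:
 "phase (rs_nu F aT) k \<beta> L lam q = of_real (norm k + lam powr \<beta> * ((k /\<^sub>R norm k) \<bullet> q)) + amp_symbol F aT k \<beta> L lam q"
 by (simp add: phase_def amp_symbol_def Let_def C_tensor_eq add.assoc)

text \<open>For m = 0 only the radial factor remains. Together with the evaluations below it
  identifies the entries (0,0), (0,1), (0,2) and (1,0) of the double expansion with carrier,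
  transport, transverse Laplacian and the nu^0 term: precisely the entries that the sum in the
  amplitude equation leaves out.\<close>

lemma contr_C_ten_0:
 "contr p (C_ten \<nu> 0 p k) eta = of_real (norm k powi (1 - int p)) * contr p (radial_tensor k 0 p) eta"
proof -
 have n: "contr b (nu_tensor \<nu> k 0 0 b) eta = (if b = 0 then 1 else 0)" for b
  by (simp add: contr_nu_tensor compositions_0 half_coeff_def)
 have "contr p (C_ten \<nu> 0 p k) eta = (\<Sum>r\<le>p. if r = p then of_real (norm k powi (1 - int p)) * contr p (radial_tensor k 0 p) eta else 0)"
 proof -
  have f: "(\<Sum>n\<le>0::nat. f n) = f 0" for f :: "nat => complex" by simp
  show ?thesis unfolding contr_C_ten f by (intro sum.cong refl) (auto simp: n)
 qed
 then show ?thesis by simp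
qed

lemma radial_indices_012: "radial_indices 0 = {(0, 0)}" "radial_indices (Suc 0) = {(1, 1)}" "radial_indices 2 = {(0, 1), (2, 2)}"
 unfolding radial_indices_def by (auto; presburger)+

lemma contr_C_ten_00: "contr 0 (C_ten \<nu> 0 0 k) eta = of_real (norm k)"
 by (simp add: contr_C_ten_0 contr_radial_tensor radial_indices_012 radial_coeff_def)

lemma contr_C_ten_01: "k ~= 0 ==> contr (Suc 0) (C_ten \<nu> 0 (Suc 0) k) eta = of_real ((k /\<^sub>R norm k) \<bullet> eta)"
 by (simp add: contr_C_ten_0 contr_radial_tensor radial_indices_012 radial_coeff_def)

lemma contr_C_ten_02:
 assumes "k ~= 0"
 shows "contr 2 (C_ten \<nu> 0 2 k) eta = of_real (((norm k)^2 * (norm eta)^2 - (k \<bullet> eta)\<^sup>2) / (2 * norm k ^ 3))"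
proof -
 have c: "radial_coeff 0 0 (Suc 0) = 1/2" "radial_coeff 0 2 2 = -1/2"
  by (simp_all add: radial_coeff_def lessThan_Suc numeral_2_eq_2)
 have p: "norm k powi (1 - int 2) = 1 / norm k" by (simp add: power_int_minus divide_inverse)
 have "norm k powi (1 - int 2) * ((1/2) * (eta \<bullet> eta) + (-1/2) * ((k /\<^sub>R norm k) \<bullet> eta)^2) = ((norm k)^2 * (norm eta)^2 - (k \<bullet> eta)\<^sup>2) / (2 * norm k ^ 3)"
  unfolding p using assms
  by (simp add: power_divide field_simps power2_norm_eq_inner[symmetric] power2_eq_square power3_eq_cube)
 moreover have "contr 2 (C_ten \<nu> 0 2 k) eta = of_real (norm k powi (1 - int 2) * ((1/2) * (eta \<bullet> eta) + (-1/2) * ((k /\<^sub>R norm k) \<bullet> eta)^2))"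
  unfolding contr_C_ten_0 contr_radial_tensor radial_indices_012 of_real_mult[of "norm k powi _"] by (simp add: c)
 ultimately show ?thesis by (simp only:)
qed

lemma contr_C_ten_10: "contr 0 (C_ten \<nu> (Suc 0) 0 k) eta = \<nu> 0 k / of_real (2 * norm k)"
proof -
 have h: "half_coeff (Suc 0) = 1/2" by (simp add: half_coeff_def numeral_2_eq_2)
 have c: "compositions (Suc 0) 0 = {[0]}" unfolding compositions_def by (auto simp: length_Suc_conv)
 have c': "compositions 0 (Suc 0) = {}" by (simp add: compositions_0)
 have r: "contr 0 (radial_tensor k (Suc 0) 0) eta = 1" unfolding contr_radial_tensor radial_indices_012 by (simp add: radial_coeff_def)
 have n0: "contr 0 (nu_tensor \<nu> k 0 (Suc 0) 0) eta = 0" unfolding contr_nu_tensor c' by simp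
 have n1: "contr 0 (nu_tensor \<nu> k (Suc 0) 0 0) eta = \<nu> 0 k / 2"
  unfolding contr_nu_tensor c h by (simp add: c contr_0)
 have f: "(\<Sum>n\<le>Suc 0. f n) = f 0 + f (Suc 0)" "(\<Sum>r\<le>0::nat. f r) = f 0" for f :: "nat => complex" by simp_all
 have d: "(0::nat) - 0 = 0" "Suc 0 - 0 = Suc 0" "Suc 0 - Suc 0 = 0" by simp_all
 have "contr 0 (C_ten \<nu> (Suc 0) 0 k) eta = of_real (norm k powi (1 - 2 * int (Suc 0) - int 0)) * (\<nu> 0 k / 2)"
  unfolding contr_C_ten f d n0 n1 r by (simp only: mult_1_right mult_zero_right add_0_left)
 also have "norm k powi (1 - 2 * int (Suc 0) - int 0) = inverse (norm k)" by (simp add: power_int_minus)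
 also have "of_real (inverse (norm k)) * (\<nu> 0 k / 2) = \<nu> 0 k / of_real (2 * norm k)"
  unfolding of_real_inverse of_real_mult divide_inverse inverse_mult_distrib by (simp only: mult_ac of_real_numeral)
 finally show ?thesis .
qed

lemma contr_bounded:
 fixes T :: "'d::finite tensor"
 obtains B where "B >= 0" "!!q. norm q <= rho ==> norm (contr p T q) <= B"
proof -
 have "compact (contr p T ` cball 0 rho)" by (intro compact_continuous_image contr_continuous) simp
 then obtain B where B: "!!y. y \<in> contr p T ` cball 0 rho ==> norm y <= B"
  using compact_imp_bounded bounded_iff by metis
 show thesis by (rule that[of "max B 0"]) (use B in \<open>force simp: le_max_iff_disj\<close>)+
qed

text \<open>The amplitude equation with its explicit terms is the Taylor sum over m \<le> L, p \<le>
  P, up to explicit terms that lie beyond degree P. Those have an exponent of epsilon of at least P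
  + 1.\<close>

lemma phase_difference:
 assumes k: "k ~= 0" and L: "L >= 1" and \<beta>: "\<beta> > 0"
 defines "P \<equiv> nat \<lfloor>real L / \<beta>\<rfloor>"
 obtains B where "B >= 0" "!!lam q. 0 < lam ==> lam <= 1 ==> norm q <= rho ==>
  norm (phase \<nu> k \<beta> L lam q - (\<Sum>m\<le>L. of_real (lam ^ m) * (\<Sum>p\<le>P. contr p (C_ten \<nu> m p k) ((lam powr \<beta>) *\<^sub>R q)))) <= B * (lam powr \<beta>) ^ Suc P"
proof -
 obtain B1 where B1: "B1 >= 0" "!!q. norm q <= rho ==> norm (contr (Suc 0) (C_ten \<nu> 0 (Suc 0) k) q) <= B1" using contr_bounded by blast
 obtain B2 where B2: "B2 >= 0" "!!q. norm q <= rho ==> norm (contr 2 (C_ten \<nu> 0 2 k) q) <= B2" using contr_bounded by blast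
 show thesis
 proof (rule that[of "B1 + B2"])
  fix lam :: real and q :: "real^'a" assume lam: "0 < lam" "lam <= 1" and q: "norm q <= rho"
  define epsilon where "epsilon = lam powr \<beta>"
  have epsilon: "0 <= epsilon" "epsilon <= 1" using lam \<beta> by (auto simp: epsilon_def powr_le_one_le powr_mono2[of \<beta> lam 1, simplified])
  define c where "c = (\<lambda>(m, p). of_real (lam ^ m * epsilon ^ p) * contr p (C_ten \<nu> m p k) q)"
  \<comment> \<open>The explicitly written terms. For small P the entries (0,1) and (0,2) can lie
    outside the rectangle \<open>G\<close>; this is the only discrepancy. The entry (1,0) is inside
    because L \<ge> 1.\<close>
  define X where "X = {(0, 0), (0, 1), (0, 2), (1::nat, 0::nat)}"
  define G where "G = {..L} \<times> {..P}"
  have P: "int p <= \<lfloor>real L / \<beta>\<rfloor> \<longleftrightarrow> p <= P" for p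
   unfolding P_def using \<beta> by (subst nat_le_eq_zle[symmetric]) auto
  have fin: "finite X" "finite G" "finite (amp_indices L \<beta>)" using \<beta> by (auto simp: X_def G_def finite_amp_indices)
  have un: "G \<union> X = amp_indices L \<beta> \<union> X" "amp_indices L \<beta> \<inter> X = {}"
   using L by (auto simp: G_def X_def amp_indices_def P)
  have "phase \<nu> k \<beta> L lam q = sum c X + sum c (amp_indices L \<beta>)"
   using k by (simp add: phase_def Let_def epsilon_def[symmetric] X_def c_def contr_C_ten_00 contr_C_ten_01 contr_C_ten_02 contr_C_ten_10)
  also have "... = sum c (G \<union> X)" unfolding un(1) using fin un(2) by (simp add: sum.union_disjoint)
  also have "... = sum c G + sum c (X - G)" using fin sum.union_disjoint[of G "X - G" c] by simp
  finally have 1: "phase \<nu> k \<beta> L lam q = sum c G + sum c (X - G)" .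
  have 2: "sum c G = (\<Sum>m\<le>L. of_real (lam ^ m) * (\<Sum>p\<le>P. contr p (C_ten \<nu> m p k) (epsilon *\<^sub>R q)))"
   unfolding G_def c_def sum.cartesian_product[symmetric] sum_distrib_left contr_scaleR
   by (simp add: mult.assoc)
  have "norm (sum c (X - G)) <= (\<Sum>x\<in>X - G. norm (c x))" by (rule norm_sum)
  also have "... <= (\<Sum>x\<in>X - G. (if snd x = 1 then B1 else B2) * epsilon ^ Suc P)"
  proof (rule sum_mono)
   fix x assume x: "x \<in> X - G"
   then have x': "x = (0, 1) \<and> P < 1 \<or> x = (0, 2) \<and> P < 2" using L by (auto simp: X_def G_def)
   then have e: "epsilon ^ snd x <= epsilon ^ Suc P" using epsilon by (intro power_decreasing) auto
   have "norm (c x) = epsilon ^ snd x * norm (contr (snd x) (C_ten \<nu> 0 (snd x) k) q)"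
    using x' epsilon by (auto simp: c_def norm_mult norm_power)
   also have "... <= epsilon ^ Suc P * (if snd x = 1 then B1 else B2)"
    using x' e epsilon B1 B2 q by (intro mult_mono) auto
   finally show "norm (c x) <= (if snd x = 1 then B1 else B2) * epsilon ^ Suc P" by (simp add: mult.commute)
  qed
  also have "... <= (\<Sum>x\<in>{(0::nat, 1::nat), (0, 2)}. (if snd x = 1 then B1 else B2) * epsilon ^ Suc P)"
   using B1 B2 epsilon L by (intro sum_mono2) (auto simp: X_def G_def)
  finally show "norm (phase \<nu> k \<beta> L lam q - (\<Sum>m\<le>L. of_real (lam ^ m) * (\<Sum>p\<le>P. contr p (C_ten \<nu> m p k) ((lam powr \<beta>) *\<^sub>R q)))) <= (B1 + B2) * (lam powr \<beta>) ^ Suc P"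
   unfolding 1 2 epsilon_def[symmetric] by (simp add: distrib_right)
 qed (use B1 B2 in simp)
qed

text \<open>Transfers the bounds from the truncated square root d to the phase f, from which it
  differs by O(epsilon^(P + 1)). The squares are compared through (f - d)(f + d), whose second
  factor is bounded.\<close>

lemma phase_expansion:
 fixes k :: "real^'d::finite"
 assumes k: "k ~= 0" and delta: "delta > 0" and \<nu>: "!!a. a <= L ==> smooth_on (ball k delta) (\<nu> a)"
  and L: "L >= 1" and \<beta>: "\<beta> > 0" and rho: "rho >= 0"
 defines "P \<equiv> nat \<lfloor>real L / \<beta>\<rfloor>"
 obtains C lam0 where "C >= 0" "0 < lam0" "lam0 <= 1"
  "!!lam q. 0 < lam ==> lam <= lam0 ==> norm q <= rho ==>
   norm (phase \<nu> k \<beta> L lam q - of_real (norm k)) <= C * (lam + lam powr \<beta>)"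
  "!!lam q. 0 < lam ==> lam <= lam0 ==> norm q <= rho ==>
   norm ((phase \<nu> k \<beta> L lam q)^2 - (of_real ((norm (k + (lam powr \<beta>) *\<^sub>R q))^2)
    + (\<Sum>j<L. of_real (lam ^ Suc j) * \<nu> j (k + (lam powr \<beta>) *\<^sub>R q)))) <= C * (lam ^ Suc L + (lam powr \<beta>) ^ Suc P)"
proof -
 obtain C1 r where C1: "C1 >= 0" "r > 0"
  "!!lam eta. 0 <= lam ==> lam <= 1 ==> norm eta <= r ==>
   norm ((\<Sum>m\<le>L. of_real (lam ^ m) * disp \<nu> m (k + eta)) - (\<Sum>m\<le>L. of_real (lam ^ m) * (\<Sum>p\<le>P. contr p (C_ten \<nu> m p k) eta))) <= C1 * norm eta ^ Suc P"
  "!!lam eta. 0 <= lam ==> lam <= 1 ==> norm eta <= r ==>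
   norm ((\<Sum>m\<le>L. of_real (lam ^ m) * disp \<nu> m (k + eta))^2 - (of_real ((norm (k + eta))^2) + (\<Sum>j<L. of_real (lam ^ Suc j) * \<nu> j (k + eta)))) <= C1 * lam ^ Suc L"
  "!!lam eta. 0 <= lam ==> lam <= 1 ==> norm eta <= r ==>
   norm ((\<Sum>m\<le>L. of_real (lam ^ m) * disp \<nu> m (k + eta)) - of_real (norm k)) <= C1 * (lam + norm eta)"
  by (rule dispersion_expansion[OF k delta \<nu>, where P=P]) (assumption, rule that)
 obtain B where B: "B >= 0" "!!lam q. 0 < lam ==> lam <= 1 ==> norm q <= rho ==>
  norm (phase \<nu> k \<beta> L lam q - (\<Sum>m\<le>L. of_real (lam ^ m) * (\<Sum>p\<le>P. contr p (C_ten \<nu> m p k) ((lam powr \<beta>) *\<^sub>R q)))) <= B * (lam powr \<beta>) ^ Suc P"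
  by (rule phase_difference[OF k L \<beta>, where rho=rho and \<nu>=\<nu>, folded P_def]) (rule that)
 \<comment> \<open>Ensures epsilon (rho + 1) \<le> r, so that epsilon q stays within the radius of
   validity of the expansion for every q in the ball.\<close>
 define lam0 where "lam0 = min 1 ((r / (rho + 1)) powr (1 / \<beta>))"
 define D where "D = B + C1 * rho ^ Suc P"
 define E where "E = C1 * (1 + rho)"
 define C where "C = D + E + D * (2 * norm k + 4 * E + D) + C1"
 have D0: "D >= 0" and E0: "E >= 0" using B(1) C1(1) rho by (auto simp: D_def E_def)
 have m0: "D * (2 * norm k + 4 * E + D) >= 0" using D0 E0 by simp
 have C: "C >= 0" "D + E <= C" "C1 <= C" "D * (2 * norm k + 4 * E + D) <= C"
  unfolding C_def using D0 E0 m0 C1(1) by linarith+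
 have main: "norm (phase \<nu> k \<beta> L lam q - of_real (norm k)) <= C * (lam + lam powr \<beta>) \<and>
   norm ((phase \<nu> k \<beta> L lam q)^2 - (of_real ((norm (k + (lam powr \<beta>) *\<^sub>R q))^2)
    + (\<Sum>j<L. of_real (lam ^ Suc j) * \<nu> j (k + (lam powr \<beta>) *\<^sub>R q)))) <= C * (lam ^ Suc L + (lam powr \<beta>) ^ Suc P)"
  if lam: "0 < lam" "lam <= lam0" and q: "norm q <= rho" for lam q
 proof -
  have lam1: "lam <= 1" using lam by (simp add: lam0_def)
  define epsilon where "epsilon = lam powr \<beta>"
  have epsilon: "0 <= epsilon" "epsilon <= 1" using lam lam1 \<beta> powr_mono2[of \<beta> lam 1] by (auto simp: epsilon_def)
  have "epsilon <= ((r / (rho + 1)) powr (1 / \<beta>)) powr \<beta>"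
   unfolding epsilon_def using lam \<beta> by (intro powr_mono2) (auto simp: lam0_def)
  also have "... = r / (rho + 1)" using C1(2) rho \<beta> by (simp add: powr_powr)
  finally have epsilonr: "epsilon * (rho + 1) <= r" using rho by (simp add: field_simps)
  have n1: "norm (epsilon *\<^sub>R q) <= epsilon * rho" using q epsilon by (simp add: mult_left_mono)
  have n2: "norm (epsilon *\<^sub>R q) <= r"
  proof -
   have "epsilon * rho <= epsilon * (rho + 1)" using epsilon by (intro mult_left_mono) auto
   then show ?thesis using n1 epsilonr by linarith
  qed
  define d where "d = (\<Sum>m\<le>L. complex_of_real (lam ^ m) * disp \<nu> m (k + epsilon *\<^sub>R q))"
  define S where "S = (\<Sum>m\<le>L. complex_of_real (lam ^ m) * (\<Sum>p\<le>P. contr p (C_ten \<nu> m p k) (epsilon *\<^sub>R q)))"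
  define f where "f = phase \<nu> k \<beta> L lam q"
  define kappa where "kappa = complex_of_real ((norm (k + epsilon *\<^sub>R q))^2) + (\<Sum>j<L. of_real (lam ^ Suc j) * \<nu> j (k + epsilon *\<^sub>R q))"
  have fS: "norm (f - S) <= B * epsilon ^ Suc P"
   unfolding f_def S_def epsilon_def by (rule B(2)[OF lam(1) lam1 q])
  have dS: "norm (d - S) <= C1 * norm (epsilon *\<^sub>R q) ^ Suc P"
   unfolding d_def S_def by (rule C1(3)) (use lam lam1 n2 in auto)
  have d2: "norm (d\<^sup>2 - kappa) <= C1 * lam ^ Suc L"
   unfolding d_def kappa_def by (rule C1(4)) (use lam lam1 n2 in auto)
  have dk: "norm (d - of_real (norm k)) <= C1 * (lam + norm (epsilon *\<^sub>R q))"
   unfolding d_def by (rule C1(5)) (use lam lam1 n2 in auto)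
  have "C1 * norm (epsilon *\<^sub>R q) ^ Suc P <= C1 * (epsilon * rho) ^ Suc P"
   using C1(1) n1 by (intro mult_left_mono power_mono) auto
  then have fd: "norm (f - d) <= D * epsilon ^ Suc P"
   using fS dS norm_triangle_ineq4[of "f - S" "d - S"] unfolding D_def power_mult_distrib distrib_right mult.assoc mult.commute[of "epsilon ^ _"]
   by (simp only: diff_diff_eq2 add_diff_cancel diff_add_cancel)
  have eP: "epsilon ^ Suc P <= epsilon" using power_decreasing[of 1 "Suc P" epsilon] epsilon by simp
  have fd1: "norm (f - d) <= D * epsilon"
   by (rule order_trans[OF fd]) (intro mult_left_mono eP D0)
  have "C1 * (lam + norm (epsilon *\<^sub>R q)) <= C1 * ((1 + rho) * (lam + epsilon))"
  proof (rule mult_left_mono[OF _ C1(1)])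
   have "(1 + rho) * (lam + epsilon) = lam + epsilon * rho + (rho * lam + epsilon)" by (simp add: algebra_simps)
   moreover have "0 <= rho * lam" using rho lam by simp
   ultimately show "lam + norm (epsilon *\<^sub>R q) <= (1 + rho) * (lam + epsilon)" using n1 epsilon by linarith
  qed
  then have dk1: "norm (d - of_real (norm k)) <= E * (lam + epsilon)" using dk by (simp add: E_def mult.assoc)
  have "norm (f - of_real (norm k)) <= D * epsilon + E * (lam + epsilon)"
   using norm_triangle_ineq[of "f - d" "d - of_real (norm k)"] fd1 dk1 by simp
  also have "... <= D * (lam + epsilon) + E * (lam + epsilon)"
   using lam D0 by (intro add_right_mono mult_left_mono) auto
  also have "... = (D + E) * (lam + epsilon)" by (simp add: distrib_right)
  also have "... <= C * (lam + epsilon)" using lam epsilon by (intro mult_right_mono C) auto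
  finally have r1: "norm (f - of_real (norm k)) <= C * (lam + epsilon)" .
  have nd: "norm d <= norm k + 2 * E"
  proof -
   have "E * (lam + epsilon) <= E * 2" using lam1 epsilon E0 by (intro mult_left_mono) auto
   then show ?thesis using norm_triangle_ineq[of "d - of_real (norm k)" "of_real (norm k)"] dk1 by simp
  qed
  have "D * epsilon <= D * 1" using D0 epsilon by (intro mult_left_mono) auto
  then have nf: "norm f <= norm k + 2 * E + D"
   using norm_triangle_ineq[of "f - d" d] fd1 nd by simp
  have "f\<^sup>2 - d\<^sup>2 = (f - d) * (f + d)" by (simp add: power2_eq_square algebra_simps)
  then have "norm (f\<^sup>2 - d\<^sup>2) = norm (f - d) * norm (f + d)" by (simp add: norm_mult)
  also have "... <= (D * epsilon ^ Suc P) * (2 * norm k + 4 * E + D)"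
   using fd nf nd norm_triangle_ineq[of f d] D0 epsilon by (intro mult_mono) auto
  also have "... <= C * epsilon ^ Suc P" using mult_right_mono[OF C(4), of "epsilon ^ Suc P"] epsilon by (simp add: mult_ac)
  finally have s1: "norm (f\<^sup>2 - d\<^sup>2) <= C * epsilon ^ Suc P" .
  have s2: "C1 * lam ^ Suc L <= C * lam ^ Suc L" using lam by (intro mult_right_mono C) auto
  have r2: "norm (f\<^sup>2 - kappa) <= C * (lam ^ Suc L + epsilon ^ Suc P)"
   using norm_triangle_ineq[of "f\<^sup>2 - d\<^sup>2" "d\<^sup>2 - kappa"] s1 s2 d2 by (simp add: distrib_left)
  show ?thesis using r1 r2 unfolding f_def kappa_def epsilon_def by blast
 qed
 show thesis
 proof (rule that[of C lam0])
  show "0 < lam0" using C1(2) rho by (simp add: lam0_def)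
 qed (use main C in \<open>auto simp: lam0_def\<close>)
qed

section \<open>The convergence rate and the quasimode\<close>

lemma sum_Suc_0_insert: "(\<Sum>n\<le>L. f n) = f 0 + (\<Sum>n\<in>{1..L}. f n)" for f :: "nat => 'a::comm_monoid_add"
proof -
 have "{..L} = insert 0 {1..L}" by auto
 then show ?thesis by simp
qed

text \<open>Makes each of lambda and epsilon at most lambda^gamma, and each of lambda^(L + 1) and
  epsilon^(P + 1) at most lambda^(L + gamma). The third entry is positive because P + 1 exceeds L /
  \<beta>; it depends on \<beta> and L only.\<close>

definition rate :: "real => nat => real" where
 "rate \<beta> L = min 1 (min \<beta> (\<beta> * real (Suc (nat \<lfloor>real L / \<beta>\<rfloor>)) - real L))"

lemma rate: "\<beta> > 0 ==> 0 < rate \<beta> L" "rate \<beta> L <= 1" "rate \<beta> L <= \<beta>"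
proof -
 assume \<beta>: "\<beta> > 0"
 have "real L / \<beta> < real (Suc (nat \<lfloor>real L / \<beta>\<rfloor>))"
  using \<beta> real_of_int_floor_add_one_gt[of "real L / \<beta>"] by (simp add: add.commute)
 then have "real L < \<beta> * real (Suc (nat \<lfloor>real L / \<beta>\<rfloor>))" using \<beta> by (simp add: divide_less_eq mult.commute)
 then show "0 < rate \<beta> L" unfolding rate_def using \<beta> by simp
qed (auto simp: rate_def)

lemma rate_bounds:
 assumes \<beta>: "\<beta> > 0" and lam: "0 < lam" "lam <= 1"
 shows "lam <= lam powr rate \<beta> L" "lam powr \<beta> <= lam powr rate \<beta> L" "lam powr rate \<beta> L <= 1"
  "lam ^ Suc L <= lam ^ L * lam powr rate \<beta> L" "(lam powr \<beta>) ^ Suc (nat \<lfloor>real L / \<beta>\<rfloor>) <= lam ^ L * lam powr rate \<beta> L"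
proof -
 have m: "lam powr b <= lam powr a" if "a <= b" for a b using lam that by (rule_tac powr_mono') auto
 show 1: "lam <= lam powr rate \<beta> L" using m[OF rate(2)[of \<beta> L]] lam by simp
 show "lam powr \<beta> <= lam powr rate \<beta> L" by (rule m) (rule rate(3))
 show "lam powr rate \<beta> L <= 1" using m[of 0 "rate \<beta> L"] rate(1)[OF \<beta>, of L] lam by simp
 show "lam ^ Suc L <= lam ^ L * lam powr rate \<beta> L" using 1 lam by (simp add: mult.commute)
 let ?P = "Suc (nat \<lfloor>real L / \<beta>\<rfloor>)"
 have "(lam powr \<beta>) ^ ?P = lam powr (\<beta> * real ?P)" using lam by (subst powr_realpow[symmetric]) (simp, simp only: powr_powr)
 also have "... <= lam powr (real L + rate \<beta> L)" by (rule m) (auto simp: rate_def)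
 also have "... = lam ^ L * lam powr rate \<beta> L" using lam by (simp add: powr_add powr_realpow)
 finally show "(lam powr \<beta>) ^ ?P <= lam ^ L * lam powr rate \<beta> L" .
qed

context trig_field
begin

text \<open>The vector potential of the whole corrector part: \<open>Psi\<close> minus its constant
  mode is the shifted divergence of \<open>head\<close>.\<close>

definition head :: "nat => real => real^'d => int^'m => complex^'d" where
 "head L lam K xi = (\<Sum>n\<in>{1..L}. of_real (lam ^ n) *s pot n K xi)"

lemma Psi_head: "Psi L lam K xi = (if xi = 0 then 1 else 0) + \<i> * cdot (wave_vec F K xi) (head L lam K xi)"
 unfolding Psi_def head_def sum_Suc_0_insert[of "\<lambda>n. of_real (lam ^ n) * phi n K xi"]
 by (simp add: phi_0) (simp add: phi_eq cdot_sum_right cdot_smult_right sum_distrib_left mult_ac)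

text \<open>A vector field whose shifted divergence is the initial velocity mismatch 1 - s Psi, with
  s the ratio of true to nominal frequency. The constant mode 1 - s is represented along K, using K
  \<noteq> 0; the corrector modes use \<open>head\<close>, so K + F xi is never divided by.\<close>

definition init_flux :: "nat => real => real^'d => real => int^'m => complex^'d" where
 "init_flux L lam K s xi = (if xi = 0 then (- \<i> * of_real ((1 - s) / (norm K)^2)) *s cvec K else 0) - of_real s *s head L lam K xi"

lemma init_flux:
 assumes "K ~= 0"
 shows "\<i> * cdot (wave_vec F K xi) (init_flux L lam K s xi) = (if xi = 0 then 1 else 0) - of_real s * Psi L lam K xi"
proof -
 have d: "cdot u (v - w) = cdot u v - cdot u w" for u v w :: "complex^'d"
  by (simp add: cdot_def right_diff_distrib sum_subtractf)
 have k: "cdot (cvec K) (cvec K) = of_real ((norm K)^2)"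
  using cdot_wave_vec[of F K 0] by (simp add: cdot_wave_vec_0)
 have i: "\<i> * (\<i> * z) = - z" for z by simp
 show ?thesis
  using assms unfolding init_flux_def Psi_head d right_diff_distrib cdot_smult_right
  by (cases "xi = 0") (simp_all add: cdot_wave_vec_0 cdot_smult_right k i field_simps)
qed

text \<open>A finite intersection of open sets. Here the finiteness of \<open>freqs\<close> pays:
  non-resonance with respect to finitely many frequencies persists nearby.\<close>

lemma open_regular: "open {K. regular K}"
proof -
 have "open {K. detuning F K xi ~= 0}" for xi
  unfolding detuning_def by (intro open_Collect_neq continuous_intros)
 then have "open (\<Inter>xi\<in>freqs - {0}. {K. detuning F K xi ~= 0})"
  by (intro open_INT finite_Diff finite_freqs) auto
 moreover have "{K. regular K} = (\<Inter>xi\<in>freqs - {0}. {K. detuning F K xi ~= 0})" by (auto simp: regular_def)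
 ultimately show ?thesis by simp
qed

lemma nonresonant_regular: "k \<in> nonresonant F ==> regular k"
 unfolding regular_def nonresonant_def detuning_def by auto

text \<open>Near regular wave vectors the coefficients agree with real-valued rational functions;
  smoothness and reality of all derivatives are inherited from these.\<close>

lemma rs_nu_smooth:
 assumes U: "open U" "!!K. K \<in> U ==> regular K" and n: "n < N"
 shows "smooth_on U (rs_nu F aT n)" "x \<in> U ==> partials is (rs_nu F aT n) x \<in> \<real>"
proof -
 have sm: "smooth_on U (nu n)" by (rule rational_on_smooth[OF U(1) rational_nu[OF U(2)]])
 have eq: "rs_nu F aT n x = nu n x" if "x \<in> U" for x using rs_nu_eq U(2) n that by auto
 show 1: "smooth_on U (rs_nu F aT n)"
  unfolding smooth_on_def using partials_cong_open[OF U(1) eq sm] by blast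
 show "partials is (rs_nu F aT n) x \<in> \<real>" if "x \<in> U"
  by (rule partials_real[OF U(1) 1 _ that]) (use eq U(2) nu_real in auto)
qed

lemma amp_symbol_real:
 assumes k: "regular k" and L: "L < N" and \<beta>: "\<beta> > 0"
 shows "amp_symbol F aT k \<beta> L lam q = of_real (Re (amp_symbol F aT k \<beta> L lam q))"
  "continuous_on UNIV (\<lambda>q. Re (amp_symbol F aT k \<beta> L lam q))"
proof -
 have re: "partials is (rs_nu F aT n) k \<in> \<real>" if "n <= L" for n "is"
  by (rule rs_nu_smooth(2)[OF open_regular]) (use that L k in auto)
 have 0: "rs_nu F aT 0 k \<in> \<real>" using re[of 0 "[]"] by simp
 have "amp_symbol F aT k \<beta> L lam q \<in> \<real>"
  unfolding amp_symbol_def Let_def C_tensor_eq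
 proof (intro Reals_add Reals_mult Reals_divide Reals_of_real 0 sum_in_Reals)
  fix x assume "x \<in> amp_indices L \<beta>"
  then obtain m p where x: "x = (m, p)" "m <= L" by (auto simp: amp_indices_def)
  have "contr p (C_ten (rs_nu F aT) m p k) q \<in> \<real>"
   by (intro contr_real C_ten_real re) (use x in auto)
  then show "(case x of (m, p) => of_real (lam ^ m * (lam powr \<beta>) ^ p) * contr p (C_ten (rs_nu F aT) m p k) q) \<in> \<real>"
   unfolding x(1) prod.case by (intro Reals_mult Reals_of_real)
 qed
 then show "amp_symbol F aT k \<beta> L lam q = of_real (Re (amp_symbol F aT k \<beta> L lam q))" by (rule of_real_Re[symmetric])
 show "continuous_on UNIV (\<lambda>q. Re (amp_symbol F aT k \<beta> L lam q))"
  unfolding amp_symbol_def Let_def case_prod_beta divide_inverse by (intro continuous_intros contr_continuous)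
qed

lemma Psi_rational: "(!!K. K \<in> U ==> regular K) ==> rational_on U (\<lambda>K. Psi L lam K xi)"
 unfolding Psi_def by (intro rational_on.intros rational_on_sum rational_phi)

text \<open>A finite sum of nonnegative functions, continuous on the open ball, is bounded on the
  compact ball of half the radius; each summand is then bounded as well.\<close>

lemma coefficients_bounded:
 assumes delta: "!!K. K \<in> ball k delta ==> regular K" and "delta > 0"
 obtains B where "B >= 0" "!!K xi. K \<in> cball k (delta / 2) ==> xi \<in> freqs ==> (\<Sum>n\<le>L. norm (phi n K xi)) <= B"
  "!!K xi. K \<in> cball k (delta / 2) ==> xi \<in> freqs ==> remainder_bound L K xi <= B"
  "!!K xi i. K \<in> cball k (delta / 2) ==> xi \<in> freqs ==> (\<Sum>n\<le>L. norm (pot n K xi $ i)) <= B"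
proof -
 define f where "f K xi = (\<Sum>n\<le>L. norm (phi n K xi))" for K xi
 define g where "g K xi = (\<Sum>n\<le>L. \<Sum>i\<in>UNIV. norm (pot n K xi $ i))" for K xi
 define h where "h K xi = f K xi + remainder_bound L K xi + g K xi" for K xi
 have sub: "cball k (delta / 2) \<subseteq> ball k delta" using \<open>delta > 0\<close> by auto
 have "continuous_on (ball k delta) (\<lambda>K. \<Sum>xi\<in>freqs. h K xi)"
  unfolding h_def f_def g_def remainder_bound_def case_prod_beta
  by (intro continuous_intros rational_on_continuous rational_phi rational_pot rational_nu rational_cdot rational_flux rational_wave_vec delta)
 then have "compact ((\<lambda>K. \<Sum>xi\<in>freqs. h K xi) ` cball k (delta / 2))"
  by (intro compact_continuous_image compact_cball) (rule continuous_on_subset[OF _ sub])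
 then obtain B where B: "!!K. K \<in> cball k (delta / 2) ==> norm (\<Sum>xi\<in>freqs. h K xi) <= B"
  using compact_imp_bounded bounded_iff by (metis imageI)
 have n: "f K xi >= 0" "g K xi >= 0" "remainder_bound L K xi >= 0" for K xi
  by (auto simp: f_def g_def remainder_bound_def case_prod_beta intro!: sum_nonneg add_nonneg_nonneg)
 have hB: "h K xi <= B" if "K \<in> cball k (delta / 2)" "xi \<in> freqs" for K xi
 proof -
  have "h K xi <= (\<Sum>xi\<in>freqs. h K xi)" using that n by (intro member_le_sum finite_freqs) (auto simp: h_def)
  then show ?thesis using B[OF that(1)] by simp
 qed
 show thesis
 proof (rule that[of B])
  show "B >= 0" using hB[of k 0] n[of k 0] zero_freqs \<open>delta > 0\<close> by (force simp: h_def)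
  fix K xi assume *: "K \<in> cball k (delta / 2)" "xi \<in> freqs"
  note hB[OF *] n[of K xi]
  then show "(\<Sum>n\<le>L. norm (phi n K xi)) <= B" "remainder_bound L K xi <= B" by (auto simp: h_def f_def[symmetric])
  fix i
  have "(\<Sum>n\<le>L. norm (pot n K xi $ i)) <= g K xi"
   unfolding g_def by (intro sum_mono member_le_sum) auto
  then show "(\<Sum>n\<le>L. norm (pot n K xi $ i)) <= B" using hB[OF *] n[of K xi] by (simp add: h_def)
 qed
qed

lemma weighted_tail_le:
 assumes "0 < lam" "lam <= 1"
 shows "norm (\<Sum>n\<in>{1..L}. complex_of_real (lam ^ n) * c n) <= lam * (\<Sum>n\<le>L. norm (c n))"
proof -
 have "norm (\<Sum>n\<in>{1..L}. complex_of_real (lam ^ n) * c n) <= (\<Sum>n\<in>{1..L}. lam * norm (c n))"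
 proof (rule sum_norm_le)
  fix n assume "n \<in> {1..L}"
  then have "lam ^ n <= lam ^ 1" using assms by (intro power_decreasing) auto
  then show "norm (complex_of_real (lam ^ n) * c n) <= lam * norm (c n)"
   unfolding norm_mult norm_of_real using assms by (intro mult_right_mono) auto
 qed
 also have "... <= (\<Sum>n\<le>L. lam * norm (c n))" using assms by (intro sum_mono2) auto
 finally show ?thesis by (simp add: sum_distrib_left)
qed

definition Om :: "real^'d => real => nat => real => real^'d => real" where
 "Om k \<beta> L lam q = norm k + lam powr \<beta> * ((k /\<^sub>R norm k) \<bullet> q) + Re (amp_symbol F aT k \<beta> L lam q)"

text \<open>The symbol of the operator minus s^2 applied to the truncated Bloch wave. With s the
  packet frequency this is the amplitude of the residual in the wave equation.\<close>

definition defect :: "nat => real => real^'d => real => int^'m => complex" where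
 "defect L lam K s xi = of_real (detuning F K xi + (norm K)^2) * Psi L lam K xi
   - of_real lam * (\<i> * cdot (wave_vec F K xi) (flux (Psi L lam K) K xi)) - of_real (s\<^sup>2) * Psi L lam K xi"

text \<open>The algebraic input of the comparison: near k the corrected wave is close to the plane
  wave, its defect is of order lambda^(L + gamma), and the initial velocity mismatch has a vector
  potential of order lambda^gamma. The lower bound on the frequency permits dividing by it.\<close>

lemma quasimode:
 assumes k: "k \<in> nonresonant F - {0}" and L: "L >= 1" "L < N" and \<beta>: "\<beta> > 0" and rho: "rho >= 0"
 obtains C lam0 delta where "C >= 0" "0 < lam0" "lam0 <= 1" "!!K. K \<in> ball k delta ==> regular K \<and> K ~= 0"
  "!!lam q. 0 < lam ==> lam <= lam0 ==> norm q <= rho ==> k + lam powr \<beta> *\<^sub>R q \<in> ball k delta"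
  "!!lam q. 0 < lam ==> lam <= lam0 ==> norm q <= rho ==> Om k \<beta> L lam q >= norm k / 2"
  "!!lam q xi. 0 < lam ==> lam <= lam0 ==> norm q <= rho ==> xi \<in> freqs ==>
   norm (Psi L lam (k + lam powr \<beta> *\<^sub>R q) xi - (if xi = 0 then 1 else 0)) <= C * lam powr rate \<beta> L"
  "!!lam q xi. 0 < lam ==> lam <= lam0 ==> norm q <= rho ==> xi \<in> freqs ==>
   norm (defect L lam (k + lam powr \<beta> *\<^sub>R q) (Om k \<beta> L lam q) xi) <= C * (lam ^ L * lam powr rate \<beta> L)"
  "!!lam q xi i. 0 < lam ==> lam <= lam0 ==> norm q <= rho ==> xi \<in> freqs ==>
   norm (init_flux L lam (k + lam powr \<beta> *\<^sub>R q) (Om k \<beta> L lam q / norm k) xi $ i) <= C * lam powr rate \<beta> L"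
proof -
 have reg: "regular k" and k0: "k ~= 0" using k nonresonant_regular by auto
 obtain delta0 where delta0: "delta0 > 0" "ball k delta0 \<subseteq> {K. regular K}"
  using open_regular reg open_contains_ball by (metis mem_Collect_eq)
 define delta where "delta = min delta0 (norm k)"
 have delta: "delta > 0" "!!K. K \<in> ball k delta ==> regular K" using delta0 k0 by (auto simp: delta_def)
 have n0: "K ~= 0" if "K \<in> ball k delta" for K using that by (auto simp: delta_def dist_norm)
 have half: "norm K >= norm k / 2" if "K \<in> cball k (delta / 2)" for K
 proof -
  have "norm (k - K) <= norm k / 2" using that by (auto simp: delta_def dist_norm)
  then show ?thesis using norm_triangle_ineq2[of k K] by simp
 qed
 have sm: "smooth_on (ball k delta) (rs_nu F aT n)" if "n <= L" for n
  by (rule rs_nu_smooth) (use delta that L in auto)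
 obtain B where B: "B >= 0" "!!K xi. K \<in> cball k (delta / 2) ==> xi \<in> freqs ==> (\<Sum>n\<le>L. norm (phi n K xi)) <= B"
  "!!K xi. K \<in> cball k (delta / 2) ==> xi \<in> freqs ==> remainder_bound L K xi <= B"
  "!!K xi i. K \<in> cball k (delta / 2) ==> xi \<in> freqs ==> (\<Sum>n\<le>L. norm (pot n K xi $ i)) <= B"
  by (rule coefficients_bounded[OF delta(2) delta(1), where L=L]) (assumption, rule that)
 obtain C1 lam1 where C1: "C1 >= 0" "0 < lam1" "lam1 <= 1"
  "!!lam q. 0 < lam ==> lam <= lam1 ==> norm q <= rho ==>
   norm (phase (rs_nu F aT) k \<beta> L lam q - of_real (norm k)) <= C1 * (lam + lam powr \<beta>)"
  "!!lam q. 0 < lam ==> lam <= lam1 ==> norm q <= rho ==>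
   norm ((phase (rs_nu F aT) k \<beta> L lam q)^2 - (of_real ((norm (k + (lam powr \<beta>) *\<^sub>R q))^2)
    + (\<Sum>j<L. of_real (lam ^ Suc j) * rs_nu F aT j (k + (lam powr \<beta>) *\<^sub>R q)))) <= C1 * (lam ^ Suc L + (lam powr \<beta>) ^ Suc (nat \<lfloor>real L / \<beta>\<rfloor>))"
  by (rule phase_expansion[OF k0 delta(1) sm L(1) \<beta> rho]) (assumption, rule that)
 \<comment> \<open>Threshold for lambda^gamma. The first entry keeps the frequency within |k|/2 of
   |k|, the second keeps k + epsilon q in the ball of radius delta/2. Adding 1 in the denominators
   avoids division by zero.\<close>
 define s where "s = min (norm k / (4 * (C1 + 1))) (delta / (2 * (rho + 1)))"
 have s: "s > 0" using k0 C1 delta rho by (simp add: s_def)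
 have s1: "s * (4 * (C1 + 1)) <= norm k" and s2: "s * (2 * (rho + 1)) <= delta"
 proof -
  have "s <= norm k / (4 * (C1 + 1))" "s <= delta / (2 * (rho + 1))" by (simp_all add: s_def)
  then show "s * (4 * (C1 + 1)) <= norm k" "s * (2 * (rho + 1)) <= delta" using C1(1) rho by (simp_all add: pos_le_divide_eq)
 qed
 define gamma where "gamma = rate \<beta> L"
 have gamma: "gamma > 0" using rate(1)[OF \<beta>] by (simp add: gamma_def)
 define lam0 where "lam0 = min lam1 (s powr (1 / gamma))"
 define n where "n = norm k"
 have np: "n > 0" using k0 by (simp add: n_def)
 define Ca where "Ca = 2 * C1 * (B + 1) + B"
 define Cb where "Cb = (2 * C1 / n) * (2 / n) + (1 + 2 * C1 / n) * B"
 define C where "C = B + Ca + Cb"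
 have Cs: "Ca >= 0" "Cb >= 0" using B(1) C1(1) np by (auto simp: Ca_def Cb_def intro!: add_nonneg_nonneg mult_nonneg_nonneg)
 have C: "C >= 0" "B <= C" "Ca <= C" "Cb <= C" unfolding C_def using Cs B(1) by linarith+
 have main: "k + lam powr \<beta> *\<^sub>R q \<in> ball k delta \<and> Om k \<beta> L lam q >= norm k / 2 \<and>
  (\<forall>xi\<in>freqs. norm (Psi L lam (k + lam powr \<beta> *\<^sub>R q) xi - (if xi = 0 then 1 else 0)) <= C * lam powr gamma \<and>
   norm (defect L lam (k + lam powr \<beta> *\<^sub>R q) (Om k \<beta> L lam q) xi) <= C * (lam ^ L * lam powr gamma) \<and>
   (\<forall>i. norm (init_flux L lam (k + lam powr \<beta> *\<^sub>R q) (Om k \<beta> L lam q / norm k) xi $ i) <= C * lam powr gamma))"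
  if lam: "0 < lam" "lam <= lam0" and q: "norm q <= rho" for lam q
 proof -
  define epsilon where "epsilon = lam powr \<beta>"
  define l where "l = lam powr gamma"
  define K where "K = k + epsilon *\<^sub>R q"
  define omega where "omega = Om k \<beta> L lam q"
  have lam1: "lam <= lam1" "lam <= 1" using lam C1(3) by (auto simp: lam0_def)
  note rb = rate_bounds[OF \<beta> lam(1) lam1(2), of L, folded gamma_def, folded l_def epsilon_def]
  have l0: "l > 0" using lam by (simp add: l_def)
  have "l <= (s powr (1 / gamma)) powr gamma"
   unfolding l_def using lam gamma by (intro powr_mono2) (auto simp: lam0_def)
  then have ls: "l <= s" using s gamma by (simp add: powr_powr)
  have Kc: "K \<in> cball k (delta / 2)"
  proof -
   have "norm (epsilon *\<^sub>R q) <= s * (rho + 1)"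
    using rb(2) ls q rho s lam by (simp add: epsilon_def) (intro mult_mono, auto)
   then have "norm (epsilon *\<^sub>R q) <= delta / 2" using s2 by (simp add: field_simps)
   then show ?thesis by (simp add: K_def dist_norm)
  qed
  then have Kb: "K \<in> ball k delta" using delta(1) by auto
  have regK: "regular K" by (rule delta(2)[OF Kb])
  have ph: "phase (rs_nu F aT) k \<beta> L lam q = of_real omega"
   unfolding phase_amp_symbol omega_def Om_def of_real_add
   by (simp only: amp_symbol_real(1)[OF reg L(2) \<beta>, symmetric])
  have w1: "\<bar>omega - n\<bar> <= 2 * C1 * l"
  proof -
   have "norm (complex_of_real omega - of_real (norm k)) <= C1 * (lam + epsilon)"
    unfolding epsilon_def ph[symmetric] by (rule C1(4)[OF lam(1) lam1(1) q])
   also have "... <= C1 * (l + l)" using rb C1(1) by (intro mult_left_mono add_mono) auto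
   finally show ?thesis unfolding n_def by (simp flip: of_real_diff)
  qed
  have w2: "omega >= n / 2"
  proof -
   have "2 * C1 * l <= 2 * (C1 + 1) * s" using ls C1(1) l0 by (intro mult_mono) auto
   then have "2 * (2 * C1 * l) <= n" using s1 by (simp add: n_def algebra_simps)
   then show ?thesis using w1 by (simp add: field_simps)
  qed
  have w3: "\<bar>1 - omega / n\<bar> <= 2 * C1 / n * l"
  proof -
   have "1 - omega / n = - (omega - n) / n" using np by (simp add: field_simps)
   then have "\<bar>1 - omega / n\<bar> = \<bar>omega - n\<bar> / n" using np by (simp add: abs_divide)
   also have "... <= 2 * C1 * l / n" using w1 np by (intro divide_right_mono) auto
   finally show ?thesis by simp
  qed
  have w4: "\<bar>omega / n\<bar> <= 1 + 2 * C1 / n"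
  proof -
   have "2 * C1 / n * l <= 2 * C1 / n * 1" using rb(3) C1(1) np by (intro mult_left_mono) auto
   then show ?thesis using w3 by linarith
  qed
  have all: "norm (Psi L lam K xi - (if xi = 0 then 1 else 0)) <= C * l \<and>
   norm (defect L lam K omega xi) <= C * (lam ^ L * l) \<and> (\<forall>i. norm (init_flux L lam K (omega / n) xi $ i) <= C * l)"
   if xi: "xi \<in> freqs" for xi
  proof (intro conjI allI)
   have "Psi L lam K xi - (if xi = 0 then 1 else 0) = (\<Sum>n\<in>{1..L}. complex_of_real (lam ^ n) * phi n K xi)"
    unfolding Psi_def sum_Suc_0_insert by (simp add: phi_0)
   then have P1: "norm (Psi L lam K xi - (if xi = 0 then 1 else 0)) <= lam * (\<Sum>n\<le>L. norm (phi n K xi))"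
    using weighted_tail_le[OF lam(1) lam1(2), where L=L and c="\<lambda>n. phi n K xi"] by simp
   also have "... <= l * B" using lam l0 by (intro mult_mono rb(1) B(2)[OF Kc xi] sum_nonneg) auto
   also have "... <= C * l" using mult_right_mono[OF C(2), of l] l0 by (simp add: mult.commute)
   finally show "norm (Psi L lam K xi - (if xi = 0 then 1 else 0)) <= C * l" .
   have "lam * (\<Sum>n\<le>L. norm (phi n K xi)) <= 1 * B"
    using lam lam1 by (intro mult_mono B(2)[OF Kc xi] sum_nonneg) auto
   then have P2: "norm (Psi L lam K xi) <= B + 1"
    using P1 norm_triangle_ineq[of "Psi L lam K xi - (if xi = 0 then 1 else 0)" "if xi = 0 then 1 else 0"]
    by (auto split: if_splits)
   define kappa where "kappa = complex_of_real ((norm K)^2) + (\<Sum>l<L. of_real (lam ^ Suc l) * nu l K)"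
   \<comment> \<open>The square of the phase reproduces the truncated eigenvalue; both error terms,
     lambda^(L + 1) and epsilon^(P + 1), are absorbed in lambda^L times the rate.\<close>
   have kappa: "norm (kappa - of_real (omega\<^sup>2)) <= 2 * C1 * (lam ^ L * l)"
   proof -
    have "kappa = complex_of_real ((norm K)^2) + (\<Sum>j<L. of_real (lam ^ Suc j) * rs_nu F aT j K)"
     unfolding kappa_def using L(2) by (simp add: rs_nu_eq[OF regK])
    then have "norm (kappa - of_real (omega\<^sup>2)) <= C1 * (lam ^ Suc L + epsilon ^ Suc (nat \<lfloor>real L / \<beta>\<rfloor>))"
     using C1(5)[OF lam(1) lam1(1) q] unfolding ph epsilon_def[symmetric] K_def[symmetric]
     by (simp only: norm_minus_commute of_real_power)
    also have "... <= C1 * (lam ^ L * l + lam ^ L * l)" using rb C1(1) by (intro mult_left_mono add_mono) auto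
    finally show ?thesis by (simp add: algebra_simps)
   qed
   have "defect L lam K omega xi = (kappa - of_real (omega\<^sup>2)) * Psi L lam K xi + remainder L lam K xi"
    unfolding defect_def residual[OF regK xi] kappa_def by (simp add: algebra_simps)
   then have "norm (defect L lam K omega xi) <= norm (kappa - of_real (omega\<^sup>2)) * norm (Psi L lam K xi) + norm (remainder L lam K xi)"
    by (simp add: norm_triangle_ineq flip: norm_mult)
   also have "... <= 2 * C1 * (lam ^ L * l) * (B + 1) + (lam ^ L * l) * B"
   proof (intro add_mono mult_mono kappa P2)
    have "norm (remainder L lam K xi) <= lam ^ Suc L * remainder_bound L K xi"
     using lam lam1 by (intro norm_remainder_le) auto
    also have "... <= lam ^ Suc L * B" using lam by (intro mult_left_mono B(3)[OF Kc xi]) auto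
    also have "... <= lam ^ L * l * B" using rb(4) B(1) by (rule mult_right_mono)
    finally show "norm (remainder L lam K xi) <= lam ^ L * l * B" .
   qed (use lam l0 C1(1) B(1) in auto)
   also have "... = Ca * (lam ^ L * l)" by (simp add: Ca_def algebra_simps)
   also have "... <= C * (lam ^ L * l)" using lam l0 by (intro mult_right_mono C) auto
   finally show "norm (defect L lam K omega xi) <= C * (lam ^ L * l)" .
   fix i
   have h: "norm (head L lam K xi $ i) <= l * B"
   proof -
    have "head L lam K xi $ i = (\<Sum>n\<in>{1..L}. complex_of_real (lam ^ n) * pot n K xi $ i)"
     by (simp add: head_def)
    then have "norm (head L lam K xi $ i) <= lam * (\<Sum>n\<le>L. norm (pot n K xi $ i))"
     using weighted_tail_le[OF lam(1) lam1(2), where L=L and c="\<lambda>n. pot n K xi $ i"] by simp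
    also have "... <= l * B" using lam l0 by (intro mult_mono rb(1) B(4)[OF Kc xi] sum_nonneg) auto
    finally show ?thesis .
   qed
   have c: "norm ((- \<i> * complex_of_real ((1 - omega / n) / (norm K)^2)) * of_real (K $ i)) <= (2 * C1 / n * l) * (2 / n)"
   proof -
    have nK: "norm K >= n / 2" "norm K > 0" using half[OF Kc] np n_def by auto
    have "norm ((- \<i> * complex_of_real ((1 - omega / n) / (norm K)^2)) * of_real (K $ i)) = \<bar>1 - omega / n\<bar> * (\<bar>K $ i\<bar> / (norm K)^2)"
     unfolding norm_mult norm_of_real by (simp add: abs_divide)
    also have "... <= (2 * C1 / n * l) * (2 / n)"
    proof (intro mult_mono w3)
     have "\<bar>K $ i\<bar> / (norm K)^2 <= norm K / (norm K)^2"
      using component_le_norm_cart[of K i] by (intro divide_right_mono) auto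
     also have "... = 1 / norm K" using nK by (simp add: power2_eq_square)
     also have "... <= 1 / (n / 2)" using nK np by (intro divide_left_mono) auto
     finally show "\<bar>K $ i\<bar> / (norm K)^2 <= 2 / n" by simp
    qed (use C1(1) np l0 in auto)
    finally show ?thesis .
   qed
   have "init_flux L lam K (omega / n) xi $ i = (if xi = 0 then (- \<i> * of_real ((1 - omega / n) / (norm K)^2)) * of_real (K $ i) else 0) - of_real (omega / n) * (head L lam K xi $ i)"
    by (simp add: init_flux_def cvec_def)
   also have "norm ... <= (2 * C1 / n * l) * (2 / n) + \<bar>omega / n\<bar> * norm (head L lam K xi $ i)"
   proof (rule order_trans[OF norm_triangle_ineq4 add_mono])
    have "0 <= (2 * C1 / n * l) * (2 / n)" using C1(1) np l0 by simp
    then show "norm (if xi = 0 then (- \<i> * of_real ((1 - omega / n) / (norm K)^2)) * of_real (K $ i) else 0) <= (2 * C1 / n * l) * (2 / n)"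
     using c by (simp only: norm_zero split: if_splits) simp
   qed (simp only: norm_mult norm_of_real)
   also have "... <= (2 * C1 / n * l) * (2 / n) + (1 + 2 * C1 / n) * (l * B)"
    using C1(1) np by (intro add_left_mono mult_mono w4 h) auto
   also have "... = Cb * l" by (simp add: Cb_def algebra_simps)
   also have "... <= C * l" using l0 by (intro mult_right_mono C) auto
   finally show "norm (init_flux L lam K (omega / n) xi $ i) <= C * l" .
  qed
  show ?thesis using all Kb w2 unfolding l_def K_def epsilon_def omega_def n_def by blast
 qed
 show thesis
 proof (rule that[of C lam0 delta])
  show "0 < lam0" using C1(2) s by (simp add: lam0_def)
 qed (use main C delta n0 C1 in \<open>auto simp: lam0_def gamma_def\<close>)
qed

end

section \<open>Integrating the second-order equation once in time\<close>

lemma second_order_energy: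
 fixes w wt r R :: "real => real^'d::finite => complex" and p :: "real => real^'d => complex^'d"
  and A :: "real^'d => complex^'d^'d" and H :: "real^'d => complex^'d"
  and dq :: "'d => 'd => real => real^'d => complex" and dH :: "'d => 'd => real^'d => complex"
 assumes A: "continuous_on UNIV A" "!!x u v. (A x *v u) \<bullet> v = u \<bullet> (A x *v v)"
   "!!x v. (norm v)\<^sup>2 / 2 <= (A x *v v) \<bullet> v" "!!x v. norm (A x *v v) <= 2 * norm v"
  and H: "continuous_on UNIV H" "integrable lborel (\<lambda>x. (norm (H x))\<^sup>2)" "(LINT x|lborel. (norm (H x))\<^sup>2) <= h\<^sup>2"
  and cw: "continuous_on ({0..} \<times> UNIV) (\<lambda>z. w (fst z) (snd z))"
  and cp: "!!i. continuous_on ({0..} \<times> UNIV) (\<lambda>z. p (fst z) (snd z) $ i)"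
  and cr: "continuous_on ({0..} \<times> UNIV) (\<lambda>z. r (fst z) (snd z))"
  and cq: "!!i l. continuous_on ({0..} \<times> UNIV) (\<lambda>z. dq i l (fst z) (snd z))"
  and cH: "!!i l. continuous_on UNIV (dH i l)"
  and wt: "!!t x. t >= 0 ==> ((\<lambda>s. w s x) has_vector_derivative wt t x) (at t within {0..})"
  and wtt: "!!t x. t >= 0 ==> ((\<lambda>s. wt s x) has_vector_derivative (\<Sum>i\<in>UNIV. dq i i t x) + R t x) (at t within {0..})"
  and rt: "!!t x. t >= 0 ==> ((\<lambda>s. r s x) has_vector_derivative R t x) (at t within {0..})"
  and r0: "!!x. r 0 x = 0"
  and wt0: "!!x. wt 0 x = (\<Sum>i\<in>UNIV. dH i i x)"
  and wx: "!!t x. t >= 0 ==> (w t has_derivative (\<lambda>h. \<Sum>l\<in>UNIV. h $ l *\<^sub>R p t x $ l)) (at x)"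
  and qx: "!!i t x. t >= 0 ==> ((\<lambda>x. (A x *v p t x) $ i) has_derivative (\<lambda>h. \<Sum>l\<in>UNIV. h $ l *\<^sub>R dq i l t x)) (at x)"
  and Hx: "!!i x. ((\<lambda>x. H x $ i) has_derivative (\<lambda>h. \<Sum>l\<in>UNIV. h $ l *\<^sub>R dH i l x)) (at x)"
  and r2: "!!t. 0 <= t ==> L2_le (r t) rho" and rho: "rho > 0"
  and w0: "L2_le (w 0) b" and h: "h >= 0" and T: "T >= 0"
 shows "L2_le (w T) (b + 2 * h + T * rho)"
proof -
 \<comment> \<open>The time primitive of the gradient. The fields \<open>dV\<close> are the
   derivatives of A g + H, because \<open>A\<close> does not depend on time and commutes with the
   integral.\<close>
 define g where "g t x = (\<chi> i. tint (\<lambda>s x. p s x $ i) t x)" for t x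
 define q where "q i = (\<lambda>t x. (A x *v p t x) $ i)" for i
 define dV where "dV i l t x = tint (dq i l) t x + dH i l x" for i l t x
 have cpv: "continuous_on ({0..} \<times> UNIV) (\<lambda>z. p (fst z) (snd z))"
 proof -
  have "continuous_on ({0..} \<times> UNIV) (\<lambda>z. \<chi> i. p (fst z) (snd z) $ i)" by (intro continuous_on_vec_lambda cp)
  then show ?thesis by simp
 qed
 have cA: "continuous_on ({0..} \<times> UNIV) (\<lambda>z::real \<times> (real^'d). A (snd z) $ i $ j)" for i j
  using continuous_on_compose2[OF A(1) continuous_on_snd[OF continuous_on_id], of "{0..} \<times> UNIV"]
  by (intro continuous_intros) auto
 have cq': "continuous_on ({0..} \<times> UNIV) (\<lambda>z. q i (fst z) (snd z))" for i
  unfolding q_def matrix_vector_mult_def vec_lambda_beta by (intro continuous_intros cA cp)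
 have Ag: "(A x *v g t x) $ i = tint (q i) t x" for t x i
 proof -
  have "(A x *v g t x) $ i = (\<Sum>j\<in>UNIV. integral {0..t} (\<lambda>s. A x $ i $ j * p s x $ j))"
   by (simp add: matrix_vector_mult_def g_def tint_def)
  also have "... = integral {0..t} (\<lambda>s. \<Sum>j\<in>UNIV. A x $ i $ j * p s x $ j)"
  proof (rule integral_sum[symmetric])
   fix j
   have "continuous_on {0..t} (\<lambda>s. p s x $ j)" by (rule continuous_slice_time[OF cp]) auto
   then show "(\<lambda>s. A x $ i $ j * p s x $ j) integrable_on {0..t}"
    by (intro integrable_continuous_real continuous_on_mult continuous_on_const)
  qed simp
  finally show ?thesis by (simp add: tint_def q_def matrix_vector_mult_def)
 qed
 have g0: "g 0 x = 0" for x by (simp add: g_def vec_eq_iff)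
 have wt_eq: "wt t x = (\<Sum>i\<in>UNIV. dV i i t x) + r t x" if t: "t >= 0" for t x
 proof -
  \<comment> \<open>Both sides of the first-order identity have the same time derivative, and at t =
    0 the flux of \<open>H\<close> supplies exactly the initial velocity; so their difference
    vanishes.\<close>
  define D where "D s = wt s x - ((\<Sum>i\<in>UNIV. dV i i s x) + r s x)" for s
  have "(D has_vector_derivative 0) (at s within {0..})" if "s \<in> {0..}" for s
  proof -
   have "(D has_vector_derivative ((\<Sum>i\<in>UNIV. dq i i s x) + R s x) - ((\<Sum>i\<in>UNIV. dq i i s x + 0) + R s x)) (at s within {0..})"
    unfolding D_def dV_def using that
    by (intro derivative_intros has_vector_derivative_sum tint_time_derivative cq wtt rt) auto
   then show ?thesis by simp
  qed
  from has_vector_derivative_zero_constant[OF _ this] obtain c where c: "!!s. s \<in> {0..} ==> D s = c" by auto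
  have "D 0 = 0" by (simp add: D_def dV_def wt0 r0)
  then show ?thesis using c[of 0] c[of t] t by (simp add: D_def)
 qed
 show ?thesis
 proof (rule energy_estimate[where A=A and H=H and g=g and p=p and r=r and dV=dV, OF A H cw cpv _ cr])
  show "continuous_on ({0..} \<times> UNIV) (\<lambda>z. g (fst z) (snd z))"
   unfolding g_def by (intro continuous_intros tint_continuous cp)
  show "continuous_on ({0..} \<times> UNIV) (\<lambda>z. dV i l (fst z) (snd z))" for i l
  proof -
   have "continuous_on ({0..} \<times> UNIV) (\<lambda>z::real \<times> (real^'d). dH i l (snd z))"
    using continuous_on_compose2[OF cH continuous_on_snd[OF continuous_on_id], of "{0..} \<times> UNIV"] by auto
   then show ?thesis unfolding dV_def by (intro continuous_intros tint_continuous cq)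
  qed
  show "((\<lambda>s. w s x) has_vector_derivative (\<Sum>i\<in>UNIV. dV i i t x) + r t x) (at t within {0..})" if "t >= 0" for t x
   using wt[OF that] wt_eq[OF that] by simp
  show "((\<lambda>s. g s x) has_vector_derivative p t x) (at t within {0..})" if "t >= 0" for t x
  proof -
   have c: "((\<lambda>s. tint (\<lambda>s x. p s x $ i) s x) has_vector_derivative p t x $ i) (at t within {0..})" for i
    by (rule tint_time_derivative[OF cp that])
   show ?thesis
    unfolding has_vector_derivative_def
   proof (subst has_derivative_componentwise_within, intro ballI)
    fix b :: "complex^'d" assume "b \<in> Basis"
    then obtain i c0 where b: "b = axis i c0" by (auto simp: Basis_vec_def)
    have "((\<lambda>s. tint (\<lambda>s x. p s x $ i) s x \<bullet> c0) has_derivative (\<lambda>h. (h *\<^sub>R p t x $ i) \<bullet> c0)) (at t within {0..})"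
     using c[of i] unfolding has_vector_derivative_def by (rule has_derivative_inner_left)
    then show "((\<lambda>s. g s x \<bullet> b) has_derivative (\<lambda>h. (h *\<^sub>R p t x) \<bullet> b)) (at t within {0..})"
     by (simp add: b inner_axis g_def)
   qed
  qed
  show "((\<lambda>x. (A x *v g t x + H x) $ i) has_derivative (\<lambda>h. \<Sum>l\<in>UNIV. h $ l *\<^sub>R dV i l t x)) (at x)" if "t >= 0" for i t x
  proof -
   have "((\<lambda>x. tint (q i) t x + H x $ i) has_derivative (\<lambda>h. (\<Sum>l\<in>UNIV. h $ l *\<^sub>R tint (dq i l) t x) + (\<Sum>l\<in>UNIV. h $ l *\<^sub>R dH i l x))) (at x)"
    using qx unfolding q_def[symmetric] by (intro has_derivative_add tint_space_derivative cq cq' Hx) (auto simp: q_def)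
   then show ?thesis by (simp add: Ag dV_def scaleR_add_right sum.distrib)
  qed
 qed (use wx g0 r2 rho w0 h T in auto)
qed

text \<open>Extracts the partial derivatives with joint continuity up to t = 0. All derivatives in
  time are one-sided there, since the regularity is assumed on the closed half space only.\<close>

lemma C2_data:
 fixes u :: "real => real^'d::finite => complex"
 assumes "C2_on ({0..} \<times> UNIV) (\<lambda>(t, x). u t x)"
 obtains ut p dp where
  "continuous_on ({0..} \<times> UNIV) (\<lambda>z. u (fst z) (snd z))"
  "!!i. continuous_on ({0..} \<times> UNIV) (\<lambda>z. p i (fst z) (snd z))"
  "!!i l. continuous_on ({0..} \<times> UNIV) (\<lambda>z. dp i l (fst z) (snd z))"
  "!!t x. t >= 0 ==> ((\<lambda>s. u s x) has_vector_derivative ut t x) (at t within {0..})"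
  "!!t x. t >= 0 ==> ((\<lambda>s. ut s x) has_vector_derivative time_deriv (time_deriv u) t x) (at t within {0..})"
  "!!t x. t >= 0 ==> time_deriv u t x = ut t x"
  "!!t x. t >= 0 ==> (u t has_derivative (\<lambda>h. \<Sum>l\<in>UNIV. h $ l *\<^sub>R p l t x)) (at x)"
  "!!i t x. t >= 0 ==> (p i t has_derivative (\<lambda>h. \<Sum>l\<in>UNIV. h $ l *\<^sub>R dp i l t x)) (at x)"
proof -
 let ?S = "{0::real..} \<times> (UNIV :: (real^'d) set)"
 let ?f = "\<lambda>z. u (fst z) (snd z)"
 obtain Df :: "real \<times> (real^'d) => (real \<times> (real^'d)) \<Rightarrow>\<^sub>L complex" and D2f where
  Df: "!!z. z \<in> ?S ==> (?f has_derivative blinfun_apply (Df z)) (at z within ?S)"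
  and D2f: "!!z. z \<in> ?S ==> (Df has_derivative blinfun_apply (D2f z)) (at z within ?S)" and c2: "continuous_on ?S D2f"
  using assms unfolding C2_on_def case_prod_beta' by blast
 have c1: "continuous_on ?S Df" by (rule has_derivative_continuous_on) (rule D2f)
 have c0: "continuous_on ?S ?f" by (rule has_derivative_continuous_on) (rule Df)
 \<comment> \<open>Nontriviality of the one-sided filter makes derivatives within
   \<open>{0..}\<close> unique, so \<open>time_deriv\<close> evaluates to the Frechet
   derivative.\<close>
 have bn: "at t within {0::real..} ~= bot" if "t >= 0" for t
 proof -
  have "{t<..} \<subseteq> {0..}" using that by auto
  from at_le[OF this, of t] show ?thesis using trivial_limit_at_right_real[of t] by (auto simp: bot_unique)
 qed
 have tm: "((\<lambda>s. (s, x)) has_derivative (\<lambda>s. (s, 0))) (at t within {0..})" for t and x :: "real^'d"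
  by (auto intro!: derivative_eq_intros)
 have sp: "((\<lambda>x. (t, x)) has_derivative (\<lambda>h. (0, h))) (at x)" for t :: real and x :: "real^'d"
  by (auto intro!: derivative_eq_intros)
 have ct: "((\<lambda>s. f (s, x)) has_derivative (\<lambda>s. f' (s, 0))) (at t within {0..})"
  if "(f has_derivative f') (at (t, x) within ?S)" for f :: "real \<times> (real^'d) => 'z::real_normed_vector" and f' t x
  by (rule has_derivative_in_compose[OF tm has_derivative_subset[OF that]]) auto
 have cs: "((\<lambda>x. f (t, x)) has_derivative (\<lambda>h. f' (0, h))) (at x)"
  if "(f has_derivative f') (at (t, x) within ?S)" "t >= 0" for f :: "real \<times> (real^'d) => 'z::real_normed_vector" and f' t x
  by (rule has_derivative_in_compose[OF sp has_derivative_subset[OF that(1)]]) (use that in auto)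
 define ut where "ut t x = blinfun_apply (Df (t, x)) (1, 0)" for t x
 define p where "p l t x = blinfun_apply (Df (t, x)) (0, axis l 1)" for l t x
 define dp where "dp i l t x = blinfun_apply (blinfun_apply (D2f (t, x)) (0, axis l 1)) (0, axis i 1)" for i l t x
 have ax: "L (0, h) = (\<Sum>l\<in>UNIV. h $ l *\<^sub>R L (0, axis l 1))" if L: "bounded_linear L" for L :: "real \<times> (real^'d) => complex" and h
 proof -
  have "bounded_linear (\<lambda>h. L (0, h))"
   by (rule bounded_linear_compose[OF L bounded_linear_Pair[OF bounded_linear_zero bounded_linear_ident]])
  then show ?thesis by (rule linear_axis_sum)
 qed
 have u1: "((\<lambda>s. u s x) has_vector_derivative ut t x) (at t within {0..})" if "t >= 0" for t x
 proof -
  have "((\<lambda>s. u s x) has_derivative (\<lambda>s. blinfun_apply (Df (t, x)) (s, 0))) (at t within {0..})"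
   using ct[OF Df, of t x] that by simp
  moreover have "blinfun_apply (Df (t, x)) (s, 0) = s *\<^sub>R ut t x" for s
   using blinfun.scaleR_right[of "Df (t, x)" s "(1, 0)"] by (simp add: ut_def)
  ultimately show ?thesis by (simp add: has_vector_derivative_def)
 qed
 have td: "time_deriv u t x = ut t x" if "t >= 0" for t x
  unfolding time_deriv_def by (rule vector_derivative_within[OF bn[OF that] u1[OF that]])
 have u2: "((\<lambda>s. ut s x) has_vector_derivative blinfun_apply (blinfun_apply (D2f (t, x)) (1, 0)) (1, 0)) (at t within {0..})" if "t >= 0" for t x
 proof -
  have "((\<lambda>s. Df (s, x)) has_derivative (\<lambda>s. blinfun_apply (D2f (t, x)) (s, 0))) (at t within {0..})"
   using ct[OF D2f, of t x] that by simp
  from bounded_linear.has_derivative[OF blinfun.bounded_linear_left[of "(1, 0)"] this]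
  have "((\<lambda>s. ut s x) has_derivative (\<lambda>s. blinfun_apply (blinfun_apply (D2f (t, x)) (s, 0)) (1, 0))) (at t within {0..})"
   by (simp add: ut_def)
  moreover have "blinfun_apply (blinfun_apply (D2f (t, x)) (s, 0)) (1, 0) = s *\<^sub>R blinfun_apply (blinfun_apply (D2f (t, x)) (1, 0)) (1, 0)" for s
   using blinfun.scaleR_right[of "D2f (t, x)" s "(1, 0)"] by (simp add: blinfun.scaleR_left)
  then have "(\<lambda>s. blinfun_apply (blinfun_apply (D2f (t, x)) (s, 0)) (1, 0)) = (\<lambda>s. s *\<^sub>R blinfun_apply (blinfun_apply (D2f (t, x)) (1, 0)) (1, 0))"
   by (rule ext)
  ultimately show ?thesis unfolding has_vector_derivative_def by (simp only:)
 qed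
 have tdd: "time_deriv (time_deriv u) t x = blinfun_apply (blinfun_apply (D2f (t, x)) (1, 0)) (1, 0)" if "t >= 0" for t x
 proof -
  have "((\<lambda>s. time_deriv u s x) has_vector_derivative blinfun_apply (blinfun_apply (D2f (t, x)) (1, 0)) (1, 0)) (at t within {0..})"
   by (rule has_vector_derivative_transform[OF _ _ u2[OF that]]) (use that td in auto)
  then show ?thesis unfolding time_deriv_def[of "time_deriv u"] by (rule vector_derivative_within[OF bn[OF that]])
 qed
 show thesis
 proof (rule that[of p dp ut])
  show "continuous_on ?S ?f" by (rule c0)
  show "continuous_on ?S (\<lambda>z. p i (fst z) (snd z))" for i
   unfolding p_def by (intro continuous_intros) (simp add: c1)
  show "continuous_on ?S (\<lambda>z. dp i l (fst z) (snd z))" for i l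
   unfolding dp_def by (intro continuous_intros) (simp add: c2)
  show "(u t has_derivative (\<lambda>h. \<Sum>l\<in>UNIV. h $ l *\<^sub>R p l t x)) (at x)" if "t >= 0" for t x
  proof -
   have "((\<lambda>x. u t x) has_derivative (\<lambda>h. blinfun_apply (Df (t, x)) (0, h))) (at x)"
    using cs[OF Df, of t x] that by simp
   then show ?thesis unfolding p_def ax[OF blinfun.bounded_linear_right[of "Df (t, x)"], symmetric] .
  qed
  show "(p i t has_derivative (\<lambda>h. \<Sum>l\<in>UNIV. h $ l *\<^sub>R dp i l t x)) (at x)" if "t >= 0" for i t x
  proof -
   have "((\<lambda>x. Df (t, x)) has_derivative (\<lambda>h. blinfun_apply (D2f (t, x)) (0, h))) (at x)"
    using cs[OF D2f, of t x] that by simp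
   from bounded_linear.has_derivative[OF blinfun.bounded_linear_left[of "(0, axis i 1)"] this]
   have "((\<lambda>x. p i t x) has_derivative (\<lambda>h. blinfun_apply (blinfun_apply (D2f (t, x)) (0, h)) (0, axis i 1))) (at x)"
    by (simp add: p_def)
   moreover have "bounded_linear (\<lambda>z. blinfun_apply (blinfun_apply (D2f (t, x)) z) (0, axis i 1))"
    by (rule bounded_linear_compose[OF blinfun.bounded_linear_left blinfun.bounded_linear_right])
   from ax[OF this] have "(\<lambda>h. blinfun_apply (blinfun_apply (D2f (t, x)) (0, h)) (0, axis i 1)) = (\<lambda>h. \<Sum>l\<in>UNIV. h $ l *\<^sub>R dp i l t x)"
    unfolding dp_def by (intro ext)
   ultimately show ?thesis by (simp only:)
  qed
 qed (use u1 u2 td tdd in auto)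
qed

section \<open>Superpositions of wave packets\<close>

text \<open>Finite sums of packets with common width \<open>e\<close> and prefactor
  \<open>c\<close>. In the application the index is a sign, which selects the branch of the
  frequency, together with a torus frequency, which shifts the carrier.\<close>

locale packets =
 fixes I :: "'i set" and p :: "'i => real^'d::finite" and e :: real and Omega :: "'i => real^'d => real" and c :: complex and rho :: real
 assumes finite_I: "finite I" and Omega: "!!i. continuous_on UNIV (Omega i)"
begin

definition pk :: "('i => real^'d => complex) => real => real^'d => complex" where
 "pk g t x = (\<Sum>i\<in>I. c * of_real (e powr (real CARD('d) / 2)) * osc (p i) e (Omega i) (g i) t x)"

definition amps :: "('i => real^'d => complex) => bool" where
 "amps g \<longleftrightarrow> (\<forall>i\<in>I. cpt rho (g i))"

lemma amps_mult: "amps g ==> (!!i. i \<in> I ==> continuous_on (cball 0 rho) (h i)) ==> amps (\<lambda>i k. h i k * g i k)"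
 unfolding amps_def by (auto intro: cpt_mult)

lemma amps_time: "amps g ==> amps (\<lambda>i k. - \<i> * of_real (Omega i k) * g i k)"
 by (intro amps_mult continuous_intros continuous_on_subset[OF Omega]) auto

lemma amps_space: "amps g ==> amps (\<lambda>i k. \<i> * of_real ((p i + e *\<^sub>R k) $ l) * g i k)"
 by (intro amps_mult continuous_intros)

lemma pk_continuous: "amps g ==> continuous_on S (\<lambda>z. pk g (fst z) (snd z))"
 unfolding pk_def amps_def
 by (intro continuous_intros continuous_on_subset[OF osc_continuous[unfolded case_prod_beta']] Omega) auto

lemma pk_time:
 assumes "amps g"
 shows "((\<lambda>s. pk g s x) has_vector_derivative pk (\<lambda>i k. - \<i> * of_real (Omega i k) * g i k) t x) (at t within S)"
 unfolding pk_def using assms unfolding amps_def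
 by (intro has_vector_derivative_sum has_vector_derivative_mult_right osc_has_vector_derivative_time Omega) auto

lemma pk_space:
 assumes "amps g"
 shows "(pk g t has_derivative (\<lambda>h. \<Sum>l\<in>UNIV. h $ l *\<^sub>R pk (\<lambda>i k. \<i> * of_real ((p i + e *\<^sub>R k) $ l) * g i k) t x)) (at x)"
proof -
 let ?c = "c * of_real (e powr (real CARD('d) / 2))"
 have "((\<lambda>x. \<Sum>i\<in>I. ?c * osc (p i) e (Omega i) (g i) t x) has_derivative
  (\<lambda>h. \<Sum>i\<in>I. ?c * (\<Sum>l\<in>UNIV. h $ l *\<^sub>R osc (p i) e (Omega i) (\<lambda>k. \<i> * of_real ((p i + e *\<^sub>R k) $ l) * g i k) t x))) (at x)"
  using assms unfolding amps_def
  by (intro has_derivative_sum has_derivative_mult_right osc_has_derivative_space Omega) auto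
 moreover have "(\<Sum>i\<in>I. ?c * (\<Sum>l\<in>UNIV. h $ l *\<^sub>R osc (p i) e (Omega i) (\<lambda>k. \<i> * of_real ((p i + e *\<^sub>R k) $ l) * g i k) t x))
  = (\<Sum>l\<in>UNIV. h $ l *\<^sub>R pk (\<lambda>i k. \<i> * of_real ((p i + e *\<^sub>R k) $ l) * g i k) t x)" for h
  unfolding pk_def scaleR_sum_right sum_distrib_left by (subst sum.swap) simp
 ultimately show ?thesis unfolding pk_def[abs_def] by simp
qed

lemma pk_cong: "(!!i k. i \<in> I ==> g i k = h i k) ==> pk g t x = pk h t x"
 unfolding pk_def by (intro sum.cong refl arg_cong2[of _ _ _ _ "(*)"]) (simp add: osc_def)

lemma pk_add: "amps g ==> amps h ==> pk (\<lambda>i k. g i k + h i k) t x = pk g t x + pk h t x"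
 unfolding pk_def amps_def sum.distrib[symmetric]
 by (intro sum.cong refl) (simp add: osc_add[OF _ _ Omega, of rho] distrib_left)

lemma pk_cmult: "pk (\<lambda>i k. a * g i k) t x = a * pk g t x"
 unfolding pk_def osc_cmult sum_distrib_left by (simp add: mult_ac)

lemma pk_diff: "amps g ==> amps h ==> pk (\<lambda>i k. g i k - h i k) t x = pk g t x - pk h t x"
 using pk_add[of g "\<lambda>i k. (-1) * h i k"] pk_cmult[of "-1" h] amps_mult[of h "\<lambda>_ _. -1"] by simp

lemma pk_sum:
 assumes "!!j. j \<in> J ==> amps (g j)"
 shows "pk (\<lambda>i k. \<Sum>j\<in>J. g j i k) t x = (\<Sum>j\<in>J. pk (g j) t x)"
proof -
 have "osc (p i) e (Omega i) (\<lambda>k. \<Sum>j\<in>J. g j i k) t x = (\<Sum>j\<in>J. osc (p i) e (Omega i) (g j i) t x)" if "i \<in> I" for i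
  using assms that by (intro osc_sum[of _ rho] Omega) (auto simp: amps_def)
 then have "pk (\<lambda>i k. \<Sum>j\<in>J. g j i k) t x = (\<Sum>i\<in>I. \<Sum>j\<in>J. c * of_real (e powr (real CARD('d) / 2)) * osc (p i) e (Omega i) (g j i) t x)"
  by (simp add: pk_def sum_distrib_left)
 then show ?thesis unfolding pk_def by (subst (asm) sum.swap) simp
qed

lemma pk_L2:
 assumes g: "amps g" and e: "e > 0" and b: "b >= 0" "!!i k. i \<in> I ==> k \<in> cball 0 rho ==> norm (g i k) <= b"
 shows "L2_le (pk g t) ((real (card I))^2 * norm c * sqrt ((2 * pi) ^ CARD('d) * measure lborel (cball (0::real^'d) rho)) * b)"
proof -
 let ?M = "sqrt ((2 * pi) ^ CARD('d) * measure lborel (cball (0::real^'d) rho))"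
 have "L2_le (\<lambda>x. \<Sum>i\<in>I. c * (of_real (e powr (real CARD('d) / 2)) * osc (p i) e (Omega i) (g i) t x)) (real (card I) * (\<Sum>i\<in>I. norm c * (?M * b)))"
  by (intro L2_le_sum finite_I L2_le_cmult osc_L2 Omega e b) (use g in \<open>auto simp: amps_def\<close>)
 then show ?thesis unfolding pk_def[abs_def] by (simp add: mult_ac power2_eq_square)
qed

end

lemma osc_initial: "osc p e Omega g 0 x = osc p e Omega' g 0 x"
 by (simp add: osc_def)

text \<open>Used to equate two computations of one derivative: by the product rule with the
  derivative of the medium, and on the Fourier side of a packet sum.\<close>

lemma directional_coeff_unique:
 fixes f :: "real^'d::finite => complex"
 assumes "(f has_derivative (\<lambda>h. \<Sum>l\<in>UNIV. h $ l *\<^sub>R D l)) (at x)" "(f has_derivative (\<lambda>h. \<Sum>l\<in>UNIV. h $ l *\<^sub>R E l)) (at x)"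
 shows "D i = E i"
proof -
 have "(\<Sum>l\<in>UNIV. axis i 1 $ l *\<^sub>R f l) = f i" for f :: "'d => complex"
  by (simp add: axis_def if_distrib[of "\<lambda>r. r *\<^sub>R _"] cong: if_cong)
 then show ?thesis using fun_cong[OF has_derivative_unique[OF assms], of "axis i 1"] by simp
qed

lemma has_derivative_matrix_field:
 fixes A :: "real^'d::finite => complex^'d^'d" and v :: "real^'d => complex^'d"
 assumes "!!j. ((\<lambda>x. A x $ i $ j) has_derivative (\<lambda>h. \<Sum>l\<in>UNIV. h $ l *\<^sub>R dA j l)) (at x)"
  and "!!j. ((\<lambda>x. v x $ j) has_derivative (\<lambda>h. \<Sum>l\<in>UNIV. h $ l *\<^sub>R dv j l)) (at x)"
 shows "((\<lambda>x. (A x *v v x) $ i) has_derivative (\<lambda>h. \<Sum>l\<in>UNIV. h $ l *\<^sub>R (\<Sum>j\<in>UNIV. dA j l * v x $ j + A x $ i $ j * dv j l))) (at x)"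
proof -
 have "((\<lambda>x. \<Sum>j\<in>UNIV. A x $ i $ j * v x $ j) has_derivative (\<lambda>h. \<Sum>j\<in>UNIV. A x $ i $ j * (\<Sum>l\<in>UNIV. h $ l *\<^sub>R dv j l) + (\<Sum>l\<in>UNIV. h $ l *\<^sub>R dA j l) * v x $ j)) (at x)"
  by (intro has_derivative_sum has_derivative_mult assms)
 moreover have "(\<Sum>j\<in>UNIV. A x $ i $ j * (\<Sum>l\<in>UNIV. h $ l *\<^sub>R dv j l) + (\<Sum>l\<in>UNIV. h $ l *\<^sub>R dA j l) * v x $ j)
  = (\<Sum>l\<in>UNIV. h $ l *\<^sub>R (\<Sum>j\<in>UNIV. dA j l * v x $ j + A x $ i $ j * dv j l))" for h
  unfolding scaleR_sum_right
  by (subst sum.swap) (simp add: sum_distrib_left sum_distrib_right scaleR_add_right sum.distrib add.commute)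
 ultimately show ?thesis by (simp add: matrix_vector_mult_def)
qed

lemma L2_vector:
 fixes H :: "real^'d::finite => complex^'d"
 assumes "!!i. L2_le (\<lambda>x. H x $ i) b"
 shows "integrable lborel (\<lambda>x. (norm (H x))\<^sup>2)" "(LINT x|lborel. (norm (H x))\<^sup>2) <= (sqrt (real CARD('d)) * b)^2"
proof -
 have n: "(norm (H x))\<^sup>2 = (\<Sum>i\<in>UNIV. (norm (H x $ i))\<^sup>2)" for x
  by (simp add: norm_vec_def L2_set_def sum_nonneg)
 have i: "integrable lborel (\<lambda>x. (norm (H x $ i))\<^sup>2)" for i using assms[of i] by (simp add: L2_le_def L2_def)
 show "integrable lborel (\<lambda>x. (norm (H x))\<^sup>2)" unfolding n by (intro Bochner_Integration.integrable_sum i)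
 have "(LINT x|lborel. (norm (H x))\<^sup>2) = (\<Sum>i\<in>UNIV. LINT x|lborel. (norm (H x $ i))\<^sup>2)"
  unfolding n by (intro Bochner_Integration.integral_sum i)
 also have "... <= (\<Sum>i\<in>(UNIV :: 'd set). b\<^sup>2)" using assms by (intro sum_mono) (simp add: L2_le_def)
 finally show "(LINT x|lborel. (norm (H x))\<^sup>2) <= (sqrt (real CARD('d)) * b)^2" by (simp add: power_mult_distrib)
qed

section \<open>The oscillating medium and its action on packets\<close>

context trig_field
begin

definition medium :: "real => real^'d => complex^'d^'d" where
 "medium lam x = mat 1 + lam *\<^sub>R aT (transpose F *v x)"

lemma medium_entry: "medium lam x $ i $ j = (if i = j then 1 else 0) + of_real lam * aT (transpose F *v x) $ i $ j"
 by (simp add: medium_def mat_def scaleR_conv_of_real[where 'a=complex])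

lemma phase_transpose: "ivec eta \<bullet> (transpose F *v x) = (F *v ivec eta) \<bullet> x"
 unfolding transpose_matrix_vector by (metis dot_lmul_matrix inner_commute)

definition dmedium :: "real => 'd => 'd => 'd => real^'d => complex" where
 "dmedium lam i j l x = of_real lam * (\<Sum>eta\<in>S. a eta $ i $ j * (\<i> * of_real ((F *v ivec eta) $ l) * cis ((F *v ivec eta) \<bullet> x)))"

lemma medium_has_derivative:
 "((\<lambda>x. medium lam x $ i $ j) has_derivative (\<lambda>h. \<Sum>l\<in>UNIV. h $ l *\<^sub>R dmedium lam i j l x)) (at x)"
proof -
 have c: "((\<lambda>x. cis (q \<bullet> x)) has_derivative (\<lambda>h. (q \<bullet> h) *\<^sub>R (\<i> * cis (q \<bullet> x)))) (at x)" for q :: "real^'d"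
  by (rule has_derivative_cis) (auto intro!: derivative_eq_intros)
 have e: "(q \<bullet> h) *\<^sub>R (\<i> * z) = (\<Sum>l\<in>UNIV. h $ l *\<^sub>R (\<i> * of_real (q $ l) * z))" for q h :: "real^'d" and z
  by (simp add: inner_vec_def scaleR_conv_of_real sum_distrib_right sum_distrib_left mult_ac)
 have "((\<lambda>x. (if i = j then 1 else 0) + of_real lam * (\<Sum>eta\<in>S. a eta $ i $ j * cis ((F *v ivec eta) \<bullet> x))) has_derivative
  (\<lambda>h. 0 + of_real lam * (\<Sum>eta\<in>S. a eta $ i $ j * (((F *v ivec eta) \<bullet> h) *\<^sub>R (\<i> * cis ((F *v ivec eta) \<bullet> x)))))) (at x)"
  by (intro has_derivative_add has_derivative_const has_derivative_mult_right has_derivative_sum c)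
 moreover have "0 + of_real lam * (\<Sum>eta\<in>S. a eta $ i $ j * (((F *v ivec eta) \<bullet> h) *\<^sub>R (\<i> * cis ((F *v ivec eta) \<bullet> x)))) = (\<Sum>l\<in>UNIV. h $ l *\<^sub>R dmedium lam i j l x)" for h
 proof -
  have "(\<Sum>eta\<in>S. a eta $ i $ j * (((F *v ivec eta) \<bullet> h) *\<^sub>R (\<i> * cis ((F *v ivec eta) \<bullet> x)))) =
   (\<Sum>l\<in>UNIV. \<Sum>eta\<in>S. h $ l *\<^sub>R (a eta $ i $ j * (\<i> * of_real ((F *v ivec eta) $ l) * cis ((F *v ivec eta) \<bullet> x))))"
   unfolding e sum_distrib_left by (subst sum.swap) simp
  then show ?thesis by (simp add: dmedium_def sum_distrib_left scaleR_sum_right)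
 qed
 ultimately show ?thesis unfolding medium_entry aT_eq phase_transpose by simp
qed

lemma dmedium_continuous: "continuous_on X (dmedium lam i j l)"
 unfolding dmedium_def[abs_def] cis_conv_exp by (intro continuous_intros)

lemma medium_continuous: "continuous_on X (medium lam)"
proof -
 have "continuous_on X (\<lambda>x. medium lam x $ i $ j)" for i j
  by (rule has_derivative_continuous_on) (rule has_derivative_at_withinI[OF medium_has_derivative])
 then have "continuous_on X (\<lambda>x. \<chi> i. \<chi> j. medium lam x $ i $ j)" by (intro continuous_on_vec_lambda)
 then show ?thesis by simp
qed

lemma aT_bounded: obtains B where "B >= 0" "!!y v. norm (aT y *v v) <= B * norm v"
proof (rule that[of "\<Sum>i\<in>UNIV. \<Sum>j\<in>UNIV. \<Sum>eta\<in>S. norm (a eta $ i $ j)"])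
 fix y v
 have "norm (aT y $ i $ j) <= (\<Sum>eta\<in>S. norm (a eta $ i $ j))" for i j
  unfolding aT_eq by (rule sum_norm_le) (simp add: norm_mult)
 then show "norm (aT y *v v) <= (\<Sum>i\<in>UNIV. \<Sum>j\<in>UNIV. \<Sum>eta\<in>S. norm (a eta $ i $ j)) * norm v"
  by (intro order_trans[OF norm_matrix_vector_mult_le] mult_right_mono sum_mono) auto
qed (intro sum_nonneg norm_ge_zero)

lemma medium_mult: "medium lam x *v v = v + lam *\<^sub>R (aT (transpose F *v x) *v v)"
 by (simp add: medium_def matrix_vector_mult_add_rdistrib) (simp add: vec_eq_iff matrix_vector_mult_def scaleR_sum_right)

text \<open>For lambda B at most 1/2 the perturbation changes |v|^2 by at most half of itself; the
  constants match those required by the energy estimate.\<close>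

lemma medium_elliptic:
 assumes he: "!!y. hermitian (aT y)" and B: "!!y v. norm (aT y *v v) <= B * norm v" and lam: "0 < lam" "lam * B <= 1 / 2"
 shows "(medium lam x *v u) \<bullet> v = u \<bullet> (medium lam x *v v)"
  "(norm v)\<^sup>2 / 2 <= (medium lam x *v v) \<bullet> v" "norm (medium lam x *v v) <= 2 * norm v"
proof -
 let ?w = "aT (transpose F *v x) *v v"
 have n: "lam * norm ?w <= norm v / 2"
 proof -
  have "lam * norm ?w <= lam * (B * norm v)" using lam by (intro mult_left_mono B) auto
  also have "... <= (1 / 2) * norm v" using lam mult_right_mono[of "lam * B" "1 / 2" "norm v"] by (simp add: mult.assoc)
  finally show ?thesis by simp
 qed
 show "(medium lam x *v u) \<bullet> v = u \<bullet> (medium lam x *v v)"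
  by (simp add: medium_mult inner_add_left inner_add_right hermitian_inner[OF he])
 have "norm (lam *\<^sub>R ?w) <= norm v" using n lam norm_ge_zero[of v] by (simp del: norm_ge_zero)
 then show "norm (medium lam x *v v) <= 2 * norm v"
  unfolding medium_mult using norm_triangle_ineq[of v "lam *\<^sub>R ?w"] by linarith
 have "\<bar>(lam *\<^sub>R ?w) \<bullet> v\<bar> <= norm (lam *\<^sub>R ?w) * norm v" by (rule Cauchy_Schwarz_ineq2)
 also have "... <= (norm v / 2) * norm v" using n lam by (intro mult_right_mono) auto
 finally have "- ((norm v)^2 / 2) <= (lam *\<^sub>R ?w) \<bullet> v" by (simp add: power2_eq_square)
 then show "(norm v)\<^sup>2 / 2 <= (medium lam x *v v) \<bullet> v"
  unfolding medium_mult inner_add_left power2_norm_eq_inner[symmetric] by linarith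
qed

text \<open>Each Fourier mode of the field shifts the carrier k + F zeta to k + F (eta + zeta) and
  leaves the dispersion relation alone. Multiplication thus becomes the convolution that defines
  \<open>flux\<close>, separately for each branch.\<close>

lemma aT_mult_packets:
 assumes J: "finite J" and Omega: "!!s. continuous_on UNIV (Omega s)"
  and cp: "!!s zeta. s \<in> J ==> cpt rho (g (s, zeta))"
  and z: "!!s zeta q. zeta \<notin> levels n ==> g (s, zeta) q = 0" and n: "n < N"
 shows "aT (transpose F *v x) $ i $ j * packets.pk (J \<times> freqs) (\<lambda>z. k + F *v ivec (snd z)) e (\<lambda>z. Omega (fst z)) c g t x
  = packets.pk (J \<times> freqs) (\<lambda>z. k + F *v ivec (snd z)) e (\<lambda>z. Omega (fst z)) c
    (\<lambda>z q. \<Sum>zeta\<in>freqs. a (snd z - zeta) $ i $ j * g (fst z, zeta) q) t x"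
proof -
 interpret packets "J \<times> freqs" "\<lambda>z. k + F *v ivec (snd z)" e "\<lambda>z. Omega (fst z)" c rho
  by standard (use J finite_freqs Omega in auto)
 define C where "C = c * of_real (e powr (real CARD('d) / 2))"
 define E where "E s zeta xi = osc (k + F *v ivec xi) e (Omega s) (g (s, zeta)) t x" for s zeta xi
 have E: "cis ((F *v ivec eta) \<bullet> x) * E s zeta zeta = E s zeta (eta + zeta)" for s zeta eta
  unfolding E_def osc_shift by (simp add: ivec_add matrix_vector_right_distrib add_ac)
 have E0: "E s zeta xi = 0" if "zeta \<notin> levels n" for s zeta xi
  unfolding E_def osc_def z[OF that] by simp
 have sh: "(\<Sum>eta\<in>S. a eta $ i $ j * E s zeta (eta + zeta)) = (\<Sum>xi\<in>freqs. a (xi - zeta) $ i $ j * E s zeta xi)" for s zeta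
 proof (cases "zeta \<in> levels n")
  case True
  have "a eta $ i $ j = 0" if "eta \<in> S" "eta + zeta \<notin> freqs" for eta
   using levels_add[OF True that(1)] levels_freqs[of "Suc n"] n that by auto
  then show ?thesis by (intro sum_shift finite_S finite_freqs) (auto simp: a_supp)
 qed (simp add: E0)
 have "aT (transpose F *v x) $ i $ j * pk g t x = (\<Sum>z\<in>J \<times> freqs. C * (\<Sum>eta\<in>S. a eta $ i $ j * (cis ((F *v ivec eta) \<bullet> x) * E (fst z) (snd z) (snd z))))"
  unfolding pk_def aT_eq phase_transpose C_def[symmetric] sum_distrib_left[of "sum _ _"]
  by (intro sum.cong refl) (simp add: E_def sum_distrib_left sum_distrib_right mult_ac)
 also have "... = (\<Sum>z\<in>J \<times> freqs. C * (\<Sum>xi\<in>freqs. a (xi - snd z) $ i $ j * E (fst z) (snd z) xi))"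
  unfolding E sh ..
 also have "... = (\<Sum>s\<in>J. \<Sum>zeta\<in>freqs. \<Sum>xi\<in>freqs. C * (a (xi - zeta) $ i $ j * E s zeta xi))"
  by (simp add: sum.cartesian_product' sum_distrib_left)
 also have "... = (\<Sum>s\<in>J. \<Sum>xi\<in>freqs. \<Sum>zeta\<in>freqs. C * (a (xi - zeta) $ i $ j * E s zeta xi))"
  by (intro sum.cong refl sum.swap)
 also have "... = (\<Sum>z\<in>J \<times> freqs. C * (\<Sum>zeta\<in>freqs. a (snd z - zeta) $ i $ j * E (fst z) zeta (snd z)))"
  by (simp add: sum.cartesian_product' sum_distrib_left)
 also have "... = pk (\<lambda>z q. \<Sum>zeta\<in>freqs. a (snd z - zeta) $ i $ j * g (fst z, zeta) q) t x"
  unfolding pk_def C_def[symmetric]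
 proof (intro sum.cong refl arg_cong2[of _ _ _ _ "(*)"])
  fix z assume "z \<in> J \<times> freqs"
  then have "osc (k + F *v ivec (snd z)) e (Omega (fst z)) (\<lambda>q. \<Sum>zeta\<in>freqs. a (snd z - zeta) $ i $ j * g (fst z, zeta) q) t x
   = (\<Sum>zeta\<in>freqs. osc (k + F *v ivec (snd z)) e (Omega (fst z)) (\<lambda>q. a (snd z - zeta) $ i $ j * g (fst z, zeta) q) t x)"
   by (intro osc_sum[of _ rho] Omega cpt_mult cp continuous_intros) auto
  then show "(\<Sum>zeta\<in>freqs. a (snd z - zeta) $ i $ j * E (fst z) zeta (snd z)) = osc (k + F *v ivec (snd z)) e (Omega (fst z)) (\<lambda>q. \<Sum>zeta\<in>freqs. a (snd z - zeta) $ i $ j * g (fst z, zeta) q) t x"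
   by (simp add: osc_cmult E_def)
 qed
 finally show ?thesis .
qed

text \<open>At t = 0 the frequency drops out, so the two branches have equal phases and only the sum
  of their amplitudes matters. This is how two branches can match both initial data.\<close>

lemma packets_initial:
 assumes Omega: "!!s. continuous_on UNIV (Omega s)" and g: "!!s xi. cpt rho (g (s, xi))" and h: "!!s xi. cpt rho (h (s, xi))"
  and eq: "!!xi q. xi \<in> freqs ==> g (1, xi) q + g (- 1, xi) q = h (1, xi) q + h (- 1, xi) q"
 shows "packets.pk ({1, - 1 :: real} \<times> freqs) (\<lambda>z. k + F *v ivec (snd z)) e (\<lambda>z. Omega (fst z)) c g 0 x
  = packets.pk ({1, - 1 :: real} \<times> freqs) (\<lambda>z. k + F *v ivec (snd z)) e (\<lambda>z. Omega (fst z)) c h 0 x"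
proof -
 interpret packets "{1, - 1 :: real} \<times> freqs" "\<lambda>z. k + F *v ivec (snd z)" e "\<lambda>z. Omega (fst z)" c rho
  by standard (use finite_freqs Omega in auto)
 define C where "C = c * of_real (e powr (real CARD('d) / 2))"
 have "pk f 0 x = (\<Sum>xi\<in>freqs. C * osc (k + F *v ivec xi) e (Omega 1) (\<lambda>q. f (1, xi) q + f (- 1, xi) q) 0 x)"
  if f: "!!s xi. cpt rho (f (s, xi))" for f
 proof -
  have "pk f 0 x = (\<Sum>s\<in>{1, - 1}. \<Sum>xi\<in>freqs. C * osc (k + F *v ivec xi) e (Omega 1) (f (s, xi)) 0 x)"
   unfolding pk_def C_def[symmetric] sum.cartesian_product' by (simp add: osc_initial[of _ _ "Omega (- 1)" _ _ "Omega 1"])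
  also have "... = (\<Sum>xi\<in>freqs. C * osc (k + F *v ivec xi) e (Omega 1) (f (1, xi)) 0 x + C * osc (k + F *v ivec xi) e (Omega 1) (f (- 1, xi)) 0 x)"
   by (simp add: sum.distrib)
  finally show ?thesis by (simp add: osc_add[OF f f assms(1)] distrib_left)
 qed
 from this[of g, OF g] this[of h, OF h] show ?thesis by (simp add: eq)
qed

end

section \<open>Comparison of the solution with the Bloch packet\<close>

context trig_field
begin

definition amp :: "real^'d => (real^'d => complex) => (real^'d => complex) => real => real^'d => complex" where
 "amp k uh vh s q = uh q + of_real s * (\<i> * vh q / of_real (norm k))"

abbreviation (input) pks where
 "pks k \<beta> L lam c \<equiv> packets.pk ({1, - 1 :: real} \<times> freqs) (\<lambda>z. k + F *v ivec (snd z)) (lam powr \<beta>) (\<lambda>z q. fst z * Om k \<beta> L lam q) c"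

text \<open>The difference of the exact solution and the Bloch packet solves the wave equation up to
  a source and goes through \<open>second_order_energy\<close>; replacing the Bloch packet by its
  constant mode costs another O(E1). All smallness is expressed by \<open>E1\<close> for the data
  and \<open>E2\<close> for the residual.\<close>

lemma approximation:
 fixes k :: "real^'d" and u :: "real => real^'d => complex"
 assumes k: "k ~= 0" and L: "L < N" and lam: "0 < lam"
  and OmC: "continuous_on UNIV (Om k \<beta> L lam)"
  and reg: "!!K. K \<in> ball k delta ==> regular K \<and> K ~= 0"
  and inb: "!!q. norm q <= rho ==> k + lam powr \<beta> *\<^sub>R q \<in> ball k delta"
  and Omk: "!!q. norm q <= rho ==> Om k \<beta> L lam q >= norm k / 2"
  and P1: "!!q xi. norm q <= rho ==> xi \<in> freqs ==>
   norm (Psi L lam (k + lam powr \<beta> *\<^sub>R q) xi - (if xi = 0 then 1 else 0)) <= E1"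
  and P2: "!!q xi. norm q <= rho ==> xi \<in> freqs ==>
   norm (defect L lam (k + lam powr \<beta> *\<^sub>R q) (Om k \<beta> L lam q) xi) <= E2"
  and P3: "!!q xi i. norm q <= rho ==> xi \<in> freqs ==>
   norm (init_flux L lam (k + lam powr \<beta> *\<^sub>R q) (Om k \<beta> L lam q / norm k) xi $ i) <= E1"
  and E: "E1 >= 0" "E2 > 0"
  and el: "!!x u v. (medium lam x *v u) \<bullet> v = u \<bullet> (medium lam x *v v)"
   "!!x v. (norm v)\<^sup>2 / 2 <= (medium lam x *v v) \<bullet> v" "!!x v. norm (medium lam x *v v) <= 2 * norm v"
  and uh: "cpt rho uh" "!!q. norm (uh q) <= M" and vh: "cpt rho vh" "!!q. norm (vh q) <= M"
  and C2: "C2_on ({0..} \<times> UNIV) (\<lambda>(t, x). u t x)"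
  and wave: "!!t x. t >= 0 ==> time_deriv (time_deriv u) t x = divergence (\<lambda>x. medium lam x *v grad (u t) x) x"
  and u0: "!!x. u 0 x = pks k \<beta> L lam c (\<lambda>z q. if snd z = 0 then uh q else 0) 0 x"
  and v0: "!!x. time_deriv u 0 x = pks k \<beta> L lam c (\<lambda>z q. if snd z = 0 then vh q else 0) 0 x"
  and T: "T >= 0"
 defines "Z \<equiv> (real (card ({1, - 1 :: real} \<times> freqs)))\<^sup>2 * norm c * sqrt ((2 * pi) ^ CARD('d) * measure lborel (cball (0::real^'d) rho))"
 shows "L2_le (\<lambda>x. u T x - pks k \<beta> L lam c (\<lambda>z q. if snd z = 0 then amp k uh vh (fst z) q else 0) T x)
  (2 * ((Z * (E1 * M) + 2 * (sqrt (real CARD('d)) * (Z * (E1 * M))) + T * (4 * (Z * (E2 * (M + M / norm k) * (2 / norm k))) + E2)) + Z * (E1 * (M + M / norm k))))"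
proof -
 let ?J = "{1, - 1 :: real}"
 define e where "e = lam powr \<beta>"
 have e: "e > 0" using lam by (simp add: e_def)
 define Kq where "Kq q = k + e *\<^sub>R q" for q :: "real^'d"
 define omega where "omega = Om k \<beta> L lam"
 define wv where "wv = (\<lambda>xi q i. wave_vec F (Kq q) xi $ i)"
 define A where "A = amp k uh vh"
 have omegaC: "continuous_on UNIV (\<lambda>q. s * omega q)" for s unfolding omega_def by (intro continuous_intros OmC)
 interpret P: packets "?J \<times> freqs" "\<lambda>z. k + F *v ivec (snd z)" e "\<lambda>z q. fst z * omega q" c rho
  by standard (auto simp: finite_freqs intro: omegaC)
 note Om = Omk[folded omega_def]
 have n: "norm k > 0" using k by simp
 have pos: "omega q > 0" if "norm q <= rho" for q using Om[OF that] n by linarith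
 have M: "M >= 0" using uh(2)[of 0] norm_ge_zero order_trans by blast
 have Z: "Z >= 0" by (simp add: Z_def)
 have regK: "regular (Kq q)" "Kq q ~= 0" if "norm q <= rho" for q using reg[OF inb[OF that]] by (auto simp: Kq_def e_def)
 have sub: "Kq ` cball 0 rho \<subseteq> ball k delta" using inb by (auto simp: Kq_def e_def)
 have KC: "continuous_on (cball 0 rho) Kq" unfolding Kq_def by (intro continuous_intros)
 have ratC: "continuous_on (cball 0 rho) (\<lambda>q. f (Kq q))" if "rational_on (ball k delta) f" for f
  by (rule continuous_on_compose2[OF rational_on_continuous[OF that] KC sub])
 have rr: "regular K" if "K \<in> ball k delta" for K using reg[OF that] by simp
 have wC: "continuous_on (cball 0 rho) (\<lambda>q. of_real (omega q) :: complex)"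
  unfolding omega_def by (intro continuous_intros continuous_on_subset[OF OmC]) auto
 have PsiC: "continuous_on (cball 0 rho) (\<lambda>q. Psi L lam (Kq q) xi)" for xi
  by (rule ratC[of "\<lambda>K. Psi L lam K xi"]) (rule Psi_rational[OF rr])
 have wvC: "continuous_on (cball 0 rho) (\<lambda>q. wv xi q i)" for xi i
  unfolding wv_def by (rule ratC[of "\<lambda>K. wave_vec F K xi $ i"]) (rule rational_wave_vec)
 have flC: "continuous_on (cball 0 rho) (\<lambda>q. flux (Psi L lam (Kq q)) (Kq q) xi $ i)" for xi i
  by (rule ratC[of "\<lambda>K. flux (Psi L lam K) K xi $ i"]) (intro rational_flux Psi_rational rr)
 have cdC: "continuous_on (cball 0 rho) (\<lambda>q. cdot (wave_vec F (Kq q) xi) (flux (Psi L lam (Kq q)) (Kq q) xi))" for xi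
  by (rule ratC[of "\<lambda>K. cdot (wave_vec F K xi) (flux (Psi L lam K) K xi)"]) (intro rational_cdot rational_wave_vec rational_flux Psi_rational rr)
 have dtC: "continuous_on (cball 0 rho) (\<lambda>q. of_real (detuning F (Kq q) xi + (norm (Kq q))^2) :: complex)" for xi
  unfolding detuning_def by (intro continuous_intros KC)
 have dfC: "continuous_on (cball 0 rho) (\<lambda>q. defect L lam (Kq q) (omega q) xi)" for xi
  unfolding defect_def of_real_power by (intro continuous_intros PsiC cdC dtC wC)
 have hdC: "continuous_on (cball 0 rho) (\<lambda>q. init_flux L lam (Kq q) (omega q / norm k) xi $ i)" for xi i
 proof -
  have h: "continuous_on (cball 0 rho) (\<lambda>q. head L lam (Kq q) xi $ i)"
  proof -
   have "rational_on (ball k delta) (\<lambda>K. \<Sum>n\<in>{1..L}. of_real (lam ^ n) * pot n K xi $ i)"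
    by (intro rational_on_sum rational_on.intros rational_pot rr)
   from ratC[OF this] show ?thesis by (simp add: head_def)
  qed
  have f: "continuous_on (cball 0 rho) (\<lambda>q. complex_of_real ((1 - omega q / norm k) / (norm (Kq q))^2) * of_real (Kq q $ i))"
   by (intro continuous_intros KC continuous_on_subset[OF OmC[folded omega_def]]) (use n regK in auto)
  have g: "continuous_on (cball 0 rho) (\<lambda>q. of_real (omega q / norm k) * head L lam (Kq q) xi $ i)"
   by (intro continuous_on_mult h continuous_on_of_real continuous_on_divide continuous_on_const continuous_on_subset[OF OmC[folded omega_def]]) (use n in auto)
  have "continuous_on (cball 0 rho) (\<lambda>q. (if xi = 0 then - \<i> * (complex_of_real ((1 - omega q / norm k) / (norm (Kq q))^2) * of_real (Kq q $ i)) else 0) - of_real (omega q / norm k) * head L lam (Kq q) xi $ i)"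
  proof (cases "xi = 0")
   case True
   show ?thesis unfolding if_P[OF True] by (intro continuous_on_diff continuous_on_mult continuous_on_const f g)
  next
   case False
   show ?thesis unfolding if_not_P[OF False] by (intro continuous_on_diff continuous_on_const g)
  qed
  then show ?thesis unfolding init_flux_def by (simp add: cvec_def mult.assoc if_distrib[of "\<lambda>v. v $ i"] cong: if_cong)
 qed
 have A: "cpt rho (A s)" for s
 proof -
  have "cpt rho (\<lambda>q. uh q + (of_real s * \<i> / of_real (norm k)) * vh q)"
   by (intro cpt_add cpt_mult uh vh continuous_intros)
  then show ?thesis by (simp add: A_def amp_def[abs_def] mult_ac)
 qed
 have AB: "norm (A s q) <= M + M / norm k" if "s \<in> ?J" for s q
 proof -
  have "norm (A s q) <= norm (uh q) + norm (of_real s * (\<i> * vh q / of_real (norm k)))" unfolding A_def amp_def by (rule norm_triangle_ineq)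
  also have "... = norm (uh q) + norm (vh q) / norm k" using that by (auto simp: norm_mult norm_divide)
  also have "... <= M + M / norm k" using n uh(2) vh(2) by (intro add_mono divide_right_mono) auto
  finally show ?thesis .
 qed
 have MA: "M + M / norm k >= 0" using M n by simp
 text \<open>The ansatz: each amplitude carries the truncated Bloch wave with the frequency \<open>\<plusminus>\<omega>\<close>.\<close>
 define gW where "gW z q = Psi L lam (Kq q) (snd z) * A (fst z) q" for z :: "real \<times> (int^'m)" and q
 have aW: "P.amps gW" unfolding P.amps_def gW_def by (intro ballI cpt_mult A PsiC)
 define gt where "gt z q = - \<i> * of_real (fst z * omega q) * gW z q" for z q
 define gtt where "gtt z q = - \<i> * of_real (fst z * omega q) * gt z q" for z q
 have at: "P.amps gt" unfolding gt_def[abs_def] by (rule P.amps_time[OF aW])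
 define gp where "gp i z q = \<i> * of_real ((k + F *v ivec (snd z) + e *\<^sub>R q) $ i) * gW z q" for i z q
 define gpp where "gpp i l z q = \<i> * of_real ((k + F *v ivec (snd z) + e *\<^sub>R q) $ l) * gp i z q" for i l z q
 have ap: "P.amps (gp i)" for i unfolding gp_def[abs_def] by (rule P.amps_space[OF aW])
 have app: "P.amps (gpp i l)" for i l unfolding gpp_def[abs_def] by (rule P.amps_space[OF ap])
 have wve: "of_real ((k + F *v ivec xi + e *\<^sub>R q) $ i) = wv xi q i" for xi q i
  by (simp add: wv_def wave_vec_def cvec_def Kq_def)
 have Wt: "((\<lambda>s. P.pk gW s x) has_vector_derivative P.pk gt t x) (at t within {0..})" for t x
  unfolding gt_def[abs_def] by (rule P.pk_time[OF aW])
 have Wtt: "((\<lambda>s. P.pk gt s x) has_vector_derivative P.pk gtt t x) (at t within {0..})" for t x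
  unfolding gtt_def[abs_def] by (rule P.pk_time[OF at])
 have Wx: "(P.pk gW t has_derivative (\<lambda>h. \<Sum>l\<in>UNIV. h $ l *\<^sub>R P.pk (gp l) t x)) (at x)" for t x
  unfolding gp_def[abs_def] by (rule P.pk_space[OF aW])
 have Wxx: "(P.pk (gp i) t has_derivative (\<lambda>h. \<Sum>l\<in>UNIV. h $ l *\<^sub>R P.pk (gpp i l) t x)) (at x)" for i t x
  unfolding gpp_def[abs_def] by (rule P.pk_space[OF ap])
 \<comment> \<open>Amplitudes of the medium applied to the gradient of the ansatz. This is again a
   packet sum, since one multiplication by the field stays within \<open>freqs\<close>.\<close>
 define gV where "gV i z q = (\<i> * wv (snd z) q i * Psi L lam (Kq q) (snd z) + of_real lam * flux (Psi L lam (Kq q)) (Kq q) (snd z) $ i) * A (fst z) q" for i z q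
 have aV: "P.amps (gV i)" for i
  unfolding P.amps_def gV_def by (intro ballI cpt_mult A continuous_intros wvC PsiC flC)
 define gdV where "gdV i z q = \<i> * of_real ((k + F *v ivec (snd z) + e *\<^sub>R q) $ i) * gV i z q" for i z q
 have adV: "P.amps (gdV i)" for i unfolding gdV_def[abs_def] by (rule P.amps_space[OF aV])
 have Psi_supp: "Psi L lam K zeta = 0" if "zeta \<notin> levels L" for K zeta
  unfolding Psi_def
 proof (intro sum.neutral ballI)
  fix n assume "n \<in> {..L}"
  then have "zeta \<notin> levels n" using levels_mono[of n L] that by auto
  then show "of_real (lam ^ n) * phi n K zeta = 0" by (simp add: phi_supp)
 qed
 have VW: "(medium lam x *v (\<chi> j. P.pk (gp j) t x)) $ i = P.pk (gV i) t x" for t x i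
 proof -
  have am: "P.amps (\<lambda>z q. \<Sum>zeta\<in>freqs. a (snd z - zeta) $ i $ j * gp j (fst z, zeta) q)" for j
   unfolding P.amps_def
  proof (intro ballI cpt_sum cpt_mult continuous_intros)
   fix z zeta assume "z \<in> ?J \<times> freqs" "zeta \<in> freqs"
   then show "cpt rho (gp j (fst z, zeta))" using ap[of j] by (auto simp: P.amps_def mem_Times_iff)
  qed
  have aT: "aT (transpose F *v x) $ i $ j * P.pk (gp j) t x = P.pk (\<lambda>z q. \<Sum>zeta\<in>freqs. a (snd z - zeta) $ i $ j * gp j (fst z, zeta) q) t x" for j
  proof (rule aT_mult_packets[where Omega="\<lambda>s q. s * omega q" and n=L and rho=rho])
   show "cpt rho (gp j (s, zeta))" for s zeta
    unfolding gp_def[abs_def] gW_def fst_conv snd_conv by (intro cpt_mult A PsiC continuous_intros)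
   show "gp j (s, zeta) q = 0" if "zeta \<notin> levels L" for s zeta q
    by (simp add: gp_def gW_def Psi_supp[OF that])
  qed (auto intro: omegaC L)
  have "(medium lam x *v (\<chi> j. P.pk (gp j) t x)) $ i = (\<Sum>j\<in>UNIV. (if i = j then P.pk (gp j) t x else 0) + of_real lam * (aT (transpose F *v x) $ i $ j * P.pk (gp j) t x))"
   unfolding matrix_vector_mult_def vec_lambda_beta medium_entry by (intro sum.cong refl) (simp add: distrib_right)
  also have "... = P.pk (gp i) t x + (\<Sum>j\<in>UNIV. of_real lam * (aT (transpose F *v x) $ i $ j * P.pk (gp j) t x))"
   by (simp add: sum.distrib)
  also have "... = P.pk (gp i) t x + of_real lam * P.pk (\<lambda>z q. \<Sum>j\<in>UNIV. \<Sum>zeta\<in>freqs. a (snd z - zeta) $ i $ j * gp j (fst z, zeta) q) t x"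
   unfolding aT by (subst P.pk_sum[OF am]) (simp add: sum_distrib_left)
  also have "... = P.pk (\<lambda>z q. gp i z q + of_real lam * (\<Sum>j\<in>UNIV. \<Sum>zeta\<in>freqs. a (snd z - zeta) $ i $ j * gp j (fst z, zeta) q)) t x"
  proof -
   have "P.amps (\<lambda>z q. of_real lam * (\<Sum>j\<in>UNIV. \<Sum>zeta\<in>freqs. a (snd z - zeta) $ i $ j * gp j (fst z, zeta) q))"
    using am by (intro P.amps_mult continuous_intros) (auto simp: P.amps_def intro: cpt_sum)
   from P.pk_add[OF ap this] show ?thesis unfolding P.pk_cmult by simp
  qed
  also have "... = P.pk (gV i) t x"
  proof (rule P.pk_cong)
   fix z q
   have fl: "(\<Sum>j\<in>UNIV. \<Sum>zeta\<in>freqs. a (snd z - zeta) $ i $ j * gp j (fst z, zeta) q) = flux (Psi L lam (Kq q)) (Kq q) (snd z) $ i * A (fst z) q"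
    unfolding flux_def sum_component gp_def gW_def fst_conv snd_conv wve
    by (subst sum.swap) (simp add: matrix_vector_mult_def sum_distrib_left sum_distrib_right wv_def mult_ac)
   show "gp i z q + of_real lam * (\<Sum>j\<in>UNIV. \<Sum>zeta\<in>freqs. a (snd z - zeta) $ i $ j * gp j (fst z, zeta) q) = gV i z q"
    unfolding fl unfolding gp_def gV_def gW_def wve by (simp only: distrib_right distrib_left mult_ac)
  qed
  finally show ?thesis .
 qed
 define dqW where "dqW i l t x = (\<Sum>j\<in>UNIV. dmedium lam i j l x * P.pk (gp j) t x + medium lam x $ i $ j * P.pk (gpp j l) t x)" for i l t x
 have qW: "((\<lambda>x. (medium lam x *v (\<chi> j. P.pk (gp j) t x)) $ i) has_derivative (\<lambda>h. \<Sum>l\<in>UNIV. h $ l *\<^sub>R dqW i l t x)) (at x)" for i t x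
  unfolding dqW_def using has_derivative_matrix_field[OF medium_has_derivative, of "\<lambda>x. \<chi> j. P.pk (gp j) t x" "\<lambda>j l. P.pk (gpp j l) t x" x lam i] Wxx
  by simp
 \<comment> \<open>The derivative obtained by the product rule is needed for continuity and for
   comparison with the solution, the packet form for computing the residual; both describe the same
   divergence.\<close>
 have dqW_div: "dqW i i t x = P.pk (gdV i) t x" for i t x
 proof -
  have "((\<lambda>x. (medium lam x *v (\<chi> j. P.pk (gp j) t x)) $ i) has_derivative (\<lambda>h. \<Sum>l\<in>UNIV. h $ l *\<^sub>R P.pk (\<lambda>z q. \<i> * of_real ((k + F *v ivec (snd z) + e *\<^sub>R q) $ l) * gV i z q) t x)) (at x)"
   unfolding VW by (rule P.pk_space[OF aV])
  from directional_coeff_unique[OF qW this] show ?thesis by (simp add: gdV_def[abs_def])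
 qed
 define gR where "gR z q = defect L lam (Kq q) (omega q) (snd z) * A (fst z) q" for z :: "real \<times> (int^'m)" and q
 have aR: "P.amps gR" unfolding P.amps_def gR_def by (intro ballI cpt_mult A dfC)
 have resid: "P.pk gtt t x = (\<Sum>i\<in>UNIV. dqW i i t x) + P.pk gR t x" for t x
 proof -
  have sV: "P.amps (\<lambda>z q. \<Sum>i\<in>UNIV. gdV i z q)"
   unfolding P.amps_def using adV[unfolded P.amps_def] by (intro ballI cpt_sum) blast
  have "(\<Sum>i\<in>UNIV. dqW i i t x) + P.pk gR t x = P.pk (\<lambda>z q. (\<Sum>i\<in>UNIV. gdV i z q) + gR z q) t x"
   unfolding dqW_div P.pk_add[OF sV aR] P.pk_sum[OF adV] ..
  also have "... = P.pk gtt t x"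
  proof (rule P.pk_cong)
   fix z :: "real \<times> (int^'m)" and q assume z: "z \<in> ?J \<times> freqs"
   let ?w = "wave_vec F (Kq q) (snd z)" and ?P = "Psi L lam (Kq q)"
   have ii: "\<i> * (\<i> * y) = - y" for y by simp
   have s1: "(\<Sum>i\<in>UNIV. - (?w $ i * ?w $ i) * ?P (snd z) * A (fst z) q) = (- cdot ?w ?w * ?P (snd z)) * A (fst z) q"
    by (simp add: cdot_def sum_distrib_right sum_negf)
   have s2: "(\<Sum>i\<in>UNIV. of_real lam * \<i> * (?w $ i * flux ?P (Kq q) (snd z) $ i) * A (fst z) q) = of_real lam * \<i> * cdot ?w (flux ?P (Kq q) (snd z)) * A (fst z) q"
    by (simp add: cdot_def sum_distrib_left sum_distrib_right mult_ac)
   have "(\<Sum>i\<in>UNIV. gdV i z q) = (\<Sum>i\<in>UNIV. - (?w $ i * ?w $ i) * ?P (snd z) * A (fst z) q + of_real lam * \<i> * (?w $ i * flux ?P (Kq q) (snd z) $ i) * A (fst z) q)"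
    unfolding gdV_def gV_def wve by (intro sum.cong refl) (simp add: wv_def ii algebra_simps)
   also have "... = (- cdot ?w ?w * ?P (snd z) + of_real lam * \<i> * cdot ?w (flux ?P (Kq q) (snd z))) * A (fst z) q"
    unfolding sum.distrib s1 s2 distrib_right ..
   also have "... = - (defect L lam (Kq q) (omega q) (snd z) + of_real ((omega q)^2) * ?P (snd z)) * A (fst z) q"
    unfolding cdot_wave_vec defect_def by (simp add: algebra_simps)
   finally have fin: "(\<Sum>i\<in>UNIV. gdV i z q) = - (defect L lam (Kq q) (omega q) (snd z) + of_real ((omega q)^2) * ?P (snd z)) * A (fst z) q" .
   have "(\<Sum>i\<in>UNIV. gdV i z q) + gR z q = - (of_real ((omega q)^2) * ?P (snd z) * A (fst z) q)"
    unfolding fin gR_def by (simp add: algebra_simps)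
   moreover have "gtt z q = (\<i> * \<i>) * ((of_real (fst z * omega q) * of_real (fst z * omega q)) * (?P (snd z) * A (fst z) q))"
    by (simp only: gtt_def gt_def gW_def mult_ac mult_minus_left mult_minus_right minus_minus)
   moreover have "of_real (fst z * omega q) * of_real (fst z * omega q) = complex_of_real ((omega q)^2)"
    using z by (auto simp: power2_eq_square)
   moreover have "\<i> * \<i> = - 1" by simp
   ultimately show "(\<Sum>i\<in>UNIV. gdV i z q) + gR z q = gtt z q" by (simp only: mult.assoc mult_minus_left mult_1_left)
  qed
  finally show ?thesis by simp
 qed
 text \<open>A time primitive of the residual. Since the residual oscillates in time, its primitive stays
  bounded uniformly in \<open>t\<close>.\<close>
 define gB where "gB z q = (\<i> * of_real (fst z * omega q) / of_real ((omega q)^2)) * gR z q" for z q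
 have aB: "P.amps gB"
  unfolding gB_def of_real_mult of_real_power by (intro P.amps_mult aR continuous_intros wC) (use pos in \<open>force\<close>)
 have Bt: "((\<lambda>s. P.pk gB s x) has_vector_derivative P.pk gR t x) (at t within {0..})" for t x
 proof -
  have "P.pk (\<lambda>z q. - \<i> * of_real (fst z * omega q) * gB z q) t x = P.pk gR t x"
  proof (rule P.pk_cong)
   fix z :: "real \<times> (int^'m)" and q assume z: "z \<in> ?J \<times> freqs"
   show "- \<i> * of_real (fst z * omega q) * gB z q = gR z q"
   \<comment> \<open>The frequency is known to be nonzero only inside the ball; outside, the
     amplitude of the residual is zero anyway.\<close>
   proof (cases "norm q <= rho")
    case True
    then have "omega q ~= 0" using pos by force
    then show ?thesis using z by (auto simp: gB_def power2_eq_square)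
   next
    case False
    then have "gR z q = 0" using aR z by (auto simp: P.amps_def cpt_def)
    then show ?thesis by (simp add: gB_def)
   qed
  qed
  then show ?thesis using P.pk_time[OF aB, of x t "{0..}"] by simp
 qed
 \<comment> \<open>Vector potential of the initial velocity error; \<open>vel\<close> confirms that
   its divergence is that error.\<close>
 define gH where "gH i z q = init_flux L lam (Kq q) (omega q / norm k) (snd z) $ i * vh q" for i and z :: "real \<times> (int^'m)" and q
 have aH: "P.amps (gH i)" for i unfolding P.amps_def gH_def by (intro ballI cpt_mult vh hdC)
 define gdH where "gdH i l z q = \<i> * of_real ((k + F *v ivec (snd z) + e *\<^sub>R q) $ l) * gH i z q" for i l z q
 have adH: "P.amps (gdH i l)" for i l unfolding gdH_def[abs_def] by (rule P.amps_space[OF aH])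
 have pks: "pks k \<beta> L lam c = P.pk" unfolding e_def omega_def ..
 have ini: "P.pk g 0 x = P.pk h 0 x"
  if "!!s xi. cpt rho (g (s, xi))" "!!s xi. cpt rho (h (s, xi))" "!!xi q. xi \<in> freqs ==> g (1, xi) q + g (- 1, xi) q = h (1, xi) q + h (- 1, xi) q" for g h x
  by (rule packets_initial[where Omega="\<lambda>s q. s * omega q"]) (rule omegaC that; assumption)+
 have d0: "cpt rho (\<lambda>q. if xi = 0 then f q else 0)" if "cpt rho f" for f and xi :: "int^'m"
  using that by (cases "xi = 0") (auto simp: cpt_def)
 obtain ut p dp where ud: "continuous_on ({0..} \<times> UNIV) (\<lambda>z. u (fst z) (snd z))"
  "!!i. continuous_on ({0..} \<times> UNIV) (\<lambda>z. p i (fst z) (snd z))"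
  "!!i l. continuous_on ({0..} \<times> UNIV) (\<lambda>z. dp i l (fst z) (snd z))"
  "!!t x. t >= 0 ==> ((\<lambda>s. u s x) has_vector_derivative ut t x) (at t within {0..})"
  "!!t x. t >= 0 ==> ((\<lambda>s. ut s x) has_vector_derivative time_deriv (time_deriv u) t x) (at t within {0..})"
  "!!t x. t >= 0 ==> time_deriv u t x = ut t x"
  "!!t x. t >= 0 ==> (u t has_derivative (\<lambda>h. \<Sum>l\<in>UNIV. h $ l *\<^sub>R p l t x)) (at x)"
  "!!i t x. t >= 0 ==> (p i t has_derivative (\<lambda>h. \<Sum>l\<in>UNIV. h $ l *\<^sub>R dp i l t x)) (at x)"
  by (rule C2_data[OF C2]) (rule that)
 define dqu where "dqu i l t x = (\<Sum>j\<in>UNIV. dmedium lam i j l x * p j t x + medium lam x $ i $ j * dp j l t x)" for i l t x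
 have qu: "((\<lambda>x. (medium lam x *v (\<chi> j. p j t x)) $ i) has_derivative (\<lambda>h. \<Sum>l\<in>UNIV. h $ l *\<^sub>R dqu i l t x)) (at x)" if "t >= 0" for i t x
  unfolding dqu_def using has_derivative_matrix_field[OF medium_has_derivative, of "\<lambda>x. \<chi> j. p j t x" "\<lambda>j l. dp j l t x" x lam i] ud(8)[OF that]
  by simp
 have ax: "(\<Sum>l\<in>UNIV. axis i 1 $ l *\<^sub>R f l) = f i" for f :: "'d => complex" and i
  by (simp add: axis_def if_distrib[of "\<lambda>r. r *\<^sub>R _"] cong: if_cong)
 have utt: "time_deriv (time_deriv u) t x = (\<Sum>i\<in>UNIV. dqu i i t x)" if "t >= 0" for t x
 proof -
  have "grad (u t) = (\<lambda>x. \<chi> j. p j t x)"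
   unfolding grad_def by (intro ext) (simp add: partial_eqI[OF ud(7)[OF that]] ax)
  then show ?thesis unfolding wave[OF that] divergence_def using partial_eqI[OF qu[OF that]] by (simp add: ax)
 qed
 define w where "w t x = u t x - P.pk gW t x" for t x
 define H where "H x = (\<chi> i. P.pk (gH i) 0 x)" for x
 define r where "r t x = P.pk gB 0 x - P.pk gB t x" for t x
 have cmed: "continuous_on ({0..} \<times> UNIV) (\<lambda>z::real \<times> (real^'d). medium lam (snd z) $ i $ j)" "continuous_on ({0..} \<times> UNIV) (\<lambda>z::real \<times> (real^'d). dmedium lam i j l (snd z))" for i j l
  using continuous_on_compose2[OF medium_continuous[of UNIV lam] continuous_on_snd[OF continuous_on_id], of "{0..} \<times> UNIV"]
   continuous_on_compose2[OF dmedium_continuous[of UNIV lam i j l] continuous_on_snd[OF continuous_on_id], of "{0..} \<times> UNIV"]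
  by (auto intro: continuous_on_component)
 have w0: "L2_le (w 0) (Z * (E1 * M))"
 proof -
  let ?g = "\<lambda>(z :: real \<times> (int^'m)) (q :: real^'d). ((if snd z = 0 then 1 else 0) - Psi L lam (Kq q) (snd z)) * uh q"
  have a1: "P.amps ?g" unfolding P.amps_def by (intro ballI cpt_mult uh continuous_intros PsiC)
  have a2: "P.amps (\<lambda>z q. if snd z = 0 then uh q else 0)" unfolding P.amps_def using d0[OF uh(1)] by auto
  have "w 0 x = P.pk (\<lambda>z q. (if snd z = 0 then uh q else 0) - gW z q) 0 x" for x
   unfolding w_def u0 pks P.pk_diff[OF a2 aW] ..
  also have "P.pk (\<lambda>z q. (if snd z = 0 then uh q else 0) - gW z q) 0 x = P.pk ?g 0 x" for x
  proof (rule ini)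
   show "cpt rho (\<lambda>q. (if snd (s, xi) = 0 then uh q else 0) - gW (s, xi) q)" for s xi
    using cpt_add[OF d0[OF uh(1), of xi] cpt_mult[OF A[of s], of "\<lambda>q. - Psi L lam (Kq q) xi"]] PsiC[of xi]
    by (simp add: gW_def continuous_on_minus)
   show "cpt rho (?g (s, xi))" for s xi by (intro cpt_mult uh continuous_intros PsiC)
   show "((if snd (1::real, xi) = 0 then uh q else 0) - gW (1, xi) q) + ((if snd (- 1::real, xi) = 0 then uh q else 0) - gW (- 1, xi) q) = ?g (1, xi) q + ?g (- 1, xi) q" for xi and q :: "real^'d"
    by (auto simp: gW_def A_def amp_def algebra_simps)
  qed
  finally have "w 0 = P.pk ?g 0" by (rule ext)
  moreover have "L2_le (P.pk ?g 0) (Z * (E1 * M))"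
   unfolding Z_def
  proof (rule P.pk_L2[OF a1 e])
   fix z :: "real \<times> (int^'m)" and q :: "real^'d" assume z: "z \<in> ?J \<times> freqs" and "q \<in> cball 0 rho"
   then have "norm ((if snd z = 0 then 1 else 0) - Psi L lam (Kq q) (snd z)) <= E1"
    using P1[of q "snd z"] by (auto simp: Kq_def e_def norm_minus_commute)
   then show "norm (?g z q) <= E1 * M" unfolding norm_mult using E M by (intro mult_mono uh) auto
  qed (use E M in simp)
  ultimately show ?thesis by simp
 qed
 \<comment> \<open>Summed over both signs, the contributions of the initial displacement cancel and
   those of the initial velocity add up to 2 (omega/|k|) Psi times \<open>vh\<close>. The prescribed
   data contribute twice \<open>vh\<close> at frequency 0, and the difference is the divergence
   represented by \<open>init_flux\<close>.\<close>
 have vel: "ut 0 x - P.pk gt 0 x = (\<Sum>i\<in>UNIV. P.pk (gdH i i) 0 x)" for x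
 proof -
  have a2: "P.amps (\<lambda>z q. if snd z = 0 then vh q else 0)" unfolding P.amps_def using d0[OF vh(1)] by auto
  have cgt: "cpt rho (gt (s, xi))" for s xi
   unfolding gt_def[abs_def] gW_def fst_conv snd_conv of_real_mult by (intro cpt_mult A PsiC continuous_intros wC)
  have cH: "cpt rho (gdH i i (s, xi))" for i s xi
   unfolding gdH_def[abs_def] gH_def snd_conv by (intro cpt_mult vh hdC continuous_intros)
  have "ut 0 x = P.pk (\<lambda>z q. if snd z = 0 then vh q else 0) 0 x"
   using v0[of x] ud(6)[of 0 x] unfolding pks by simp
  then have "ut 0 x - P.pk gt 0 x = P.pk (\<lambda>z q. (if snd z = 0 then vh q else 0) - gt z q) 0 x"
   unfolding P.pk_diff[OF a2 at] by simp
  also have "... = P.pk (\<lambda>z q. \<Sum>i\<in>UNIV. gdH i i z q) 0 x"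
  proof (rule ini)
   show "cpt rho (\<lambda>q. (if snd (s, xi) = 0 then vh q else 0) - gt (s, xi) q)" for s xi
    using cpt_add[OF d0[OF vh(1), of xi] cpt_mult[OF cgt[of s xi], of "\<lambda>_. -1"]] by simp
   show "cpt rho (\<lambda>q. \<Sum>i\<in>UNIV. gdH i i (s, xi) q)" for s xi by (intro cpt_sum cH)
   fix xi q
   show "((if snd (1::real, xi) = 0 then vh q else 0) - gt (1, xi) q) + ((if snd (- 1::real, xi) = 0 then vh q else 0) - gt (- 1, xi) q)
    = (\<Sum>i\<in>UNIV. gdH i i (1, xi) q) + (\<Sum>i\<in>UNIV. gdH i i (- 1, xi) q)"
   proof (cases "norm q <= rho")
    case True
    have "(\<Sum>i\<in>UNIV. gdH i i (s, xi) q) = \<i> * cdot (wave_vec F (Kq q) xi) (init_flux L lam (Kq q) (omega q / norm k) xi) * vh q" for s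
     unfolding gdH_def gH_def snd_conv wve by (simp add: cdot_def wv_def sum_distrib_left sum_distrib_right mult_ac)
    also have "\<i> * cdot (wave_vec F (Kq q) xi) (init_flux L lam (Kq q) (omega q / norm k) xi) = (if xi = 0 then 1 else 0) - of_real (omega q / norm k) * Psi L lam (Kq q) xi"
     by (rule init_flux[OF regK(2)[OF True]])
    finally have s: "(\<Sum>i\<in>UNIV. gdH i i (s, xi) q) = ((if xi = 0 then 1 else 0) - of_real (omega q / norm k) * Psi L lam (Kq q) xi) * vh q" for s .
    have g: "gt (1, xi) q + gt (- 1, xi) q = 2 * (of_real (omega q / norm k) * Psi L lam (Kq q) xi * vh q)"
     using n by (simp add: gt_def gW_def A_def amp_def field_simps)
    have "((if snd (1::real, xi) = 0 then vh q else 0) - gt (1, xi) q) + ((if snd (- 1::real, xi) = 0 then vh q else 0) - gt (- 1, xi) q)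
     = 2 * (if xi = 0 then vh q else 0) - (gt (1, xi) q + gt (- 1, xi) q)" by simp
    then show ?thesis unfolding s g by (auto simp: algebra_simps)
   next
    case False
    then have "gt (s, xi) q = 0" "vh q = 0" "gdH i i (s, xi) q = 0" for s i
     using cgt cH vh(1) by (auto simp: cpt_def)
    then show ?thesis by simp
   qed
  qed
  also have "... = (\<Sum>i\<in>UNIV. P.pk (gdH i i) 0 x)" by (rule P.pk_sum[OF adH])
  finally show ?thesis .
 qed
 have HL: "L2_le (\<lambda>x. H x $ i) (Z * (E1 * M))" for i
 proof -
  have "L2_le (P.pk (gH i) 0) (Z * (E1 * M))"
   unfolding Z_def
  proof (rule P.pk_L2[OF aH e])
   fix z :: "real \<times> (int^'m)" and q :: "real^'d" assume "z \<in> ?J \<times> freqs" and "q \<in> cball 0 rho"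
   then show "norm (gH i z q) <= E1 * M"
    unfolding gH_def norm_mult using E M P3[of q "snd z" i]
    by (intro mult_mono vh) (auto simp: Kq_def e_def omega_def)
  qed (use E M in simp)
  then show ?thesis by (simp add: H_def)
 qed
 \<comment> \<open>The source is the difference of the primitive at times 0 and t, each bounded by
   the defect over the frequency. The summand \<open>E2\<close> makes the bound strictly positive,
   as the energy estimate demands.\<close>
 have rL: "L2_le (r t) (4 * (Z * (E2 * (M + M / norm k) * (2 / norm k))) + E2)" for t
 proof -
  have b: "L2_le (P.pk gB t) (Z * (E2 * (M + M / norm k) * (2 / norm k)))" for t
   unfolding Z_def
  proof (rule P.pk_L2[OF aB e])
   fix z :: "real \<times> (int^'m)" and q :: "real^'d" assume z: "z \<in> ?J \<times> freqs" and q: "q \<in> cball 0 rho"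
   then have nq: "norm q <= rho" by simp
   have "norm (\<i> * complex_of_real (fst z * omega q) / of_real ((omega q)^2)) = 1 / omega q"
    using pos[OF nq] z by (auto simp: norm_mult norm_divide norm_power power2_eq_square)
   also have "... <= 1 / (norm k / 2)" using Om[OF nq] n by (intro frac_le) auto
   finally have 1: "norm (\<i> * complex_of_real (fst z * omega q) / of_real ((omega q)^2)) <= 2 / norm k" by simp
   have 2: "norm (gR z q) <= E2 * (M + M / norm k)"
    unfolding gR_def norm_mult using P2[OF nq, of "snd z"] z E MA
    by (intro mult_mono AB) (auto simp: Kq_def e_def omega_def)
   have "norm (gB z q) <= (2 / norm k) * (E2 * (M + M / norm k))"
    unfolding gB_def norm_mult[of "_ / _"] using n by (intro mult_mono 1 2) auto
   then show "norm (gB z q) <= E2 * (M + M / norm k) * (2 / norm k)" by (simp add: mult_ac)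
  qed (use E MA n in simp)
  from L2_le_add[OF b[of 0] L2_le_cmult[OF b[of t], of "-1"]]
  have "L2_le (r t) (2 * (Z * (E2 * (M + M / norm k) * (2 / norm k)) + Z * (E2 * (M + M / norm k) * (2 / norm k))))"
   by (simp add: r_def[abs_def])
  moreover have "2 * (y + y) <= 4 * y + E2" for y :: real
  proof -
   have "2 * (y + y) = 4 * y" by simp
   then show ?thesis using E(2) by simp
  qed
  ultimately show ?thesis by (rule L2_le_mono)
 qed
 have main: "L2_le (w T) (Z * (E1 * M) + 2 * (sqrt (real CARD('d)) * (Z * (E1 * M))) + T * (4 * (Z * (E2 * (M + M / norm k) * (2 / norm k))) + E2))"
 proof (rule second_order_energy[where A="medium lam" and H=H and r=r and R="\<lambda>t x. - P.pk gR t x" and wt="\<lambda>t x. ut t x - P.pk gt t x"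
    and p="\<lambda>t x. \<chi> i. p i t x - P.pk (gp i) t x" and dq="\<lambda>i l t x. dqu i l t x - dqW i l t x" and dH="\<lambda>i l x. P.pk (gdH i l) 0 x",
    OF medium_continuous el _ L2_vector[OF HL]])
  have pk0: "continuous_on UNIV (P.pk g 0)" if "P.amps g" for g
  proof -
   have "continuous_on UNIV (\<lambda>x::real^'d. (0::real, x))" by (intro continuous_intros)
   from continuous_on_compose2[OF P.pk_continuous[OF that, of UNIV] this] show ?thesis by simp
  qed
  show "continuous_on UNIV H" unfolding H_def by (intro continuous_on_vec_lambda pk0[OF aH])
  show "continuous_on ({0..} \<times> UNIV) (\<lambda>z. w (fst z) (snd z))"
   unfolding w_def by (intro continuous_intros ud(1) P.pk_continuous aW)
  show "continuous_on ({0..} \<times> UNIV) (\<lambda>z. (\<chi> i. p i (fst z) (snd z) - P.pk (gp i) (fst z) (snd z)) $ i)" for i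
   unfolding vec_lambda_beta by (intro continuous_on_diff ud(2) P.pk_continuous ap)
  show "continuous_on ({0..} \<times> UNIV) (\<lambda>z. r (fst z) (snd z))"
  proof -
   have "continuous_on ({0..} \<times> UNIV) (\<lambda>z::real \<times> (real^'d). P.pk gB 0 (snd z))"
    using continuous_on_compose2[OF pk0[OF aB] continuous_on_snd[OF continuous_on_id], of "{0..} \<times> UNIV"] by auto
   then show ?thesis unfolding r_def by (intro continuous_on_diff P.pk_continuous aB)
  qed
  show "continuous_on ({0..} \<times> UNIV) (\<lambda>z. dqu i l (fst z) (snd z) - dqW i l (fst z) (snd z))" for i l
   unfolding dqu_def dqW_def
   by (intro continuous_on_diff continuous_on_sum continuous_on_add continuous_on_mult cmed ud(2,3) P.pk_continuous ap app)
  show "continuous_on UNIV (\<lambda>x. P.pk (gdH i l) 0 x)" for i l using pk0[OF adH] by simp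
  show "((\<lambda>s. w s x) has_vector_derivative ut t x - P.pk gt t x) (at t within {0..})" if "t >= 0" for t x
   unfolding w_def by (intro has_vector_derivative_diff ud(4) Wt that)
  show "((\<lambda>s. ut s x - P.pk gt s x) has_vector_derivative (\<Sum>i\<in>UNIV. dqu i i t x - dqW i i t x) + - P.pk gR t x) (at t within {0..})" if "t >= 0" for t x
   using has_vector_derivative_diff[OF ud(5)[OF that, of x] Wtt[where x=x and t=t]] unfolding utt[OF that] resid
   by (simp add: sum_subtractf algebra_simps)
  show "((\<lambda>s. r s x) has_vector_derivative - P.pk gR t x) (at t within {0..})" if "t >= 0" for t x
   unfolding r_def using has_vector_derivative_diff[OF has_vector_derivative_const[of "P.pk gB 0 x"] Bt[where x=x and t=t]] by simp
  show "r 0 x = 0" for x by (simp add: r_def)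
  show "ut 0 x - P.pk gt 0 x = (\<Sum>i\<in>UNIV. P.pk (gdH i i) 0 x)" for x by (rule vel)
  show "(w t has_derivative (\<lambda>h. \<Sum>l\<in>UNIV. h $ l *\<^sub>R (\<chi> i. p i t x - P.pk (gp i) t x) $ l)) (at x)" if "t >= 0" for t x
   using has_derivative_diff[OF ud(7)[OF that, of x] Wx[where x=x and t=t]] unfolding w_def[abs_def]
   by (simp add: scaleR_diff_right sum_subtractf)
  show "((\<lambda>x. (medium lam x *v (\<chi> i. p i t x - P.pk (gp i) t x)) $ i) has_derivative (\<lambda>h. \<Sum>l\<in>UNIV. h $ l *\<^sub>R (dqu i l t x - dqW i l t x))) (at x)" if "t >= 0" for i t x
  proof -
   have "(medium lam x *v (\<chi> i. p i t x - P.pk (gp i) t x)) $ i = (medium lam x *v (\<chi> j. p j t x)) $ i - (medium lam x *v (\<chi> j. P.pk (gp j) t x)) $ i" for x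
    by (simp add: matrix_vector_mult_def right_diff_distrib sum_subtractf)
   then show ?thesis using has_derivative_diff[OF qu[OF that, of i x] qW[where i=i and x=x and t=t]] by (simp add: scaleR_diff_right sum_subtractf)
  qed
  show "((\<lambda>x. H x $ i) has_derivative (\<lambda>h. \<Sum>l\<in>UNIV. h $ l *\<^sub>R P.pk (gdH i l) 0 x)) (at x)" for i x
   unfolding H_def vec_lambda_beta gdH_def[abs_def] by (rule P.pk_space[OF aH])
  have "Z * (E2 * (M + M / norm k) * (2 / norm k)) >= 0" using Z E MA n by simp
  then show "4 * (Z * (E2 * (M + M / norm k) * (2 / norm k))) + E2 > 0" using E by linarith
  show "sqrt (real CARD('d)) * (Z * (E1 * M)) >= 0" using Z E M by simp
 qed (use rL w0 T in auto)
 \<comment> \<open>The ansatz differs from the approximation by its corrector modes only; their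
   amplitudes are of order \<open>E1\<close> uniformly in time.\<close>
 have corr: "L2_le (P.pk (\<lambda>(z :: real \<times> (int^'m)) q. (Psi L lam (Kq q) (snd z) - (if snd z = 0 then 1 else 0)) * A (fst z) q) T) (Z * (E1 * (M + M / norm k)))"
  unfolding Z_def
 proof (rule P.pk_L2[OF _ e])
  show "P.amps (\<lambda>(z :: real \<times> (int^'m)) q. (Psi L lam (Kq q) (snd z) - (if snd z = 0 then 1 else 0)) * A (fst z) q)"
   unfolding P.amps_def by (intro ballI cpt_mult A continuous_intros PsiC)
  fix z :: "real \<times> (int^'m)" and q :: "real^'d" assume "z \<in> ?J \<times> freqs" "q \<in> cball 0 rho"
  then show "norm ((Psi L lam (Kq q) (snd z) - (if snd z = 0 then 1 else 0)) * A (fst z) q) <= E1 * (M + M / norm k)"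
   unfolding norm_mult using P1[of q "snd z"] E by (intro mult_mono AB) (auto simp: Kq_def e_def)
 qed (use E MA in simp)
 have aU: "P.amps (\<lambda>z q. if snd z = 0 then A (fst z) q else 0)" unfolding P.amps_def using d0[OF A] by auto
 have "P.pk (\<lambda>(z :: real \<times> (int^'m)) q. (Psi L lam (Kq q) (snd z) - (if snd z = 0 then 1 else 0)) * A (fst z) q) T x = P.pk gW T x - P.pk (\<lambda>z q. if snd z = 0 then A (fst z) q else 0) T x" for x
  unfolding P.pk_diff[OF aW aU, symmetric] by (rule P.pk_cong) (auto simp: gW_def algebra_simps)
 then have "u T x - P.pk (\<lambda>z q. if snd z = 0 then A (fst z) q else 0) T x
  = w T x + P.pk (\<lambda>(z :: real \<times> (int^'m)) q. (Psi L lam (Kq q) (snd z) - (if snd z = 0 then 1 else 0)) * A (fst z) q) T x" for x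
  by (simp add: w_def)
 then show ?thesis unfolding pks A_def[symmetric] using L2_le_add[OF main corr] by simp
qed

end

section \<open>Identification of the approximation with packets, and conclusion\<close>

lemma osc_fourier:
 assumes "schwartz f" "cpt rho (fourier f)"
 shows "osc 0 1 Omega (fourier f) 0 x = of_real ((2 * pi) ^ CARD('d)) * f (x :: real^'d::finite)"
proof -
 obtain B where B: "B >= 0" "!!x. norm (partials [] f x) <= B * weight x"
  using assms(1) unfolding schwartz_def by (rule schwartz_bounded_weight[of _ "[]"]) auto
 have w: "weight x <= 1" for x :: "real^'d"
 proof -
  have "1 <= (1 + norm x) ^ (2 * CARD('d))" by (rule one_le_power) simp
  then show ?thesis unfolding weight_def by (subst divide_le_eq_1_pos) (simp_all add: zero_less_power add_pos_nonneg)
 qed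
 have nb: "norm (f x) <= B" for x
 proof -
  have "B * weight x <= B * 1" using B(1) w by (intro mult_left_mono) auto
  then show ?thesis using B(2)[of x] by simp
 qed
 have i: "integrable lborel f" and c: "continuous_on UNIV f"
  using schwartz_integrable[OF assms(1), of "[]"] schwartz_continuous[OF assms(1), of "[]"] by simp_all
 show ?thesis using fourier_inversion[OF c i nb cpt_integrable[OF assms(2)], of x] by (simp add: osc_def)
qed

lemma cpt_fourier:
 assumes "schwartz f" "compact (fourier_support f)"
 obtains rho where "rho >= 0" "!!r. r >= rho ==> cpt r (fourier f)"
proof -
 obtain rho where rho: "!!x. x \<in> fourier_support f ==> norm x <= rho"
  using compact_imp_bounded[OF assms(2)] bounded_iff by blast
 have "fourier f k = 0" if "norm k > rho" for k
  using rho[of k] that closure_subset[of "{k. fourier f k ~= 0}"] by (auto simp: fourier_support_def)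
 moreover have "continuous_on UNIV (fourier f)"
  using schwartz_integrable[OF assms(1), of "[]"] by (intro fourier_continuous) simp
 ultimately show thesis
  by (intro that[of "max 0 rho"]) (auto simp: cpt_def intro: continuous_on_subset)
qed

lemma osc_modulate: "osc k e Omega g t x = cis (k \<bullet> x) * osc 0 1 Omega g t (e *\<^sub>R x)"
proof -
 have "osc 0 e Omega g t x = osc 0 1 Omega g t (e *\<^sub>R x)" by (simp add: osc_def)
 then show ?thesis using osc_shift[of k x 0 e Omega g t] by simp
qed

context trig_field
begin

lemma Om_continuous: "regular k ==> L < N ==> \<beta> > 0 ==> continuous_on UNIV (Om k \<beta> L lam)"
 unfolding Om_def by (intro continuous_intros amp_symbol_real(2))

lemma pks_zero_mode:
 assumes Omega: "!!z. continuous_on UNIV (Omega z)"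
 shows "packets.pk ({1, - 1 :: real} \<times> freqs) (\<lambda>z. k + F *v ivec (snd z)) e Omega c (\<lambda>z q. if snd z = 0 then g (fst z) q else 0) t x
  = c * of_real (e powr (real CARD('d) / 2)) * (osc k e (Omega (1, 0)) (g 1) t x + osc k e (Omega (- 1, 0)) (g (- 1)) t x)"
proof -
 interpret packets "{1, - 1 :: real} \<times> freqs" "\<lambda>z. k + F *v ivec (snd z)" e Omega c 0
  by standard (use finite_freqs Omega in auto)
 have i0: "F *v ivec 0 = 0" by (simp add: ivec_def matrix_vector_mult_def vec_eq_iff)
 have z: "osc p e Omega' (\<lambda>q. 0) t x = 0" for p Omega' by (simp add: osc_def)
 have "packets.pk ({1, - 1 :: real} \<times> freqs) (\<lambda>z. k + F *v ivec (snd z)) e Omega c (\<lambda>z q. if snd z = 0 then g (fst z) q else 0) t x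
  = (\<Sum>s\<in>{1, - 1}. \<Sum>xi\<in>freqs. if xi = 0 then c * of_real (e powr (real CARD('d) / 2)) * osc k e (Omega (s, 0)) (g s) t x else 0)"
  unfolding pk_def sum.cartesian_product' by (intro sum.cong refl) (simp add: i0 z split: if_splits)
 then show ?thesis by (simp add: finite_freqs zero_freqs distrib_left)
qed

text \<open>The prefactor combines the normalization (2 pi)^d of Fourier inversion with a factor 2,
  because both branches carry the same amplitude in this sum.\<close>

lemma pks_wave_packet:
 assumes Omega: "!!z. continuous_on UNIV (Omega z)" and f: "schwartz f" "cpt rho (fourier f)"
 shows "packets.pk ({1, - 1 :: real} \<times> freqs) (\<lambda>z. k + F *v ivec (snd z)) e Omega (of_real (1 / (2 * (2 * pi) ^ CARD('d)))) (\<lambda>z q. if snd z = 0 then fourier f q else 0) 0 x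
  = wave_packet e k f x"
 unfolding pks_zero_mode[where g="\<lambda>_. fourier f", OF Omega] osc_modulate[of k] osc_fourier[OF f] wave_packet_def by simp

text \<open>Evaluating carrier and envelope at the moving point adds |k| + epsilon (k/|k|) . q to
  the amplitude symbol in the time phase. The sum is \<open>Om\<close>, so the branch is a packet
  with the frequency of the ansatz.\<close>

lemma U_branch_osc:
 assumes A: "amplitude_solution s F aT k \<beta> L lam u\<^sub>0 v\<^sub>0 A" and k: "k ~= 0" "regular k" and L: "L < N" and \<beta>: "\<beta> > 0"
  and cp: "cpt rho (fourier (A 0))" and t: "t >= 0"
 shows "of_real ((2 * pi) ^ CARD('d)) * U_branch s k (lam powr \<beta>) A t x
  = of_real ((lam powr \<beta>) powr (real CARD('d) / 2)) * osc k (lam powr \<beta>) (\<lambda>q. s * Om k \<beta> L lam q) (fourier (A 0)) t x"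
proof -
 let ?e = "lam powr \<beta>"
 define y where "y = x - (s * t) *\<^sub>R (k /\<^sub>R norm k)"
 define Q where "Q q = Re (amp_symbol F aT k \<beta> L lam q)" for q
 have "of_real ((2 * pi) ^ CARD('d)) * A t (?e *\<^sub>R y) = osc 0 1 (\<lambda>q. s * Q q) (fourier (A 0)) t (?e *\<^sub>R y)"
  unfolding Q_def by (rule amplitude_formula[OF A _ _ cp t]) (rule amp_symbol_real[OF k(2) L \<beta>])+
 then have "of_real ((2 * pi) ^ CARD('d)) * U_branch s k ?e A t x = of_real (?e powr (real CARD('d) / 2)) * (cis (k \<bullet> y) * osc 0 1 (\<lambda>q. s * Q q) (fourier (A 0)) t (?e *\<^sub>R y))"
  unfolding U_branch_def wave_packet_def y_def[symmetric] by (simp add: mult_ac)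
 also have "cis (k \<bullet> y) * osc 0 1 (\<lambda>q. s * Q q) (fourier (A 0)) t (?e *\<^sub>R y) = osc k ?e (\<lambda>q. s * Om k \<beta> L lam q) (fourier (A 0)) t x"
  unfolding osc_modulate[of k, symmetric] unfolding osc_def
 proof (intro Bochner_Integration.integral_cong refl arg_cong2[of _ _ _ _ "(*)"] arg_cong[of _ _ cis])
  fix q
  have kk: "k \<bullet> (k /\<^sub>R norm k) = norm k" using k(1) by (simp add: power2_norm_eq_inner[symmetric] power2_eq_square)
  have "(k + ?e *\<^sub>R q) \<bullet> y = (k + ?e *\<^sub>R q) \<bullet> x - s * t * (norm k + ?e * ((k /\<^sub>R norm k) \<bullet> q))"
   unfolding y_def inner_diff_right inner_scaleR_right[of _ "s * t"] inner_add_left[of k _ "k /\<^sub>R norm k"] kk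
   by (simp add: inner_commute)
  then show "(k + ?e *\<^sub>R q) \<bullet> y - t * (s * Q q) = (k + ?e *\<^sub>R q) \<bullet> x - t * (s * Om k \<beta> L lam q)"
   by (simp add: Om_def Q_def algebra_simps)
 qed
 finally show ?thesis .
qed

lemma fourier_amp:
 assumes A: "amplitude_solution s F aT k \<beta> L lam u\<^sub>0 v\<^sub>0 A" and u: "schwartz u\<^sub>0" and v: "schwartz v\<^sub>0"
 shows "fourier (A 0) = amp k (fourier u\<^sub>0) (fourier v\<^sub>0) s"
proof -
 have i: "integrable lborel u\<^sub>0" "integrable lborel v\<^sub>0"
  using schwartz_integrable[OF u, of "[]"] schwartz_integrable[OF v, of "[]"] by simp_all
 have A0: "A 0 x = u\<^sub>0 x + (of_real s * \<i> / of_real (norm k)) * v\<^sub>0 x" for x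
  using A unfolding amplitude_solution_def Let_def by (auto simp: mult_ac)
 show ?thesis
 proof
  fix q
  have "fourier (A 0) q = (LINT x|lborel. cis (- (q \<bullet> x)) * u\<^sub>0 x + (of_real s * \<i> / of_real (norm k)) * (cis (- (q \<bullet> x)) * v\<^sub>0 x))"
   unfolding fourier_def A0 by (simp add: distrib_left mult_ac)
  also have "... = fourier u\<^sub>0 q + (of_real s * \<i> / of_real (norm k)) * fourier v\<^sub>0 q"
   unfolding fourier_def using fourier_integrable[OF i(1)] fourier_integrable[OF i(2)] by simp
  finally show "fourier (A 0) q = amp k (fourier u\<^sub>0) (fourier v\<^sub>0) s q" by (simp add: amp_def mult_ac)
 qed
qed

text \<open>The approximation is the frequency-0 part of the Bloch ansatz, with the same dispersion
  relation and the same amplitudes; the comparison then takes place within one family of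
  packets.\<close>

lemma U_approx_pks:
 assumes Ap: "amplitude_solution 1 F aT k \<beta> L lam u\<^sub>0 v\<^sub>0 Ap" and Am: "amplitude_solution (- 1) F aT k \<beta> L lam u\<^sub>0 v\<^sub>0 Am"
  and u: "schwartz u\<^sub>0" "cpt rho (fourier u\<^sub>0)" and v: "schwartz v\<^sub>0" "cpt rho (fourier v\<^sub>0)"
  and k: "k ~= 0" "regular k" and L: "L < N" and \<beta>: "\<beta> > 0" and t: "t >= 0"
 shows "U_approx k (lam powr \<beta>) Ap Am t x = pks k \<beta> L lam (of_real (1 / (2 * (2 * pi) ^ CARD('d)))) (\<lambda>z q. if snd z = 0 then amp k (fourier u\<^sub>0) (fourier v\<^sub>0) (fst z) q else 0) t x"
proof -
 let ?c = "complex_of_real ((2 * pi) ^ CARD('d))"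
 have c: "?c ~= 0" by simp
 have cp: "cpt rho (amp k (fourier u\<^sub>0) (fourier v\<^sub>0) s)" for s
 proof -
  have "cpt rho (\<lambda>q. fourier u\<^sub>0 q + (of_real s * \<i> / of_real (norm k)) * fourier v\<^sub>0 q)"
   by (intro cpt_add cpt_mult u v continuous_on_const)
  then show ?thesis by (simp add: amp_def[abs_def] mult_ac)
 qed
 have b: "?c * U_branch s k (lam powr \<beta>) A t x = of_real ((lam powr \<beta>) powr (real CARD('d) / 2)) *
   osc k (lam powr \<beta>) (\<lambda>q. s * Om k \<beta> L lam q) (amp k (fourier u\<^sub>0) (fourier v\<^sub>0) s) t x"
  if A: "amplitude_solution s F aT k \<beta> L lam u\<^sub>0 v\<^sub>0 A" for s A
  using U_branch_osc[OF A k L \<beta> _ t, of rho x] cp unfolding fourier_amp[OF A u(1) v(1)] by blast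
 have "?c * (2 * U_approx k (lam powr \<beta>) Ap Am t x) = ?c * U_branch 1 k (lam powr \<beta>) Ap t x + ?c * U_branch (- 1) k (lam powr \<beta>) Am t x"
  by (simp add: U_approx_def distrib_left)
 then have U: "U_approx k (lam powr \<beta>) Ap Am t x = of_real (1 / (2 * (2 * pi) ^ CARD('d))) * (?c * U_branch 1 k (lam powr \<beta>) Ap t x + ?c * U_branch (- 1) k (lam powr \<beta>) Am t x)"
  by (simp add: field_simps)
 have cOm: "continuous_on UNIV ((\<lambda>z q. fst z * Om k \<beta> L lam q) z)" for z :: "real \<times> (int^'m)"
  by (intro continuous_intros Om_continuous k(2) L \<beta>)
 show ?thesis
  unfolding U b[OF Ap] b[OF Am] pks_zero_mode[where Omega="\<lambda>z q. fst z * Om k \<beta> L lam q" and g="amp k (fourier u\<^sub>0) (fourier v\<^sub>0)", OF cOm]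
  by (simp only: fst_conv distrib_left mult.assoc)
qed

lemma wave_approximation:
 fixes k :: "real^'d"
 assumes k: "k \<in> nonresonant F - {0}" and L: "L >= 1" "L < N" and \<beta>: "\<beta> > 0" and he: "!!y. hermitian (aT y)"
  and u: "schwartz u\<^sub>0" "compact (fourier_support u\<^sub>0)" and v: "schwartz v\<^sub>0" "compact (fourier_support v\<^sub>0)"
 shows "\<exists>lam\<^sub>0>0. \<exists>C. \<forall>lam u Ap Am.
    0 < lam \<and> lam <= lam\<^sub>0 -->
    wave_solution (quasiperiodic_field F aT) lam (wave_packet (lam powr \<beta>) k u\<^sub>0) (wave_packet (lam powr \<beta>) k v\<^sub>0) u -->
    amplitude_solution 1 F aT k \<beta> L lam u\<^sub>0 v\<^sub>0 Ap -->
    amplitude_solution (-1) F aT k \<beta> L lam u\<^sub>0 v\<^sub>0 Am -->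
    (\<forall>t\<ge>0. L2 (\<lambda>x. u t x - U_approx k (lam powr \<beta>) Ap Am t x) \<and>
     L2_norm (\<lambda>x. u t x - U_approx k (lam powr \<beta>) Ap Am t x) <= C * lam powr rate \<beta> L * (1 + lam ^ L * t))"
proof -
 obtain rho1 where rho1: "rho1 >= 0" "!!r. r >= rho1 ==> cpt r (fourier u\<^sub>0)" using cpt_fourier[OF u] by blast
 obtain rho2 where rho2: "rho2 >= 0" "!!r. r >= rho2 ==> cpt r (fourier v\<^sub>0)" using cpt_fourier[OF v] by blast
 define rho where "rho = max rho1 rho2"
 have cu: "cpt rho (fourier u\<^sub>0)" and cv: "cpt rho (fourier v\<^sub>0)" and rho: "rho >= 0" using rho1 rho2 by (auto simp: rho_def)
 obtain M1 where M1: "M1 >= 0" "!!q. norm (fourier u\<^sub>0 q) <= M1" using cpt_bounded[OF cu] by blast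
 obtain M2 where M2: "M2 >= 0" "!!q. norm (fourier v\<^sub>0 q) <= M2" using cpt_bounded[OF cv] by blast
 define M where "M = max M1 M2"
 have M: "M >= 0" "!!q. norm (fourier u\<^sub>0 q) <= M" "!!q. norm (fourier v\<^sub>0 q) <= M"
  unfolding M_def using M1 M2 by (auto simp: le_max_iff_disj)
 obtain B where B: "B >= 0" "!!y v. norm (aT y *v v) <= B * norm v" using aT_bounded by blast
 have k0: "k ~= 0" "norm k > 0" and reg: "regular k" using k nonresonant_regular by auto
 obtain C1 lam1 delta where q: "C1 >= 0" "0 < lam1" "lam1 <= 1" "!!K. K \<in> ball k delta ==> regular K \<and> K ~= 0"
  "!!lam q. 0 < lam ==> lam <= lam1 ==> norm q <= rho ==> k + lam powr \<beta> *\<^sub>R q \<in> ball k delta"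
  "!!lam q. 0 < lam ==> lam <= lam1 ==> norm q <= rho ==> Om k \<beta> L lam q >= norm k / 2"
  "!!lam q xi. 0 < lam ==> lam <= lam1 ==> norm q <= rho ==> xi \<in> freqs ==>
   norm (Psi L lam (k + lam powr \<beta> *\<^sub>R q) xi - (if xi = 0 then 1 else 0)) <= C1 * lam powr rate \<beta> L"
  "!!lam q xi. 0 < lam ==> lam <= lam1 ==> norm q <= rho ==> xi \<in> freqs ==>
   norm (defect L lam (k + lam powr \<beta> *\<^sub>R q) (Om k \<beta> L lam q) xi) <= C1 * (lam ^ L * lam powr rate \<beta> L)"
  "!!lam q xi i. 0 < lam ==> lam <= lam1 ==> norm q <= rho ==> xi \<in> freqs ==>
   norm (init_flux L lam (k + lam powr \<beta> *\<^sub>R q) (Om k \<beta> L lam q / norm k) xi $ i) <= C1 * lam powr rate \<beta> L"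
  by (rule quasimode[OF k L \<beta> rho]) (rule that)
 define c where "c = complex_of_real (1 / (2 * (2 * pi) ^ CARD('d)))"
 define Z where "Z = (real (card ({1, - 1 :: real} \<times> freqs)))^2 * norm c * sqrt ((2 * pi) ^ CARD('d) * measure lborel (cball (0::real^'d) rho))"
 define MA where "MA = M + M / norm k"
 define D1 where "D1 = Z * (C1 * M) + 2 * (sqrt (real CARD('d)) * (Z * (C1 * M))) + Z * (C1 * MA)"
 define D2 where "D2 = (4 * (Z * (MA * (2 / norm k))) + 1) * (C1 + 1)"
 have Z: "Z >= 0" by (simp add: Z_def)
 have MA: "MA >= 0" using M(1) k0 by (simp add: MA_def)
 have D: "D1 >= 0" "D2 >= 0" using Z MA M(1) q(1) k0 by (auto simp: D1_def D2_def intro!: add_nonneg_nonneg mult_nonneg_nonneg)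
 \<comment> \<open>Besides the threshold of the quasimode, the second entry gives lambda B \<le> 1/2
   and hence ellipticity of the medium.\<close>
 define lam0 where "lam0 = min lam1 (1 / (2 * (B + 1)))"
 have lam0: "lam0 > 0" using q(2) B(1) by (simp add: lam0_def)
 show ?thesis
 proof (rule exI[of _ lam0], rule conjI[OF lam0], rule exI[of _ "2 * (D1 + D2)"], intro allI impI)
  fix lam and w :: "real => real^'d => complex" and Ap Am and t :: real
  assume lam: "0 < lam \<and> lam <= lam0" and t: "t >= 0"
   and w: "wave_solution (quasiperiodic_field F aT) lam (wave_packet (lam powr \<beta>) k u\<^sub>0) (wave_packet (lam powr \<beta>) k v\<^sub>0) w"
   and Ap: "amplitude_solution 1 F aT k \<beta> L lam u\<^sub>0 v\<^sub>0 Ap" and Am: "amplitude_solution (-1) F aT k \<beta> L lam u\<^sub>0 v\<^sub>0 Am"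
  have l: "0 < lam" "lam <= lam1" using lam by (auto simp: lam0_def)
  have lB: "lam * B <= 1 / 2"
  proof -
   have "lam <= 1 / (2 * (B + 1))" using lam by (simp add: lam0_def)
   then have "lam * (2 * (B + 1)) <= 1" using B(1) by (simp add: pos_le_divide_eq)
   then show ?thesis using l by (simp add: algebra_simps)
  qed
  define g where "g = lam powr rate \<beta> L"
  have g: "g > 0" using l by (simp add: g_def)
  \<comment> \<open>C1 is enlarged by 1 because the comparison requires a strictly positive residual
    bound, while C1 could be 0.\<close>
  define E2 where "E2 = (C1 + 1) * (lam ^ L * g)"
  have E2: "E2 > 0" using q(1) l g by (simp add: E2_def)
  have OmC: "continuous_on UNIV (Om k \<beta> L lam)"
   by (rule Om_continuous[OF reg L(2) \<beta>])
  then have Om': "continuous_on UNIV ((\<lambda>z q. fst z * Om k \<beta> L lam q) z)" for z :: "real \<times> (int^'m)"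
   by (intro continuous_intros)
  have med: "mat 1 + lam *\<^sub>R quasiperiodic_field F aT x = medium lam x" for x
   by (simp add: medium_def quasiperiodic_field_def)
  have "L2_le (\<lambda>x. w t x - pks k \<beta> L lam c (\<lambda>z q. if snd z = 0 then amp k (fourier u\<^sub>0) (fourier v\<^sub>0) (fst z) q else 0) t x)
   (2 * ((Z * (C1 * g * M) + 2 * (sqrt (real CARD('d)) * (Z * (C1 * g * M))) + t * (4 * (Z * (E2 * (M + M / norm k) * (2 / norm k))) + E2)) + Z * (C1 * g * (M + M / norm k))))"
   unfolding Z_def
  proof (rule approximation[OF k0(1) L(2) l(1) OmC q(4) q(5)[OF l] q(6)[OF l] q(7)[OF l, folded g_def] _ q(9)[OF l, folded g_def] _ _ medium_elliptic[OF he B(2) l(1) lB] cu M(2) cv M(3)])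
   show "norm (defect L lam (k + lam powr \<beta> *\<^sub>R q) (Om k \<beta> L lam q) xi) <= E2" if "norm q <= rho" "xi \<in> freqs" for q xi
   proof -
    have "C1 * (lam ^ L * g) <= E2" unfolding E2_def using l g by (intro mult_right_mono) auto
    then show ?thesis using q(8)[OF l that] unfolding g_def by linarith
   qed
   show "C2_on ({0..} \<times> UNIV) (\<lambda>(t, x). w t x)" using w by (simp add: wave_solution_def)
   show "time_deriv (time_deriv w) t x = divergence (\<lambda>x. medium lam x *v grad (w t) x) x" if "t >= 0" for t x
    using w that unfolding wave_solution_def med by blast
   show "w 0 x = pks k \<beta> L lam c (\<lambda>z q. if snd z = 0 then fourier u\<^sub>0 q else 0) 0 x" for x
    unfolding c_def pks_wave_packet[where Omega="\<lambda>z q. fst z * Om k \<beta> L lam q", OF Om' u(1) cu] using w by (simp add: wave_solution_def)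
   show "time_deriv w 0 x = pks k \<beta> L lam c (\<lambda>z q. if snd z = 0 then fourier v\<^sub>0 q else 0) 0 x" for x
    unfolding c_def pks_wave_packet[where Omega="\<lambda>z q. fst z * Om k \<beta> L lam q", OF Om' v(1) cv] using w by (simp add: wave_solution_def)
  qed (use g q(1) E2 t in auto)
  moreover have "2 * ((Z * (C1 * g * M) + 2 * (sqrt (real CARD('d)) * (Z * (C1 * g * M))) + t * (4 * (Z * (E2 * (M + M / norm k) * (2 / norm k))) + E2)) + Z * (C1 * g * (M + M / norm k)))
   <= 2 * (D1 + D2) * g * (1 + lam ^ L * t)"
  proof -
   have a: "Z * (C1 * g * M) + 2 * (sqrt (real CARD('d)) * (Z * (C1 * g * M))) + Z * (C1 * g * (M + M / norm k)) = D1 * g"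
    unfolding D1_def MA_def[symmetric] by (simp only: distrib_right distrib_left mult_ac)
   have b: "t * (4 * (Z * (E2 * (M + M / norm k) * (2 / norm k))) + E2) = D2 * g * (lam ^ L * t)"
    unfolding D2_def E2_def MA_def[symmetric] by (simp only: distrib_right distrib_left mult_ac mult_1_left mult_1_right)
   have d: "D1 * g + D2 * g * (lam ^ L * t) <= (D1 + D2) * g * (1 + lam ^ L * t)"
   proof -
    have "(D1 + D2) * g * (1 + lam ^ L * t) = D1 * g + D2 * g * (lam ^ L * t) + (D2 * g + D1 * g * (lam ^ L * t))"
     by (simp add: algebra_simps)
    moreover have "D2 * g + D1 * g * (lam ^ L * t) >= 0" using D g l t by simp
    ultimately show ?thesis by linarith
   qed
   have "2 * ((Z * (C1 * g * M) + 2 * (sqrt (real CARD('d)) * (Z * (C1 * g * M))) + t * (4 * (Z * (E2 * (M + M / norm k) * (2 / norm k))) + E2)) + Z * (C1 * g * (M + M / norm k)))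
    = 2 * (D1 * g + D2 * g * (lam ^ L * t))"
    unfolding a[symmetric] b[symmetric] by simp
   also have "... <= 2 * ((D1 + D2) * g * (1 + lam ^ L * t))" using d by simp
   finally show ?thesis by (simp only: mult.assoc)
  qed
  ultimately have "L2_le (\<lambda>x. w t x - U_approx k (lam powr \<beta>) Ap Am t x) (2 * (D1 + D2) * g * (1 + lam ^ L * t))"
   unfolding U_approx_pks[OF Ap Am u(1) cu v(1) cv k0(1) reg L(2) \<beta> t] c_def[symmetric] by (rule L2_le_mono)
  from L2_le_norm[OF this]
  show "L2 (\<lambda>x. w t x - U_approx k (lam powr \<beta>) Ap Am t x) \<and>
   L2_norm (\<lambda>x. w t x - U_approx k (lam powr \<beta>) Ap Am t x) <= 2 * (D1 + D2) * lam powr rate \<beta> L * (1 + lam ^ L * t)"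
   unfolding g_def .
 qed
qed

end

theorem corollary3:
 fixes \<beta> :: real and L :: nat
 assumes "\<beta> > 0" and "L \<ge> 1"
 shows "\<exists>\<gamma>. 0 < \<gamma> \<and> \<gamma> \<le> 1 \<and>
  (\<forall>(F :: real^'m::finite^'d::finite) (aT :: real^'m \<Rightarrow> complex^'d^'d)
   (u\<^sub>0 :: real^'d \<Rightarrow> complex) (v\<^sub>0 :: real^'d \<Rightarrow> complex) (k\<^sub>0 :: real^'d).
   QP' F aT \<longrightarrow>
   (\<forall>i j. trig_poly (\<lambda>y. aT y $ i $ j)) \<longrightarrow>
   (\<forall>y. hermitian (aT y)) \<longrightarrow>
   schwartz u\<^sub>0 \<longrightarrow> schwartz v\<^sub>0 \<longrightarrow>
   compact (fourier_support u\<^sub>0) \<longrightarrow> compact (fourier_support v\<^sub>0) \<longrightarrow>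
   0 \<notin> fourier_support v\<^sub>0 \<longrightarrow>
   k\<^sub>0 \<in> nonresonant F - {0} \<longrightarrow>
   (\<exists>lam\<^sub>0>0. \<exists>C. \<forall>lam u Ap Am.
    0 < lam \<and> lam \<le> lam\<^sub>0 \<longrightarrow>
    wave_solution (quasiperiodic_field F aT) lam
     (wave_packet (lam powr \<beta>) k\<^sub>0 u\<^sub>0) (wave_packet (lam powr \<beta>) k\<^sub>0 v\<^sub>0) u \<longrightarrow>
    amplitude_solution 1 F aT k\<^sub>0 \<beta> L lam u\<^sub>0 v\<^sub>0 Ap \<longrightarrow>
    amplitude_solution (-1) F aT k\<^sub>0 \<beta> L lam u\<^sub>0 v\<^sub>0 Am \<longrightarrow>
    (\<forall>t\<ge>0.
     L2 (\<lambda>x. u t x - U_approx k\<^sub>0 (lam powr \<beta>) Ap Am t x) \<and>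
     L2_norm (\<lambda>x. u t x - U_approx k\<^sub>0 (lam powr \<beta>) Ap Am t x)
      \<le> C * lam powr \<gamma> * (1 + lam ^ L * t))))"
proof (rule exI[of _ "rate \<beta> L"], intro conjI rate assms(1) allI impI)
 fix F :: "real^'m::finite^'d::finite" and aT :: "real^'m => complex^'d^'d" and u\<^sub>0 v\<^sub>0 :: "real^'d => complex" and k\<^sub>0 :: "real^'d"
 assume tr: "\<forall>i j. trig_poly (\<lambda>y. aT y $ i $ j)" and he: "\<forall>y. hermitian (aT y)"
  and u: "schwartz u\<^sub>0" and v: "schwartz v\<^sub>0" and cu: "compact (fourier_support u\<^sub>0)" and cv: "compact (fourier_support v\<^sub>0)"
  and k: "k\<^sub>0 \<in> nonresonant F - {0}"
 obtain a S where "trig_field aT a S" using trig_field_exists[of aT] tr he by blast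
 \<comment> \<open>One level more than the order: the correctors up to L live on
   \<open>levels L\<close>, and the multiplication by the field in the residual reaches
   \<open>levels (Suc L)\<close>, which is then all of \<open>freqs\<close>.\<close>
 then interpret trig_field F aT a S "Suc L" .
 show "\<exists>lam\<^sub>0>0. \<exists>C. \<forall>lam u Ap Am.
    0 < lam \<and> lam <= lam\<^sub>0 -->
    wave_solution (quasiperiodic_field F aT) lam
     (wave_packet (lam powr \<beta>) k\<^sub>0 u\<^sub>0) (wave_packet (lam powr \<beta>) k\<^sub>0 v\<^sub>0) u -->
    amplitude_solution 1 F aT k\<^sub>0 \<beta> L lam u\<^sub>0 v\<^sub>0 Ap -->
    amplitude_solution (-1) F aT k\<^sub>0 \<beta> L lam u\<^sub>0 v\<^sub>0 Am -->
    (\<forall>t\<ge>0.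
     L2 (\<lambda>x. u t x - U_approx k\<^sub>0 (lam powr \<beta>) Ap Am t x) \<and>
     L2_norm (\<lambda>x. u t x - U_approx k\<^sub>0 (lam powr \<beta>) Ap Am t x)
      <= C * lam powr rate \<beta> L * (1 + lam ^ L * t))"
  by (rule wave_approximation[OF k assms(2) _ assms(1) _ u cu v cv]) (use he in auto)
qed

end
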